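(* (i) The singularity $I_{2,2}^{l,m}$: $(x^2+y^{2l+1},\,y^2+x^{2m+1})$, $l\ge m\ge1$, can be represented by a germ of a Lorentzian-harmonic map into the 2-sphere. There is an $\mathcal A_e$-versal deformation of this singularity by germs of families of Lorentzian-harmonic maps. (ii) The singularities $I_{2,2}^{l}$: $(x^2-y^2+x^{2l+1},\,xy)$, $l\ge1$, cannot be represented by a germ of a Lorentzian-harmonic map into the 2-sphere. (iii) There are no finitely $\mathcal A$-determined germs of Lorentzian-harmonic maps into the 2-sphere with a zero 2-jet at the singular point.
   Context: A real analytic map $N$ from an open subset of the Lorentz plane $\mathbb R^{1,1}$ with null coordinates $(x,y)$ to $\mathbb S^2\subset\mathbb R^3$ is Lorentzian-harmonic if $N\times N_{xy}=0$. Near the origin, with $N(0,0)=(0,0,1)$, write $N=(1+u^2+v^2)^{-1/2}(u,v,1)$; up to analytic coordinate changes in the target, the germ of $N$ is identified with the map-germ $(u,v):(\mathbb R^2,0)\to(\mathbb R^2,0)$, and its jets are those of $(u,v)$. $\mathcal A$ is the group of pairs $(h,k)$ of germs of analytic diffeomorphisms of source and target (fixing the origin), acting on map-germs $g:(\mathbb R^2,0)\to(\mathbb R^2,0)$ by $k\circ g\circ h^{-1}$. A germ is finitely $\mathcal A$-determined if for some $k$ every germ with the same $k$-jet is $\mathcal A$-equivalent to it. A singularity (an $\mathcal A$-class) can be represented by a Lorentzian-harmonic map-germ if its $\mathcal A$-orbit contains a germ $(u,v):(\mathbb R^2,0)\to(\mathbb R^2,0)$ of analytic functions such that $N=(1+u^2+v^2)^{-1/2}(u,v,1)$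 is Lorentzian-harmonic, i.e. satisfies $N\times N_{xy}=0$ in the null coordinates $(x,y)$. An $\mathcal A_e$-versal deformation by Lorentzian-harmonic maps is an $\mathcal A_e$-versal deformation (in the usual sense, with extended tangent space $\mathcal E_2\{g_x,g_y\}+g^*(\mathcal E_2)\{e_1,e_2\}$) of a representing Lorentzian-harmonic germ, all of whose members are Lorentzian-harmonic. *)

theory Defs
  imports "HOL-Analysis.Analysis"
begin

section \<open>Real analytic germs\<close>

text \<open>
  A point of n-dimensional space, for a variable dimension n, is a function
  \<^typ>\<open>nat \<Rightarrow> real\<close> of which only the coordinates below n are used. The power series forces an
  analytic germ to be independent of the remaining coordinates near the origin.
\<close>

definition multi_indices :: "nat \<Rightarrow> (nat \<Rightarrow> nat) set" where
  "multi_indices n = {\<alpha>. \<forall>i\<ge>n. \<alpha> i = 0}"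

definition analytic_germ :: "nat \<Rightarrow> ((nat \<Rightarrow> real) \<Rightarrow> 'b::real_normed_vector) \<Rightarrow> bool" where
  "analytic_germ n f \<longleftrightarrow>
     (\<exists>c. \<exists>r>0. \<forall>z. (\<forall>i<n. \<bar>z i\<bar> < r) \<longrightarrow>
        ((\<lambda>\<alpha>. (\<Prod>i<n. z i ^ \<alpha> i) *\<^sub>R c \<alpha>) has_sum f z) (multi_indices n))"

text \<open>
  In a d-parameter family the parameter is the first argument. Joint analyticity in the source
  point (coordinates 0 and 1) and the parameter (coordinates 2, ..., d+1) is required.
\<close>

definition analytic_family ::
    "nat \<Rightarrow> ((nat \<Rightarrow> real) \<Rightarrow> real \<times> real \<Rightarrow> 'b::real_normed_vector) \<Rightarrow> bool" where
  "analytic_family d F \<longleftrightarrow> analytic_germ (d + 2) (\<lambda>z. F (\<lambda>i. z (i + 2)) (z 0, z 1))"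

definition analytic_germ2 :: "(real \<times> real \<Rightarrow> 'b::real_normed_vector) \<Rightarrow> bool" where
  "analytic_germ2 f \<longleftrightarrow> analytic_germ 2 (\<lambda>z. f (z 0, z 1))"

definition near0 :: "nat \<Rightarrow> ((nat \<Rightarrow> real) \<Rightarrow> real \<times> real \<Rightarrow> bool) \<Rightarrow> bool" where
  "near0 d P \<longleftrightarrow> (\<exists>r>0. \<forall>s. (\<forall>i<d. \<bar>s i\<bar> < r) \<longrightarrow> (\<forall>p\<in>ball 0 r. P s p))"

definition partial_x :: "(real \<times> real \<Rightarrow> 'b::real_normed_vector) \<Rightarrow> real \<times> real \<Rightarrow> 'b" where
  "partial_x f p = vector_derivative (\<lambda>t. f (t, snd p)) (at (fst p))"

definition partial_y :: "(real \<times> real \<Rightarrow> 'b::real_normed_vector) \<Rightarrow> real \<times> real \<Rightarrow> 'b" where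
  "partial_y f p = vector_derivative (\<lambda>t. f (fst p, t)) (at (snd p))"

definition same_jet ::
    "nat \<Rightarrow> (real \<times> real \<Rightarrow> real \<times> real) \<Rightarrow> (real \<times> real \<Rightarrow> real \<times> real) \<Rightarrow> bool" where
  "same_jet k f g \<longleftrightarrow>
     (\<forall>i j. i + j \<le> k \<longrightarrow>
        (partial_x ^^ i) ((partial_y ^^ j) f) 0 = (partial_x ^^ i) ((partial_y ^^ j) g) 0)"


section \<open>\<open>\<A>\<close>-equivalence\<close>

text \<open>Analytic map-germs of the plane fixing the origin.\<close>

definition map_germ :: "(real \<times> real \<Rightarrow> real \<times> real) \<Rightarrow> bool" where
  "map_germ f \<longleftrightarrow> f 0 = 0 \<and> analytic_germ2 f"

definition inverse_germs ::
    "(real \<times> real \<Rightarrow> real \<times> real) \<Rightarrow> (real \<times> real \<Rightarrow> real \<times> real) \<Rightarrow> bool" where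
  "inverse_germs h h' \<longleftrightarrow> map_germ h \<and> map_germ h' \<and>
     (\<forall>\<^sub>F p in nhds 0. h' (h p) = p \<and> h (h' p) = p)"

definition diffeo_germ :: "(real \<times> real \<Rightarrow> real \<times> real) \<Rightarrow> bool" where
  "diffeo_germ h \<longleftrightarrow> (\<exists>h'. inverse_germs h h')"

text \<open>Here \<open>h'\<close> is the inverse of the source diffeomorphism \<open>h\<close>.\<close>

definition A_equivalent ::
    "(real \<times> real \<Rightarrow> real \<times> real) \<Rightarrow> (real \<times> real \<Rightarrow> real \<times> real) \<Rightarrow> bool" where
  "A_equivalent f g \<longleftrightarrow>
     (\<exists>h h' k. inverse_germs h h' \<and> diffeo_germ k \<and> (\<forall>\<^sub>F p in nhds 0. g p = k (f (h' p))))"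

definition finitely_A_determined :: "(real \<times> real \<Rightarrow> real \<times> real) \<Rightarrow> bool" where
  "finitely_A_determined f \<longleftrightarrow>
     (\<exists>k. \<forall>g. map_germ g \<and> same_jet k f g \<longrightarrow> A_equivalent f g)"


section \<open>\<open>\<A>\<^sub>e\<close>-versal deformations\<close>

definition deformation ::
    "(real \<times> real \<Rightarrow> real \<times> real) \<Rightarrow> nat \<Rightarrow>
     ((nat \<Rightarrow> real) \<Rightarrow> real \<times> real \<Rightarrow> real \<times> real) \<Rightarrow> bool" where
  "deformation g d F \<longleftrightarrow> analytic_family d F \<and> (\<forall>\<^sub>F p in nhds 0. F (\<lambda>_. 0) p = g p)"

text \<open>
  The e-parameter deformation G is \<open>\<A>\<^sub>e\<close>-isomorphic to the pull-back of the d-parameter deformation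
  F along a base change \<open>\<phi>\<close>. The families h and k of diffeomorphisms of source and target start at
  the identity, and their members need not fix the origin.
\<close>

definition induced_from ::
    "nat \<Rightarrow> ((nat \<Rightarrow> real) \<Rightarrow> real \<times> real \<Rightarrow> real \<times> real) \<Rightarrow>
     nat \<Rightarrow> ((nat \<Rightarrow> real) \<Rightarrow> real \<times> real \<Rightarrow> real \<times> real) \<Rightarrow> bool" where
  "induced_from d F e G \<longleftrightarrow>
     (\<exists>(\<phi> :: (nat \<Rightarrow> real) \<Rightarrow> nat \<Rightarrow> real) h k.
        (\<forall>i<d. analytic_germ e (\<lambda>s. \<phi> s i) \<and> \<phi> (\<lambda>_. 0) i = 0) \<and>
        deformation (\<lambda>p. p) e h \<and> deformation (\<lambda>p. p) e k \<and>
        near0 e (\<lambda>s p. G s p = k s (F (\<phi> s) (h s p))))"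

text \<open>
  The extended tangent space \<open>\<E>\<^sub>2{g\<^sub>x, g\<^sub>y} + g\<^sup>*(\<E>\<^sub>2){e\<^sub>1, e\<^sub>2}\<close>; since its elements are germs, membership
  is closed under equality near the origin.
\<close>

definition extended_tangent_space ::
    "(real \<times> real \<Rightarrow> real \<times> real) \<Rightarrow> (real \<times> real \<Rightarrow> real \<times> real) set" where
  "extended_tangent_space g = {\<xi>. analytic_germ2 \<xi> \<and>
     (\<exists>a b \<eta>1 \<eta>2 :: real \<times> real \<Rightarrow> real.
        analytic_germ2 a \<and> analytic_germ2 b \<and> analytic_germ2 \<eta>1 \<and> analytic_germ2 \<eta>2 \<and>
        (\<forall>\<^sub>F p in nhds 0. \<xi> p = a p *\<^sub>R partial_x g p + b p *\<^sub>R partial_y g p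
                               + (\<eta>1 (g p), \<eta>2 (g p))))}"

definition initial_velocity ::
    "((nat \<Rightarrow> real) \<Rightarrow> real \<times> real \<Rightarrow> real \<times> real) \<Rightarrow> nat \<Rightarrow> real \<times> real \<Rightarrow> real \<times> real" where
  "initial_velocity F i p = vector_derivative (\<lambda>t. F ((\<lambda>_. 0)(i := t)) p) (at 0)"

text \<open>
  Versality is the universal property (every deformation of g is induced from F). The last
  condition is its infinitesimal form: the extended tangent space and the initial velocities of F
  together span all analytic germs. It follows from the universal property by differentiating at parameter
  value zero, and is recorded so that the notion is explicitly tied to that tangent space.
\<close>

definition Ae_versal ::
    "(real \<times> real \<Rightarrow> real \<times> real) \<Rightarrow> nat \<Rightarrow>
     ((nat \<Rightarrow> real) \<Rightarrow> real \<times> real \<Rightarrow> real \<times> real) \<Rightarrow> bool" where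
  "Ae_versal g d F \<longleftrightarrow> deformation g d F \<and>
     (\<forall>e G. deformation g e G \<longrightarrow> induced_from d F e G) \<and>
     (\<forall>\<xi>. analytic_germ2 \<xi> \<longrightarrow>
        (\<exists>c :: nat \<Rightarrow> real.
           (\<lambda>p. \<xi> p - (\<Sum>i<d. c i *\<^sub>R initial_velocity F i p)) \<in> extended_tangent_space g))"


section \<open>Lorentzian-harmonic maps into the 2-sphere\<close>

definition sphere_lift :: "(real \<times> real \<Rightarrow> real \<times> real) \<Rightarrow> real \<times> real \<Rightarrow> real ^ 3" where
  "sphere_lift g p =
     (let (u, v) = g p in (1 / sqrt (1 + u\<^sup>2 + v\<^sup>2)) *\<^sub>R vector [u, v, 1])"

definition lorentz_harmonic_at :: "(real \<times> real \<Rightarrow> real ^ 3) \<Rightarrow> real \<times> real \<Rightarrow> bool" where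
  "lorentz_harmonic_at N p \<longleftrightarrow> cross3 (N p) (partial_y (partial_x N) p) = 0"

definition lorentz_harmonic_germ :: "(real \<times> real \<Rightarrow> real \<times> real) \<Rightarrow> bool" where
  "lorentz_harmonic_germ g \<longleftrightarrow>
     map_germ g \<and> (\<forall>\<^sub>F p in nhds 0. lorentz_harmonic_at (sphere_lift g) p)"

definition lorentz_representable :: "(real \<times> real \<Rightarrow> real \<times> real) \<Rightarrow> bool" where
  "lorentz_representable f \<longleftrightarrow> (\<exists>g. A_equivalent f g \<and> lorentz_harmonic_germ g)"

definition lorentz_versal_deformation ::
    "(real \<times> real \<Rightarrow> real \<times> real) \<Rightarrow> nat \<Rightarrow>
     ((nat \<Rightarrow> real) \<Rightarrow> real \<times> real \<Rightarrow> real \<times> real) \<Rightarrow> bool" where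
  "lorentz_versal_deformation g d F \<longleftrightarrow>
     Ae_versal g d F \<and> near0 d (\<lambda>s p. lorentz_harmonic_at (sphere_lift (F s)) p)"


section \<open>The singularities\<close>

definition I22_lm :: "nat \<Rightarrow> nat \<Rightarrow> real \<times> real \<Rightarrow> real \<times> real" where
  "I22_lm l m = (\<lambda>(x, y). (x\<^sup>2 + y ^ (2 * l + 1), y\<^sup>2 + x ^ (2 * m + 1)))"

definition I22_l :: "nat \<Rightarrow> real \<times> real \<Rightarrow> real \<times> real" where
  "I22_l l = (\<lambda>(x, y). (x\<^sup>2 - y\<^sup>2 + x ^ (2 * l + 1), x * y))"

end

theory Submission
  imports Defs
begin

text \<open>
  In the gnomonic coordinates \<open>F = (u, v)\<close> a map is Lorentzian-harmonic iff it solves the semilinear wave equation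
  \<open>F\<^sub>x\<^sub>y = ((F \<bullet> F\<^sub>x) F\<^sub>y + (F \<bullet> F\<^sub>y) F\<^sub>x) / (1 + |F|\<^sup>2)\<close>, whose analytic solutions are determined by arbitrary data
  \<open>U(x) + V(y)\<close> on the two null axes.

  (i) Take \<open>U = (x\<^sup>2, x^(2m+1) + \<Sum>\<^sub>j b\<^sub>j x^(2j+1))\<close> and \<open>V = (y^(2l+1) + \<Sum>\<^sub>i a\<^sub>i y^(2i+1), y\<^sup>2)\<close>. At \<open>a = b = 0\<close> the linear
  equation satisfied by \<open>F\<^sub>x\<close> on \<open>x = 0\<close> and by \<open>F\<^sub>y\<close> on \<open>y = 0\<close> gives \<open>F = U + V + x\<^sup>2y\<^sup>2R\<close>, and the remainder is absorbed by
  a change of the source variables. The derivatives with respect to the parameters are the missing odd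
  powers modulo \<open>xy\<close>, which lies in the tangent space. A division argument with parameters then
  solves the infinitesimal versality equation along any deformation, and integrating the resulting
  analytic vector fields, backwards in the source and forwards in the target, trivialises it.

  (ii) The equation excludes the term \<open>xy\<close> from the 2-jet. The quadratic map \<open>(x\<^sup>2 - y\<^sup>2, xy)\<close> has no linear change of
  variables for which both components lose their mixed term.

  (iii) If the 2-jet vanishes, then \<open>F\<^sub>x\<close> is divisible by \<open>x\<^sup>2\<close>, so the Jacobian vanishes to second order along a
  curve, a property invariant under \<open>\<A>\<close>-equivalence. A dimension count shows that a generic perturbation
  of arbitrarily high order has an isolated point of this kind at most.
\<close>

text \<open>Implicit functions, flows and the Goursat problem become fixed points in one Banach
  algebra of absolutely summable coefficient families. Parameters and time are further variables
  there, so joint analyticity costs nothing extra, and smallness is obtained by rescaling the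
  variables.

  The obstacle in the versality proof is division with parameters. Instead of a preparation theorem
  an explicit reduction is used whose error operator has norm at most 1/2, so that a fixed point
  removes it. The admissible error is a power of the source radius, hence the parameter radius is
  chosen after it.

  An arbitrary deformation \<open>G\<close> is compared with the unfolding \<open>Ft\<close> inside
  the single family \<open>Ft + G - I22\<close>, which carries both sets of parameters. Along the
  ray \<open>t s\<close> of the parameters of \<open>G\<close> the others move too, and their final
  position is the base change.

  In (iii) the perturbation has to keep a jet of any order and yet be free at every nearby point.
  The factor \<open>(x^2 + y^2)^(K+1)\<close> vanishes at the origin only, and quadratic polynomials
  realise every 2-jet at every point; this gives the 12 coefficients.\<close>

text \<open>Points of variable dimension are functions on the naturals; \<open>NEAR z. P z\<close> means: for all \<open>z\<close> with small first
  two coordinates.\<close>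

abbreviation germ :: "nat \<Rightarrow> ((nat \<Rightarrow> real) \<Rightarrow> 'b::real_normed_vector) \<Rightarrow> bool" where
  "germ \<equiv> analytic_germ"

type_synonym pnt = "nat \<Rightarrow> real"
type_synonym fnc = "pnt \<Rightarrow> real"

abbreviation hrd :: "(real \<Rightarrow> real) \<Rightarrow> real \<Rightarrow> real filter \<Rightarrow> bool" (infix "hrd" 50) where
  "f hrd d \<equiv> f has_real_derivative d"

section \<open>The Banach algebra of absolutely convergent power series\<close>

text \<open>The index set consists of all functions, so that one type serves every dimension and
  variables can be adjoined without changing it. Absolute summability means convergence on the
  closed unit polydisc; other radii enter by rescaling the variables, see
  \<open>rep\<close>.\<close>

typedef mps = "{c :: (nat => nat) => real. (%a. abs(c a)) summable_on UNIV}"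
 morphisms mcoef Abs_mps
 by (rule exI[of _ "%_. 0"]) simp

setup_lifting type_definition_mps

lemma mcoef_abs_summable: "(%a. abs(mcoef c a)) summable_on UNIV"
 using mcoef[of c] by simp

lemma abs_summable_add:
 fixes f g :: "'a => real"
 assumes "(%a. abs(f a)) summable_on A" "(%a. abs(g a)) summable_on A"
 shows "(%a. abs(f a + g a)) summable_on A"
proof -
 have "(%a. abs(f a) + abs(g a)) summable_on A" using assms by (rule summable_on_add)
 then show ?thesis
  by (rule summable_on_comparison_test) auto
qed

lemma abs_summable_diff:
 fixes f g :: "'a => real"
 assumes "(%a. abs(f a)) summable_on A" "(%a. abs(g a)) summable_on A"
 shows "(%a. abs(f a - g a)) summable_on A"
 using abs_summable_add[of f A "%a. - g a"] assms by simp

instantiation mps :: real_vector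
begin

lift_definition zero_mps :: mps is "%_. 0" by simp
lift_definition plus_mps :: "mps => mps => mps" is "%c d a. c a + d a"
 by (rule abs_summable_add)
lift_definition minus_mps :: "mps => mps => mps" is "%c d a. c a - d a"
 by (rule abs_summable_diff)
lift_definition uminus_mps :: "mps => mps" is "%c a. - c a" by simp
lift_definition scaleR_mps :: "real => mps => mps" is "%r c a. r*c a"
 by (simp add: abs_mult summable_on_cmult_right)

instance
proof
 fix c d e :: mps and r s :: real
 show "c + d + e = c + (d + e)" by transfer (simp add: add.assoc)
 show "c + d = d + c" by transfer (simp add: add.commute)
 show "0 + c = c" by transfer simp
 show "- c + c = 0" by transfer simp
 show "c - d = c + - d" by transfer simp
 show "r *\<^sub>R (c + d) = r *\<^sub>R c + r *\<^sub>R d" by transfer (simp add: distrib_left)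
 show "(r + s) *\<^sub>R c = r *\<^sub>R c + s *\<^sub>R c" by transfer (simp add: distrib_right)
 show "r *\<^sub>R s *\<^sub>R c = (r * s) *\<^sub>R c" by transfer (simp add: mult.assoc)
 show "1 *\<^sub>R c = c" by transfer simp
qed

end

instantiation mps :: real_normed_vector
begin

definition norm_mps :: "mps => real" where "norm_mps c = (\<Sum>\<^sub>\<infinity>a. abs(mcoef c a))"
definition dist_mps :: "mps => mps => real" where "dist_mps c d = norm (c - d)"
definition sgn_mps :: "mps => mps" where "sgn_mps c = c /\<^sub>R norm c"
definition uniformity_mps :: "(mps \<times> mps) filter" where
 "uniformity_mps = (INF e\<in>{0<..}. principal {(c, d). dist c d < e})"
definition open_mps :: "mps set => bool" where
 "open_mps U \<longleftrightarrow> (ALL c:U. eventually (%(c', d). c' = c --> d \<in> U) uniformity)"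

instance
proof
 fix c d :: mps
 show "dist c d = norm (c - d)" by (rule dist_mps_def)
 show "sgn c = c /\<^sub>R norm c" by (rule sgn_mps_def)
 show "uniformity = (INF e\<in>{0<..}. principal {(c, d :: mps). dist c d < e})"
  by (rule uniformity_mps_def)
 fix U :: "mps set"
 show "open U \<longleftrightarrow> (ALL c:U. eventually (%(c', d). c' = c --> d \<in> U) uniformity)"
  by (rule open_mps_def)
next
 fix c d :: mps and r :: real
 have "mcoef c a = 0" if "norm c = 0" for a
 proof -
  have "abs(mcoef c a) = (\<Sum>\<^sub>\<infinity>b\<in>{a}. abs(mcoef c b))" by simp
  also have "\<dots> <= norm c" unfolding norm_mps_def
   by (rule infsum_mono_neutral) (auto simp: mcoef_abs_summable)
  finally show ?thesis using that by simp
 qed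
 then have "norm c = 0 ==> c = 0" by (simp add: mcoef_inject[symmetric] zero_mps.rep_eq fun_eq_iff)
 moreover have "norm (0::mps) = 0" by (simp add: norm_mps_def zero_mps.rep_eq)
 ultimately show "norm c = 0 \<longleftrightarrow> c = 0" by blast
 have "norm (c + d) <= (\<Sum>\<^sub>\<infinity>a. abs(mcoef c a) + abs(mcoef d a))"
  unfolding norm_mps_def
  by (rule infsum_mono) (auto simp: plus_mps.rep_eq intro: abs_summable_add summable_on_add mcoef_abs_summable)
 also have "\<dots> = norm c + norm d"
  unfolding norm_mps_def by (intro infsum_add mcoef_abs_summable)
 finally show "norm (c + d) <= norm c + norm d" .
 show "norm (r *\<^sub>R c) = abs(r)*norm c"
  unfolding norm_mps_def by (simp add: scaleR_mps.rep_eq abs_mult infsum_cmult_right')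
qed

end

lemma mcoef_linear [simp]:
 "mcoef 0 a = 0" "mcoef (c + d) a = mcoef c a + mcoef d a"
 "mcoef (c - d) a = mcoef c a - mcoef d a" "mcoef (- c) a = - mcoef c a"
 "mcoef (r *\<^sub>R c) a = r*mcoef c a"
 by (transfer, simp)+

lemma mcoef_le_norm: "abs(mcoef c a) <= norm c"
proof -
 have "abs(mcoef c a) = (\<Sum>\<^sub>\<infinity>b\<in>{a}. abs(mcoef c b))" by simp
 also have "\<dots> <= norm c" unfolding norm_mps_def
  by (rule infsum_mono_neutral) (auto simp: mcoef_abs_summable)
 finally show ?thesis .
qed

lemma sum_mcoef_le_norm: "finite F ==> (\<Sum>a\<in>F. abs(mcoef c a)) <= norm c"
 unfolding norm_mps_def by (intro finite_sum_le_infsum mcoef_abs_summable) auto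

lemma norm_mps_le:
 assumes "!!F. finite F ==> (\<Sum>a\<in>F. abs(mcoef c a)) <= B"
 shows "norm c <= B"
 unfolding norm_mps_def by (intro infsum_le_finite_sums mcoef_abs_summable assms)

lemma bounded_linear_mcoef: "bounded_linear (%c. mcoef c a)"
 by (rule bounded_linear_intro[where K=1]) (auto simp: mcoef_le_norm)

instance mps :: banach
proof
 fix X :: "nat => mps" assume C: "Cauchy X"
 have "EX L. (%n. mcoef (X n) a) \<longlonglongrightarrow> L" for a
  using bounded_linear.Cauchy[OF bounded_linear_mcoef C, of a]
  by (simp add: Cauchy_convergent_iff convergent_def)
 then obtain L where L: "!!a. (%n. mcoef (X n) a) \<longlonglongrightarrow> L a" by metis
 \<comment> \<open>A uniform bound on the finite partial sums of the distance to the coefficientwise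
   limit yields both the summability of the limit and the convergence in norm.\<close>
 have fin: "(\<Sum>a\<in>F. abs(mcoef (X n) a - L a)) <= e"
  if F: "finite F" and N: "!!m. m >= N ==> norm (X n - X m) <= e" for F n N e
 proof (rule tendsto_upperbound)
  show "(%m. \<Sum>a\<in>F. abs(mcoef (X n) a - mcoef (X m) a)) \<longlonglongrightarrow> (\<Sum>a\<in>F. abs(mcoef (X n) a - L a))"
   by (intro tendsto_intros L)
  show "\<forall>\<^sub>F m in sequentially. (\<Sum>a\<in>F. abs(mcoef (X n) a - mcoef (X m) a)) <= e"
   unfolding eventually_sequentially
  proof (intro exI[of _ N] allI impI)
   fix m assume "N <= m"
   have "(\<Sum>a\<in>F. abs(mcoef (X n) a - mcoef (X m) a)) <= norm (X n - X m)"
    using sum_mcoef_le_norm[OF F, of "X n - X m"] by simp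
   then show "(\<Sum>a\<in>F. abs(mcoef (X n) a - mcoef (X m) a)) <= e"
    using N[OF \<open>N \<le> m\<close>] by linarith
  qed
 qed simp
 have ev: "EX N. ALL n>=N. ALL m>=N. norm (X n - X m) <= e" if "e > 0" for e
  using metric_CauchyD[OF C that] unfolding dist_norm by (meson less_imp_le)
 have summ: "(%a. abs(mcoef (X n) a - L a)) summable_on UNIV"
  if "!!m. m >= N ==> norm (X n - X m) <= e" for n N e
  by (rule nonneg_bdd_above_summable_on) (use fin[OF _ that] in \<open>auto intro!: bdd_aboveI[of _ e]\<close>)
 obtain N1 where "ALL n>=N1. ALL m>=N1. norm (X n - X m) <= 1" using ev[of 1] by auto
 then have "(%a. abs(mcoef (X N1) a - L a)) summable_on UNIV"
  by (intro summ[of N1 N1 1]) auto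
 then have "(%a. abs(L a)) summable_on UNIV"
  using abs_summable_diff[of "mcoef (X N1)" UNIV "%a. mcoef (X N1) a - L a"]
  by (simp add: mcoef_abs_summable)
 then have co: "mcoef (Abs_mps L) = L" by (simp add: Abs_mps_inverse)
 have "X \<longlonglongrightarrow> Abs_mps L"
 proof (rule LIMSEQ_I)
  fix e :: real assume "e > 0"
  obtain N where N: "ALL n>=N. ALL m>=N. norm (X n - X m) <= e / 2"
   using ev[of "e/2"] \<open>e > 0\<close> by auto
  have "norm (X n - Abs_mps L) < e" if "n >= N" for n
  proof -
   have "norm (X n - Abs_mps L) <= e / 2"
    by (rule norm_mps_le) (use fin[of _ N n "e/2"] N that in \<open>simp add: co\<close>)
   then show ?thesis using \<open>e > 0\<close> by simp
  qed
  then show "EX N. ALL n>=N. norm (X n - Abs_mps L) < e" by blast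
 qed
 then show "convergent X" by (rule convergentI)
qed

section \<open>Monomials, and bounded linear maps given by their values on monomials\<close>

lift_definition mmono :: "(nat => nat) => mps" is "%a b. if b = a then 1 else 0"
proof -
 fix a :: "nat => nat"
 have "(%b. abs(if b = a then 1 else 0 :: real)) summable_on {a}" by simp
 then show "(%b. abs(if b = a then 1 else 0 :: real)) summable_on UNIV"
  by (rule summable_on_cong_neutral[THEN iffD1, rotated -1]) auto
qed

lemma mcoef_mono: "mcoef (mmono a) b = (if b = a then 1 else 0)"
 by (simp add: mmono.rep_eq)

lemma infsum_indicator_real: "(\<Sum>\<^sub>\<infinity>b. if b = a then f b else (0::real)) = f a"
proof -
 have "(\<Sum>\<^sub>\<infinity>b. if b = a then f b else 0) = (\<Sum>\<^sub>\<infinity>b\<in>{a}. f b)"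
  by (rule infsum_cong_neutral) auto
 then show ?thesis by simp
qed

lemma norm_mono [simp]: "norm (mmono a) = 1"
proof -
 have "norm (mmono a) = (\<Sum>\<^sub>\<infinity>b. if b = a then 1 else (0::real))"
  unfolding norm_mps_def mcoef_mono by (rule infsum_cong) auto
 then show ?thesis using infsum_indicator_real[of a "%_. 1"] by simp
qed

text \<open>The universal property of this l^1 space: a bounded assignment of values to the
  monomials extends to a bounded linear map with the same bound. Product, evaluation, restriction,
  division and integration are all defined in this way.\<close>

definition lin :: "((nat => nat) => 'b::banach) => mps => 'b" where
 "lin ph c = (\<Sum>\<^sub>\<infinity>a. mcoef c a *\<^sub>R ph a)"

context
 fixes ph :: "(nat => nat) => 'b::banach" and M :: real
 assumes bnd: "!!a. norm (ph a) <= M"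
begin

lemma lin_abs_summable: "(%a. norm (mcoef c a *\<^sub>R ph a)) summable_on UNIV"
proof (rule summable_on_comparison_test)
 show "(%a. abs(mcoef c a)*M) summable_on UNIV"
  by (rule summable_on_cmult_left) (rule mcoef_abs_summable)
qed (use bnd in \<open>auto intro: mult_left_mono\<close>)

lemma lin_has_sum: "((%a. mcoef c a *\<^sub>R ph a) has_sum lin ph c) UNIV"
 unfolding lin_def using abs_summable_summable[OF lin_abs_summable] by (rule has_sum_infsum)

lemma lin_add: "lin ph (c + d) = lin ph c + lin ph d"
 using has_sum_add[OF lin_has_sum[of c] lin_has_sum[of d]] lin_has_sum[of "c + d"]
 by (simp add: scaleR_left_distrib has_sum_unique)

lemma lin_scaleR: "lin ph (r *\<^sub>R c) = r *\<^sub>R lin ph c"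
 using has_sum_bounded_linear[OF bounded_linear_scaleR_right lin_has_sum[of c], of r]
  lin_has_sum[of "r *\<^sub>R c"]
 by (simp add: has_sum_unique)

lemma norm_lin: "norm (lin ph c) <= M*norm c"
proof -
 have "norm (lin ph c) <= (\<Sum>\<^sub>\<infinity>a. norm (mcoef c a *\<^sub>R ph a))"
  unfolding lin_def by (rule norm_infsum_bound[OF lin_abs_summable])
 also have "\<dots> <= (\<Sum>\<^sub>\<infinity>a. M*abs(mcoef c a))"
 proof (rule infsum_mono[OF lin_abs_summable])
  show "(%a. M*abs(mcoef c a)) summable_on UNIV"
   by (rule summable_on_cmult_right) (rule mcoef_abs_summable)
  show "norm (mcoef c a *\<^sub>R ph a) <= M*abs(mcoef c a)" for a
   using mult_left_mono[OF bnd[of a] abs_ge_zero[of "mcoef c a"]] by (simp add: mult.commute)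
 qed
 also have "\<dots> = M*norm c" by (simp add: infsum_cmult_right' norm_mps_def)
 finally show ?thesis .
qed

lemma bounded_linear_lin: "bounded_linear (lin ph)"
 by (rule bounded_linear_intro[where K=M]) (auto simp: lin_add lin_scaleR norm_lin mult.commute)

end

lemma lin_mono [simp]: "lin ph (mmono a) = ph a"
proof -
 have "lin ph (mmono a) = (\<Sum>\<^sub>\<infinity>b\<in>{a}. ph b)"
  unfolding lin_def by (rule infsum_cong_neutral) (auto simp: mcoef_mono)
 then show ?thesis by simp
qed

lemma mps_has_sum_mono: "((%a. mcoef c a *\<^sub>R mmono a) has_sum c) UNIV"
proof -
 have *: "((%a. mcoef c a *\<^sub>R mmono a) has_sum lin mmono c) UNIV"
  by (rule lin_has_sum[where M=1]) simp
 have "mcoef (lin mmono c) b = mcoef c b" for b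
 proof -
  have "((%a. mcoef c a*mcoef (mmono a) b) has_sum mcoef (lin mmono c) b) UNIV"
   using has_sum_bounded_linear[OF bounded_linear_mcoef *, of b] by simp
  moreover have "(%a. mcoef c a*mcoef (mmono a) b) = (%a. if a = b then mcoef c a else 0)"
   by (auto simp: mcoef_mono)
  ultimately have "mcoef (lin mmono c) b = (\<Sum>\<^sub>\<infinity>a. if a = b then mcoef c a else 0)"
   by (simp add: infsumI)
  then show ?thesis by (simp add: infsum_indicator_real)
 qed
 then have "lin mmono c = c" by (simp add: mcoef_inject[symmetric] fun_eq_iff)
 with * show ?thesis by simp
qed

text \<open>Finite combinations of monomials are dense. Operator identities, the ring axioms
  included, are thereby reduced to monomials, where they become identities between
  exponents.\<close>

lemma mps_ext:
 fixes f g :: "mps => 'b::real_normed_vector"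
 assumes "bounded_linear f" "bounded_linear g" "!!a. f (mmono a) = g (mmono a)"
 shows "f c = g c"
proof -
 have "((%a. mcoef c a *\<^sub>R f (mmono a)) has_sum f c) UNIV" if "bounded_linear f"
  for f :: "mps => 'b"
  using has_sum_bounded_linear[OF that mps_has_sum_mono[of c]]
  by (simp add: linear_simps(5)[OF that])
 from this[OF assms(1)] this[OF assms(2)] show ?thesis
  using assms(3) by (simp add: has_sum_unique)
qed

lemma lin_fun_add:
 assumes "!!a. norm (ph a) <= M" "!!a. norm (ps a) <= N"
 shows "lin (%a. ph a + ps a) c = lin ph c + lin ps c"
 using has_sum_add[OF lin_has_sum[OF assms(1), of c] lin_has_sum[OF assms(2), of c]]
 by (simp add: lin_def scaleR_right_distrib infsumI)

lemma lin_fun_scaleR: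
 assumes "!!a. norm (ph a) <= M"
 shows "lin (%a. r *\<^sub>R ph a) c = r *\<^sub>R lin ph c"
 using has_sum_bounded_linear[OF bounded_linear_scaleR_right lin_has_sum[OF assms, of c], of r]
 by (simp add: lin_def infsumI mult.commute)

section \<open>Multiplication of power series\<close>

definition mshift :: "(nat => nat) => mps => mps" where
 "mshift a = lin (%b. mmono (%i. a i + b i))"

lemma bounded_linear_mshift: "bounded_linear (mshift a)"
 unfolding mshift_def by (rule bounded_linear_lin[where M=1]) simp

lemma norm_mshift: "norm (mshift a c) <= norm c"
 unfolding mshift_def using norm_lin[of "%b. mmono (%i. a i + b i)" 1 c] by simp

lemma mshift_mono [simp]: "mshift a (mmono b) = mmono (%i. a i + b i)"
 by (simp add: mshift_def)

instantiation mps :: comm_ring_1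
begin

definition one_mps :: mps where "one_mps = mmono (%_. 0)"
text \<open>Convolution, obtained by extending the addition of exponents linearly in each factor;
  sums over the decompositions of a multi-index never have to be written down.\<close>

definition times_mps :: "mps => mps => mps" where "times_mps c d = lin (%a. mshift a d) c"

lemma times_mps_bounded_linear:
 "bounded_linear (%c. c*d)" "bounded_linear (%d. c*d)" "norm (c*d) <= norm c*norm d"
 for c d :: mps
proof -
 have b1: "bounded_linear (%c. c*d)" for d :: mps
  unfolding times_mps_def by (rule bounded_linear_lin) (rule norm_mshift)
 have nm: "norm (c*d) <= norm c*norm d" for c d :: mps
  unfolding times_mps_def using norm_lin[of "%a. mshift a d" "norm d" c, OF norm_mshift] by (simp add: mult.commute)
 have b2: "bounded_linear (%d. c*d)" for c :: mps
 proof (rule bounded_linear_intro[where K="norm c"])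
  fix d e :: mps and r :: real
  show "c*(d + e) = c*d + c*e"
   using lin_fun_add[of "%a. mshift a d" "norm d" "%a. mshift a e" "norm e" c, OF norm_mshift norm_mshift]
   by (simp add: times_mps_def linear_simps[OF bounded_linear_mshift])
  show "c*(r *\<^sub>R d) = r *\<^sub>R (c*d)"
   using lin_fun_scaleR[of "%a. mshift a d" "norm d" r c, OF norm_mshift]
   by (simp add: times_mps_def linear_simps[OF bounded_linear_mshift])
  show "norm (c*d) <= norm d*norm c" using nm[of c d] by (simp add: mult.commute)
 qed
 show "bounded_linear (%c. c*d)" "bounded_linear (%d. c*d)" "norm (c*d) <= norm c*norm d"
  by (rule b1 b2 nm)+
qed

instance
proof -
 note b1 = times_mps_bounded_linear(1) and b2 = times_mps_bounded_linear(2)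
 have mt [simp]: "mmono a*d = mshift a d" for a d
  by (simp add: times_mps_def)
 have comm: "c*d = d*c" for c d :: mps
 proof (rule mps_ext[of "%c. c*d" "%c. d*c", OF b1 b2])
  fix a
  show "mmono a*d = d*mmono a"
   by (rule mps_ext[of "%d. mmono a*d" "%d. d*mmono a", OF b2 b1]) (simp add: add.commute)
 qed
 have assoc: "c*d*e = c*(d*e)" for c d e :: mps
 proof (rule mps_ext[of "%c. c*d*e" "%c. c*(d*e)", OF bounded_linear_compose[OF b1 b1] b1])
  fix a
  show "mmono a*d*e = mmono a*(d*e)"
  proof (rule mps_ext[of "%d. mmono a*d*e" "%d. mmono a*(d*e)",
     OF bounded_linear_compose[OF b1 b2] bounded_linear_compose[OF b2 b1]])
   fix b
   show "mmono a*mmono b*e = mmono a*(mmono b*e)"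
    by (rule mps_ext[of "%e. mmono a*mmono b*e" "%e. mmono a*(mmono b*e)",
       OF b2 bounded_linear_compose[OF b2 b2]]) (simp add: add.assoc)
  qed
 qed
 have one: "1*c = c" for c :: mps
  unfolding one_mps_def
  by (rule mps_ext[of "%c. mmono (%_. 0)*c" "%c. c", OF b2 bounded_linear_ident]) simp
 show "OFCLASS(mps, comm_ring_1_class)"
 proof
  fix c d e :: mps
  show "c*d*e = c*(d*e)" by (rule assoc)
  show "c*d = d*c" by (rule comm)
  show "1*c = c" by (rule one)
  show "(c + d)*e = c*e + d*e" by (rule linear_simps(1)[OF b1])
  have "mcoef 1 (%_. 0) = 1" by (simp add: one_mps_def mcoef_mono)
  then show "(0::mps) ~= 1" by (metis mcoef_linear(1) zero_neq_one)
 qed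
qed

end

instance mps :: real_normed_algebra_1
proof
 fix c d :: mps and r :: real
 show "r *\<^sub>R c*d = r *\<^sub>R (c*d)" by (rule linear_simps(5)[OF times_mps_bounded_linear(1)])
 show "c*r *\<^sub>R d = r *\<^sub>R (c*d)" by (rule linear_simps(5)[OF times_mps_bounded_linear(2)])
 show "norm (c*d) <= norm c*norm d" by (rule times_mps_bounded_linear(3))
 show "norm (1::mps) = 1" by (simp add: one_mps_def)
qed

lemma mono_mult: "mmono a*mmono b = mmono (%i. a i + b i)"
 by (simp add: times_mps_def)

subsection \<open>Evaluation\<close>

class comm_banach_algebra = banach + real_normed_algebra_1 + comm_ring_1

instance real :: comm_banach_algebra ..
instance mps :: comm_banach_algebra ..

text \<open>One evaluation for two purposes: with values in the reals it evaluates a series at a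
  point, with values in \<open>mps\<close> it substitutes series for the variables.
  \<open>ev_ev\<close> is then the compatibility of the two. The class
  \<open>comm_banach_algebra\<close> exists to cover both cases at once.\<close>

definition ev :: "nat => (nat => 'b::comm_banach_algebra) => mps => 'b" where
 "ev n G = lin (%a. \<Prod>i<n. G i ^ a i)"

lemma norm_prod_power_le_1:
 fixes G :: "nat => 'b::comm_banach_algebra"
 assumes "!!i. i < n ==> norm (G i) <= 1"
 shows "norm (\<Prod>i<n. G i ^ a i) <= 1"
proof -
 have "norm (\<Prod>i<n. G i ^ a i) <= (\<Prod>i<n. norm (G i ^ a i))" by (rule norm_prod_le)
 also have "\<dots> <= (\<Prod>i<n. 1)"
 proof (rule prod_mono)
  fix i assume "i \<in> {..<n}"
  then have "norm (G i) ^ a i <= 1" using assms by (simp add: power_le_one)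
  then show "0 <= norm (G i ^ a i) & norm (G i ^ a i) <= 1"
   using norm_power_ineq[of "G i" "a i"] by simp
 qed
 finally show ?thesis by simp
qed

lemma ev_mono: "ev n G (mmono a) = (\<Prod>i<n. G i ^ a i)"
 by (simp add: ev_def)

lemma ev_cong: "(!!i. i < n ==> G i = H i) ==> ev n G c = ev n H c"
 unfolding ev_def by (simp cong: prod.cong_simp)

context
 fixes n :: nat and G :: "nat => 'b::comm_banach_algebra"
 assumes G: "!!i. i < n ==> norm (G i) <= 1"
begin

lemma bounded_linear_ev: "bounded_linear (ev n G)"
 unfolding ev_def by (rule bounded_linear_lin) (rule norm_prod_power_le_1[OF G])

lemma norm_ev_le: "norm (ev n G c) <= norm c"
 unfolding ev_def using norm_lin[OF norm_prod_power_le_1[OF G], where c=c] by simp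

lemma ev_mult: "ev n G (c*d) = ev n G c*ev n G d"
proof (rule mps_ext[of "%c. ev n G (c*d)" "%c. ev n G c*ev n G d"])
 show "bounded_linear (%c. ev n G (c*d))"
  by (rule bounded_linear_compose[OF bounded_linear_ev bounded_linear_mult_left])
 show "bounded_linear (%c. ev n G c*ev n G d)"
  by (rule bounded_linear_mult_const[OF bounded_linear_ev])
 fix a
 show "ev n G (mmono a*d) = ev n G (mmono a)*ev n G d"
 proof (rule mps_ext[of "%d. ev n G (mmono a*d)" "%d. ev n G (mmono a)*ev n G d"])
  show "bounded_linear (%d. ev n G (mmono a*d))"
   by (rule bounded_linear_compose[OF bounded_linear_ev bounded_linear_mult_right])
  show "bounded_linear (%d. ev n G (mmono a)*ev n G d)"
   by (rule bounded_linear_const_mult[OF bounded_linear_ev])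
 qed (simp add: mono_mult ev_mono power_add prod.distrib)
qed

lemma ev_1: "ev n G 1 = 1"
 by (simp add: one_mps_def ev_mono)

lemma ev_add: "ev n G (c + d) = ev n G c + ev n G d"
 and ev_diff: "ev n G (c - d) = ev n G c - ev n G d"
 and ev_0: "ev n G 0 = 0"
 and ev_minus: "ev n G (- c) = - ev n G c"
 and ev_scaleR: "ev n G (r *\<^sub>R c) = r *\<^sub>R ev n G c"
 using linear_simps[OF bounded_linear_ev] by blast+

lemma ev_power: "ev n G (c ^ k) = ev n G c ^ k"
 by (induction k) (simp_all add: ev_1 ev_mult)

lemma ev_sum: "ev n G (sum f A) = (\<Sum>i\<in>A. ev n G (f i))"
 by (induction A rule: infinite_finite_induct) (simp_all add: ev_0 ev_add)

lemma ev_prod: "ev n G (prod f A) = (\<Prod>i\<in>A. ev n G (f i))"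
 by (induction A rule: infinite_finite_induct) (simp_all add: ev_1 ev_mult)

lemma ev_ev:
 fixes H :: "nat => mps"
 assumes H: "!!i. i < m ==> norm (H i) <= 1"
 shows "ev n G (ev m H c) = ev m (%i. ev n G (H i)) c"
proof (rule mps_ext[of "%c. ev n G (ev m H c)" "%c. ev m (%i. ev n G (H i)) c"])
 have bl: "bounded_linear (ev m H)"
  unfolding ev_def by (rule bounded_linear_lin) (rule norm_prod_power_le_1[OF H])
 show "bounded_linear (%c. ev n G (ev m H c))"
  by (rule bounded_linear_compose[OF bounded_linear_ev bl])
 show "bounded_linear (%c. ev m (%i. ev n G (H i)) c)"
  unfolding ev_def[of m]
 proof (rule bounded_linear_lin)
  show "norm (\<Prod>i<m. ev n G (H i) ^ a i) <= 1" for a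
   by (rule norm_prod_power_le_1) (rule order_trans[OF norm_ev_le H])
 qed
qed (simp add: ev_mono ev_prod ev_power)

end

text \<open>The constant does not depend on the exponents: a monomial of total degree
  \<open>s\<close> in factors of norm at most 1/2 changes by at most \<open>s 2^(1-s) e\<close>, and
  \<open>s 2^(1-s)\<close> never exceeds 1. Consequently \<open>ev\<close> is Lipschitz on the ball
  of radius 1/2, which is where the contraction arguments take place.\<close>

lemma norm_prod_power_diff:
 fixes G H :: "nat => 'b::comm_banach_algebra"
 assumes "!!i. i < n ==> norm (G i) <= 1/2" "!!i. i < n ==> norm (H i) <= 1/2"
  and "!!i. i < n ==> norm (G i - H i) <= e" and "0 <= e"
 shows "norm ((\<Prod>i<n. G i ^ a i) - (\<Prod>i<n. H i ^ a i)) <= e"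
proof -
 \<comment> \<open>the sharper bound \<open>s 2\<^sup>-\<^sup>s 2e\<close>, \<open>s\<close> the total degree, is what telescopes\<close>
 have pw: "norm (u ^ k) <= (1/2) ^ k" if "norm u <= 1/2" for u :: 'b and k
  using norm_power_ineq[of u k] power_mono[OF that, of k] by simp
 have step: "norm (p*u - q * v) <= real (j + k)*(1/2) ^ (j + k)*(2*e)"
  if "norm (p - q) <= real j*(1/2) ^ j*(2*e)" "norm (u - v) <= real k*(1/2) ^ k*(2*e)"
   "norm u <= (1/2) ^ k" "norm q <= (1/2) ^ j" for p q u v :: 'b and j k
 proof -
  have "p*u - q * v = (p - q)*u + q*(u - v)" by (simp add: algebra_simps)
  then have "norm (p*u - q * v) <= norm ((p - q)*u) + norm (q*(u - v))"
   using norm_triangle_ineq by metis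
  also have "\<dots> <= norm (p - q)*norm u + norm q*norm (u - v)"
   by (intro add_mono norm_mult_ineq)
  also have "\<dots> <= (real j*(1/2) ^ j*(2*e))*(1/2) ^ k + (1/2) ^ j*(real k*(1/2) ^ k*(2*e))"
   using that \<open>0 \<le> e\<close> by (intro add_mono mult_mono) auto
  also have "\<dots> = real (j + k)*(1/2) ^ (j + k)*(2*e)" by (simp add: power_add algebra_simps)
  finally show ?thesis .
 qed
 have pd: "norm (u ^ k - v ^ k) <= real k*(1/2) ^ k*(2*e)"
  if "norm u <= 1/2" "norm v <= 1/2" "norm (u - v) <= e" for u v :: 'b and k
 proof (induction k)
  case (Suc k)
  show ?case using step[of "u ^ k" "v ^ k" k u v 1] Suc that pw[of v k]
   by (simp add: mult.commute[of u] mult.commute[of v])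
 qed simp
 have pr: "norm (\<Prod>i<k. H i ^ a i) <= (1/2) ^ (\<Sum>i<k. a i)" if "k <= n" for k
  using that
 proof (induction k)
  case (Suc k)
  have "norm ((\<Prod>i<k. H i ^ a i)*H k ^ a k) <= norm (\<Prod>i<k. H i ^ a i)*norm (H k ^ a k)"
   by (rule norm_mult_ineq)
  also have "\<dots> <= (1/2) ^ (\<Sum>i<k. a i)*(1/2) ^ a k"
   using Suc assms(2)[of k] by (intro mult_mono pw) auto
  finally show ?case by (simp add: power_add)
 qed simp
 have "norm ((\<Prod>i<k. G i ^ a i) - (\<Prod>i<k. H i ^ a i))
   <= real (\<Sum>i<k. a i)*(1/2) ^ (\<Sum>i<k. a i)*(2*e)" if "k <= n" for k
  using that
 proof (induction k)
  case (Suc k)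
  then have "k < n" "k <= n" by auto
  have "norm ((\<Prod>i<k. G i ^ a i)*G k ^ a k - (\<Prod>i<k. H i ^ a i)*H k ^ a k)
   <= real ((\<Sum>i<k. a i) + a k)*(1/2) ^ ((\<Sum>i<k. a i) + a k)*(2*e)"
   by (intro step pd pw pr Suc.IH assms \<open>k < n\<close> \<open>k \<le> n\<close>)
  then show ?case by simp
 qed simp
 from this[of n] have "norm ((\<Prod>i<n. G i ^ a i) - (\<Prod>i<n. H i ^ a i))
   <= (real (\<Sum>i<n. a i)*(1/2) ^ (\<Sum>i<n. a i)*2)*e" by (simp add: mult.assoc)
 moreover have "real s*(1/2) ^ s*2 <= 1" for s :: nat
 proof (induction s)
  case (Suc s)
  show ?case
  proof (cases "s = 0")
   case False
   then have "real (Suc s) <= 2*real s" by simp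
   then have "real (Suc s)*(1/2) ^ Suc s <= (2*real s)*(1/2) ^ Suc s"
    by (rule mult_right_mono) simp
   moreover have "(1/2) ^ s <= (1/2 :: real) ^ 1"
    using False by (intro power_decreasing) auto
   ultimately show ?thesis using Suc by (simp add: algebra_simps)
  qed simp
 qed simp
 ultimately show ?thesis
  using mult_right_mono[of "real (\<Sum>i<n. a i)*(1/2) ^ (\<Sum>i<n. a i)*2" 1 e] \<open>0 \<le> e\<close>
  by fastforce
qed

lemma ev_lipschitz:
 fixes G H :: "nat => 'b::comm_banach_algebra"
 assumes "!!i. i < n ==> norm (G i) <= 1/2" "!!i. i < n ==> norm (H i) <= 1/2"
  and "!!i. i < n ==> norm (G i - H i) <= e" and "0 <= e"
 shows "norm (ev n G c - ev n H c) <= e*norm c"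
proof -
 let ?p = "%G a. \<Prod>i<n. G i ^ a i"
 have le1: "norm (?p G a) <= 1" "norm (?p H a) <= 1" for a
  using assms(1,2) by (intro norm_prod_power_le_1; force)+
 have "ev n G c - ev n H c = lin (%a. ?p G a - ?p H a) c"
  using lin_fun_add[of "?p G" 1 "%a. - ?p H a" 1 c] lin_fun_scaleR[of "?p H" 1 "-1" c] le1
  by (simp add: ev_def)
 then show ?thesis
  using norm_lin[of "%a. ?p G a - ?p H a" e c] norm_prod_power_diff[OF assms] by simp
qed

subsection \<open>Variables, restriction, division and integration\<close>

definition Xv :: "nat => mps" where "Xv j = mmono (%i. if i = j then 1 else 0)"

text \<open>\<open>Pop j\<close> sets the j-th variable to zero, \<open>Sop j\<close> is the
  quotient of the difference by that variable, and \<open>Jop j\<close> is the integral from zero.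
  None of them raises the norm, in contrast to differentiation, which has to pass to a smaller
  polydisc.\<close>

definition Pop :: "nat => mps => mps" where
 "Pop j = lin (%a. if a j = 0 then mmono a else 0)"

definition Sop :: "nat => mps => mps" where
 "Sop j = lin (%a. if a j = 0 then 0 else mmono (a(j:=a j - 1)))"

definition Jop :: "nat => mps => mps" where
 "Jop j = lin (%a. (1 / real (Suc (a j))) *\<^sub>R mmono (a(j:=Suc (a j))))"

lemma norm_Xv [simp]: "norm (Xv j) = 1" by (simp add: Xv_def)

lemma ev_Xv [simp]: "j < n ==> ev n G (Xv j) = G j"
 by (simp add: Xv_def ev_mono if_distrib[of "%k. _ ^ k"] cong: if_cong)

lemma Pop_bl: "bounded_linear (Pop j)" and norm_Pop: "norm (Pop j c) <= norm c"
 and Sop_bl: "bounded_linear (Sop j)" and norm_Sop: "norm (Sop j c) <= norm c"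
 and Jop_bl: "bounded_linear (Jop j)" and norm_Jop: "norm (Jop j c) <= norm c"
proof -
 have 1: "norm (if a j = 0 then mmono a else 0) <= 1" for a by simp
 have 2: "norm (if a j = 0 then 0 else mmono (a(j:=a j - 1))) <= 1" for a by simp
 have 3: "norm ((1 / real (Suc (a j))) *\<^sub>R mmono (a(j:=Suc (a j)))) <= 1" for a by simp
 show "bounded_linear (Pop j)" "bounded_linear (Sop j)" "bounded_linear (Jop j)"
  unfolding Pop_def Sop_def Jop_def using 1 2 3 by (blast intro: bounded_linear_lin)+
 show "norm (Pop j c) <= norm c" "norm (Sop j c) <= norm c" "norm (Jop j c) <= norm c"
  unfolding Pop_def Sop_def Jop_def
  using norm_lin[OF 1, where c=c] norm_lin[OF 2, where c=c] norm_lin[OF 3, where c=c] by simp_all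
qed

lemma Pop_Sop: "c = Pop j c + Xv j*Sop j c"
proof (rule mps_ext[of "%c. c" "%c. Pop j c + Xv j*Sop j c"])
 show "bounded_linear (%c. Pop j c + Xv j*Sop j c)"
  by (intro bounded_linear_add Pop_bl bounded_linear_const_mult Sop_bl)
 show "mmono a = Pop j (mmono a) + Xv j*Sop j (mmono a)" for a
  by (auto simp: Pop_def Sop_def Xv_def mono_mult intro!: arg_cong[of _ _ mmono])
qed (rule bounded_linear_ident)

lemma ev_Pop:
 assumes G: "!!i. i < n ==> norm (G i) <= (1::real)" and "j < n"
 shows "ev n G (Pop j c) = ev n (G(j:=0)) c"
proof (rule mps_ext[of "%c. ev n G (Pop j c)" "%c. ev n (G(j:=0)) c"])
 show "bounded_linear (%c. ev n G (Pop j c))"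
  by (rule bounded_linear_compose[OF bounded_linear_ev[OF G] Pop_bl])
 show "bounded_linear (%c. ev n (G(j:=0)) c)"
  by (rule bounded_linear_ev) (use G in auto)
 fix a
 show "ev n G (Pop j (mmono a)) = ev n (G(j:=0)) (mmono a)"
 proof (cases "a j = 0")
  case True
  then have "(\<Prod>i<n. (G(j:=0)) i ^ a i) = (\<Prod>i<n. G i ^ a i)" by (intro prod.cong) auto
  then show ?thesis using True by (simp add: Pop_def ev_mono)
 next
  case False
  then have "(\<Prod>i<n. (G(j:=0)) i ^ a i) = 0"
   using \<open>j < n\<close> by (intro prod_zero) (auto intro!: bexI[of _ j] simp: power_0_left)
  then show ?thesis using False by (simp add: Pop_def ev_mono ev_0[OF G])
 qed
qed

section \<open>Germs of analytic functions\<close>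

definition nbf :: "nat => (pnt) filter" where
 "nbf n = (INF r\<in>{0<..}. principal {z. ALL i<n. abs(z i) < r})"

abbreviation near2 :: "((pnt) => bool) => bool" (binder "NEAR " 10) where
 "near2 P \<equiv> eventually P (nbf 2)"

lemma ev_nbf:
 "eventually P (nbf n) \<longleftrightarrow> (EX r>0. ALL z. (ALL i<n. abs(z i) < r) --> P z)"
proof -
 have "eventually P (nbf n) \<longleftrightarrow> (EX r:{0<..}. eventually P (principal {z. ALL i<n. abs(z i) < r}))"
  unfolding nbf_def
 proof (rule eventually_INF_base)
  fix r s :: real assume "r \<in> {0<..}" "s \<in> {0<..}"
  then show "EX t:{0<..}. principal {z. ALL i<n. abs(z i) < t}
    <= inf (principal {z. ALL i<n. abs(z i) < r}) (principal {z. ALL i<n. abs(z i) < s})"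
   by (intro bexI[of _ "min r s"]) auto
 qed auto
 then show ?thesis by (auto simp: eventually_principal)
qed

text \<open>The variables are measured in units of \<open>r\<close>, so the norm of \<open>c\<close>
  is the sum of the absolute values of the terms at the corner of the polydisc of radius
  \<open>r\<close>.\<close>

definition rep :: "nat => real => (fnc) => mps => bool" where
 "rep n r f c \<longleftrightarrow> (ALL z. (ALL i<n. abs(z i) < r) --> f z = ev n (%i. z i / r) c)"

lemma abs_divide_le_1: "abs(x) < r ==> abs(x / r) <= (1::real)"
 by (simp add: field_simps abs_if split: if_splits)

lemma norm_divide_le_1:
 fixes z :: "pnt"
 shows "ALL i<n. abs(z i) < r ==> i < n ==> norm (z i / r) <= (1::real)"
 using abs_divide_le_1[of "z i" r] by (simp only: real_norm_def)

context
 fixes n :: nat and z :: "pnt" and r :: real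
 assumes z: "ALL i<n. abs(z i) < r"
begin

lemma evz_norm: "abs(ev n (%i. z i / r) c) <= norm c"
 using norm_ev_le[of n "%i. z i / r" c, OF norm_divide_le_1[OF z]] by simp

lemma evz_mult: "ev n (%i. z i / r) (c*d) = ev n (%i. z i / r) c*ev n (%i. z i / r) d"
 by (rule ev_mult[of n "%i. z i / r", OF norm_divide_le_1[OF z]])

lemma evz_add: "ev n (%i. z i / r) (c + d) = ev n (%i. z i / r) c + ev n (%i. z i / r) d"
 and evz_diff: "ev n (%i. z i / r) (c - d) = ev n (%i. z i / r) c - ev n (%i. z i / r) d"
 and evz_0: "ev n (%i. z i / r) 0 = 0"
 and evz_1: "ev n (%i. z i / r) 1 = 1"
 and evz_minus: "ev n (%i. z i / r) (- c) = - ev n (%i. z i / r) c"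
 and evz_scaleR: "ev n (%i. z i / r) (k *\<^sub>R c) = k*ev n (%i. z i / r) c"
 and evz_power: "ev n (%i. z i / r) (c ^ m) = ev n (%i. z i / r) c ^ m"
 and evz_sum: "ev n (%i. z i / r) (sum f A) = (\<Sum>j\<in>A. ev n (%i. z i / r) (f j))"
 using norm_divide_le_1[OF z]
 by (simp_all only: ev_add ev_diff ev_0 ev_1 ev_minus ev_scaleR ev_power ev_sum real_scaleR_def)

lemma evz_ev:
 assumes "!!i. i < m ==> norm (H i) <= 1"
 shows "ev n (%i. z i / r) (ev m H c) = ev m (%j. ev n (%i. z i / r) (H j)) c"
 by (rule ev_ev[of n "%i. z i / r", OF norm_divide_le_1[OF z] assms])

end

lemma norm_ev_tail:
 fixes G :: "nat => 'b::comm_banach_algebra"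
 assumes "!!i. i < n ==> norm (G i) <= t" "0 <= t" "t <= 1"
 shows "norm (ev n G c - ev n (%_. 0) c) <= t*norm c"
proof -
 let ?p = "%(G :: nat => 'b) a. \<Prod>i<n. G i ^ a i"
 have le1: "norm (?p G a) <= 1" "norm (?p (%_. 0) a) <= 1" for a
  using assms by (intro norm_prod_power_le_1; force)+
 have "ev n G c - ev n (%_. 0) c = lin (%a. ?p G a - ?p (%_. 0) a) c"
  using lin_fun_add[of "?p G" 1 "%a. - ?p (%_. 0) a" 1 c]
   lin_fun_scaleR[of "?p (%_. 0)" 1 "-1" c] le1
  by (simp add: ev_def)
 moreover have "norm (?p G a - ?p (%_. 0) a) <= t" for a
 proof (cases "ALL i<n. a i = 0")
  case False
  then obtain j where j: "j < n" "a j ~= 0" by auto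
  then have "?p (%_. 0) a = 0" by (intro prod_zero) (auto intro!: bexI[of _ j] simp: power_0_left)
  moreover have "norm (?p G a) <= t"
  proof -
   have "norm (?p G a) = norm (G j*(G j ^ (a j - 1)*(\<Prod>i\<in>{..<n} - {j}. G i ^ a i)))"
    using j by (simp add: prod.remove[of _ j] mult.assoc[symmetric] power_eq_if)
   also have "\<dots> = norm (G j*(\<Prod>i<n. G i ^ (a(j:=a j - 1)) i))"
    using j by (simp add: prod.remove[of _ j])
   also have "\<dots> <= norm (G j)*norm (\<Prod>i<n. G i ^ (a(j:=a j - 1)) i)"
    by (rule norm_mult_ineq)
   also have "\<dots> <= t*1"
    using assms j by (intro mult_mono norm_prod_power_le_1) force+
   finally show ?thesis by simp
  qed
  ultimately show ?thesis by simp
 qed (use \<open>0 \<le> t\<close> in simp)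
 ultimately show ?thesis
  using norm_lin[of "%a. ?p G a - ?p (%_. 0) a" t c] by simp
qed

lemma rep_scale:
 assumes "rep n r f c" "0 < s" "s <= r"
 shows "rep n s f (ev n (%i. (s / r) *\<^sub>R Xv i) c)"
 unfolding rep_def
proof (intro allI impI)
 fix z :: "pnt" assume z: "ALL i<n. abs(z i) < s"
 have "ev n (%i. z i / s) (ev n (%i. (s / r) *\<^sub>R Xv i) c)
   = ev n (%i. ev n (%i. z i / s) ((s / r) *\<^sub>R Xv i)) c"
  by (rule evz_ev[OF z]) (use assms in \<open>auto simp: abs_divide_le_1\<close>)
 also have "\<dots> = ev n (%i. z i / r) c"
  by (rule ev_cong) (use assms in \<open>auto simp: evz_scaleR[OF z]\<close>)
 finally show "f z = ev n (%i. z i / s) (ev n (%i. (s / r) *\<^sub>R Xv i) c)"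
  using assms z unfolding rep_def by (metis order_less_le_trans)
qed

lemma multi_indices_monomial_power:
 "(\<Prod>i<n. (z i / r) ^ a i) = (\<Prod>i<n. z i ^ a i) / r ^ (\<Sum>i<n. a i)" for z :: "pnt"
 by (simp add: power_divide prod_dividef power_sum)

lemma rep_imp_analytic_germ:
 assumes "rep n r f c" "0 < r"
 shows "germ n f"
proof -
 \<comment> \<open>pushing the coefficients forward makes them supported on the multi-indices of length n\<close>
 define d where "d = ev n Xv c"
 have supp: "mcoef d a = 0" if "a \<notin> multi_indices n" for a
 proof -
  have "mcoef (ev n Xv c) a = (%_. 0) c"
  proof (rule mps_ext[of "%c. mcoef (ev n Xv c) a" "%_. 0" c])
   show "bounded_linear (%c. mcoef (ev n Xv c) a)"
    by (rule bounded_linear_compose[OF bounded_linear_mcoef bounded_linear_ev]) simp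
   fix b
   have pw: "mmono e ^ k = mmono (%i. k*e i)" for e k
    by (induction k) (simp_all add: one_mps_def mono_mult)
   have pr: "(\<Prod>i<m. Xv i ^ b i) = mmono (%i. if i < m then b i else 0)" for m
   proof (induction m)
    case (Suc m)
    have "(%i. (if i < m then b i else 0) + b m*(if i = m then 1 else 0))
      = (%i. if i < Suc m then b i else 0)" by (auto simp: less_Suc_eq)
    then show ?case using Suc by (simp add: Xv_def pw mono_mult)
   qed (simp add: one_mps_def)
   have "a ~= (%i. if i < n then b i else 0)"
    using that by (auto simp: multi_indices_def)
   then show "mcoef (ev n Xv (mmono b)) a = 0" by (simp add: ev_mono pr mcoef_mono)
  qed (rule bounded_linear_zero)
  then show ?thesis by (simp add: d_def)
 qed
 have "((%a. (\<Prod>i<n. z i ^ a i) *\<^sub>R (mcoef d a / r ^ (\<Sum>i<n. a i))) has_sum f z) (multi_indices n)"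
  if z: "ALL i<n. abs(z i) < r" for z
 proof -
  have le: "!!i. i < n ==> norm (z i / r) <= 1" using norm_divide_le_1[OF z] .
  have "f z = ev n (%i. z i / r) c" using assms z by (simp add: rep_def)
  also have "\<dots> = ev n (%i. z i / r) d"
   unfolding d_def by (subst ev_ev) (use le in \<open>auto intro!: ev_cong\<close>)
  finally have "f z = ev n (%i. z i / r) d" .
  moreover have "((%a. mcoef d a *\<^sub>R (\<Prod>i<n. (z i / r) ^ a i)) has_sum ev n (%i. z i / r) d) UNIV"
   unfolding ev_def by (rule lin_has_sum) (rule norm_prod_power_le_1[OF le])
  ultimately have "((%a. mcoef d a *\<^sub>R (\<Prod>i<n. (z i / r) ^ a i)) has_sum f z) UNIV" by simp
  then have "((%a. mcoef d a *\<^sub>R (\<Prod>i<n. (z i / r) ^ a i)) has_sum f z) (multi_indices n)"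
   by (rule has_sum_cong_neutral[THEN iffD1, rotated -1]) (auto simp: supp)
  then show ?thesis by (simp add: multi_indices_monomial_power mult.commute)
 qed
 then show ?thesis unfolding analytic_germ_def using \<open>0 < r\<close>
  by (intro exI[of _ "%a. mcoef d a / r ^ (\<Sum>i<n. a i)"] exI[of _ r]) auto
qed

lemma germ_imp_rep:
 fixes f :: "fnc"
 assumes "germ n f"
 shows "EX r>0. EX c. rep n r f c"
proof -
 obtain c r where "r > 0" and c: "!!z. ALL i<n. abs(z i) < r ==>
   ((%a. (\<Prod>i<n. z i ^ a i) *\<^sub>R c a) has_sum f z) (multi_indices n)"
  using assms unfolding analytic_germ_def by blast
 define s where "s = r / 2"
 have "0 < s" "s < r" using \<open>r > 0\<close> by (auto simp: s_def)
 define d where "d a = (if a \<in> multi_indices n then s ^ (\<Sum>i<n. a i)*c a else 0)" for a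
 have "((%a. (\<Prod>i<n. s ^ a i) *\<^sub>R c a) has_sum f (%_. s)) (multi_indices n)"
  using c[of "%_. s"] \<open>0 < s\<close> \<open>s < r\<close> by simp
 then have "(%a. (\<Prod>i<n. s ^ a i) *\<^sub>R c a) summable_on (multi_indices n)"
  by (rule has_sum_imp_summable)
 moreover have "(%a. (\<Prod>i<n. s ^ a i) *\<^sub>R c a) summable_on (multi_indices n)
   \<longleftrightarrow> d summable_on (multi_indices n)"
  by (rule summable_on_cong) (simp add: d_def power_sum)
 ultimately have "d summable_on (multi_indices n)" by simp
 then have "(%a. abs(d a)) summable_on (multi_indices n)"
  unfolding real_norm_def[symmetric] by (rule summable_on_iff_abs_summable_on_real[THEN iffD1])
 then have "(%a. abs(d a)) summable_on UNIV"
  by (rule summable_on_cong_neutral[THEN iffD1, rotated -1]) (auto simp: d_def)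
 then have co: "mcoef (Abs_mps d) = d" by (simp add: Abs_mps_inverse)
 have "rep n s f (Abs_mps d)"
  unfolding rep_def
 proof (intro allI impI)
  fix z :: "pnt" assume z: "ALL i<n. abs(z i) < s"
  have "((%a. d a *\<^sub>R (\<Prod>i<n. (z i / s) ^ a i)) has_sum ev n (%i. z i / s) (Abs_mps d)) UNIV"
   unfolding ev_def using lin_has_sum[OF norm_prod_power_le_1[OF norm_divide_le_1[OF z]], where c="Abs_mps d"]
   by (simp only: co)
  then have "((%a. (\<Prod>i<n. z i ^ a i) *\<^sub>R c a) has_sum ev n (%i. z i / s) (Abs_mps d)) (multi_indices n)"
   by (rule has_sum_cong_neutral[THEN iffD1, rotated -1])
    (use \<open>0 < s\<close> in \<open>auto simp: d_def multi_indices_monomial_power\<close>)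
  then show "f z = ev n (%i. z i / s) (Abs_mps d)"
   using c[of z] z \<open>s < r\<close> by (meson has_sum_unique order_less_trans)
 qed
 with \<open>0 < s\<close> show ?thesis by blast
qed

text \<open>Speaking of all small radii through a filter gives finitely many germs a common radius
  by mere conjunction.\<close>

lemma germ_iff_rep:
 fixes f :: "fnc"
 shows "germ n f \<longleftrightarrow> (\<forall>\<^sub>F r in at_right 0. EX c. rep n r f c)"
proof
 assume "germ n f"
 then obtain r c where "r > 0" "rep n r f c" using germ_imp_rep by blast
 then show "\<forall>\<^sub>F r in at_right 0. EX c. rep n r f c"
  unfolding eventually_at_right_field
  by (intro exI[of _ r]) (use rep_scale in \<open>blast intro: less_imp_le\<close>)
next
 assume *: "\<forall>\<^sub>F r in at_right 0. EX c. rep n r f c"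
 have "\<forall>\<^sub>F r in at_right (0::real). r > 0" by (simp add: eventually_at_filter)
 from eventually_happens[OF eventually_conj[OF this *]] obtain r c where "r > 0" "rep n r f c"
  by auto
 then show "germ n f" by (blast intro: rep_imp_analytic_germ)
qed

text \<open>Shrinking the radius from \<open>R\<close> to \<open>r\<close> multiplies every
  nonconstant term by at most \<open>r / R\<close>. A germ that vanishes at the origin can therefore
  be made as small in norm as a contraction demands.\<close>

lemma rep_small:
 fixes f :: "fnc"
 assumes "germ n f" "f (%_. 0) = 0" "e > 0"
 shows "\<forall>\<^sub>F r in at_right 0. EX c. rep n r f c & norm c <= e"
proof -
 obtain R c where R: "R > 0" "rep n R f c" using assms germ_imp_rep by blast
 have z: "ev n (%_. 0) c = (0::real)"
  using R assms(2) unfolding rep_def by (force dest: spec[of _ "%_. 0"])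
 have zW: "ev n (%_. 0) c = (0::mps)"
 proof -
  have "ev n (%_. 0) c = (of_real (ev n (%_. 0 :: real) c) :: mps)"
  proof (rule mps_ext[of "ev n (%_. 0::mps)" "%c. of_real (ev n (%_. 0 :: real) c)"])
   show "bounded_linear (%c. of_real (ev n (%_. 0 :: real) c) :: mps)"
    by (rule bounded_linear_compose[OF bounded_linear_of_real bounded_linear_ev]) simp
  qed (auto simp: ev_mono intro: bounded_linear_ev)
  then show ?thesis by (simp add: z)
 qed
 define t where "t = min R (R*e / (norm c + 1))"
 have "t > 0" using R assms(3) by (auto simp: t_def intro!: divide_pos_pos add_nonneg_pos)
 have "EX c. rep n r f c & norm c <= e" if "0 < r" "r < t" for r
 proof (intro exI conjI)
  have "r <= R" using that by (simp add: t_def)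
  then show "rep n r f (ev n (%i. (r / R) *\<^sub>R Xv i) c)" using R that by (intro rep_scale) auto
  have "norm (ev n (%i. (r / R) *\<^sub>R Xv i) c - ev n (%_. 0) c) <= r / R*norm c"
   using that R \<open>r \<le> R\<close> by (intro norm_ev_tail) auto
  also have "\<dots> <= r / R*(norm c + 1)" using that R by (intro mult_left_mono) auto
  also have "\<dots> <= e"
  proof -
   have "r <= R*e / (norm c + 1)" using that by (simp add: t_def)
   then have "r*(norm c + 1) <= R*e"
    by (subst (asm) pos_le_divide_eq) (auto intro: add_nonneg_pos)
   then show ?thesis using R by (simp add: field_simps)
  qed
  finally show "norm (ev n (%i. (r / R) *\<^sub>R Xv i) c) <= e" by (simp add: zW)
 qed
 then show ?thesis unfolding eventually_at_right_field using \<open>t > 0\<close> by blast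
qed

subsection \<open>Closure properties\<close>

lemma eventually_at_right_pos: "\<forall>\<^sub>F r in at_right (0::real). r > 0"
 by (simp add: eventually_at_filter)

lemma germ_cong:
 fixes f g :: "fnc"
 assumes "germ n f" "\<forall>\<^sub>F z in nbf n. f z = g z"
 shows "germ n g"
proof -
 obtain t where "t > 0" and fg: "!!z. ALL i<n. abs(z i) < t ==> f z = g z"
  using assms(2) unfolding ev_nbf by blast
 have "\<forall>\<^sub>F r in at_right 0. r < t"
  using \<open>t > 0\<close> unfolding eventually_at_right_field by blast
 moreover have "\<forall>\<^sub>F r in at_right 0. EX c. rep n r f c"
  using assms(1) by (simp add: germ_iff_rep)
 ultimately have "\<forall>\<^sub>F r in at_right 0. EX c. rep n r g c"
 proof eventually_elim
  case (elim r)
  then obtain c where c: "rep n r f c" and "r < t" by auto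
  have "rep n r g c" unfolding rep_def
  proof (intro allI impI)
   fix z :: "pnt" assume z: "ALL i<n. abs(z i) < r"
   then have "ALL i<n. abs(z i) < t" using \<open>r < t\<close> by auto
   then show "g z = ev n (%i. z i / r) c" using fg[of z] c z by (simp add: rep_def)
  qed
  then show ?case ..
 qed
 then show ?thesis by (simp add: germ_iff_rep)
qed

lemma rep_scaleR_1: "rep n r (%_. k) (k *\<^sub>R 1)"
 unfolding rep_def
proof (intro allI impI)
 fix z :: "pnt" assume z: "ALL i<n. abs(z i) < r"
 show "k = ev n (%i. z i / r) (k *\<^sub>R 1)" by (simp add: evz_scaleR[OF z] evz_1[OF z])
qed

lemma rep_add:
 assumes "rep n r f c" "rep n r g d"
 shows "rep n r (%z. f z + g z) (c + d)"
 unfolding rep_def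
proof (intro allI impI)
 fix z :: "pnt" assume z: "ALL i<n. abs(z i) < r"
 show "f z + g z = ev n (%i. z i / r) (c + d)" using assms z by (simp add: evz_add[OF z] rep_def)
qed

lemma rep_mult:
 assumes "rep n r f c" "rep n r g d"
 shows "rep n r (%z. f z*g z) (c*d)"
 unfolding rep_def
proof (intro allI impI)
 fix z :: "pnt" assume z: "ALL i<n. abs(z i) < r"
 show "f z*g z = ev n (%i. z i / r) (c*d)" using assms z by (simp add: evz_mult[OF z] rep_def)
qed

lemma germ_const [simp, intro]: "germ n (%_. k :: real)"
 by (rule rep_imp_analytic_germ[OF rep_scaleR_1[of n 1]]) simp

lemma germ_var [intro]: "i < n ==> germ n (%z. z i)"
 by (rule rep_imp_analytic_germ[of n 1 _ "Xv i"]) (auto simp: rep_def)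

lemma germ_add [intro]:
 fixes f g :: "fnc"
 assumes "germ n f" "germ n g"
 shows "germ n (%z. f z + g z)"
 unfolding germ_iff_rep
 by (rule eventually_mono[OF eventually_conj[OF assms[unfolded germ_iff_rep]]])
  (blast intro: rep_add)

lemma germ_mult [intro]:
 fixes f g :: "fnc"
 assumes "germ n f" "germ n g"
 shows "germ n (%z. f z*g z)"
 unfolding germ_iff_rep
 by (rule eventually_mono[OF eventually_conj[OF assms[unfolded germ_iff_rep]]])
  (blast intro: rep_mult)

lemma germ_minus [intro]:
 fixes f :: "fnc"
 shows "germ n f ==> germ n (%z. - f z)"
 using germ_mult[of n "%_. -1" f] by simp

lemma germ_diff [intro]:
 fixes f g :: "fnc"
 shows "germ n f ==> germ n g ==> germ n (%z. f z - g z)"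
 using germ_add[of n f "%z. - g z"] by auto

lemma germ_power [intro]:
 fixes f :: "fnc"
 shows "germ n f ==> germ n (%z. f z ^ k)"
 by (induction k) auto

lemma germ_sum [intro]:
 fixes f :: "'i => fnc"
 shows "(!!i. i \<in> A ==> germ n (f i)) ==> germ n (%z. \<Sum>i\<in>A. f i z)"
 by (induction A rule: infinite_finite_induct) auto

lemma germ_divide_const [intro]:
 fixes f :: "fnc"
 shows "germ n f ==> germ n (%z. f z / k)"
 using germ_mult[of n f "%_. inverse k"] by (simp add: divide_inverse)

lemma germ_compose:
 fixes f :: "fnc" and g :: "nat => fnc"
 assumes f: "germ m f"
  and g: "!!i. i < m ==> germ n (g i)" "!!i. i < m ==> g i (%_. 0) = 0"
 shows "germ n (%z. f (%i. g i z))"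
proof -
 obtain R c where R: "R > 0" "rep m R f c" using f germ_imp_rep by blast
 have "\<forall>\<^sub>F r in at_right 0. ALL i:{..<m}. EX d. rep n r (g i) d & norm d <= R / 2"
  by (rule eventually_ball_finite) (use R g in \<open>auto simp del: le_divide_eq_numeral1 intro!: rep_small\<close>)
 from eventually_happens[OF eventually_conj[OF eventually_at_right_pos this]]
 obtain r where "r > 0" and "ALL i:{..<m}. EX d. rep n r (g i) d & norm d <= R / 2" by auto
 then obtain d where d: "!!i. i < m ==> rep n r (g i) (d i)" "!!i. i < m ==> norm (d i) <= R / 2"
  unfolding Ball_def lessThan_iff by metis
 have dn: "norm ((1 / R) *\<^sub>R d i) <= 1" if "i < m" for i
  using d(2)[OF that] R by (simp add: field_simps)
 have "rep n r (%z. f (%i. g i z)) (ev m (%i. (1 / R) *\<^sub>R d i) c)"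
  unfolding rep_def
 proof (intro allI impI)
  fix z :: "pnt" assume z: "ALL i<n. abs(z i) < r"
  have zn: "!!i. i < n ==> norm (z i / r) <= 1" using norm_divide_le_1[OF z] .
  have gz: "g i z = ev n (%i. z i / r) (d i)" if "i < m" for i
   using d(1)[OF that] z by (simp add: rep_def)
  have "abs(g i z) < R" if "i < m" for i
   using evz_norm[OF z, of "d i"] gz[OF that] d(2)[OF that] R by simp
  then have "f (%i. g i z) = ev m (%i. g i z / R) c" using R by (simp add: rep_def)
  also have "\<dots> = ev m (%i. ev n (%i. z i / r) ((1 / R) *\<^sub>R d i)) c"
   by (rule ev_cong) (simp add: gz evz_scaleR[OF z])
  also have "\<dots> = ev n (%i. z i / r) (ev m (%i. (1 / R) *\<^sub>R d i) c)"
   by (rule evz_ev[OF z, symmetric]) (use dn in auto)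
  finally show "f (%i. g i z) = ev n (%i. z i / r) (ev m (%i. (1 / R) *\<^sub>R d i) c)" .
 qed
 then show ?thesis using \<open>r > 0\<close> by (rule rep_imp_analytic_germ)
qed

lemma linear_fixpoint:
 fixes D :: "'b::banach => 'b"
 assumes "bounded_linear D" "!!x. norm (D x) <= 1/2*norm x"
 shows "EX x. x = b + D x"
proof -
 have "EX! x. b + D x = x"
 proof (rule banach_fix_type[of "1/2" "%x. b + D x"])
  show "ALL x y. dist (b + D x) (b + D y) <= 1/2*dist x y"
   using assms by (simp add: dist_norm linear_simps(2)[OF assms(1), symmetric])
 qed auto
 then show ?thesis by metis
qed

lemma germ_inverse:
 fixes f :: "fnc"
 assumes f: "germ n f" and nz: "f (%_. 0) ~= 0"
 shows "germ n (%z. inverse (f z))"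
proof -
 define k where "k = f (%_. 0)"
 have "germ n (%z. 1 - f z / k)" using f by auto
 then have "\<forall>\<^sub>F r in at_right 0. EX c. rep n r (%z. 1 - f z / k) c & norm c <= 1/2"
  by (rule rep_small) (use nz in \<open>auto simp: k_def\<close>)
 from eventually_happens[OF eventually_conj[OF eventually_at_right_pos this]]
 obtain r c where r: "r > 0" "rep n r (%z. 1 - f z / k) c" "norm c <= 1/2" by auto
 \<comment> \<open>\<open>1 - c\<close> represents \<open>f z / k\<close>, and \<open>d\<close> is
   its inverse, the sum of the geometric series in \<open>c\<close>.\<close>
 obtain d where d: "d = 1 + c*d"
  using linear_fixpoint[of "%d. c*d" 1]
   order_trans[OF norm_mult_ineq mult_right_mono[OF r(3) norm_ge_zero]]
   bounded_linear_mult_right by metis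
 have "rep n r (%z. inverse (f z)) (inverse k *\<^sub>R d)"
  unfolding rep_def
 proof (intro allI impI)
  fix z :: "pnt" assume z: "ALL i<n. abs(z i) < r"
  have zn: "!!i. i < n ==> norm (z i / r) <= 1" using norm_divide_le_1[OF z] .
  let ?e = "ev n (%i. z i / r)"
  have "?e d = 1 + (1 - f z / k)*?e d"
   using arg_cong[OF d, of ?e] r(2) z by (simp add: evz_add[OF z] evz_mult[OF z] evz_1[OF z] rep_def)
  then have "f z*(?e d / k) = 1" using nz by (simp add: k_def field_simps)
  then have i: "inverse (f z) = ?e d / k" by (rule inverse_unique)
  then show "inverse (f z) = ?e (inverse k *\<^sub>R d)"
   using evz_scaleR[OF z, of "inverse k" d] unfolding i by (simp only: divide_inverse mult.commute)
 qed
 then show ?thesis using r(1) by (rule rep_imp_analytic_germ)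
qed

lemma germ_division:
 fixes f :: "fnc"
 assumes "germ n f" "j < n"
 shows "EX q. germ n q & (\<forall>\<^sub>F z in nbf n. f z = f (z(j:=0)) + z j*q z)"
proof -
 obtain r c where r: "r > 0" "rep n r f c" using assms germ_imp_rep by blast
 define q where "q z = ev n (%i. z i / r) (Sop j c) / r" for z
 have "germ n (%z. ev n (%i. z i / r) (Sop j c) / r)"
  by (intro germ_divide_const rep_imp_analytic_germ[of n r _ "Sop j c"])
   (auto simp: rep_def r)
 moreover have "f z = f (z(j:=0)) + z j*q z" if z: "ALL i<n. abs(z i) < r" for z
 proof -
  have zn: "!!i. i < n ==> norm (z i / r) <= 1" using norm_divide_le_1[OF z] .
  have "ev n (%i. z i / r) c = ev n (%i. z i / r) (Pop j c + Xv j*Sop j c)"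
   using Pop_Sop[of c j] by simp
  also have "\<dots> = ev n ((%i. z i / r)(j:=0)) c + z j / r*ev n (%i. z i / r) (Sop j c)"
   using assms zn by (simp add: evz_add[OF z] evz_mult[OF z] ev_Pop)
  also have "ev n ((%i. z i / r)(j:=0)) c = ev n (%i. (z(j:=0)) i / r) c"
   by (rule ev_cong) auto
  also have "\<dots> = f (z(j:=0))" using z r by (auto simp: rep_def)
  finally show ?thesis using z r by (simp add: rep_def q_def)
 qed
 ultimately show ?thesis unfolding ev_nbf q_def using r(1) by blast
qed

subsection \<open>Differentiation\<close>

text \<open>\<open>Dop n i c\<close> is the i-th derivative of \<open>c\<close>; its expansion is in the variables \<open>2z\<close>, which keeps the
 coefficients absolutely summable.\<close>

definition Dop :: "nat => nat => mps => mps" where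
 "Dop n i c = 2 *\<^sub>R ev (2*n) (%k. if k < n then Xv k else 0)
   (Sop (n + i) (ev n (%k. (1/2) *\<^sub>R Xv k + (1/2) *\<^sub>R Xv (n + k)) c))"

lemma bounded_linear_Dop: "bounded_linear (Dop n i)"
proof -
 have 1: "!!k. norm ((1/2) *\<^sub>R Xv k + (1/2) *\<^sub>R Xv (n + k)) <= 1"
  by (rule order_trans[OF norm_triangle_ineq]) simp
 have 2: "!!k. norm (if k < n then Xv k else 0) <= 1" by simp
 show ?thesis unfolding Dop_def
  by (intro bounded_linear_compose[OF bounded_linear_scaleR_right]
    bounded_linear_compose[OF bounded_linear_ev] bounded_linear_compose[OF Sop_bl]
    bounded_linear_ev 1 2)
qed

text \<open>Telescoping: the variables \<open>p, ..., p + q - 1\<close> are set to zero one after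
  the other, and each step splits off one quotient.\<close>

lemma ev_block:
 fixes w :: "pnt"
 assumes w: "!!i. i < N ==> abs(w i) <= 1" and "p + q <= N"
 shows "ev N w c - ev N (%i. if p <= i & i < p + q then 0 else w i) c
  = (\<Sum>k<q. w (p + k)*ev N (%i. if p <= i & i < p + k then 0 else w i) (Sop (p + k) c))"
 using \<open>p + q \<le> N\<close>
proof (induction q)
 case (Suc q)
 let ?w = "%q i. if p <= i & i < p + q then 0 else w i"
 have wn: "!!i. i < N ==> norm (?w q i) <= 1" using w by simp
 have "ev N (?w q) c = ev N (?w q) (Pop (p + q) c + Xv (p + q)*Sop (p + q) c)"
  using Pop_Sop[of c "p + q"] by simp
 also have "\<dots> = ev N ((?w q)(p + q:=0)) c + w (p + q)*ev N (?w q) (Sop (p + q) c)"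
  using Suc.prems wn by (simp add: ev_add[of N "?w q", OF wn] ev_mult[of N "?w q", OF wn] ev_Pop)
 also have "(?w q)(p + q:=0) = ?w (Suc q)" by auto
 finally have "ev N (?w q) c = ev N (?w (Suc q)) c + w (p + q)*ev N (?w q) (Sop (p + q) c)" .
 then show ?case using Suc by simp
qed (auto intro!: ev_cong)

lemma ev_block_bound:
 fixes w :: "pnt"
 assumes w: "!!i. i < N ==> abs(w i) <= 1" and "p + q <= N"
 shows "abs(ev N w c - ev N (%i. if p <= i & i < p + q then 0 else w i) c)
  <= (\<Sum>k<q. abs(w (p + k)))*norm c"
proof -
 have "abs(ev N w c - ev N (%i. if p <= i & i < p + q then 0 else w i) c)
   = abs(\<Sum>k<q. w (p + k)*ev N (%i. if p <= i & i < p + k then 0 else w i) (Sop (p + k) c))"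
  using assms by (subst ev_block) auto
 also have "\<dots> <= (\<Sum>k<q. abs(w (p + k))*norm c)"
 proof (rule order_trans[OF sum_abs], rule sum_mono)
 fix k assume "k \<in> {..<q}"
 have "norm (ev N (%i. if p <= i & i < p + k then 0 else w i) (Sop (p + k) c)) <= norm c"
  by (rule order_trans[OF norm_ev_le norm_Sop]) (use w in auto)
 then show "abs(w (p + k)*ev N (%i. if p <= i & i < p + k then 0 else w i) (Sop (p + k) c))
   <= abs(w (p + k))*norm c"
  by (simp add: abs_mult mult_left_mono)
 qed
 finally show ?thesis by (simp add: sum_distrib_right)
qed

text \<open>The expression \<open>c (z + h)\<close> is itself a series \<open>C\<close> in the
  doubled set of variables \<open>2 z\<close>, \<open>2 h\<close>. Setting the
  \<open>h\<close>-variables to zero one by one produces the linear terms, and their coefficients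
  differ from those at \<open>h = 0\<close> by a quantity of first order again, whence the
  square.\<close>

lemma Dop_taylor:
 assumes z: "!!i. i < n ==> abs(z i) <= 1/2" and h: "!!i. i < n ==> abs(h i) <= (1/2 :: real)"
 shows "abs(ev n (%i. z i + h i) c - ev n z c - (\<Sum>k<n. h k*ev n (%i. 2*z i) (Dop n k c)))
  <= 4*norm c*(\<Sum>k<n. abs(h k))^2"
proof -
 define G :: "nat => mps" where "G = (%k. (1/2) *\<^sub>R Xv k + (1/2) *\<^sub>R Xv (n + k))"
 define C where "C = ev n G c"
 define w where "w = (%i. if i < n then 2*z i else 2*h (i - n))"
 define v where "v = (%k i. if n <= i & i < n + k then 0 else w i)"
 have Gn: "norm (G i) <= 1" for i
  unfolding G_def by (rule order_trans[OF norm_triangle_ineq]) simp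
 have w1: "abs(w i) <= 1" if "i < 2*n" for i
 proof (cases "i < n")
  case False
  then have "i - n < n" using that by simp
  then show ?thesis using h[of "i - n"] False by (simp add: w_def abs_mult)
 qed (use z[of i] in \<open>simp add: w_def abs_mult\<close>)
 have v1: "norm (v k i) <= 1" if "i < 2*n" for i k
  using w1[OF that] by (auto simp: v_def)
 have evC: "ev (2*n) u C = ev n (%i. (u i + u (n + i)) / 2) c"
  if "!!i. i < 2*n ==> norm (u i) <= 1" for u :: "pnt"
  unfolding C_def
  by (subst ev_ev[OF that Gn]) (auto intro!: ev_cong simp: G_def ev_add[of "2*n" u, OF that] ev_scaleR[of "2*n" u, OF that])
 have 1: "ev (2*n) w C = ev n (%i. z i + h i) c"
  by (subst evC) (use w1 in \<open>auto intro!: ev_cong simp: w_def\<close>)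
 have 2: "ev (2*n) (v n) C = ev n z c"
  by (subst evC[OF v1]) (auto intro!: ev_cong simp: w_def v_def)
 have 3: "ev n (%i. 2*z i) (Dop n k c) = 2*ev (2*n) (v n) (Sop (n + k) C)" for k
 proof -
  have zn: "norm (2*z i) <= 1" if "i < n" for i using z[OF that] by (simp add: abs_mult)
  have sc: "ev n (%i. 2*z i) (2 *\<^sub>R u) = 2*ev n (%i. 2*z i) u" for u
   using ev_scaleR[of n "%i. 2*z i" 2 u] zn by simp
  have zr: "ev n (%i. 2*z i) 0 = 0" using ev_0[of n "%i. 2*z i"] zn by simp
  have "ev n (%i. 2*z i) (ev (2*n) (%k. if k < n then Xv k else 0) u)
    = ev (2*n) (%j. ev n (%i. 2*z i) (if j < n then Xv j else 0)) u" for u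
   by (rule ev_ev) (use zn in auto)
  also have "\<dots> u = ev (2*n) (v n) u" for u
   by (rule ev_cong) (auto simp: v_def w_def zr)
  finally show ?thesis
   by (simp add: Dop_def sc C_def[unfolded G_def, symmetric])
 qed
 have eq: "ev (2*n) w C - ev (2*n) (v n) C
   = (\<Sum>k<n. w (n + k)*ev (2*n) (v k) (Sop (n + k) C))"
  unfolding v_def by (rule ev_block) (use w1 in auto)
 have bd: "abs(ev (2*n) (v k) (Sop (n + k) C) - ev (2*n) (v n) (Sop (n + k) C))
   <= 2*(\<Sum>j<n. abs(h j))*norm c" if "k < n" for k
 proof -
  have "abs(ev (2*n) (v k) (Sop (n + k) C)
    - ev (2*n) (%i. if n <= i & i < n + n then 0 else v k i) (Sop (n + k) C))
   <= (\<Sum>j<n. abs(v k (n + j)))*norm (Sop (n + k) C)"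
   by (rule ev_block_bound) (use v1 in auto)
  also have "(%i. if n <= i & i < n + n then 0 else v k i) = v n"
   using that by (auto simp: v_def)
  also have "(\<Sum>j<n. abs(v k (n + j)))*norm (Sop (n + k) C) <= (\<Sum>j<n. 2*abs(h j))*norm c"
  proof (intro mult_mono sum_mono sum_nonneg)
   show "norm (Sop (n + k) C) <= norm c"
    unfolding C_def by (rule order_trans[OF norm_Sop norm_ev_le[OF Gn]])
  qed (auto simp: v_def w_def abs_mult)
  finally show ?thesis by (simp add: sum_distrib_left)
 qed
 have "ev n (%i. z i + h i) c - ev n z c - (\<Sum>k<n. h k*ev n (%i. 2*z i) (Dop n k c))
  = (\<Sum>k<n. 2*h k*(ev (2*n) (v k) (Sop (n + k) C) - ev (2*n) (v n) (Sop (n + k) C)))"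
  unfolding 1[symmetric] 2[symmetric] 3 eq
  by (simp add: sum_subtractf[symmetric] w_def algebra_simps)
 also have "abs(\<dots>) <= (\<Sum>k<n. 2*abs(h k)*(2*(\<Sum>j<n. abs(h j))*norm c))"
 proof (rule order_trans[OF sum_abs], rule sum_mono)
  fix k assume "k \<in> {..<n}"
  then show "abs(2*h k*(ev (2*n) (v k) (Sop (n + k) C) - ev (2*n) (v n) (Sop (n + k) C)))
    <= 2*abs(h k)*(2*(\<Sum>j<n. abs(h j))*norm c)"
   using mult_left_mono[OF bd[of k], of "2*abs(h k)"] by (simp only: abs_mult lessThan_iff) simp
 qed
 also have "\<dots> = 4*norm c*(\<Sum>k<n. abs(h k))^2"
  by (simp add: sum_distrib_right[symmetric] sum_distrib_left[symmetric] power2_eq_square)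
 finally show ?thesis .
qed

text \<open>Derivatives are taken within \<open>S\<close> so that the end points of the time
  interval \<open>[0, 1]\<close> of a flow are covered. The remainder divided by
  \<open>s - t\<close> is a null term times a convergent one.\<close>

lemma has_derivative_of_taylor:
 fixes gm :: "real => pnt"
 assumes est: "!!h. (ALL i<n. abs(h i) < dl) ==>
   abs(f (%i. gm t i + h i) - f (gm t) - (\<Sum>i<n. h i*D i)) <= K*(\<Sum>i<n. abs(h i))^2" and "dl > 0"
  and gm: "!!i. i < n ==> ((%s. gm s i) hrd gm' i) (at t within S)"
 shows "((%s. f (gm s)) hrd (\<Sum>i<n. D i*gm' i)) (at t within S)"
proof -
 define h where "h s i = gm s i - gm t i" for s i
 define q where "q s = f (gm s) - f (gm t) - (\<Sum>i<n. h s i*D i)" for s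
 have h0: "((%s. h s i) \<longlongrightarrow> 0) (at t within S)" if "i < n" for i
 proof -
  have "continuous (at t within S) (%s. gm s i)" using gm[OF that] by (rule DERIV_continuous)
  then have "((%s. gm s i) \<longlongrightarrow> gm t i) (at t within S)" by (simp add: continuous_within)
  then show ?thesis unfolding h_def using tendsto_diff[OF _ tendsto_const, of _ "gm t i" _ "gm t i"] by simp
 qed
 have h1: "((%s. h s i / (s - t)) \<longlongrightarrow> gm' i) (at t within S)" if "i < n" for i
  using gm[OF that] by (simp add: has_field_derivative_iff h_def)
 have "\<forall>\<^sub>F s in at t within S. ALL i:{..<n}. abs(h s i) < dl"
 proof (rule eventually_ball_finite)
  show "ALL i:{..<n}. \<forall>\<^sub>F s in at t within S. abs(h s i) < dl"
   using tendstoD[OF h0 \<open>dl > 0\<close>] by (auto simp: dist_real_def)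
 qed simp
 then have bnd: "\<forall>\<^sub>F s in at t within S.
   norm (q s / (s - t)) <= abs(K)*(\<Sum>i<n. abs(h s i))*(\<Sum>i<n. abs(h s i / (s - t)))"
 proof eventually_elim
  case (elim s)
  have "abs(q s) <= K*(\<Sum>i<n. abs(h s i))^2"
   using est[of "h s"] elim by (simp add: q_def h_def)
  also have "\<dots> <= abs(K)*(\<Sum>i<n. abs(h s i))^2" by (intro mult_right_mono) auto
  finally have "abs(q s) / abs(s - t) <= abs(K)*(\<Sum>i<n. abs(h s i))^2 / abs(s - t)"
   by (rule divide_right_mono) simp
  also have "abs(K)*(\<Sum>i<n. abs(h s i))^2 / abs(s - t) = abs(K)*(\<Sum>i<n. abs(h s i))*(\<Sum>i<n. abs(h s i / (s - t)))"
   by (simp add: power2_eq_square sum_divide_distrib[symmetric])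
  finally show ?case by simp
 qed
 have "((%s. abs(K)*(\<Sum>i<n. abs(h s i))*(\<Sum>i<n. abs(h s i / (s - t))))
   \<longlongrightarrow> abs(K)*(\<Sum>i<n. abs(0))*(\<Sum>i<n. abs(gm' i))) (at t within S)"
  by (intro tendsto_intros h0 h1) auto
 then have "((%s. abs(K)*(\<Sum>i<n. abs(h s i))*(\<Sum>i<n. abs(h s i / (s - t)))) \<longlongrightarrow> 0) (at t within S)"
  by simp
 then have "((%s. q s / (s - t)) \<longlongrightarrow> 0) (at t within S)"
  by (rule Lim_null_comparison[OF bnd])
 moreover have "q t = 0" by (simp add: q_def h_def)
 ultimately have "(q hrd 0) (at t within S)"
  by (simp add: has_field_derivative_iff)
 moreover have "((%s. \<Sum>i<n. h s i*D i) hrd (\<Sum>i<n. D i*gm' i)) (at t within S)"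
  unfolding h_def by (rule DERIV_sum) (auto intro!: derivative_eq_intros gm)
 ultimately have "((%s. f (gm t) + (q s + (\<Sum>i<n. h s i*D i))) hrd
   (0 + (0 + (\<Sum>i<n. D i*gm' i)))) (at t within S)"
  by (intro DERIV_add DERIV_const)
 then show ?thesis by (simp add: q_def)
qed

lemma Dop_chain:
 assumes z: "!!i. i < n ==> abs(gm t i) <= 1/2"
  and gm: "!!i. i < n ==> ((%s. gm s i) hrd gm' i) (at t within S)"
 shows "((%s. ev n (gm s) c) hrd
   (\<Sum>i<n. ev n (%i. 2*gm t i) (Dop n i c)*gm' i)) (at t within S)"
proof (rule has_derivative_of_taylor[where dl="1/2" and K="4*norm c", OF _ _ gm])
 fix h :: "pnt" assume "ALL i<n. abs(h i) < 1/2"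
 then show "abs(ev n (%i. gm t i + h i) c - ev n (gm t) c
   - (\<Sum>i<n. h i*ev n (%i. 2*gm t i) (Dop n i c))) <= 4*norm c*(\<Sum>i<n. abs(h i))^2"
  by (intro Dop_taylor z) (auto intro: less_imp_le)
qed auto

text \<open>The derivative exists by \<open>Dop_chain\<close>. That it equals the value of
  \<open>c\<close> is an identity between bounded linear maps of \<open>c\<close>, so it has to be
  computed for monomials only.\<close>

lemma Jop_derivative:
 assumes w: "!!i. i < n ==> abs(w i) <= 1/2" and "j < n" "abs(t) <= 1/2"
 shows "((%t. ev n (w(j:=t)) (Jop j c)) hrd ev n (w(j:=t)) c) (at t within S)"
proof -
 let ?w = "w(j:=t)"
 have wn: "!!i. i < n ==> norm (?w i) <= 1" "!!i. i < n ==> norm (2*?w i) <= 1"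
  using w \<open>\<bar>t\<bar> \<le> 1/2\<close> by (fastforce simp: abs_mult)+
 have *: "((%t. ev n (w(j:=t)) c) hrd ev n (%i. 2*?w i) (Dop n j c)) (at t within S)"
  for c S
 proof -
  have "((%s. ev n ((%s. w(j:=s)) s) c) hrd
    (\<Sum>i<n. ev n (%i. 2*((%s. w(j:=s)) t) i) (Dop n i c)*(if i = j then 1 else 0))) (at t within S)"
   by (rule Dop_chain) (use w assms(3) in auto)
  then show ?thesis using \<open>j < n\<close> by (simp add: if_distrib cong: if_cong)
 qed
 have "ev n (%i. 2*?w i) (Dop n j (Jop j c)) = ev n ?w c"
 proof (rule mps_ext[of "%c. ev n (%i. 2*?w i) (Dop n j (Jop j c))" "ev n ?w" c])
  show "bounded_linear (%c. ev n (%i. 2*?w i) (Dop n j (Jop j c)))"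
   by (intro bounded_linear_compose[OF bounded_linear_ev] bounded_linear_compose[OF bounded_linear_Dop]
     Jop_bl wn)
  fix a
  have Jm: "ev n (w(j:=t)) (Jop j (mmono a))
     = (1 / real (Suc (a j)))*(t ^ Suc (a j)*(\<Prod>i\<in>{..<n} - {j}. w i ^ a i))"
   if "abs(t) <= 1" for t
  proof -
   have n1: "!!i. i < n ==> norm ((w(j:=t)) i) <= 1" using w that by fastforce
   have "(\<Prod>i<n. (w(j:=t)) i ^ (a(j:=Suc (a j))) i) = t ^ Suc (a j)*(\<Prod>i\<in>{..<n} - {j}. w i ^ a i)"
    using \<open>j < n\<close> by (simp add: prod.remove[of _ j])
   then show ?thesis
    using ev_scaleR[of n "w(j:=t)" "1 / real (Suc (a j))" "mmono (a(j:=Suc (a j)))", OF n1]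
    by (simp add: Jop_def ev_mono del: of_nat_Suc)
  qed
  have "((%t. (1 / real (Suc (a j)))*(t ^ Suc (a j)*(\<Prod>i\<in>{..<n} - {j}. w i ^ a i)))
    hrd t ^ a j*(\<Prod>i\<in>{..<n} - {j}. w i ^ a i)) (at t)"
   by (auto intro!: derivative_eq_intros simp del: power_Suc)
  moreover have "\<forall>\<^sub>F s in nhds t. (1 / real (Suc (a j)))*(s ^ Suc (a j)*(\<Prod>i\<in>{..<n} - {j}. w i ^ a i))
    = ev n (w(j:=s)) (Jop j (mmono a))"
  proof -
   have "\<forall>\<^sub>F s in nhds t. dist s t < 1/2" by (rule eventually_nhds_ball[of "1/2" t, unfolded mem_ball dist_commute[of t]]) simp
   then show ?thesis
   proof eventually_elim
    case (elim s)
    then have "abs(s) <= 1" using \<open>\<bar>t\<bar> \<le> 1/2\<close> unfolding dist_real_def by linarith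
    then show ?case using Jm by simp
   qed
  qed
  ultimately have "((%t. ev n (w(j:=t)) (Jop j (mmono a))) hrd
    t ^ a j*(\<Prod>i\<in>{..<n} - {j}. w i ^ a i)) (at t)"
   by (subst (asm) DERIV_cong_ev[OF refl _ refl]) auto
  then have "ev n (%i. 2*?w i) (Dop n j (Jop j (mmono a)))
    = t ^ a j*(\<Prod>i\<in>{..<n} - {j}. w i ^ a i)"
   using *[of "Jop j (mmono a)" UNIV] by (simp add: DERIV_unique)
  also have "\<dots> = ev n ?w (mmono a)" using \<open>j < n\<close> by (simp add: ev_mono prod.remove[of _ j])
  finally show "ev n (%i. 2*?w i) (Dop n j (Jop j (mmono a))) = ev n ?w (mmono a)" .
 qed (intro bounded_linear_ev wn)
 with *[of "Jop j c"] show ?thesis by simp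
qed

definition pd :: "nat => (fnc) => fnc" where
 "pd i f z = deriv (%t. f (z(i:=t))) (z i)"

lemma germ_derivatives:
 fixes f :: "fnc"
 assumes "germ n f"
 shows "EX r>0. EX K. EX D. (ALL i<n. germ n (D i)) &
   (ALL z h. (ALL i<n. abs(z i) < r) --> (ALL i<n. abs(h i) < r) -->
    abs(f (%i. z i + h i) - f z - (\<Sum>i<n. h i*D i z)) <= K*(\<Sum>i<n. abs(h i))^2)"
proof -
 obtain R c where R: "R > 0" "rep n R f c" using assms germ_imp_rep by blast
 define D where "D i z = ev n (%k. z k / (R / 2)) (Dop n i c) / R" for i z
 have "germ n (D i)" for i
  unfolding D_def
  by (intro germ_divide_const rep_imp_analytic_germ[of n "R/2" _ "Dop n i c"])
   (use R in \<open>auto simp: rep_def\<close>)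
 moreover have "abs(f (%i. z i + h i) - f z - (\<Sum>i<n. h i*D i z))
   <= 4*norm c / R^2*(\<Sum>i<n. abs(h i))^2"
  if z: "ALL i<n. abs(z i) < R / 2" and h: "ALL i<n. abs(h i) < R / 2" for z h
 proof -
  have lt: "ALL i<n. abs(z i) < R" "ALL i<n. abs(z i + h i) < R" using z h by (fastforce)+
  have "abs(ev n (%i. z i / R + h i / R) c - ev n (%i. z i / R) c
    - (\<Sum>k<n. h k / R*ev n (%i. 2*(z i / R)) (Dop n k c)))
   <= 4*norm c*(\<Sum>k<n. abs(h k / R))^2"
   by (rule Dop_taylor) (use z h R in \<open>force simp: field_simps\<close>)+
  moreover have "f z = ev n (%i. z i / R) c"
   "f (%i. z i + h i) = ev n (%i. z i / R + h i / R) c"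
   using R lt by (auto simp: rep_def add_divide_distrib)
  moreover have "(\<Sum>k<n. abs(h k / R)) = (\<Sum>k<n. abs(h k)) / R"
   using R by (simp add: sum_divide_distrib)
  ultimately show ?thesis by (simp add: D_def power_divide mult.commute)
 qed
 ultimately show ?thesis using R(1)
  by (intro exI[of _ "R/2"] exI[of _ "4*norm c / R^2"] exI[of _ D] conjI allI impI) auto
qed

lemma germ_chain:
 fixes f :: "fnc"
 assumes "germ n f"
 shows "\<forall>\<^sub>F z in nbf n. ALL gm gm' t S. gm t = z -->
   (ALL i<n. ((%s. gm s i) hrd gm' i) (at t within S)) -->
   ((%s. f (gm s)) hrd (\<Sum>i<n. pd i f z*gm' i)) (at t within S)"
  and "!!i. i < n ==> germ n (pd i f)"
proof -
 obtain r K D where r: "r > 0" and D: "!!i. i < n ==> germ n (D i)"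
  and est: "!!z h. (ALL i<n. abs(z i) < r) ==> (ALL i<n. abs(h i) < r) ==>
    abs(f (%i. z i + h i) - f z - (\<Sum>i<n. h i*D i z)) <= K*(\<Sum>i<n. abs(h i))^2"
  using germ_derivatives[OF assms] by blast
 have ch: "((%s. f (gm s)) hrd (\<Sum>i<n. D i (gm t)*gm' i)) (at t within S)"
  if "ALL i<n. abs(gm t i) < r" "!!i. i < n ==> ((%s. gm s i) hrd gm' i) (at t within S)"
  for gm gm' t S
  by (rule has_derivative_of_taylor[where dl=r and K=K]) (use est that r in auto)
 have pD: "pd i f z = D i z" if "ALL i<n. abs(z i) < r" "i < n" for i z
 proof -
  have "((%s. f ((%s. z(i:=s)) s)) hrd
    (\<Sum>k<n. D k ((%s. z(i:=s)) (z i))*(if k = i then 1 else 0))) (at (z i))"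
   by (rule ch) (use that in auto)
  then have "((%s. f (z(i:=s))) hrd D i z) (at (z i))"
   using that by (simp add: if_distrib cong: if_cong)
  then show ?thesis unfolding pd_def by (rule DERIV_imp_deriv)
 qed
 show "\<forall>\<^sub>F z in nbf n. ALL gm gm' t S. gm t = z -->
   (ALL i<n. ((%s. gm s i) hrd gm' i) (at t within S)) -->
   ((%s. f (gm s)) hrd (\<Sum>i<n. pd i f z*gm' i)) (at t within S)"
  unfolding ev_nbf by (intro exI[of _ r]) (use r ch in \<open>auto simp: pD\<close>)
 show "germ n (pd i f)" if "i < n" for i
  by (rule germ_cong[OF D[OF that]])
   (unfold ev_nbf, intro exI[of _ r], use r pD that in auto)
qed

lemma germ_pd_DERIV:
 fixes f :: "fnc"
 assumes "germ n f" "i < n"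
 shows "\<forall>\<^sub>F z in nbf n. ((%t. f (z(i:=t))) hrd pd i f z) (at (z i))"
 using germ_chain(1)[OF assms(1)]
proof eventually_elim
 case (elim z)
 have "((%s. f ((%s. z(i:=s)) s)) hrd
   (\<Sum>k<n. pd k f z*(if k = i then 1 else 0))) (at (z i))"
  by (rule elim[rule_format]) auto
 then show ?case using assms(2) by (simp add: if_distrib cong: if_cong)
qed

section \<open>Fixed point theorems for analytic germs\<close>

text \<open>Tuples of length \<open>m\<close> are functions on the naturals with arbitrary values
  from \<open>m\<close> on and carry no complete metric, so the Picard iteration is run
  componentwise.\<close>

lemma tuple_fixpoint:
 fixes T :: "(nat => 'b::banach) => nat => 'b"
 assumes ball: "!!K i. (!!i. i < m ==> norm (K i) <= M) ==> i < m ==> norm (T K i) <= M"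
  and contr: "!!K K' e i. (!!i. i < m ==> norm (K i) <= M) ==> (!!i. i < m ==> norm (K' i) <= M) ==>
   (!!i. i < m ==> norm (K i - K' i) <= e) ==> 0 <= e ==> i < m ==> norm (T K i - T K' i) <= e / 2"
  and "0 <= M"
 shows "EX K. ALL i<m. norm (K i) <= M & K i = T K i"
proof -
 define S where "S n = (T ^^ n) (%_. 0)" for n
 have S_le: "i < m ==> norm (S n i) <= M" for n i
  by (induction n arbitrary: i) (auto simp: S_def \<open>0 \<le> M\<close> intro: ball)
 have step: "i < m ==> norm (S (Suc n) i - S n i) <= M*(1/2) ^ n" for n i
 proof (induction n arbitrary: i)
  case 0
  then show ?case using S_le[of i 1] by (simp add: S_def)
 next
  case (Suc n)
  have "norm (T (S (Suc n)) i - T (S n) i) <= M*(1/2) ^ n / 2"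
   using \<open>0 \<le> M\<close> by (intro contr S_le Suc) auto
  then show ?case by (simp add: S_def)
 qed
 have "EX L. (%n. S n i) \<longlonglongrightarrow> L" if "i < m" for i
 proof -
  have "summable (%n. S (Suc n) i - S n i)"
  proof (rule summable_comparison_test'[where N=0])
   show "summable (%n. M*(1/2) ^ n)" by (intro summable_mult summable_geometric) simp
  qed (use step[OF that] in auto)
  then have "(%n. \<Sum>k<n. S (Suc k) i - S k i) \<longlonglongrightarrow> (\<Sum>k. S (Suc k) i - S k i)"
   by (rule summable_LIMSEQ)
  moreover have "S 0 i = 0" by (simp add: S_def)
  ultimately show ?thesis using sum_lessThan_telescope[of "%n. S n i"] by auto
 qed
 then obtain K where K: "!!i. i < m ==> (%n. S n i) \<longlonglongrightarrow> K i" by metis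
 have K_le: "norm (K i) <= M" if "i < m" for i
  by (rule Lim_norm_ubound[OF _ K[OF that]]) (use S_le that in auto)
 have "K i = T K i" if "i < m" for i
 proof (rule ccontr)
  assume "K i ~= T K i"
  define e where "e = norm (K i - T K i) / 3"
  have "e > 0" using \<open>K i \<noteq> T K i\<close> by (simp add: e_def)
  have "\<forall>\<^sub>F n in sequentially. ALL j:{..<m}. norm (S n j - K j) < e"
   using tendstoD[OF K \<open>e > 0\<close>] by (intro eventually_ball_finite) (auto simp: dist_norm)
  then obtain n where n: "!!k j. k >= n ==> j < m ==> norm (S k j - K j) < e"
   unfolding eventually_sequentially by auto
  have "norm (T (S n) i - T K i) <= e / 2"
   using \<open>e > 0\<close> n by (intro contr S_le K_le that) (auto intro: less_imp_le)
  moreover have "norm (T (S n) i - K i) < e" using n[of "Suc n" i] that by (simp add: S_def)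
  moreover have "norm (K i - T K i) <= norm (K i - T (S n) i) + norm (T (S n) i - T K i)"
   using norm_triangle_ineq[of "K i - T (S n) i" "T (S n) i - T K i"] by simp
  ultimately show False
   using \<open>e > 0\<close> unfolding e_def norm_minus_commute[of "T (S n) i" "K i"] by linarith
 qed
 then show ?thesis using K_le by blast
qed

text \<open>The map \<open>G\<close> turns the unknowns into the series that are substituted into
  \<open>c\<close>. The two bounds by 1/4 keep these series in the ball of radius 1/2, where
  \<open>ev_lipschitz\<close> applies, and the contraction factor that results is
  \<open>L M\<close>.\<close>

lemma mps_implicit:
 fixes c :: "nat => mps" and G :: "(nat => mps) => nat => mps"
 assumes c: "!!i. i < m ==> norm (c i) <= M"
  and G0: "!!j. j < N ==> norm (G (%_. 0) j) <= 1/4"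
  and GL: "!!K K' e j. (!!i. i < m ==> norm (K i - K' i) <= e) ==> 0 <= e ==> j < N ==>
    norm (G K j - G K' j) <= L*e"
  and LM: "0 <= L" "0 <= M" "L*M <= 1/4"
 shows "EX K. (ALL i<m. norm (K i) <= M & K i = ev N (G K) (c i)) & (ALL j<N. norm (G K j) <= 1/2)"
proof -
 have half: "norm (G K j) <= 1/2" if "!!i. i < m ==> norm (K i) <= M" "j < N" for K j
 proof -
  have "norm (G K j - G (%_. 0) j) <= L*M" by (rule GL) (use that LM in auto)
  then have "norm (G K j) <= norm (G (%_. 0) j) + L*M"
   using norm_triangle_sub[of "G K j" "G (%_. 0) j"] by simp
  then show ?thesis using G0[OF that(2)] LM by simp
 qed
 have "EX K. ALL i<m. norm (K i) <= M & K i = ev N (G K) (c i)"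
 proof (rule tuple_fixpoint)
  fix K i assume K: "!!i. i < m ==> norm (K i :: mps) <= M" and "i < m"
  have "norm (ev N (G K) (c i)) <= norm (c i)"
   by (rule norm_ev_le) (use half[of K] K in force)
  then show "norm (ev N (G K) (c i)) <= M" using c[OF \<open>i < m\<close>] by simp
 next
  fix K K' :: "nat => mps" and e i
  assume K: "!!i. i < m ==> norm (K i) <= M" "!!i. i < m ==> norm (K' i) <= M"
   and e: "!!i. i < m ==> norm (K i - K' i) <= e" "0 <= e" and "i < m"
  have "norm (ev N (G K) (c i) - ev N (G K') (c i)) <= (L*e)*norm (c i)"
   by (rule ev_lipschitz) (use half K GL e LM in auto)
  also have "\<dots> <= (L*e)*M" using c[OF \<open>i < m\<close>] LM e by (intro mult_left_mono) auto
  also have "\<dots> <= e / 2" using mult_right_mono[OF LM(3) e(2)] e(2) by (simp add: algebra_simps)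
  finally show "norm (ev N (G K) (c i) - ev N (G K') (c i)) <= e / 2" .
 qed (rule LM)
 then show ?thesis using half by blast
qed

lemma analytic_germs_rep:
 fixes f :: "nat => fnc" and m n :: nat
 assumes "!!i. i < m ==> germ n (f i)" "R0 > 0"
 shows "EX R c M. 0 < R & R <= R0 & 0 <= M & (ALL i<m. rep n R (f i) (c i) & norm (c i) <= M)"
proof -
 have "\<forall>\<^sub>F r in at_right 0. ALL i:{..<m}. EX c. rep n r (f i) c"
  using assms by (intro eventually_ball_finite) (auto simp: germ_iff_rep)
 moreover have "\<forall>\<^sub>F r in at_right 0. r < R0"
  using assms(2) unfolding eventually_at_right_field by blast
 ultimately have "\<forall>\<^sub>F r in at_right 0. r > 0 & r <= R0 & (ALL i:{..<m}. EX c. rep n r (f i) c)"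
  using eventually_at_right_pos by eventually_elim auto
 from eventually_happens[OF this] obtain R where R: "R > 0" "R <= R0" "ALL i<m. EX c. rep n R (f i) c"
  by auto
 then obtain c where "ALL i<m. rep n R (f i) (c i)" by metis
 moreover have "norm (c i) <= (\<Sum>i<m. norm (c i))" if "i < m" for i
  using that by (intro member_le_sum) auto
 ultimately show ?thesis using R
  by (intro exI[of _ R] exI[of _ c] exI[of _ "\<Sum>i<m. norm (c i)"]) (auto intro: sum_nonneg)
qed

text \<open>Each unknown enters only through its product with a coordinate. After rescaling to the
  radius \<open>r\<close> this product carries the factor \<open>r / R\<close>, which makes the map
  a contraction whatever the derivatives of \<open>Ps\<close> are.\<close>

lemma germ_implicit:
 assumes Ps: "!!k. k < m ==> germ (n + m) (Ps k :: _ => real)"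
  and sg: "!!k. k < m ==> sg k < n"
 shows "EX Y. (ALL k<m. germ n (Y k)) &
  (\<forall>\<^sub>F z in nbf n. ALL k<m. Y k z = Ps k (%i. if i < n then z i else z (sg (i - n))*Y (i - n) z))"
proof -
 obtain R c M where R: "0 < R" "0 <= M" and c: "!!k. k < m ==> rep (n + m) R (Ps k) (c k)"
  "!!k. k < m ==> norm (c k) <= M"
  using analytic_germs_rep[of m "n + m" Ps 1, OF Ps] by auto
 define r where "r = R / (4*(M + 1))"
 have r: "0 < r" "r <= R / 4" using R by (auto simp: r_def field_simps)
 define G where "G K j = (if j < n then (r / R) *\<^sub>R Xv j else (r / R) *\<^sub>R (Xv (sg (j - n))*K (j - n)))" for K j
 have Xm: "norm (Xv i*u) <= norm u" for i u using norm_mult_ineq[of "Xv i" u] by simp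
 have "EX K. (ALL i<m. norm (K i) <= M & K i = ev (n + m) (G K) (c i)) & (ALL j<n + m. norm (G K j) <= 1/2)"
 proof (rule mps_implicit[where L="r / R"])
  show "norm (G (%_. 0) j) <= 1/4" for j using r R by (simp add: G_def field_simps)
  fix K K' :: "nat => mps" and e j
  assume e: "!!i. i < m ==> norm (K i - K' i) <= e" "0 <= e" and j: "j < n + m"
  show "norm (G K j - G K' j) <= r / R*e"
  proof (cases "j < n")
   case False
   then have "norm (Xv (sg (j - n))*(K (j - n) - K' (j - n))) <= e"
    using order_trans[OF Xm e(1)[of "j - n"]] j by simp
   then show ?thesis using False r R
    by (simp add: G_def scaleR_diff_right[symmetric] right_diff_distrib[symmetric] mult_left_mono divide_right_mono)
  qed (use e r R in \<open>simp add: G_def\<close>)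
 next
  have "r / R*M = 1/4*(M / (M + 1))" using R by (simp add: r_def)
  then show "r / R*M <= 1/4" using R by (simp add: divide_le_eq_1)
 qed (use c r R in auto)
 then obtain K where K: "!!i. i < m ==> K i = ev (n + m) (G K) (c i)" "!!j. j < n + m ==> norm (G K j) <= 1/2"
  by blast
 define Y where "Y k z = ev n (%i. z i / r) (K k)" for k z
 have "germ n (Y k)" for k
  by (rule rep_imp_analytic_germ[of n r _ "K k"]) (auto simp: rep_def Y_def r)
 moreover have "Y k z = Ps k (%i. if i < n then z i else z (sg (i - n))*Y (i - n) z)"
  if z: "ALL i<n. abs(z i) < r" and "k < m" for z k
 proof -
  let ?y = "%i. if i < n then z i else z (sg (i - n))*Y (i - n) z"
  have GK: "ev n (%i. z i / r) (G K j) = ?y j / R" if "j < n + m" for j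
   using that sg[of "j - n"] r by (auto simp: G_def Y_def evz_scaleR[OF z] evz_mult[OF z])
  have yR: "abs(?y j) < R" if "j < n + m" for j
  proof -
   have "abs(?y j / R) <= 1/2"
    using evz_norm[OF z, of "G K j"] K(2)[OF that] unfolding GK[OF that] by linarith
   then show ?thesis using R by (simp add: field_simps)
  qed
  have "Y k z = ev n (%i. z i / r) (ev (n + m) (G K) (c k))"
   unfolding Y_def using K(1)[OF \<open>k < m\<close>] by simp
  also have "\<dots> = ev (n + m) (%j. ev n (%i. z i / r) (G K j)) (c k)"
   by (rule evz_ev[OF z]) (use K(2) in force)
  also have "\<dots> = ev (n + m) (%j. ?y j / R) (c k)"
   by (rule ev_cong) (rule GK)
  also have "\<dots> = Ps k ?y"
   using c(1)[OF \<open>k < m\<close>] yR unfolding rep_def by simp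
  finally show ?thesis .
 qed
 ultimately show ?thesis unfolding ev_nbf using r(1) by blast
qed

subsection \<open>Flows\<close>

lemma germ_lipschitz:
 fixes f :: "fnc"
 assumes "germ n f"
 shows "EX L>=0. EX r>0. ALL z z'. (ALL i<n. abs(z i) < r) --> (ALL i<n. abs(z' i) < r) -->
   abs(f z) <= L & abs(f z - f z') <= L*(\<Sum>i<n. abs(z i - z' i))"
proof -
 obtain R c where R: "R > 0" "rep n R f c" using assms germ_imp_rep by blast
 have "abs(f z) <= max (norm c) (norm c / R) &
   abs(f z - f z') <= max (norm c) (norm c / R)*(\<Sum>i<n. abs(z i - z' i))"
  if z: "ALL i<n. abs(z i) < R / 2" "ALL i<n. abs(z' i) < R / 2" for z z'
 proof -
  have lt: "ALL i<n. abs(z i) < R" "ALL i<n. abs(z' i) < R" using z R by force+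
  have le: "abs(z i - z' i) <= (\<Sum>i<n. abs(z i - z' i))" if "i < n" for i
   using that by (intro member_le_sum) auto
  have "norm (ev n (%i. z i / R) c - ev n (%i. z' i / R) c) <= ((\<Sum>i<n. abs(z i - z' i)) / R)*norm c"
  proof (rule ev_lipschitz)
   fix i assume "i < n"
   then show "norm (z i / R) <= 1/2" "norm (z' i / R) <= 1/2"
    using z R by (force simp: field_simps)+
   show "norm (z i / R - z' i / R) <= (\<Sum>i<n. abs(z i - z' i)) / R"
    using le[OF \<open>i < n\<close>] R by (simp add: diff_divide_distrib[symmetric] divide_right_mono)
  qed (use R in \<open>auto intro!: divide_nonneg_pos sum_nonneg\<close>)
  then have "abs(f z - f z') <= norm c / R*(\<Sum>i<n. abs(z i - z' i))"
   using R lt by (simp add: rep_def mult.commute)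
  also have "\<dots> <= max (norm c) (norm c / R)*(\<Sum>i<n. abs(z i - z' i))"
   by (intro mult_right_mono sum_nonneg) auto
  moreover have "abs(f z) <= norm c" using evz_norm[OF lt(1)] R lt by (simp add: rep_def)
  ultimately show ?thesis by auto
 qed
 then show ?thesis using R
  by (intro exI[of _ "max (norm c) (norm c / R)"] conjI[OF _ exI[of _ "R/2"]]) (auto simp: le_max_iff_disj)
qed

text \<open>The shortness of the interval replaces a Gronwall estimate: at the maximum of
  \<open>f\<close>, the sum of the absolute values, the mean value inequality gives
  \<open>f <= C N (b - a) f\<close>, which forces \<open>f = 0\<close>.\<close>

lemma small_lipschitz_unique:
 fixes y :: "real => pnt"
 assumes d: "!!t i. t \<in> {a..b} ==> i < N ==> ((%s. y s i) hrd y' t i) (at t within {a..b})"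
  and le: "!!t i. t \<in> {a..b} ==> i < N ==> abs(y' t i) <= C*(\<Sum>k<N. abs(y t k))"
  and C: "0 <= C" "C*real N*(b - a) < 1"
  and t0: "t0 \<in> {a..b}" "!!i. i < N ==> y t0 i = 0"
  and t: "t \<in> {a..b}" "i < N"
 shows "y t i = 0"
proof -
 define f where "f t = (\<Sum>k<N. abs(y t k))" for t
 have "continuous_on {a..b} (%s. y s k)" if "k < N" for k
  using d[OF _ that] by (meson DERIV_continuous_on)
 then have "continuous_on {a..b} f" unfolding f_def by (intro continuous_intros) auto
 then obtain tm where tm: "tm \<in> {a..b}" "!!t. t \<in> {a..b} ==> f t <= f tm"
  using continuous_attains_sup[of "{a..b}" f] t0 by auto
 have f0: "0 <= f t" for t by (auto simp: f_def intro: sum_nonneg)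
 have "abs(y tm k) <= C*f tm*(b - a)" if "k < N" for k
 proof -
  have "norm (y tm k - y t0 k) <= (C*f tm)*norm (tm - t0)"
  proof (rule field_differentiable_bound[of "{a..b}" "%s. y s k" "%t. y' t k"])
   fix s assume s: "s \<in> {a..b}"
   show "((%s. y s k) hrd y' s k) (at s within {a..b})" by (rule d[OF s that])
   have "abs(y' s k) <= C*f s" using le[OF s that] by (simp add: f_def)
   also have "\<dots> <= C*f tm" by (intro mult_left_mono tm s C)
   finally show "norm (y' s k) <= C*f tm" by simp
  qed (use tm t0 in auto)
  also have "\<dots> <= (C*f tm)*(b - a)"
   using tm t0 C f0 by (intro mult_left_mono) (auto simp: abs_if)
  finally show ?thesis using t0(2)[OF that] by simp
 qed
 then have "f tm <= (\<Sum>k<N. C*f tm*(b - a))" unfolding f_def by (intro sum_mono) auto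
 then have "f tm <= (C*real N*(b - a))*f tm" by (simp add: algebra_simps)
 then have "f tm = 0" using C f0[of tm]
  by (smt (verit, ccfv_SIG) mult_less_cancel_right2)
 then have "f t = 0" using tm(2)[OF t(1)] f0[of t] by simp
 then show ?thesis using t(2) by (simp add: f_def sum_nonneg_eq_0_iff)
qed

text \<open>The coordinates from \<open>N\<close> on are the parameters \<open>s\<close> of a
  deformation, and the field is the one along the ray \<open>t s\<close>. Its factors
  \<open>z (N + j)\<close> make the velocity small near the origin, so that the solution lives on
  all of \<open>[0, 1]\<close>. The initial time is left open because one flow will start at 1 and
  another at 0.\<close>

lemma analytic_flow:
 assumes Ph: "!!j i. j < e ==> i < N ==> germ (N + e) (Ph j i :: _ => real)"
  and t0: "t0 \<in> {0..1::real}" and "R0 > 0"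
 shows "EX Y. (ALL t:{0..1}. ALL i<N. germ (N + e) (Y t i)) &
  (\<forall>\<^sub>F z in nbf (N + e). ALL i<N. Y t0 i z = z i & (ALL t:{0..1}. abs(Y t i z) < R0 &
   ((%s. Y s i z) hrd
    (\<Sum>j<e. z (N + j)*Ph j i (%k. if k < N then Y t k z else t*z k))) (at t within {0..1})))"
proof -
 obtain R c M0 where R: "0 < R" "R <= R0" "0 <= M0"
  and c0: "!!k. k < e*N ==> rep (N + e) R (Ph (k div N) (k mod N)) (c k) & norm (c k) <= M0"
  using analytic_germs_rep[of "e*N" "N + e" "%k. Ph (k div N) (k mod N)" R0] Ph \<open>R0 > 0\<close>
  by (metis less_mult_imp_div_less mod_less_divisor gr_zeroI mult_0_right not_less_zero)
 have c: "rep (N + e) R (Ph j i) (c (j*N + i)) & norm (c (j*N + i)) <= M0" if "j < e" "i < N" for i j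
 proof -
  have "j*N + i < Suc j*N" using that by simp
  also have "\<dots> <= e*N" using that by (intro mult_le_mono1) simp
  finally have "j*N + i < e*N" .
  then show ?thesis using c0[of "j*N + i"] that by simp
 qed
 \<comment> \<open>The velocities are bounded by \<open>4 rh e M0\<close>, which is at most
   \<open>R / 64\<close>, and \<open>J\<close> has norm at most 8. A point thus moves by at most
   \<open>R / 8\<close> and stays inside the radius \<open>R\<close>.\<close>
 define rh where "rh = R / (256*(real e*M0 + 1))"
 have eM: "0 <= real e*M0" using R by simp
 have rh: "0 < rh" using R eM by (auto simp: rh_def intro!: divide_pos_pos add_nonneg_pos)
 have "rh <= R / 256" unfolding rh_def by (rule frac_le) (use R eM in auto)
 note rh = rh this
 have "rh*(real e*M0 + 1) = R / 256" using eM by (simp add: rh_def add_nonneg_eq_0_iff field_simps)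
 then have rh2: "rh*(real e*M0) <= R / 256" using rh by (simp add: algebra_simps)
 let ?n = "Suc (N + e)"
 \<comment> \<open>Time is the variable with number \<open>N + e\<close>. It occurs as
   \<open>t / 4\<close>, inside the radius 1/2 on which \<open>Jop_derivative\<close> holds;
   \<open>E t\<close> fixes its value.\<close>
 define E where "E t = (%k. if k < N + e then Xv k else (t / 4) *\<^sub>R (1 :: mps))" for t
 have E1: "norm (E t k) <= 1" if "t \<in> {0..1}" for t k using that by (simp add: E_def)
 \<comment> \<open>Integration over time from \<open>t0\<close>; the factor 4 undoes the scaling
   \<open>t / 4\<close>.\<close>
 define J where "J u = 4 *\<^sub>R (Jop (N + e) u - ev ?n (E t0) (Jop (N + e) u))" for u
 have J_bl: "bounded_linear J" unfolding J_def
  by (intro bounded_linear_compose[OF bounded_linear_scaleR_right] bounded_linear_sub Jop_bl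
    bounded_linear_compose[OF bounded_linear_ev Jop_bl] E1 t0)
 have J8: "norm (J u) <= 8*norm u" for u
 proof -
  have "norm (J u) <= 4*(norm (Jop (N + e) u) + norm (ev ?n (E t0) (Jop (N + e) u)))"
   unfolding J_def norm_scaleR by (intro mult_mono norm_triangle_ineq4) auto
  also have "\<dots> <= 4*(norm u + norm u)"
   by (intro mult_left_mono add_mono norm_Jop order_trans[OF norm_ev_le norm_Jop] E1 t0) auto
  finally show ?thesis by simp
 qed
 \<comment> \<open>The unknown \<open>K\<close> is the velocity. The substituted series are the
   moving point, then the parameters multiplied by the time, and finally the parameters once more,
   because \<open>C\<close> multiplies the field by them.\<close>
 define G where "G K k = (if k < N then (1 / R) *\<^sub>R (rh *\<^sub>R Xv k + J (K k))
   else if k < N + e then (4*rh / R) *\<^sub>R (Xv k*Xv (N + e)) else (1/4) *\<^sub>R Xv (k - e))" for K k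
 define C where "C i = (\<Sum>j<e. (4*rh) *\<^sub>R (Xv (N + e + j)*ev (N + e) Xv (c (j*N + i))))" for i
 have Xm: "norm (Xv i*u) <= norm u" for i u using norm_mult_ineq[of "Xv i" u] by simp
 have XX: "norm (Xv i*Xv k) <= 1" for i k using Xm[of i "Xv k"] by simp
 have J0: "J 0 = 0" by (rule linear_simps(3)[OF J_bl])
 have "EX K. (ALL i<N. norm (K i) <= 4*rh*(real e*M0) & K i = ev (N + 2*e) (G K) (C i)) &
   (ALL j<N + 2*e. norm (G K j) <= 1/2)"
 proof (rule mps_implicit[where L="8 / R"])
  fix i assume "i < N"
  have "norm (C i) <= (\<Sum>j<e. 4*rh*M0)"
   unfolding C_def
  proof (rule sum_norm_le)
   fix j assume "j \<in> {..<e}"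
   then have "norm (ev (N + e) Xv (c (j*N + i))) <= M0"
    using order_trans[OF norm_ev_le[of "N + e" Xv "c (j*N + i)"]] c[of j i] \<open>i < N\<close> by simp
   then have "norm (Xv (N + e + j)*ev (N + e) Xv (c (j*N + i))) <= M0"
    using Xm order_trans by blast
   then show "norm ((4*rh) *\<^sub>R (Xv (N + e + j)*ev (N + e) Xv (c (j*N + i)))) <= 4*rh*M0"
    using rh by (simp add: mult_left_mono)
  qed
  then show "norm (C i) <= 4*rh*(real e*M0)" by (simp add: algebra_simps)
 next
  show "norm (G (%_. 0) j) <= 1/4" for j
  proof -
   have "4*rh / R <= 1/4" "rh / R <= 1/4" using rh R by (auto simp: field_simps)
   moreover have "4*rh / R*norm (Xv j*Xv (N + e)) <= 1/4"
    using rh R XX \<open>4 * rh / R \<le> 1/4\<close> by (intro order_trans[OF mult_right_le_one_le]) auto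
   ultimately show ?thesis using rh R by (simp add: G_def J0)
  qed
  fix K K' :: "nat => mps" and d j
  assume e: "!!i. i < N ==> norm (K i - K' i) <= d" "0 <= d" and j: "j < N + 2*e"
  show "norm (G K j - G K' j) <= 8 / R*d"
  proof (cases "j < N")
   case True
   have "norm (J (K j - K' j)) <= 8*d" using J8[of "K j - K' j"] e(1)[OF True] by linarith
   then show ?thesis using True R
    by (simp add: G_def scaleR_diff_right[symmetric] linear_simps(2)[OF J_bl] divide_right_mono)
  qed (use e R in \<open>simp add: G_def\<close>)
 next
  show "8 / R*(4*rh*(real e*M0)) <= 1/4" using R rh2 by (simp add: field_simps)
 qed (use R rh eM in auto)
 then obtain K where K: "!!i. i < N ==> norm (K i) <= 4*rh*(real e*M0)"
  "!!i. i < N ==> K i = ev (N + 2*e) (G K) (C i)" "!!j. j < N + 2*e ==> norm (G K j) <= 1/2"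
  by blast
 define w where "w z t = (%k. if k < N + e then z k / rh else t / 4)" for z :: "pnt" and t :: real
 define Y where "Y t i z = z i + ev ?n (w z t) (J (K i))" for t i z
 have germ: "germ (N + e) (Y t i)" if "t \<in> {0..1}" "i < N" for t i
  unfolding Y_def
 proof (intro germ_add germ_var)
  have "rep (N + e) rh (%z. ev ?n (w z t) (J (K i))) (ev ?n (E t) (J (K i)))"
   unfolding rep_def
  proof (intro allI impI)
   fix z :: "pnt" assume z: "ALL i<N + e. abs(z i) < rh"
   show "ev ?n (w z t) (J (K i)) = ev (N + e) (%i. z i / rh) (ev ?n (E t) (J (K i)))"
    by (subst evz_ev[OF z E1[OF that(1)]])
     (auto intro!: ev_cong simp: w_def E_def evz_scaleR[OF z] evz_1[OF z])
  qed
  then show "germ (N + e) (%z. ev ?n (w z t) (J (K i)))"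
   using rh(1) by (rule rep_imp_analytic_germ)
 qed (use that in auto)
 have main: "Y t0 i z = z i & (ALL t:{0..1}. abs(Y t i z) < R0 & ((%s. Y s i z) hrd
    (\<Sum>j<e. z (N + j)*Ph j i (%k. if k < N then Y t k z else t*z k))) (at t within {0..1}))"
  if z: "ALL i<N + e. abs(z i) < rh / 2" and "i < N" for z i
 proof (intro conjI ballI)
  have w1: "norm (w z t k) <= 1/2" if "t \<in> {0..1}" "k < ?n" for t k
   using z that rh by (auto simp: w_def field_simps abs_if split: if_splits)
  have w1': "norm (w z t k) <= 1" if "t \<in> {0..1}" "k < ?n" for t k using w1[OF that] by simp
  have w_if: "w z t k = (if k < N + e then z k / rh else t / 4)" for t k by (simp add: w_def)
  have evw: "ev ?n (w z t) (k *\<^sub>R u) = k*ev ?n (w z t) u"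
   "ev ?n (w z t) (u - v) = ev ?n (w z t) u - ev ?n (w z t) v"
   "ev ?n (w z t) (u + v) = ev ?n (w z t) u + ev ?n (w z t) v"
   "ev ?n (w z t) (u * v) = ev ?n (w z t) u*ev ?n (w z t) v"
   "ev ?n (w z t) 1 = 1"
   if "t \<in> {0..1}" for t k u v
   using w1'[OF that]
   by (simp_all only: ev_scaleR ev_diff ev_add ev_mult ev_1 real_scaleR_def)
  have wE: "ev ?n (w z t) (ev ?n (E t0) u) = ev ?n (w z t0) u" if "t \<in> {0..1}" for u t
   by (subst ev_ev[of ?n "w z t", OF w1'[OF that] E1[OF t0]])
    (auto intro!: ev_cong simp: w_if E_def evw[OF that] that)
  have evJ: "ev ?n (w z t) (J u) = 4*(ev ?n (w z t) (Jop (N + e) u) - ev ?n (w z t0) (Jop (N + e) u))"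
   if "t \<in> {0..1}" for u t
   by (simp add: J_def evw[OF that] wE[OF that])
  show "Y t0 i z = z i" using evJ[OF t0] by (simp add: Y_def)
  fix t :: real assume t: "t \<in> {0..1}"
  have JK: "abs(ev ?n (w z t) (J (K k))) <= R / 8" if "k < N" for k
  proof -
   have "abs(ev ?n (w z t) (J (K k))) <= norm (J (K k))"
    using norm_ev_le[of ?n "w z t", OF w1'[OF t]] by simp
   also have "\<dots> <= 8*(4*rh*(real e*M0))" using J8[of "K k"] K(1)[OF that] by linarith
   also have "\<dots> <= R / 8" using rh2 by simp
   finally show ?thesis .
  qed
  have YR: "abs(Y t k z) < R" if "k < N" for k
  proof -
   have "abs(z k) < rh / 2" using z that by simp
   then have "abs(z k) < R / 256" using rh by linarith
   then show ?thesis using JK[OF that] R by (simp add: Y_def)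
  qed
  then show "abs(Y t i z) < R0" using R \<open>i < N\<close> by fastforce
  let ?y = "%k. if k < N then Y t k z else t*z k"
  have "((%s. ev ?n ((w z 0)(N + e:=s)) (Jop (N + e) (K i))) hrd
    ev ?n ((w z 0)(N + e:=t / 4)) (K i)) (at (t / 4) within (%s. s / 4) ` {0..1})"
   by (rule Jop_derivative) (use w1[of 0] t in auto)
  then have "(((%s. ev ?n ((w z 0)(N + e:=s)) (Jop (N + e) (K i))) \<circ> (%s. s / 4)) hrd
    ev ?n ((w z 0)(N + e:=t / 4)) (K i)*(1/4)) (at t within {0..1})"
   by (rule DERIV_image_chain) (auto intro!: derivative_eq_intros)
  moreover have "ev ?n ((w z 0)(N + e:=s / 4)) u = ev ?n (w z s) u" for s u
   by (rule ev_cong) (auto simp: w_def)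
  ultimately have D: "((%s. ev ?n (w z s) (Jop (N + e) (K i))) hrd
    ev ?n (w z t) (K i) / 4) (at t within {0..1})"
   by (simp add: o_def)
  have "((%s. z i + 4*(ev ?n (w z s) (Jop (N + e) (K i)) - ev ?n (w z t0) (Jop (N + e) (K i))))
    hrd ev ?n (w z t) (K i)) (at t within {0..1})"
   by (auto intro!: derivative_eq_intros D)
  then have DY: "((%s. Y s i z) hrd ev ?n (w z t) (K i)) (at t within {0..1})"
   by (rule has_field_derivative_transform_within[OF _ zero_less_one t]) (simp add: Y_def evJ)
  have GK: "ev ?n (w z t) (G K k) = ?y k / R" if "k < N + e" for k
   using that R rh by (auto simp: G_def Y_def evw[OF t] w_if field_simps)
  have GK2: "ev ?n (w z t) (G K (N + e + j)) = z (N + j) / (4*rh)" if "j < e" for j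
   using that by (simp add: G_def evw[OF t] w_if)
  have "ev ?n (w z t) (K i) = ev (N + 2*e) (%k. ev ?n (w z t) (G K k)) (C i)"
   unfolding K(2)[OF \<open>i < N\<close>]
   by (subst ev_ev[of ?n "w z t", OF w1'[OF t]]) (use K(3) in force)+
  also have "\<dots> = (\<Sum>j<e. z (N + j)*Ph j i ?y)"
  proof -
   let ?g = "%k. ev ?n (w z t) (G K k)"
   have g1: "norm (?g k) <= 1" if "k < N + 2*e" for k
    using order_trans[OF norm_ev_le[of ?n "w z t", OF w1'[OF t]] K(3)[OF that]] by linarith
   have "ev (N + 2*e) ?g (C i)
     = (\<Sum>j<e. (4*rh)*(?g (N + e + j)*ev (N + 2*e) ?g (ev (N + e) Xv (c (j*N + i)))))"
    by (simp add: C_def ev_sum[of "N + 2*e" ?g, OF g1] ev_scaleR[of "N + 2*e" ?g, OF g1]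
      ev_mult[of "N + 2*e" ?g, OF g1])
   also have "\<dots> = (\<Sum>j<e. z (N + j)*Ph j i ?y)"
   proof (rule sum.cong[OF refl])
    fix j assume "j \<in> {..<e}"
    then have j: "j < e" by simp
    have "ev (N + 2*e) ?g (ev (N + e) Xv (c (j*N + i))) = ev (N + e) ?g (c (j*N + i))"
     by (subst ev_ev[of "N + 2*e" ?g, OF g1]) (auto intro!: ev_cong)
    also have "\<dots> = ev (N + e) (%k. ?y k / R) (c (j*N + i))" by (rule ev_cong) (rule GK)
    also have "\<dots> = Ph j i ?y"
    proof -
     have "abs(?y k) < R" if "k < N + e" for k
     proof (cases "k < N")
      case False
      then have "abs(t*z k) <= 1*abs(z k)" using t by (simp add: abs_mult mult_right_le_one_le mult_left_le_one_le)
      moreover have "abs(z k) < rh / 2" using z that by simp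
      then have "abs(z k) < R" using rh R by linarith
      ultimately show ?thesis using False by simp
     qed (use YR in simp)
     then show ?thesis using c[OF j \<open>i < N\<close>] unfolding rep_def by simp
    qed
    finally show "(4*rh)*(?g (N + e + j)*ev (N + 2*e) ?g (ev (N + e) Xv (c (j*N + i))))
      = z (N + j)*Ph j i ?y"
     using GK2[OF j] rh by simp
   qed
   finally show ?thesis .
  qed
  finally show "((%s. Y s i z) hrd (\<Sum>j<e. z (N + j)*Ph j i ?y)) (at t within {0..1})"
   using DY by simp
 qed
 show ?thesis
  using germ main rh(1) unfolding ev_nbf by (intro exI[of _ Y] conjI exI[of _ "rh / 2"]) auto
qed

section \<open>The Goursat problem\<close>

lemma pd_cong:
 assumes "\<forall>\<^sub>F z in nbf n. f z = g z"
 shows "\<forall>\<^sub>F z in nbf n. pd i f z = pd i g z"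
proof -
 obtain r where r: "r > 0" "!!z. ALL i<n. abs(z i) < r ==> f z = g z"
  using assms unfolding ev_nbf by blast
 have "pd i f z = pd i g z" if z: "ALL i<n. abs(z i) < r" for z
  unfolding pd_def
 proof (rule deriv_cong_ev)
  show "\<forall>\<^sub>F t in nhds (z i). f (z(i:=t)) = g (z(i:=t))"
  proof (cases "i < n")
   case True
   have "\<forall>\<^sub>F t in nhds (z i). t \<in> {-r<..<r}"
    by (rule eventually_nhds_in_open) (use z True in auto)
   then show ?thesis by eventually_elim (rule r(2), use z in auto)
  next
   case False
   then show ?thesis by (intro always_eventually allI r(2)) (use z in auto)
  qed
 qed simp
 then show ?thesis unfolding ev_nbf using r(1) by blast
qed

lemma ev_nbf_at_0: "eventually P (nbf n) ==> P (%_. 0)"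
 unfolding ev_nbf by (metis abs_zero)

lemma pd_eqI:
 "((%t. f (z(i:=t))) hrd d) (at (z i)) ==> pd i f z = d"
 unfolding pd_def by (rule DERIV_imp_deriv)

lemma ev_Jop_DERIV:
 assumes z: "ALL i<n. abs(z i) < r / 2" and "j < n"
 shows "((%t. ev n (%i. (z(j:=t)) i / r) (Jop j c)) hrd
   ev n (%i. z i / r) c / r) (at (z j))"
proof -
 have r: "r > 0" using z[rule_format, OF \<open>j < n\<close>] by simp
 let ?w = "%i. z i / r"
 have "((%t. ev n (?w(j:=t)) (Jop j c)) hrd ev n (?w(j:=z j / r)) c) (at (z j / r))"
  by (rule Jop_derivative) (use z r \<open>j < n\<close> in \<open>force simp: field_simps\<close>)+
 then have "((%t. ev n (?w(j:=t / r)) (Jop j c)) hrd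
   ev n (?w(j:=z j / r)) c*(1 / r)) (at (z j))"
  by (rule DERIV_chain2[where g="%t. t / r"]) (use r in \<open>auto intro!: derivative_eq_intros\<close>)
 moreover have "ev n (?w(j:=t / r)) u = ev n (%i. (z(j:=t)) i / r) u" for t u
  by (rule ev_cong) auto
 moreover have "?w(j:=z j / r) = ?w" by auto
 ultimately show ?thesis by (simp only: times_divide_eq_right mult_1_right)
qed

lemma ev_Jop_0:
 assumes w: "!!i. i < n ==> abs(w i) <= (1::real)" and "j < n" "w j = 0"
 shows "ev n w (Jop j c) = 0"
proof (rule mps_ext[of "%c. ev n w (Jop j c)" "%_. 0" c])
 have wn: "!!i. i < n ==> norm (w i) <= 1" using w by simp
 show "bounded_linear (%c. ev n w (Jop j c))"
  by (rule bounded_linear_compose[OF bounded_linear_ev[OF wn] Jop_bl])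
 fix a
 have "(\<Prod>i<n. w i ^ (a(j:=Suc (a j))) i) = 0"
  using assms by (intro prod_zero) (auto intro!: bexI[of _ j])
 then show "ev n w (Jop j (mmono a)) = 0"
  using ev_scaleR[of n w "1 / real (Suc (a j))" "mmono (a(j:=Suc (a j)))", OF wn]
  by (simp add: Jop_def ev_mono del: of_nat_Suc)
qed simp

lemma Jop_commute: "i ~= j ==> Jop i (Jop j c) = Jop j (Jop i c)"
proof (rule mps_ext[of "%c. Jop i (Jop j c)" "%c. Jop j (Jop i c)" c])
 show "bounded_linear (%c. Jop i (Jop j c))" "bounded_linear (%c. Jop j (Jop i c))"
  by (intro bounded_linear_compose[OF Jop_bl Jop_bl])+
 have J: "Jop j (mmono a) = (1 / real (Suc (a j))) *\<^sub>R mmono (a(j:=Suc (a j)))" for a j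
  by (simp add: Jop_def)
 assume "i ~= j"
 then show "Jop i (Jop j (mmono a)) = Jop j (Jop i (mmono a))" for a
  by (simp add: J linear_simps(5)[OF Jop_bl] fun_upd_twist mult.commute del: of_nat_Suc)
qed

lemma pd_indep:
 assumes "!!z t. f (z(j:=t)) = f z" "i ~= j"
 shows "pd i f (z(j:=t)) = pd i f z"
proof -
 have "f ((z(j:=t))(i:=s)) = f (z(i:=s))" for s
  using assms(1)[of "z(i:=s)" t] assms(2) by (simp add: fun_upd_twist)
 then show ?thesis using assms(2) by (simp add: pd_def)
qed

text \<open>The arguments of a second order equation: the values of a pair of functions, then their two
 x-derivatives, then their two y-derivatives.\<close>

definition jet1 :: "(nat => fnc) => (pnt) => pnt" where
 "jet1 F z k = (if k < 2 then F k z else if k < 4 then pd 0 (F (k - 2)) z else pd 1 (F (k - 4)) z)"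

text \<open>The unknown is the mixed derivative \<open>K\<close>, and \<open>F\<close> is
  \<open>U + V\<close> plus its double integral. The data vanish to first order at the origin, so
  all six arguments of \<open>Ph\<close> are small on a small polydisc, and every integration gains
  a factor \<open>r\<close>: the equation for \<open>K\<close> becomes a contraction. Both orders of
  differentiation are recorded since the equation will be read along either axis.\<close>

lemma analytic_goursat:
 fixes U V :: "nat => fnc" and Ph :: "nat => fnc"
 assumes n: "2 <= n"
  and U: "!!i. i < 2 ==> germ n (U i)" "!!i z t. U i (z(1:=t)) = U i z"
   "!!i. U i (%_. 0) = 0" "!!i. pd 0 (U i) (%_. 0) = 0"
  and V: "!!i. i < 2 ==> germ n (V i)" "!!i z t. V i (z(0:=t)) = V i z"
   "!!i. V i (%_. 0) = 0" "!!i. pd 1 (V i) (%_. 0) = 0"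
  and Ph: "!!i. i < 2 ==> germ 6 (Ph i)"
 shows "EX F. (ALL i<2. germ n (F i)) & (\<forall>\<^sub>F z in nbf n. ALL i<2.
   pd 1 (pd 0 (F i)) z = Ph i (jet1 F z) & pd 0 (pd 1 (F i)) z = Ph i (jet1 F z) &
   F i (z(1:=0)) = U i z + V i (z(1:=0)) & F i (z(0:=0)) = U i (z(0:=0)) + V i z)"
proof -
 have comm: "Jop 0 (Jop 1 u) = Jop 1 (Jop 0 u)" for u by (rule Jop_commute) simp
 have iU: "pd 0 (U i) (z(1:=t)) = pd 0 (U i) z" for i z t by (rule pd_indep) (use U in auto)
 have iV: "pd 1 (V i) (z(0:=t)) = pd 1 (V i) z" for i z t by (rule pd_indep) (use V in auto)
 have n01: "0 < n" "1 < n" "Suc 0 < n" using n by auto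
 obtain R c M where R: "0 < R" "0 <= M" and c: "!!k. k < 2 ==> rep 6 R (Ph k) (c k)"
  "!!k. k < 2 ==> norm (c k) <= M"
  using analytic_germs_rep[of 2 6 Ph 1, OF Ph] by auto
 have sm: "\<forall>\<^sub>F r in at_right 0. ALL i:{..<2}. EX c. rep n r (f i) c & norm c <= R / 16"
  if "!!i. i < (2::nat) ==> germ n (f i)" "!!i. f i (%_. 0) = 0" for f :: "nat => fnc"
  by (rule eventually_ball_finite) (use that R in \<open>auto simp del: le_divide_eq_numeral1 intro!: rep_small\<close>)
 have pU: "germ n (pd 0 (U i))" and pV: "germ n (pd 1 (V i))" if "i < 2" for i
  using germ_chain(2)[OF U(1)[OF that]] germ_chain(2)[OF V(1)[OF that]] n01 by blast+
 have rs: "\<forall>\<^sub>F r in at_right 0. r < min 1 (R / (4*(M + 1)))"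
  unfolding eventually_at_right_field
  by (rule exI[of _ "min 1 (R / (4*(M + 1)))"]) (use R in auto)
 have s1: "\<forall>\<^sub>F r in at_right 0. ALL i:{..<2}. EX c. rep n r (U i) c & norm c <= R / 16"
  by (rule sm) (use U in auto)
 have s2: "\<forall>\<^sub>F r in at_right 0. ALL i:{..<2}. EX c. rep n r (V i) c & norm c <= R / 16"
  by (rule sm) (use V in auto)
 have s3: "\<forall>\<^sub>F r in at_right 0. ALL i:{..<2}. EX c. rep n r (pd 0 (U i)) c & norm c <= R / 16"
  by (rule sm[of "%i. pd 0 (U i)"]) (use pU U in auto)
 have s4: "\<forall>\<^sub>F r in at_right 0. ALL i:{..<2}. EX c. rep n r (pd 1 (V i)) c & norm c <= R / 16"
  by (rule sm[of "%i. pd 1 (V i)"]) (use pV V in auto)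
 from rs s1 s2 s3 s4 eventually_at_right_pos
 have "\<forall>\<^sub>F r in at_right 0. 0 < r & r < min 1 (R / (4*(M + 1))) &
   (ALL i<2. EX c. rep n r (U i) c & norm c <= R / 16) & (ALL i<2. EX c. rep n r (V i) c & norm c <= R / 16) &
   (ALL i<2. EX c. rep n r (pd 0 (U i)) c & norm c <= R / 16) &
   (ALL i<2. EX c. rep n r (pd 1 (V i)) c & norm c <= R / 16)"
  by eventually_elim auto
 from eventually_happens[OF this] obtain r where r: "0 < r" "r < min 1 (R / (4*(M + 1)))"
  and "ALL i<2. EX c. rep n r (U i) c & norm c <= R / 16" "ALL i<2. EX c. rep n r (V i) c & norm c <= R / 16"
  "ALL i<2. EX c. rep n r (pd 0 (U i)) c & norm c <= R / 16"
  "ALL i<2. EX c. rep n r (pd 1 (V i)) c & norm c <= R / 16" by auto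
 then obtain cU cV cP cQ where cU: "!!i. i < 2 ==> rep n r (U i) (cU i) & norm (cU i) <= R / 16"
  and cV: "!!i. i < 2 ==> rep n r (V i) (cV i) & norm (cV i) <= R / 16"
  and cP: "!!i. i < 2 ==> rep n r (pd 0 (U i)) (cP i) & norm (cP i) <= R / 16"
  and cQ: "!!i. i < 2 ==> rep n r (pd 1 (V i)) (cQ i) & norm (cQ i) <= R / 16"
  by metis
 have rM: "r*M <= R / 4"
 proof -
  have "r*(4*(M + 1)) < R" using r R by (simp add: field_simps)
  then show ?thesis using r R by (simp add: algebra_simps)
 qed
 have r2: "r^2 <= r" using r by (simp add: power2_eq_square mult_left_le)
 \<comment> \<open>In the rescaled variables an integration contributes a factor \<open>r\<close>:
   two of them in \<open>F\<close>, one in each first derivative.\<close>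
 define G where "G K k = (1 / R) *\<^sub>R (if k < 2 then cU k + cV k + r^2 *\<^sub>R Jop 0 (Jop 1 (K k))
  else if k < 4 then cP (k - 2) + r *\<^sub>R Jop 1 (K (k - 2)) else cQ (k - 4) + r *\<^sub>R Jop 0 (K (k - 4)))"
  for K k
 have "EX K. (ALL i<2. norm (K i) <= M & K i = ev 6 (G K) (c i)) & (ALL j<6. norm (G K j) <= 1/2)"
 proof (rule mps_implicit[where L="r / R"])
  fix j :: nat assume j: "j < 6"
  have "norm (cU j + cV j) <= R / 8" if "j < 2"
   using norm_triangle_ineq[of "cU j" "cV j"] cU[OF that] cV[OF that] by linarith
  moreover have "norm (cP (j - 2)) <= R / 8" if "j < 4" using cP[of "j - 2"] that R by force
  moreover have "norm (cQ (j - 4)) <= R / 8" if "j < 6" using cQ[of "j - 4"] that R by force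
  ultimately show "norm (G (%_. 0) j) <= 1/4"
   using j R by (auto simp: G_def linear_simps(3)[OF Jop_bl] field_simps)
 next
  fix K K' :: "nat => mps" and e j
  assume e: "!!i. i < 2 ==> norm (K i - K' i) <= e" "0 <= e" and j: "j < (6::nat)"
  have 1: "norm (r^2 *\<^sub>R Jop 0 (Jop 1 (K k)) - r^2 *\<^sub>R Jop 0 (Jop 1 (K' k))) <= r*e" if "k < 2" for k
  proof -
   have "norm (r^2 *\<^sub>R Jop 0 (Jop 1 (K k)) - r^2 *\<^sub>R Jop 0 (Jop 1 (K' k)))
     = r^2*norm (Jop 0 (Jop 1 (K k - K' k)))"
    by (simp add: scaleR_diff_right[symmetric] linear_simps(2)[OF Jop_bl, symmetric] del: scaleR_diff_right)
   also have "\<dots> <= r*e"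
    using order_trans[OF order_trans[OF norm_Jop norm_Jop] e(1)[OF that]] r2 r
    by (intro mult_mono) auto
   finally show ?thesis .
  qed
  have 2: "norm (r *\<^sub>R Jop l (K k) - r *\<^sub>R Jop l (K' k)) <= r*e" if "k < 2" for k l
  proof -
   have "norm (r *\<^sub>R Jop l (K k) - r *\<^sub>R Jop l (K' k)) = r*norm (Jop l (K k - K' k))"
    using r by (simp add: scaleR_diff_right[symmetric] linear_simps(2)[OF Jop_bl, symmetric] del: scaleR_diff_right)
   also have "\<dots> <= r*e"
    using order_trans[OF norm_Jop e(1)[OF that]] r by (intro mult_mono) auto
   finally show ?thesis .
  qed
  have "norm (G K j - G K' j) = (1 / R)*norm (R *\<^sub>R (G K j) - R *\<^sub>R (G K' j))"
   using R by (simp add: scaleR_diff_right[symmetric] del: scaleR_diff_right)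
  also have "\<dots> <= (1 / R)*(r*e)"
   using R j 1[of j] 2[of "j - 2" 1] 2[of "j - 4" 0]
   by (intro mult_left_mono) (auto simp: G_def)
  finally show "norm (G K j - G K' j) <= r / R*e" by simp
 next
  show "r / R*M <= 1/4" using R rM by (simp add: field_simps)
 qed (use c r R in auto)
 then obtain K where K: "!!i. i < 2 ==> K i = ev 6 (G K) (c i)" "!!j. j < 6 ==> norm (G K j) <= 1/2"
  by blast
 define E where "E z u = ev n (%i. z i / r) u" for z :: "pnt" and u
 define F where "F i z = U i z + V i z + r^2*E z (Jop 0 (Jop 1 (K i)))" for i z
 have gE: "germ n (%z. E z u)" for u
  by (rule rep_imp_analytic_germ[of n r _ u]) (auto simp: rep_def E_def r)
 have gF: "germ n (F i)" if "i < 2" for i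
  unfolding F_def by (intro germ_add germ_mult germ_const U V gE that)
 have ED: "((%t. E (z(j:=t)) (Jop j u)) hrd E z u / r) (at (z j))"
  if "ALL i<n. abs(z i) < r / 2" "j < n" for z j u
  unfolding E_def by (rule ev_Jop_DERIV[OF that])
 have ev_r: "\<forall>\<^sub>F z in nbf n. ALL i<n. abs(z i) < r / 2"
  unfolding ev_nbf using r by (intro exI[of _ "r / 2"]) auto
 have p0: "\<forall>\<^sub>F z in nbf n. pd 0 (F i) z = pd 0 (U i) z + r*E z (Jop 1 (K i))" if "i < 2" for i
  using germ_pd_DERIV[OF U(1)[OF that] n01(1)] ev_r
 proof eventually_elim
  case (elim z)
  have "((%t. F i (z(0:=t))) hrd
    pd 0 (U i) z + 0 + r^2*(E z (Jop 1 (K i)) / r)) (at (z 0))"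
   unfolding F_def V(2) by (intro derivative_intros DERIV_cmult ED elim n01)
  then show ?case by (intro pd_eqI) (use r in \<open>simp add: power2_eq_square\<close>)
 qed
 have p1: "\<forall>\<^sub>F z in nbf n. pd 1 (F i) z = pd 1 (V i) z + r*E z (Jop 0 (K i))" if "i < 2" for i
  using germ_pd_DERIV[OF V(1)[OF that] n01(2)] ev_r
 proof eventually_elim
  case (elim z)
  have "((%t. F i (z(1:=t))) hrd
    0 + pd 1 (V i) z + r^2*(E z (Jop 0 (K i)) / r)) (at (z 1))"
   unfolding F_def U(2) comm
   by (intro derivative_intros DERIV_cmult ED elim n01)
  then show ?case by (intro pd_eqI) (use r in \<open>simp add: power2_eq_square\<close>)
 qed
 have p10: "\<forall>\<^sub>F z in nbf n. pd 1 (pd 0 (F i)) z = E z (K i)" if "i < 2" for i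
  using pd_cong[OF p0[OF that], of 1] ev_r
 proof eventually_elim
  case (elim z)
  have "((%t. pd 0 (U i) (z(1:=t)) + r*E (z(1:=t)) (Jop 1 (K i))) hrd
    0 + r*(E z (K i) / r)) (at (z 1))"
   unfolding iU by (intro derivative_intros DERIV_cmult ED elim n01)
  from pd_eqI[OF this] show ?case using elim r by simp
 qed
 have p01: "\<forall>\<^sub>F z in nbf n. pd 0 (pd 1 (F i)) z = E z (K i)" if "i < 2" for i
  using pd_cong[OF p1[OF that], of 0] ev_r
 proof eventually_elim
  case (elim z)
  have "((%t. pd 1 (V i) (z(0:=t)) + r*E (z(0:=t)) (Jop 0 (K i))) hrd
    0 + r*(E z (K i) / r)) (at (z 0))"
   unfolding iV by (intro derivative_intros DERIV_cmult ED elim n01)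
  from pd_eqI[OF this] show ?case using elim r by simp
 qed
 have all2: "\<forall>\<^sub>F z in nbf n. ALL i:{..<2}. P i z" if "!!i. i < 2 ==> \<forall>\<^sub>F z in nbf n. P i z" for P :: "nat => _"
  by (rule eventually_ball_finite) (use that in auto)
 have a0: "\<forall>\<^sub>F z in nbf n. ALL i:{..<2}. pd 0 (F i) z = pd 0 (U i) z + r*E z (Jop 1 (K i))"
  and a1: "\<forall>\<^sub>F z in nbf n. ALL i:{..<2}. pd 1 (F i) z = pd 1 (V i) z + r*E z (Jop 0 (K i))"
  and a10: "\<forall>\<^sub>F z in nbf n. ALL i:{..<2}. pd 1 (pd 0 (F i)) z = E z (K i)"
  and a01: "\<forall>\<^sub>F z in nbf n. ALL i:{..<2}. pd 0 (pd 1 (F i)) z = E z (K i)"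
  by (intro all2 p0 p1 p10 p01; assumption)+
 have "\<forall>\<^sub>F z in nbf n. ALL i<2. pd 1 (pd 0 (F i)) z = Ph i (jet1 F z) & pd 0 (pd 1 (F i)) z = Ph i (jet1 F z) &
   F i (z(1:=0)) = U i z + V i (z(1:=0)) & F i (z(0:=0)) = U i (z(0:=0)) + V i z"
  using a0 a1 a10 a01 ev_r
 proof eventually_elim
  case (elim z)
  have zr: "ALL i<n. abs(z i) < r" using elim(5) r by fastforce
  have zr': "ALL i<n. abs((z(k:=0)) i) < r" for k using zr r by auto
  show ?case
  proof (intro allI impI)
   fix i :: nat assume i: "i < 2"
   have GK: "E z (G K k) = jet1 F z k / R" if k: "k < 6" for k
    using k r R cU[of k] cV[of k] cP[of "k - 2"] cQ[of "k - 4"] elim(1)[rule_format, of "k - 2"]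
     elim(2)[rule_format, of "k - 4"] zr
    by (auto simp: G_def E_def jet1_def F_def evz_scaleR[OF zr] evz_add[OF zr] rep_def)
   have "E z (K i) = E z (ev 6 (G K) (c i))" using K(1)[OF i] by simp
   also have "\<dots> = ev 6 (%k. E z (G K k)) (c i)"
    unfolding E_def by (rule evz_ev[OF zr]) (use K(2) in force)
   also have "\<dots> = ev 6 (%k. jet1 F z k / R) (c i)" by (rule ev_cong) (rule GK)
   also have "\<dots> = Ph i (jet1 F z)"
   proof -
    have "abs(jet1 F z k) < R" if "k < 6" for k
    proof -
     have "abs(jet1 F z k / R) <= 1/2"
      using evz_norm[OF zr, of "G K k"] K(2)[OF that] unfolding GK[OF that, symmetric] E_def by linarith
     then show ?thesis using R by (simp add: field_simps)
    qed
    then show ?thesis using c(1)[OF i] by (simp add: rep_def)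
   qed
   finally have EK: "E z (K i) = Ph i (jet1 F z)" .
   have z1: "E (z(1:=0)) (Jop 0 (Jop 1 (K i))) = 0"
    unfolding E_def comm
    by (rule ev_Jop_0) (use norm_divide_le_1[OF zr'] n01 in auto)
   have z0: "E (z(0:=0)) (Jop 0 (Jop 1 (K i))) = 0"
    unfolding E_def by (rule ev_Jop_0) (use norm_divide_le_1[OF zr'] n01 in auto)
   show "pd 1 (pd 0 (F i)) z = Ph i (jet1 F z) & pd 0 (pd 1 (F i)) z = Ph i (jet1 F z) &
     F i (z(1:=0)) = U i z + V i (z(1:=0)) & F i (z(0:=0)) = U i (z(0:=0)) + V i z"
    using elim(3,4) i EK z0 z1 by (simp add: F_def U(2)[simplified] V(2))
  qed
 qed
 then show ?thesis using gF by blast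
qed

subsection \<open>The harmonic map equation in affine coordinates\<close>

text \<open>In the central projection \<open>N = (1 + u\<^sup>2 + v\<^sup>2)\<^sup>-\<^sup>1\<^sup>/\<^sup>2 (u, v, 1)\<close> the equation \<open>N \<times> N\<^sub>x\<^sub>y = 0\<close> becomes
 \<open>g\<^sub>x\<^sub>y = (\<langle>g, g\<^sub>x\<rangle> g\<^sub>y + \<langle>g, g\<^sub>y\<rangle> g\<^sub>x) / (1 + |g|\<^sup>2)\<close> for \<open>g = (u, v)\<close>. It is linear in \<open>g\<^sub>x\<close> for given \<open>g\<close>, \<open>g\<^sub>y\<close>.\<close>

definition hrhs :: "(pnt) => (pnt) => (pnt) => pnt" where
 "hrhs g p q i = ((g 0*p 0 + g 1*p 1)*q i + (g 0*q 0 + g 1*q 1)*p i) / (1 + (g 0)^2 + (g 1)^2)"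

lemma hrhs_commute: "hrhs g p q i = hrhs g q p i"
 by (simp add: hrhs_def algebra_simps)

lemma germ_hrhs: "i < 2 ==> germ 6 (%u. hrhs (%k. u k) (%k. u (k + 2)) (%k. u (k + 4)) i)"
 unfolding hrhs_def divide_inverse
 by (intro germ_mult germ_inverse germ_add germ_power
   germ_var germ_const) auto

lemma abs_hrhs_le:
 assumes "abs(g 0) <= 1" "abs(g 1) <= 1" "abs(p 0) <= 1" "abs(p 1) <= 1" "i < 2"
 shows "abs(hrhs g p q i) <= 4*(abs(q 0) + abs(q 1))"
proof -
 have pi: "abs(p i) <= 1" "abs(q i) <= abs(q 0) + abs(q 1)" using assms by (auto simp: less_2_cases_iff)
 have "abs((g 0*p 0 + g 1*p 1)*q i) <= 2*(abs(q 0) + abs(q 1))"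
 proof -
  have "abs(g 0*p 0) <= 1*1" "abs(g 1*p 1) <= 1*1"
   unfolding abs_mult using assms by (intro mult_mono; simp)+
  then have "abs(g 0*p 0 + g 1*p 1) <= 2" by linarith
  then show ?thesis unfolding abs_mult using pi by (intro mult_mono) auto
 qed
 moreover have "abs((g 0*q 0 + g 1*q 1)*p i) <= (abs(q 0) + abs(q 1))*1"
 proof -
  have "abs(g 0*q 0) <= 1*abs(q 0)" "abs(g 1*q 1) <= 1*abs(q 1)"
   unfolding abs_mult using assms by (intro mult_right_mono; simp)+
  then have "abs(g 0*q 0 + g 1*q 1) <= abs(q 0) + abs(q 1)" by linarith
  then show ?thesis unfolding abs_mult using pi by (intro mult_mono) auto
 qed
 ultimately have *: "abs((g 0*p 0 + g 1*p 1)*q i + (g 0*q 0 + g 1*q 1)*p i) <= 4*(abs(q 0) + abs(q 1))"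
  by linarith
 have pos: "0 < 1 + (g 0)^2 + (g 1)^2" by (intro add_pos_nonneg) auto
 have "abs(hrhs g p q i) = abs((g 0*p 0 + g 1*p 1)*q i + (g 0*q 0 + g 1*q 1)*p i) / (1 + (g 0)^2 + (g 1)^2)"
  unfolding hrhs_def abs_divide abs_of_pos[OF pos] ..
 also have "\<dots> <= abs((g 0*p 0 + g 1*p 1)*q i + (g 0*q 0 + g 1*q 1)*p i) / 1"
  using pos by (intro divide_left_mono) auto
 finally show ?thesis using * by simp
qed

section \<open>Vanishing of one null derivative along an axis\<close>

lemma ev_nbf_axis:
 assumes "eventually P (nbf n)"
 shows "EX dl>0. ALL t. abs(t) < dl --> P ((%_. 0)(j:=t))"
proof -
 obtain r where "r > 0" "!!z. ALL i<n. abs(z i) < r ==> P z"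
  using assms unfolding ev_nbf by blast
 then show ?thesis by (intro exI[of _ r]) auto
qed

lemma small_germ:
 fixes f :: "fnc"
 assumes "germ n f" "f (%_. 0) = 0" "e > 0"
 shows "\<forall>\<^sub>F z in nbf n. abs(f z) < e"
proof -
 have "\<forall>\<^sub>F r in at_right 0. EX c. rep n r f c & norm c <= e / 2"
  by (rule rep_small) (use assms in auto)
 from eventually_happens[OF eventually_conj[OF eventually_at_right_pos this]]
 obtain r c where r: "r > 0" "rep n r f c" "norm c <= e / 2" by auto
 have "abs(f z) < e" if z: "ALL i<n. abs(z i) < r" for z
 proof -
  have "abs(f z) <= norm c" using evz_norm[OF z, of c] r(2) z by (simp add: rep_def)
  then show ?thesis using r(3) assms(3) by linarith
 qed
 then show ?thesis unfolding ev_nbf using r(1) by blast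
qed

text \<open>For given \<open>F\<close> and \<open>P\<close> the right hand side is linear in
  \<open>Q\<close>, so along the j-axis \<open>Q\<close> solves a linear homogeneous ordinary
  differential equation with initial value zero. \<open>Q\<close> will be a null derivative of the
  map or such a derivative divided by a coordinate.\<close>

lemma harmonic_axis_vanish:
 fixes F P Q :: "nat => fnc"
 assumes germs: "!!i. i < 2 ==> germ n (F i)" "!!i. i < 2 ==> germ n (P i)"
   "!!i. i < 2 ==> germ n (Q i)"
  and zero: "!!i. i < 2 ==> F i (%_. 0) = 0" "!!i. i < 2 ==> P i (%_. 0) = 0"
   "!!i. i < 2 ==> Q i (%_. 0) = 0"
  and "j < n"
  and eq: "\<forall>\<^sub>F z in nbf n. ALL i<2. pd j (Q i) z = hrhs (%k. F k z) (%k. P k z) (%k. Q k z) i"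
 shows "EX dl>0. ALL t. abs(t) < dl --> (ALL i<2. Q i ((%_. 0)(j:=t)) = 0)"
proof -
 have all2: "\<forall>\<^sub>F z in nbf n. ALL i:{..<2}. R i z" if "!!i. i < 2 ==> \<forall>\<^sub>F z in nbf n. R i z" for R :: "nat => _"
  by (rule eventually_ball_finite) (use that in auto)
 have ev: "\<forall>\<^sub>F z in nbf n. (ALL i<2. abs(F i z) < 1 & abs(P i z) < 1 &
   ((%t. Q i (z(j:=t))) hrd pd j (Q i) z) (at (z j)) &
   pd j (Q i) z = hrhs (%k. F k z) (%k. P k z) (%k. Q k z) i)"
 proof -
  have "\<forall>\<^sub>F z in nbf n. ALL i:{..<2}. abs(F i z) < 1" "\<forall>\<^sub>F z in nbf n. ALL i:{..<2}. abs(P i z) < 1"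
   by (intro all2 small_germ germs zero zero_less_one; assumption)+
  moreover have "\<forall>\<^sub>F z in nbf n. ALL i:{..<2}.
    ((%t. Q i (z(j:=t))) hrd pd j (Q i) z) (at (z j))"
   by (intro all2 germ_pd_DERIV germs \<open>j < n\<close>)
  ultimately show ?thesis using eq by eventually_elim auto
 qed
 obtain d where d: "d > 0" and dP: "!!t. abs(t) < d ==> (ALL i<2. abs(F i ((%_. 0)(j:=t))) < 1 & abs(P i ((%_. 0)(j:=t))) < 1 &
   ((%s. Q i (((%_. 0)(j:=t))(j:=s))) hrd pd j (Q i) ((%_. 0)(j:=t))) (at (((%_. 0)(j:=t)) j)) &
   pd j (Q i) ((%_. 0)(j:=t)) = hrhs (%k. F k ((%_. 0)(j:=t))) (%k. P k ((%_. 0)(j:=t))) (%k. Q k ((%_. 0)(j:=t))) i)"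
  using ev_nbf_axis[OF ev, of j] by blast
 \<comment> \<open>With Lipschitz constant 4, two components and length \<open>2 dl\<close>, at most
   1/10, the product that \<open>small_lipschitz_unique\<close> wants below 1 is at most
   4/5.\<close>
 define dl where "dl = min (d / 2) (1/20)"
 have dl: "dl > 0" "dl < d" "dl <= 1/20" using d by (auto simp: dl_def)
 let ?y = "%t i. Q i ((%_. 0)(j:=t))"
 have "?y t i = 0" if "abs(t) < dl" "i < 2" for t i
 proof (rule small_lipschitz_unique[of "-dl" dl 2 ?y "%t i. pd j (Q i) ((%_. 0)(j:=t))" 4 0 t i])
  fix t i assume t: "t \<in> {-dl..dl}" and i: "i < (2::nat)"
  then have td: "abs(t) < d" using dl by auto
  show "((%s. ?y s i) hrd pd j (Q i) ((%_. 0)(j:=t))) (at t within {-dl..dl})"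
   using dP[OF td, rule_format, OF i] by (auto intro: has_field_derivative_at_within)
  have "abs(pd j (Q i) ((%_. 0)(j:=t))) <= 4*(abs(?y t 0) + abs(?y t 1))"
   using dP[OF td, rule_format, OF i] dP[OF td, rule_format, of 0] dP[OF td, rule_format, of 1] i
   by (simp only:) (rule abs_hrhs_le, auto)
  then show "abs(pd j (Q i) ((%_. 0)(j:=t))) <= 4*(\<Sum>k<2. abs(?y t k))"
   by (simp add: numeral_2_eq_2)
 next
  show "?y 0 i = 0" if "i < 2" for i
  proof -
   have "(%_. 0)(j:=0) = (%_. 0 :: real)" by auto
   then show ?thesis using zero(3)[OF that] by simp
  qed
 qed (use dl that in auto)
 then show ?thesis using dl(1) by blast
qed

section \<open>Infinitesimal versality of unfoldings of \<open>I\<^sub>2\<^sub>,\<^sub>2\<close>\<close>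

subsection \<open>Reduction of one component\<close>

lemma Pop_mmono: "Pop j (mmono a) = (if a j = 0 then mmono a else 0)"
 and Sop_mmono: "Sop j (mmono a) = (if a j = 0 then 0 else mmono (a(j:=a j - 1)))"
 by (simp_all add: Pop_def Sop_def)

lemmas Pop_simps = linear_simps[OF Pop_bl] and Sop_simps = linear_simps[OF Sop_bl]

lemma Pop_Pop: "Pop i (Pop j c) = Pop j (Pop i c)"
 by (rule mps_ext[of "%c. Pop i (Pop j c)" "%c. Pop j (Pop i c)"])
  (auto intro: bounded_linear_compose[OF Pop_bl Pop_bl] simp: Pop_mmono Pop_simps)

lemma Pop_idem: "Pop i (Pop i c) = Pop i c"
 by (rule mps_ext[of "%c. Pop i (Pop i c)" "%c. Pop i c"])
  (auto intro: bounded_linear_compose[OF Pop_bl Pop_bl] Pop_bl simp: Pop_mmono Pop_simps)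

lemma Pop_Sop_commute: "i ~= j ==> Pop i (Sop j c) = Sop j (Pop i c)"
 by (rule mps_ext[of "%c. Pop i (Sop j c)" "%c. Sop j (Pop i c)"])
  (auto intro: bounded_linear_compose[OF Pop_bl Sop_bl] bounded_linear_compose[OF Sop_bl Pop_bl]
   simp: Pop_mmono Sop_mmono Pop_simps Sop_simps)

lemma Pop_Xv_mult: "i ~= j ==> Pop i (Xv j*c) = Xv j*Pop i c"
 by (rule mps_ext[of "%c. Pop i (Xv j*c)" "%c. Xv j*Pop i c"])
  (auto intro: bounded_linear_compose[OF Pop_bl bounded_linear_mult_right]
   bounded_linear_compose[OF bounded_linear_mult_right Pop_bl] simp: Xv_def mono_mult Pop_mmono)

lemma Sop_funpow_bl: "bounded_linear (%c. (Sop j ^^ q) c)"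
 by (induction q) (auto intro: bounded_linear_compose[OF Sop_bl] bounded_linear_ident)

lemma norm_Sop_funpow: "norm ((Sop j ^^ q) c) <= norm c"
 by (induction q) (auto intro: order_trans[OF norm_Sop])

lemma Pop_Sop_funpow_commute: "i ~= j ==> Pop i ((Sop j ^^ q) c) = (Sop j ^^ q) (Pop i c)"
 by (induction q) (auto simp: Pop_Sop_commute)

lemma Sop_expansion:
 "c = (\<Sum>q<k. Xv j ^ q*Pop j ((Sop j ^^ q) c)) + Xv j ^ k*(Sop j ^^ k) c"
proof (induction k)
 case (Suc k)
 have "Xv j ^ k*(Sop j ^^ k) c = Xv j ^ k*(Pop j ((Sop j ^^ k) c) + Xv j*Sop j ((Sop j ^^ k) c))"
  using Pop_Sop[of "(Sop j ^^ k) c" j] by simp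
 then show ?case using Suc by (simp add: algebra_simps)
qed simp

lemma norm_mult_le: "norm (a :: 'b::real_normed_algebra) <= A ==> norm b <= B ==> norm (a*b) <= A*B"
 by (meson mult_mono norm_ge_zero norm_mult_ineq order_trans)

lemma norm_power_le: "norm (a :: 'b::real_normed_algebra_1) <= A ==> norm (a ^ k) <= A ^ k"
 by (meson norm_ge_zero norm_power_ineq order_trans power_mono)

text \<open>Rescaling by \<open>1 / (2 s)\<close> brings \<open>u + p\<close> and \<open>u\<close>
  into the unit ball, where the difference of two \<open>q\<close>-th powers is at most
  \<open>q\<close> times the difference of the arguments.\<close>

lemma norm_add_power_diff:
 fixes u p :: mps
 assumes u: "norm u <= s" "norm p <= s" "0 < s"
 shows "norm ((u + p) ^ q - u ^ q) <= (2 * s) ^ q*(real q*(norm p / s))"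
proof -
 define t where "t = 1 / (2 * s)"
 have t: "0 < t" "t*(2 * s) = 1" using u(3) by (auto simp: t_def)
 have "norm ((t *\<^sub>R (u + p)) ^ q - (t *\<^sub>R u) ^ q) <= real q*norm (t *\<^sub>R (u + p) - t *\<^sub>R u)"
 proof (rule norm_power_diff)
  have "norm (u + p) <= 2 * s" using norm_triangle_ineq[of u p] u by linarith
  then have "t*norm (u + p) <= t*(2 * s)" using t by (intro mult_left_mono) auto
  then show "norm (t *\<^sub>R (u + p)) <= 1" using t by simp
  have "t*norm u <= t*(2 * s)" using t u by (intro mult_left_mono) auto
  then show "norm (t *\<^sub>R u) <= 1" using t by simp
 qed
 also have "\<dots> = real q*(t*norm p)"
  using t by (simp add: scaleR_add_right)
 finally have "t ^ q*norm ((u + p) ^ q - u ^ q) <= real q*(t*norm p)"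
 proof -
  have "(t *\<^sub>R (u + p)) ^ q - (t *\<^sub>R u) ^ q = t ^ q *\<^sub>R ((u + p) ^ q - u ^ q)"
   by (simp only: scaleR_power scaleR_diff_right)
  then show "norm ((t *\<^sub>R (u + p)) ^ q - (t *\<^sub>R u) ^ q) <= real q*(t*norm p) ==>
    t ^ q*norm ((u + p) ^ q - u ^ q) <= real q*(t*norm p)" using t by simp
 qed
 then have "(2 * s) ^ q*(t ^ q*norm ((u + p) ^ q - u ^ q)) <= (2 * s) ^ q*(real q*(t*norm p))"
  using u by (intro mult_left_mono) auto
 moreover have st: "(2 * s) ^ q*t ^ q = 1" using t by (simp only: power_mult_distrib[symmetric] mult.commute) simp
 moreover have "norm ((u + p) ^ q - u ^ q) = (2 * s) ^ q*(t ^ q*norm ((u + p) ^ q - u ^ q))"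
  by (simp only: mult.assoc[symmetric] st mult_1_left)
 ultimately have "norm ((u + p) ^ q - u ^ q) <= (2 * s) ^ q*(real q*(t*norm p))" by linarith
 also have "t*norm p <= norm p / s" unfolding t_def using u(3) by (simp add: frac_le)
 then have "(2 * s) ^ q*(real q*(t*norm p)) <= (2 * s) ^ q*(real q*(norm p / s))"
  using u(3) by (intro mult_left_mono) auto
 finally show ?thesis .
qed

text \<open>Multiplicative functionals \<open>Z\<close> stand for evaluation at a point where the extra variables \<open>iu\<close>, \<open>iv\<close>
 take the values of the unfolding \<open>(h0, h1)\<close> divided by \<open>\<rho>\<close>. A series \<open>F\<close> in the first component is
 \<open>X a + e + Y\<^sup>2 c + Y U f + (\<Sum>q<l. Y V\<^sup>q g\<^sub>q) + Y V\<^sup>l G\<close>, and each summand is moved into the tangent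
 space up to a remainder of smaller norm; the last one by the Euler relation of the quasihomogeneous
 germ, whose weights are not those of \<open>I\<^sub>2\<^sub>,\<^sub>2\<close> because \<open>(2l+1)(2m+1) \<noteq> 4\<close>.\<close>

lemma reduce_component:
 fixes ix iy iu iv l m :: nat and r :: real
  and q0 q1 q0x q0y q1x q1y :: mps and w0 w1 :: "nat => mps"
 defines "x \<equiv> r *\<^sub>R Xv ix" and "y \<equiv> r *\<^sub>R Xv iy" and "rh \<equiv> r\<^sup>2 / 32"
 defines "h0 \<equiv> x ^ 2 + y ^ (2*l + 1) + q0" and "h1 \<equiv> y ^ 2 + x ^ (2*m + 1) + q1"
 defines "h0x \<equiv> 2 *\<^sub>R x + q0x" and "h1x \<equiv> real (2*m + 1) *\<^sub>R x ^ (2*m) + q1x"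
 defines "h0y \<equiv> real (2*l + 1) *\<^sub>R y ^ (2*l) + q0y" and "h1y \<equiv> 2 *\<^sub>R y + q1y"
 assumes dist: "ix ~= iy" "ix ~= iu" "ix ~= iv" "iy ~= iu" "iy ~= iv" "iu ~= iv"
  and lm: "1 <= l" "1 <= m"
  and r: "0 < r" "r*((real l + 5)*(64 ^ l*(6*real m + 2*real l + 72))) <= 1/32"
  and eps: "norm q0 <= r ^ (2*l + 2*m + 4)" "norm q1 <= r ^ (2*l + 2*m + 4)"
   "norm q0x <= r ^ (2*l + 2*m + 4)" "norm q1x <= r ^ (2*l + 2*m + 4)"
   "norm q0y <= r ^ (2*l + 2*m + 4)" "norm q1y <= r ^ (2*l + 2*m + 4)"
   "ALL q<l. norm (w0 q) <= r ^ (2*l + 2*m + 4)"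
   "ALL q<l. norm (w1 q) <= r ^ (2*l + 2*m + 4)"
 shows "EX D1 D2 A1 A2 B0 B1 C.
  bounded_linear D1 & bounded_linear D2 & (ALL F. norm (D1 F) <= 1/8*norm F & norm (D2 F) <= 1/8*norm F) &
  (ALL F j. j = ix \<or> j = iy --> Pop j (B0 F) = B0 F & Pop j (B1 F) = B1 F) &
  (ALL F j q. j = ix \<or> j = iy \<or> j = iu \<or> j = iv --> Pop j (C q F) = C q F) &
  (ALL F (Z :: mps => real). (ALL u v. Z (u + v) = Z u + Z v) --> (ALL u v. Z (u * v) = Z u*Z v) -->
   (ALL k u. Z (k *\<^sub>R u) = k*Z u) --> Z 1 = 1 --> rh*Z (Xv iu) = Z h0 --> rh*Z (Xv iv) = Z h1 -->
   Z F = Z h0x*Z (A1 F) + Z h0y*Z (A2 F) + Z (B0 F)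
     + (\<Sum>q<l. Z (C q F)*Z (y ^ (2*q + 1) + w0 q)) + Z (D1 F) &
   0 = Z h1x*Z (A1 F) + Z h1y*Z (A2 F) + Z (B1 F)
     + (\<Sum>q<l. Z (C q F)*Z (w1 q)) + Z (D2 F))"
proof -
 define ep where "ep = r ^ (2*l + 2*m + 4)"
 \<comment> \<open>The field \<open>2 x d/dx + (2m+1) y d/dy\<close> multiplies
   \<open>y^2 + x^(2m+1)\<close> by \<open>2 (2m+1)\<close>, but sends \<open>x^2 + y^(2l+1)\<close>
   to four times itself plus \<open>ka y^(2l+1)\<close>. Division by \<open>ka\<close> therefore
   puts \<open>y^(2l+1)\<close> in the first component into the tangent space.\<close>
 define ka :: real where "ka = real (2*l + 1)*real (2*m + 1) - 4"
 have ka: "1 <= ka"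
 proof -
  have "3*3 <= real (2*l + 1)*real (2*m + 1)" using lm by (intro mult_mono) auto
  then show ?thesis by (simp add: ka_def)
 qed
 \<comment> \<open>A common bound for the error multipliers: apart from the term 1/32 in
   \<open>M2\<close> each of them has norm at most \<open>b\<close>, and at most
   \<open>l + 4\<close> of them act in one component.\<close>
 define b where "b = 64 ^ l*(6*real m + 2*real l + 72)*r"
 have b: "(real l + 5)*b <= 1/32" using r(2) by (simp add: b_def mult_ac)
 have "1 <= 64 ^ l*(6*real m + 2*real l + 72)"
  using mult_mono[of 1 "64 ^ l" 1 "6*real m + 2*real l + 72"] by simp
 then have rb: "r <= b" using r(1) mult_right_mono[of 1 "64 ^ l*(6*real m + 2*real l + 72)" r]
  by (simp add: b_def)
 have "5*b <= (real l + 5)*b" using rb r by (intro mult_right_mono) auto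
 then have r1: "r <= 1" using b rb by linarith
 have rh: "0 < rh" using r by (simp add: rh_def)
 have rpow: "r ^ k <= r ^ j" if "j <= k" for j k using that r r1 by (simp add: power_decreasing)
 have ep0: "0 < ep" using r by (simp add: ep_def)
 have ep_div: "ep / r ^ k <= r" if "k <= 2*l + 2*m + 3" for k
 proof -
  have "ep <= r ^ (k + 1)" unfolding ep_def using that by (intro rpow) auto
  then show ?thesis using r by (simp add: field_simps)
 qed
 have rhpow: "r*rh ^ q = r ^ (2*q + 1) / 32 ^ q" for q
  by (simp add: rh_def power_divide power_mult)
 have eprh: "ep / (r*rh ^ q) <= 32 ^ l*r" if "q <= l" for q
 proof -
  have "ep / (r*rh ^ q) = 32 ^ q*(ep / r ^ (2*q + 1))" unfolding rhpow by simp
  also have "\<dots> <= 32 ^ l*r" using that r ep0 by (intro mult_mono ep_div power_increasing) auto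
  finally show ?thesis .
 qed
 have nx: "norm x = r" "norm y = r" using r by (auto simp: x_def y_def)
 have nxk: "norm (x ^ k) <= r ^ k" "norm (y ^ k) <= r ^ k" for k using norm_power_le[of x r k] norm_power_le[of y r k] nx by simp_all
 define p where "p = x ^ (2*m + 1) + q1"
 have np: "norm p <= 2*r ^ 3"
 proof -
  have "norm p <= r ^ (2*m + 1) + ep"
   unfolding p_def using norm_triangle_ineq[of "x ^ (2*m + 1)" q1] nxk(1)[of "2*m + 1"] eps(2)
   by (simp add: ep_def)
  also have "\<dots> <= r ^ 3 + r ^ 3" unfolding ep_def using lm by (intro add_mono rpow) auto
  finally show ?thesis by simp
 qed
 have hdiff: "norm ((1 / (r*rh ^ q)) *\<^sub>R (y*(h1 ^ q - y ^ (2*q)))) <= 64 ^ l*(real l*(2*r))"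
  if "q <= l" for q
 proof -
  have "norm p <= r^2"
  proof -
   have "2*r ^ 3 = (2*r)*r^2" by (simp add: power3_eq_cube power2_eq_square)
   also have "\<dots> <= 1*r^2" using rb b \<open>5 * b \<le> _\<close> by (intro mult_right_mono) auto
   finally show ?thesis using np by simp
  qed
  then have "norm ((y^2 + p) ^ q - (y^2) ^ q) <= (2*r^2) ^ q*(real q*(norm p / r^2))"
   using nxk(2)[of 2] r by (intro norm_add_power_diff) auto
  also have "\<dots> <= (2*r^2) ^ q*(real l*(2*r))"
  proof -
   have "norm p / r^2 <= 2*r" using np r by (simp add: field_simps power3_eq_cube power2_eq_square)
   then show ?thesis using that r by (intro mult_left_mono mult_mono) auto
  qed
  finally have "norm (h1 ^ q - y ^ (2*q)) <= (2*r^2) ^ q*(real l*(2*r))"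
   by (simp add: h1_def p_def power_mult add.assoc)
  then have "norm (y*(h1 ^ q - y ^ (2*q))) <= r*((2*r^2) ^ q*(real l*(2*r)))"
   using nx by (intro norm_mult_le) auto
  then have "norm ((1 / (r*rh ^ q)) *\<^sub>R (y*(h1 ^ q - y ^ (2*q))))
    <= (1 / (r*rh ^ q))*(r*((2*r^2) ^ q*(real l*(2*r))))"
   unfolding norm_scaleR using r rh by (intro mult_mono) auto
  also have "\<dots> = 64 ^ q*(real l*(2*r))"
  proof -
   have "2*r^2 = 64*rh" by (simp add: rh_def)
   then have "(2*r^2) ^ q = 64 ^ q*rh ^ q" by (simp only: power_mult_distrib)
   then show ?thesis using r rh by simp
  qed
  also have "\<dots> <= 64 ^ l*(real l*(2*r))"
   using that r by (intro mult_right_mono power_increasing) auto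
  finally show ?thesis .
 qed
 define a where "a = Sop ix"
 define cc where "cc F = Sop iy (Sop iy (Pop ix F))" for F
 \<comment> \<open>\<open>dd\<close> is the coefficient of \<open>Xv iy\<close> in the restriction
   to \<open>ix = 0\<close>. Its part divisible by \<open>Xv iu\<close> is split off as
   \<open>ff\<close>; the rest is expanded in \<open>Xv iv\<close>.\<close>
 define dd where "dd F = Pop iy (Sop iy (Pop ix F))" for F
 define ee where "ee F = Pop iy (Pop ix F)" for F
 define ff where "ff F = Sop iu (dd F)" for F
 define d' where "d' F = Pop iu (dd F)" for F
 define g where "g q F = Pop iv ((Sop iv ^^ q) (d' F))" for q F
 define GG where "GG F = (Sop iv ^^ l) (d' F)" for F
 have bl: "bounded_linear a" "bounded_linear cc" "bounded_linear ff" "bounded_linear (g q)" "bounded_linear GG" for q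
  unfolding a_def cc_def[abs_def] ff_def[abs_def] dd_def[abs_def] g_def[abs_def] d'_def[abs_def] GG_def[abs_def]
  by (intro bounded_linear_compose[OF Sop_bl] bounded_linear_compose[OF Pop_bl] Sop_bl Pop_bl
    bounded_linear_compose[OF Sop_funpow_bl])+
 have nd: "norm (d' F) <= norm F" "norm (dd F) <= norm F" for F
  unfolding d'_def dd_def by (meson norm_Pop norm_Sop order_trans)+
 have ne: "norm (a F) <= norm F" "norm (cc F) <= norm F" "norm (ff F) <= norm F" "norm (g q F) <= norm F"
  "norm (GG F) <= norm F" for F q
  unfolding a_def cc_def ff_def g_def GG_def
  using nd norm_Pop norm_Sop norm_Sop_funpow by (meson order_trans)+
 \<comment> \<open>The multipliers \<open>M\<close> and \<open>N\<close> collect what is left over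
   in the first and in the second component.\<close>
 define M1 where "M1 = (- 1 / (2*r)) *\<^sub>R q0x"
 \<comment> \<open>Here the summand is merely rewritten: \<open>y^2 = h1 - p\<close>, and
   \<open>h1 / r^2\<close> is the variable \<open>Xv iv\<close> divided by 32. This gain is the
   reason for the 32 in \<open>rh\<close>; the second component is not touched, so there is no
   \<open>N2\<close>.\<close>
 define M2 where "M2 = (1/32) *\<^sub>R Xv iv + (- 1 / r^2) *\<^sub>R p"
 define M3 where "M3 = (1 / (r*rh)) *\<^sub>R (y*(y ^ (2*l + 1) + q0)) + (- 1 / (2*r*rh)) *\<^sub>R (q0x*(x*y))"
 define M4 where "M4 q = (1 / (r*rh ^ q)) *\<^sub>R (y*(h1 ^ q - y ^ (2*q))) + (- 1 / (r*rh ^ q)) *\<^sub>R w0 q" for q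
 \<comment> \<open>\<open>R5\<close>, and \<open>S5\<close> below, are the defects of the two
   weighted Euler identities for the perturbed germ.\<close>
 define R5 where "R5 = 4 *\<^sub>R q0 + (- 2) *\<^sub>R (x*q0x) + (- real (2*m + 1)) *\<^sub>R (y*q0y)"
 define M5 where "M5 = (1 / (r*rh ^ l)) *\<^sub>R (y*(h1 ^ l - y ^ (2*l))) + (1 / (r*rh ^ l * ka)) *\<^sub>R R5"
 define N1 where "N1 = (- 1 / (2*r)) *\<^sub>R h1x"
 define N3 where "N3 = (- 1 / (2*r*rh)) *\<^sub>R (h1x*(x*y))"
 define N4 where "N4 q = (- 1 / (r*rh ^ q)) *\<^sub>R w1 q" for q
 define S5 where "S5 = (2*real (2*m + 1)) *\<^sub>R q1 + (- 2) *\<^sub>R (x*q1x) + (- real (2*m + 1)) *\<^sub>R (y*q1y)"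
 define N5 where "N5 = (1 / (r*rh ^ l * ka)) *\<^sub>R S5"
 define D1 where "D1 F = M1*a F + M2*cc F + M3*ff F + (\<Sum>q<l. M4 q*g q F) + M5*GG F" for F
 define D2 where "D2 F = N1*a F + N3*ff F + (\<Sum>q<l. N4 q*g q F) + N5*GG F" for F
 have h1x_le: "norm h1x <= (2*real m + 2)*r^2"
 proof -
  have "norm h1x <= real (2*m + 1)*r ^ (2*m) + ep"
   unfolding h1x_def using eps(4) nxk(1)[of "2*m"]
   by (intro order_trans[OF norm_triangle_ineq] add_mono) (auto simp: ep_def intro!: mult_left_mono)
  also have "\<dots> <= real (2*m + 1)*r^2 + r^2"
   unfolding ep_def using lm by (intro add_mono mult_left_mono rpow) auto
  finally show ?thesis by (simp add: algebra_simps)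
 qed
 have big: "c*r <= b" if "0 <= c" "c <= 64 ^ l*(6*real m + 2*real l + 72)" for c
  unfolding b_def using that r by (intro mult_right_mono) auto
 have one64: "(1::real) <= 64 ^ l" "(32::real) ^ l <= 64 ^ l" "(0::real) <= 32 ^ l" by (auto intro: power_mono)
 have bigm: "c*d <= 64 ^ l*(6*real m + 2*real l + 72)"
  if "0 <= d" "c <= 64 ^ l" "d <= 6*real m + 2*real l + 72" for c d
  using that by (intro mult_mono) auto
 have nM1: "norm M1 <= b"
 proof -
  have "norm M1 <= ep / (2*r)" using eps(3) r by (simp add: M1_def ep_def divide_right_mono)
  also have "\<dots> <= ep / r ^ 1" using r ep0 by (simp add: frac_le)
  also have "\<dots> <= r" by (rule ep_div) simp
  finally show ?thesis using rb by simp
 qed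
 have nM2: "norm M2 <= 1/32 + b"
 proof -
  have "norm M2 <= 1/32 + norm p / r^2"
   unfolding M2_def by (rule order_trans[OF norm_triangle_ineq]) simp
  also have "norm p / r^2 <= 2*r" using np r by (simp add: field_simps power3_eq_cube power2_eq_square)
  also have "2*r <= b" by (rule big) (use bigm[of 2 1] one64 in auto)
  finally show ?thesis by simp
 qed
 have rhr: "1 / (r*rh) = 32 / r ^ 3" using r by (simp add: rh_def power3_eq_cube power2_eq_square)
 have nM3: "norm M3 <= b"
 proof -
  have "norm (y*(y ^ (2*l + 1) + q0)) <= r*(r ^ 3 + r ^ 3)"
  proof (rule norm_mult_le)
   have "norm (y ^ (2*l + 1) + q0) <= r ^ (2*l + 1) + ep"
    using eps(1) nxk(2)[of "2*l + 1"] by (intro order_trans[OF norm_triangle_ineq] add_mono) (auto simp: ep_def)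
   also have "\<dots> <= r ^ 3 + r ^ 3" unfolding ep_def using lm by (intro add_mono rpow) auto
   finally show "norm (y ^ (2*l + 1) + q0) <= r ^ 3 + r ^ 3" .
  qed (use nx in auto)
  then have 1: "norm ((1 / (r*rh)) *\<^sub>R (y*(y ^ (2*l + 1) + q0))) <= 32 / r ^ 3*(r*(r ^ 3 + r ^ 3))"
   unfolding rhr norm_scaleR using r by (intro mult_mono) auto
  have "norm (q0x*(x*y)) <= r ^ 2*(r*r)"
  proof (intro norm_mult_le)
   show "norm q0x <= r ^ 2" by (rule order_trans[OF eps(3) rpow]) simp
  qed (use nx in auto)
  then have "norm ((- 1 / (2*r*rh)) *\<^sub>R (q0x*(x*y))) <= (16 / r ^ 3)*(r ^ 2*(r*r))"
   unfolding norm_scaleR using r rhr rh by (intro mult_mono) (auto simp: abs_mult field_simps)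
  with 1 have "norm M3 <= 32 / r ^ 3*(r*(r ^ 3 + r ^ 3)) + (16 / r ^ 3)*(r ^ 2*(r*r))"
   unfolding M3_def by (intro order_trans[OF norm_triangle_ineq] add_mono) auto
  also have "\<dots> = 80*r" using r by (simp add: field_simps power3_eq_cube power2_eq_square)
  also have "\<dots> <= b"
  proof (rule big)
   have "80 <= 64*(80 :: real)" by simp
   also have "\<dots> <= 64 ^ l*(6*real m + 2*real l + 72)"
    using lm power_increasing[of 1 l "64::real"] by (intro mult_mono) auto
   finally show "80 <= 64 ^ l*(6*real m + 2*real l + 72)" .
  qed simp
  finally show ?thesis .
 qed
 have w_le: "norm ((- 1 / (r*rh ^ q)) *\<^sub>R u) <= 32 ^ l*r" if "norm u <= ep" "q <= l" for u :: mps and q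
 proof -
  have "norm ((- 1 / (r*rh ^ q)) *\<^sub>R u) = norm u / (r*rh ^ q)" using r rh by simp
  also have "\<dots> <= ep / (r*rh ^ q)" using that r rh by (intro divide_right_mono) auto
  finally show ?thesis using eprh[OF that(2)] by simp
 qed
 have nM4: "norm (M4 q) <= b" if "q < l" for q
 proof -
  have "norm (M4 q) <= 64 ^ l*(real l*(2*r)) + 32 ^ l*r"
   unfolding M4_def using that eps(7)[rule_format, OF that]
   by (intro order_trans[OF norm_triangle_ineq] add_mono hdiff w_le) (auto simp: ep_def)
  also have "\<dots> <= 64 ^ l*(2*real l*r) + 64 ^ l*r"
   using one64 r by (intro add_mono mult_right_mono) auto
  also have "\<dots> = (64 ^ l*(2*real l + 1))*r" by (simp add: algebra_simps)
  also have "\<dots> <= b" by (rule big) (use bigm[of "2*real l + 1" "64 ^ l"] in auto)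
  finally show ?thesis .
 qed
 have nN4: "norm (N4 q) <= b" if "q < l" for q
 proof -
  have "norm (N4 q) <= 32 ^ l*r" unfolding N4_def using that eps(8)[rule_format, OF that] by (intro w_le) (auto simp: ep_def)
  also have "\<dots> <= b" by (rule big) (use bigm[of 1 "32 ^ l"] one64 in auto)
  finally show ?thesis .
 qed
 have xq: "norm (x*u) <= ep" "norm (y*u) <= ep" if "norm u <= ep" for u :: mps
  using norm_mult_le[of x 1 u ep] norm_mult_le[of y 1 u ep] that nx r1 by auto
 note eps' = eps[folded ep_def]
 have R5: "norm R5 <= (2*real m + 7)*ep"
 proof -
  have "norm R5 <= 4*norm q0 + 2*norm (x*q0x) + real (2*m + 1)*norm (y*q0y)"
   unfolding R5_def by (intro order_trans[OF norm_triangle_ineq] add_mono) (auto simp: ac_simps)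
  also have "\<dots> <= 4*ep + 2*ep + real (2*m + 1)*ep"
   using eps' xq by (intro add_mono mult_left_mono) auto
  finally show ?thesis by (simp add: algebra_simps)
 qed
 have S5: "norm S5 <= (6*real m + 5)*ep"
 proof -
  have "norm S5 <= (2*real (2*m + 1))*norm q1 + 2*norm (x*q1x) + real (2*m + 1)*norm (y*q1y)"
   unfolding S5_def by (intro order_trans[OF norm_triangle_ineq] add_mono) (auto simp: ac_simps)
  also have "\<dots> <= (2*real (2*m + 1))*ep + 2*ep + real (2*m + 1)*ep"
   using eps' xq by (intro add_mono mult_left_mono) auto
  finally show ?thesis by (simp add: algebra_simps)
 qed
 have k_le: "norm ((1 / (r*rh ^ l * ka)) *\<^sub>R u) <= c*(32 ^ l*r)" if "norm u <= c*ep" "0 <= c" for u :: mps and c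
 proof -
  have "norm ((1 / (r*rh ^ l * ka)) *\<^sub>R u) = (norm u / ka) / (r*rh ^ l)" using r rh ka by simp
  also have "\<dots> <= (c*ep) / (r*rh ^ l)"
  proof (rule divide_right_mono)
   have "norm u / ka <= norm u / 1" using ka by (intro divide_left_mono) auto
   then show "norm u / ka <= c*ep" using that by simp
  qed (use r rh in auto)
  also have "\<dots> = c*(ep / (r*rh ^ l))" by simp
  also have "\<dots> <= c*(32 ^ l*r)" using that by (intro mult_left_mono eprh) auto
  finally show ?thesis .
 qed
 have nM5: "norm M5 <= b"
 proof -
  have "norm M5 <= 64 ^ l*(real l*(2*r)) + (2*real m + 7)*(32 ^ l*r)"
   unfolding M5_def by (intro order_trans[OF norm_triangle_ineq] add_mono hdiff k_le R5) auto
  also have "\<dots> <= 64 ^ l*(real l*(2*r)) + (2*real m + 7)*(64 ^ l*r)"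
   using one64 r by (intro add_mono mult_left_mono mult_right_mono) auto
  also have "\<dots> = (64 ^ l*(2*real l + 2*real m + 7))*r" by (simp add: algebra_simps)
  also have "\<dots> <= b" by (rule big) (use bigm[of "2*real l + 2*real m + 7" "64 ^ l"] in auto)
  finally show ?thesis .
 qed
 have nN5: "norm N5 <= b"
 proof -
  have "norm N5 <= (6*real m + 5)*(32 ^ l*r)" unfolding N5_def by (intro k_le S5) auto
  also have "\<dots> = (32 ^ l*(6*real m + 5))*r" by (simp add: algebra_simps)
  also have "\<dots> <= b" by (rule big) (use bigm[of "6*real m + 5" "32 ^ l"] one64 in auto)
  finally show ?thesis .
 qed
 have nN1: "norm N1 <= b"
 proof -
  have "norm N1 = norm h1x / (2*r)" using r by (simp add: N1_def)
  also have "\<dots> <= (2*real m + 2)*r^2 / (2*r)" using h1x_le r by (intro divide_right_mono) auto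
  also have "\<dots> = (real m + 1)*r" using r by (simp add: power2_eq_square field_simps)
  also have "\<dots> <= b" by (rule big) (use bigm[of "real m + 1" 1] one64 in auto)
  finally show ?thesis .
 qed
 have nN3: "norm N3 <= b"
 proof -
  have "norm (h1x*(x*y)) <= (2*real m + 2)*r^2*(r*r)"
   using nx by (intro norm_mult_le h1x_le) auto
  then have "norm N3 <= (16 / r ^ 3)*((2*real m + 2)*r^2*(r*r))"
   unfolding N3_def norm_scaleR using r rhr rh by (intro mult_mono) (auto simp: abs_mult field_simps)
  also have "\<dots> = (32*real m + 32)*r" using r by (simp add: field_simps power3_eq_cube power2_eq_square)
  also have "\<dots> <= b"
  proof (rule big)
   have "32*real m + 32 <= 64*(6*real m + 2*real l + 72)" by simp
   also have "\<dots> <= 64 ^ l*(6*real m + 2*real l + 72)"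
    using lm power_increasing[of 1 l "64::real"] by (intro mult_right_mono) auto
   finally show "32*real m + 32 <= 64 ^ l*(6*real m + 2*real l + 72)" .
  qed simp
  finally show ?thesis .
 qed
 have b0: "0 <= b" using rb r by simp
 have nD1: "norm (D1 F) <= 1/8*norm F" for F
 proof -
  have "norm (D1 F) <= b*norm F + (1/32 + b)*norm F + b*norm F + (\<Sum>q<l. b*norm F) + b*norm F"
   unfolding D1_def
   by (intro order_trans[OF norm_triangle_ineq] add_mono order_trans[OF norm_sum] sum_mono norm_mult_le
     nM1 nM2 nM3 nM4 nM5 ne) auto
  also have "\<dots> = (1/32 + (real l + 4)*b)*norm F" by (simp add: algebra_simps)
  also have "\<dots> <= 1/8*norm F" using b b0 by (intro mult_right_mono) (auto simp: algebra_simps)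
  finally show ?thesis .
 qed
 have nD2: "norm (D2 F) <= 1/8*norm F" for F
 proof -
  have "norm (D2 F) <= b*norm F + b*norm F + (\<Sum>q<l. b*norm F) + b*norm F"
   unfolding D2_def
   by (intro order_trans[OF norm_triangle_ineq] add_mono order_trans[OF norm_sum] sum_mono norm_mult_le
     nN1 nN3 nN4 nN5 ne) auto
  also have "\<dots> = ((real l + 3)*b)*norm F" by (simp add: algebra_simps)
  also have "\<dots> <= 1/8*norm F" using b b0 by (intro mult_right_mono) (auto simp: algebra_simps)
  finally show ?thesis .
 qed
 have blD: "bounded_linear D1" "bounded_linear D2"
  unfolding D1_def[abs_def] D2_def[abs_def]
  by (intro bounded_linear_add bounded_linear_sum bounded_linear_const_mult bl)+
 \<comment> \<open>\<open>A1\<close> and \<open>A2\<close> are the components of the source field,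
   \<open>B0\<close> and \<open>B1\<close> those of the target field, \<open>C q\<close> the
   coefficients of the odd powers. The weighted radial field enters with the multiple
   \<open>B F\<close>, which is the last quotient \<open>GG F\<close> rescaled.\<close>
 define B where "B F = (1 / (r*rh ^ l)) *\<^sub>R GG F" for F
 define A1 where "A1 F = (1 / (2*r)) *\<^sub>R a F + (1 / (2*r*rh)) *\<^sub>R (x*y*ff F) + (2 / ka) *\<^sub>R (x*B F)" for F
 define A2 where "A2 F = (real (2*m + 1) / ka) *\<^sub>R (y*B F)" for F
 define B0 where "B0 F = ee F + (- 4*rh / ka) *\<^sub>R (Xv iu*B F)" for F
 define B1 where "B1 F = (- 2*real (2*m + 1)*rh / ka) *\<^sub>R (Xv iv * B F)" for F
 define C where "C q F = (1 / (r*rh ^ q)) *\<^sub>R g q F" for q F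
 have Pdd: "Pop j (dd F) = dd F" if "j = ix \<or> j = iy" for j F
  using that dist unfolding dd_def by (auto simp: Pop_idem Pop_Pop[of ix] Pop_Sop_commute)
 have Pd': "Pop j (d' F) = d' F" if "j = ix \<or> j = iy \<or> j = iu" for j F
  using that Pdd unfolding d'_def by (auto simp: Pop_idem Pop_Pop[of _ iu])
 have PB: "Pop j (B F) = B F" if "j = ix \<or> j = iy" for j F
  using that dist Pd' unfolding B_def GG_def by (auto simp: Pop_simps Pop_Sop_funpow_commute)
 \<comment> \<open>Independence of \<open>ix\<close> and \<open>iy\<close> makes \<open>B0\<close>
   and \<open>B1\<close> functions of the target point and the parameters. The coefficients
   \<open>C\<close> do not involve \<open>iu\<close> and \<open>iv\<close> either, so they depend on
   the parameters alone.\<close>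
 have PB01: "Pop j (B0 F) = B0 F" "Pop j (B1 F) = B1 F" if "j = ix \<or> j = iy" for j F
  using that dist PB unfolding B0_def B1_def ee_def
  by (auto simp: Pop_simps Pop_Xv_mult Pop_idem Pop_Pop[of ix])
 have PC: "Pop j (C q F) = C q F" if "j = ix \<or> j = iy \<or> j = iu \<or> j = iv" for j q F
  using that dist Pd' unfolding C_def g_def by (auto simp: Pop_simps Pop_Sop_funpow_commute Pop_idem Pop_Pop[of _ iv])
 have split: "F = Xv ix*a F + (ee F + Xv iy*(Xv iu*ff F + ((\<Sum>q<l. Xv iv ^ q*g q F) + Xv iv ^ l*GG F) + Xv iy*cc F))" for F
 proof -
  have "F = Pop ix F + Xv ix*a F" unfolding a_def by (rule Pop_Sop)
  also have "Pop ix F = ee F + Xv iy*Sop iy (Pop ix F)" unfolding ee_def by (rule Pop_Sop)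
  also have "Sop iy (Pop ix F) = dd F + Xv iy*cc F" unfolding dd_def cc_def by (rule Pop_Sop)
  also have "dd F = d' F + Xv iu*ff F" unfolding d'_def ff_def by (rule Pop_Sop)
  also have "d' F = (\<Sum>q<l. Xv iv ^ q*g q F) + Xv iv ^ l*GG F"
   unfolding g_def GG_def by (rule Sop_expansion)
  finally show ?thesis by (simp add: ac_simps)
 qed
 have main: "Z F = Z h0x*Z (A1 F) + Z h0y*Z (A2 F) + Z (B0 F)
     + (\<Sum>q<l. Z (C q F)*Z (y ^ (2*q + 1) + w0 q)) + Z (D1 F) &
   0 = Z h1x*Z (A1 F) + Z h1y*Z (A2 F) + Z (B1 F) + (\<Sum>q<l. Z (C q F)*Z (w1 q)) + Z (D2 F)"
  if Zadd: "ALL u v. Z (u + v) = Z u + Z v" and Zmult: "ALL u v. Z (u * v) = Z u*Z v"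
   and Zsc: "ALL k u. Z (k *\<^sub>R u) = k*Z u" and Z1: "Z 1 = 1"
   and Zu: "rh*Z (Xv iu) = Z h0" and Zv: "rh*Z (Xv iv) = Z h1" for F and Z :: "mps => real"
 proof
  have Z0: "Z 0 = 0" using Zsc[rule_format, of 0 0] by simp
  have Zpow: "Z (u ^ k) = Z u ^ k" for u k by (induction k) (auto simp: Z1 Zmult)
  have Zsum: "Z (\<Sum>q<k. f q) = (\<Sum>q<k. Z (f q))" for f :: "nat => mps" and k
   by (induction k) (auto simp: Z0 Zadd)
  have Zdiff: "Z (u - v) = Z u - Z v" for u v
   using Zadd[rule_format, of "u - v" v] by simp
  have Zneg: "Z (- u) = - Z u" for u using Zsc[rule_format, of "- 1" u] by simp
  note Zr = Zadd[rule_format] Zmult[rule_format] Zsc[rule_format] Zpow Zsum Zdiff Zneg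
  define X Y H1 where "X = Z x" and "Y = Z y" and "H1 = Z h1"
  have r0: "r ~= 0" "rh ~= 0" "ka ~= 0" using r rh ka by auto
  have Xv: "Z (Xv ix) = X / r" "Z (Xv iy) = Y / r" "Z (Xv iu) = Z h0 / rh" "Z (Xv iv) = H1 / rh"
   using r0 Zu Zv by (auto simp: X_def Y_def H1_def x_def y_def Zr field_simps)
  have H0: "Z h0 = X ^ 2 + Y ^ (2*l + 1) + Z q0" "H1 = Y ^ 2 + X ^ (2*m + 1) + Z q1"
   by (simp_all add: h0_def h1_def H1_def X_def Y_def Zr)
  have Hd: "Z h0x = 2*X + Z q0x" "Z h1x = real (2*m + 1)*X ^ (2*m) + Z q1x"
   "Z h0y = real (2*l + 1)*Y ^ (2*l) + Z q0y" "Z h1y = 2*Y + Z q1y"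
   by (simp_all add: h0x_def h1x_def h0y_def h1y_def X_def Y_def Zr del: of_nat_Suc of_nat_add of_nat_mult)
  have Zp: "Z p = X ^ (2*m + 1) + Z q1" by (simp add: p_def X_def Zr)
  define zB where "zB = Z (B F)"
  have zG: "Z (GG F) = r*rh ^ l*zB" using r0 by (simp add: zB_def B_def Zr)
  have ZA1: "Z (A1 F) = Z (a F) / (2*r) + X*Y*Z (ff F) / (2*r*rh) + 2 / ka*(X*zB)"
   by (simp add: A1_def Zr X_def Y_def zB_def)
  have ZA2: "Z (A2 F) = real (2*m + 1) / ka*(Y*zB)"
   by (simp add: A2_def Zr Y_def zB_def)
  have ZB0: "Z (B0 F) = Z (ee F) - 4 / ka*(Z h0*zB)"
   using r0 by (simp add: B0_def Zr Xv zB_def)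
  have ZB1: "Z (B1 F) = - 2*real (2*m + 1) / ka*(H1*zB)"
   using r0 by (simp add: B1_def Zr Xv zB_def)
  have ZF: "Z F = X / r*Z (a F) + Z (ee F) + Y / r*(Z h0 / rh)*Z (ff F)
    + (\<Sum>q<l. Y / r*((H1 / rh) ^ q*Z (g q F))) + Y / r*((H1 / rh) ^ l*Z (GG F)) + (Y / r)^2*Z (cc F)"
   by (subst split[of F]) (simp add: Zr Xv power2_eq_square algebra_simps sum_distrib_left)
  have t1: "X / r*Z (a F) = Z h0x*(Z (a F) / (2*r)) + Z M1*Z (a F)"
   using r0 by (simp add: Hd M1_def Zr field_simps)
  have t1': "0 = Z h1x*(Z (a F) / (2*r)) + Z N1*Z (a F)"
   using r0 by (simp add: N1_def Zr field_simps)
  have t2: "(Y / r)^2*Z (cc F) = Z M2*Z (cc F)"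
  proof -
   have "Z M2 = H1 / r^2 - Z p / r^2" using r0 by (simp add: M2_def Zr Xv rh_def)
   also have "\<dots> = (Y / r)^2" unfolding Zp H0 by (simp add: power_divide diff_divide_distrib[symmetric])
   finally show ?thesis by simp
  qed
  have t3: "Y / r*(Z h0 / rh)*Z (ff F) = Z h0x*(X*Y*Z (ff F) / (2*r*rh)) + Z M3*Z (ff F)"
  proof -
   have ZM3: "Z M3 = Y*(Y ^ (2*l + 1) + Z q0) / (r*rh) - Z q0x*(X*Y) / (2*r*rh)"
    by (simp add: M3_def Zr X_def Y_def)
   show ?thesis unfolding ZM3 H0 Hd using r0 by (simp add: field_simps power2_eq_square)
  qed
  have t3': "0 = Z h1x*(X*Y*Z (ff F) / (2*r*rh)) + Z N3*Z (ff F)"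
   using r0 by (simp add: N3_def Zr X_def Y_def field_simps)
  have t4: "Y / r*((H1 / rh) ^ q*Z (g q F)) = Z (C q F)*Z (y ^ (2*q + 1) + w0 q) + Z (M4 q)*Z (g q F)" for q
  proof -
   have ZM4: "Z (M4 q) = (Y*(H1 ^ q - Y ^ (2*q)) - Z (w0 q)) / (r*rh ^ q)"
    by (simp add: M4_def Zr H1_def Y_def diff_divide_distrib)
   have Zy: "Z (y ^ (2*q + 1) + w0 q) = Y*Y ^ (2*q) + Z (w0 q)" by (simp add: Zr Y_def)
   have ZC: "Z (C q F) = Z (g q F) / (r*rh ^ q)" by (simp add: C_def Zr)
   show ?thesis unfolding ZM4 Zy ZC using r0 by (simp add: power_divide field_simps)
  qed
  have t4': "0 = Z (C q F)*Z (w1 q) + Z (N4 q)*Z (g q F)" for q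
   using r0 by (simp add: C_def N4_def Zr)
  have t5: "Y / r*((H1 / rh) ^ l*Z (GG F)) = Z h0x*(2 / ka*(X*zB))
    + Z h0y*(real (2*m + 1) / ka*(Y*zB)) - 4 / ka*(Z h0*zB) + Z M5*Z (GG F)"
  proof -
   have ZR5: "Z R5 = 4*Z q0 - 2*(X*Z q0x) - real (2*m + 1)*(Y*Z q0y)"
    by (simp add: R5_def Zr X_def Y_def algebra_simps)
   have ZM5: "Z M5 = Y*(H1 ^ l - Y ^ (2*l)) / (r*rh ^ l)
     + (4*Z q0 - 2*(X*Z q0x) - real (2*m + 1)*(Y*Z q0y)) / (r*rh ^ l * ka)"
    unfolding M5_def Zr(1,3) ZR5 by (simp add: Zr X_def Y_def H1_def)
   have "Z M5*Z (GG F) = Y*(H1 ^ l - Y ^ (2*l))*zB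
     + (4*Z q0 - 2*(X*Z q0x) - real (2*m + 1)*(Y*Z q0y)) / ka*zB"
    unfolding zG ZM5 using r0 by (simp add: field_simps)
   moreover have "Y / r*((H1 / rh) ^ l*Z (GG F)) = Y*H1 ^ l*zB"
    using r0 unfolding zG by (simp add: power_divide)
   moreover have "ka*(Y*Y ^ (2*l)) = Z h0x*(2*X) + Z h0y*(real (2*m + 1)*Y) - 4*Z h0
     + (4*Z q0 - 2*(X*Z q0x) - real (2*m + 1)*(Y*Z q0y))"
    unfolding H0 Hd ka_def by (simp add: algebra_simps power2_eq_square)
   then have "Y*Y ^ (2*l)*zB = (Z h0x*(2*X) + Z h0y*(real (2*m + 1)*Y) - 4*Z h0
     + (4*Z q0 - 2*(X*Z q0x) - real (2*m + 1)*(Y*Z q0y))) / ka*zB"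
    using r0 by (simp add: nonzero_eq_divide_eq mult.commute)
   ultimately show ?thesis
    by (simp add: add_divide_distrib diff_divide_distrib ring_distribs)
  qed
  have t5': "0 = Z h1x*(2 / ka*(X*zB)) + Z h1y*(real (2*m + 1) / ka*(Y*zB))
    - 2*real (2*m + 1) / ka*(H1*zB) + Z N5*Z (GG F)"
  proof -
   have ZS5: "Z S5 = 2*real (2*m + 1)*Z q1 - 2*(X*Z q1x) - real (2*m + 1)*(Y*Z q1y)"
    by (simp add: S5_def Zr X_def Y_def algebra_simps)
   have "Z N5*Z (GG F) = (2*real (2*m + 1)*Z q1 - 2*(X*Z q1x) - real (2*m + 1)*(Y*Z q1y)) / ka*zB"
    unfolding zG N5_def Zr(3) ZS5 using r0 by (simp add: field_simps)
   moreover have "0 = Z h1x*(2*X) + Z h1y*(real (2*m + 1)*Y) - 2*real (2*m + 1)*H1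
     + (2*real (2*m + 1)*Z q1 - 2*(X*Z q1x) - real (2*m + 1)*(Y*Z q1y))"
    unfolding H0 Hd by (simp add: algebra_simps power2_eq_square)
   then have "0 = (Z h1x*(2*X) + Z h1y*(real (2*m + 1)*Y) - 2*real (2*m + 1)*H1
     + (2*real (2*m + 1)*Z q1 - 2*(X*Z q1x) - real (2*m + 1)*(Y*Z q1y))) / ka*zB"
    by (metis div_0 mult_zero_left)
   ultimately show ?thesis
    by (simp add: add_divide_distrib diff_divide_distrib ring_distribs)
  qed
  show "Z F = Z h0x*Z (A1 F) + Z h0y*Z (A2 F) + Z (B0 F)
    + (\<Sum>q<l. Z (C q F)*Z (y ^ (2*q + 1) + w0 q)) + Z (D1 F)"
   unfolding ZF t1 t2 t3 t4 t5 ZA1 ZA2 ZB0 D1_def Zr(1,2,5) sum.distrib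
   by (simp add: ring_distribs)
  show "0 = Z h1x*Z (A1 F) + Z h1y*Z (A2 F) + Z (B1 F) + (\<Sum>q<l. Z (C q F)*Z (w1 q)) + Z (D2 F)"
  proof -
   have "(\<Sum>q<l. Z (C q F)*Z (w1 q)) + (\<Sum>q<l. Z (N4 q)*Z (g q F)) = 0"
    unfolding sum.distrib[symmetric] t4'[symmetric] by simp
   then show ?thesis
    using t1' t3' t5' unfolding ZA1 ZA2 ZB1 D2_def Zr(1,2,5)
    by (simp add: ring_distribs add_divide_distrib diff_divide_distrib)
  qed
 qed
 show ?thesis
  by (rule exI[of _ D1], rule exI[of _ D2], rule exI[of _ A1], rule exI[of _ A2], rule exI[of _ B0],
    rule exI[of _ B1], rule exI[of _ C], intro conjI)
   (use blD nD1 nD2 PB01 PC main in blast)+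
qed

subsection \<open>The infinitesimal versality theorem with parameters\<close>

definition base :: "(pnt) => pnt" where
 "base z = (%i. if i < 2 then z i else 0)"

lemma base_simps [simp]: "base z 0 = z 0" "base z (Suc 0) = z (Suc 0)" "base z 1 = z 1"
 "2 <= i ==> base z i = 0" "base (base z) = base z" "base (%_. 0) = (%_. 0)"
 by (auto simp: base_def)

lemma base_upd: "j < 2 ==> base (z(j:=t)) = (base z)(j:=t)"
 by (auto simp: base_def)

lemma germ_depends:
 fixes f :: "fnc"
 assumes "germ n f"
 shows "\<forall>\<^sub>F z in nbf n. ALL z'. (ALL i<n. z' i = z i) --> f z' = f z"
proof -
 obtain r c where r: "r > 0" "rep n r f c" using assms germ_imp_rep by blast
 have "f z' = f z" if "ALL i<n. abs(z i) < r" "ALL i<n. z' i = z i" for z z'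
  using r(2) that unfolding rep_def by (simp add: ev_cong[of n "%i. z' i / r" "%i. z i / r"])
 then show ?thesis unfolding ev_nbf using r(1) by blast
qed

text \<open>Hadamard's lemma in the parameters: they are set to zero one by one, the last one first,
  and each contributes its quotient.\<close>

lemma germ_param_division:
 fixes f :: "fnc"
 assumes f: "germ n f" and n: "2 <= n" and b: "\<forall>\<^sub>F z in nbf n. f (base z) = 0"
 shows "EX q. (ALL i. germ n (q i)) & (\<forall>\<^sub>F z in nbf n. f z = (\<Sum>i=2..<n. z i*q i z))"
proof -
 define zk where "zk p z = (%i. if p <= i then 0 else z i)" for p :: nat and z :: "pnt"
 have "EX q. (ALL i. germ n (q i)) & (\<forall>\<^sub>F z in nbf n. f z = f (zk 2 z) + (\<Sum>i=2..<n. z i*q i z))"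
  using n
 proof (induction rule: inc_induct)
  case base
  have "\<forall>\<^sub>F z in nbf n. f z = f (zk n z) + (\<Sum>i=n..<n. z i*(%_ _. 0) i z)"
   using germ_depends[OF f]
  proof eventually_elim
   case (elim z)
   have "f (zk n z) = f z" by (rule elim[THEN spec[of _ "zk n z"], THEN mp]) (simp add: zk_def)
   then show ?case by simp
  qed
  then show ?case by (intro exI[of _ "%_ _. 0"]) auto
 next
  case (step p)
  then obtain q where q: "!!i. germ n (q i)"
   "\<forall>\<^sub>F z in nbf n. f z = f (zk (Suc p) z) + (\<Sum>i=Suc p..<n. z i*q i z)" by blast
  have "germ n (%z. f (%i. zk (Suc p) z i))"
  proof (rule germ_compose[OF f])
   show "germ n (%z. zk (Suc p) z i)" if "i < n" for i
    unfolding zk_def using that by (cases "Suc p <= i") auto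
  qed (simp add: zk_def)
  then obtain g where g: "germ n g"
   "\<forall>\<^sub>F z in nbf n. f (zk (Suc p) z) = f (zk (Suc p) (z(p:=0))) + z p*g z"
   using germ_division[of n "%z. f (zk (Suc p) z)" p] step by auto
  have zk: "zk (Suc p) (z(p:=0)) = zk p z" for z
   by (auto simp: zk_def fun_eq_iff not_less_eq_eq le_less_Suc_eq)
  have s: "(\<Sum>i=p..<n. z i*(q(p:=g)) i z) = z p*g z + (\<Sum>i=Suc p..<n. z i*q i z)" for z
   using step by (simp add: sum.atLeast_Suc_lessThan)
  have "\<forall>\<^sub>F z in nbf n. f z = f (zk p z) + (\<Sum>i=p..<n. z i*(q(p:=g)) i z)"
   using q(2) g(2) by eventually_elim (simp only: s zk)
  then show ?case using q(1) g(1) by (intro exI[of _ "q(p:=g)"]) auto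
 qed
 then obtain q where q: "!!i. germ n (q i)"
  "\<forall>\<^sub>F z in nbf n. f z = f (zk 2 z) + (\<Sum>i=2..<n. z i*q i z)" by blast
 have zkb: "zk 2 z = base z" for z by (auto simp: zk_def base_def)
 have "\<forall>\<^sub>F z in nbf n. f z = (\<Sum>i=2..<n. z i*q i z)"
  using q(2) b by eventually_elim (simp add: zkb)
 with q(1) show ?thesis by blast
qed

text \<open>Expansion with separate radii \<open>r\<close> for the two source variables and \<open>\<tau>\<close> for the parameters, as an
 element that tolerates two further variables.\<close>

definition rep2 :: "nat => real => real => (fnc) => mps => bool" where
 "rep2 n r ta f c \<longleftrightarrow> (ALL z w. (ALL i<n. abs(z i) < (if i < 2 then r else ta)) --> (ALL i<n + 2. abs(w i) <= 1) -->
   (ALL i<n. w i = z i / (if i < 2 then r else ta)) --> f z = ev (n + 2) w c)"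

lemma rep2I:
 assumes "rep n r f c" "0 < ta" "ta <= r"
 shows "EX c'. rep2 n r ta f c' & norm c' <= norm c"
proof -
 let ?G = "%i. if i < 2 then Xv i else (ta / r) *\<^sub>R Xv i"
 have G: "!!i. norm (?G i) <= 1" using assms by simp
 have "rep2 n r ta f (ev n ?G c)"
  unfolding rep2_def
 proof (intro allI impI)
  fix z w assume z: "ALL i<n. abs(z i) < (if i < 2 then r else ta)" and w: "ALL i<n + 2. abs(w i) <= 1"
   and wz: "ALL i<n. w i = z i / (if i < 2 then r else ta)"
  have zr: "ALL i<n. abs(z i) < r" using z assms by (force split: if_splits)
  have wn: "norm (w i) <= 1" if "i < n + 2" for i using w that by simp
  have sc: "ev (n + 2) w (k *\<^sub>R u) = k*ev (n + 2) w u" for k u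
   using wn by (simp only: ev_scaleR real_scaleR_def)
  have "ev (n + 2) w (ev n ?G c) = ev n (%i. ev (n + 2) w (?G i)) c"
   by (rule ev_ev) (use wn G in auto)
  also have "\<dots> = ev n (%i. z i / r) c"
   by (rule ev_cong) (use wz assms in \<open>auto simp: sc simp del: add_2_eq_Suc add_2_eq_Suc'\<close>)
  finally show "f z = ev (n + 2) w (ev n ?G c)" using assms(1) zr by (simp add: rep_def)
 qed
 moreover have "norm (ev n ?G c) <= norm c" by (rule norm_ev_le) (use G in auto)
 ultimately show ?thesis by blast
qed

text \<open>The order of the quantifiers matters. The source radius \<open>r\<close> is fixed first;
  then \<open>ta\<close> is chosen against a bound \<open>ep\<close> that may depend on
  \<open>r\<close>, since \<open>reduce_component\<close> asks for errors below a high power of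
  \<open>r\<close>.\<close>

lemma rep2_small:
 fixes f :: "fnc"
 assumes "germ n f" "2 <= n" "\<forall>\<^sub>F z in nbf n. f (base z) = 0"
 shows "\<forall>\<^sub>F r in at_right 0. ALL ep>0. \<forall>\<^sub>F ta in at_right 0. EX c. rep2 n r ta f c & norm c <= ep"
proof -
 obtain q where q: "!!i. germ n (q i)" "\<forall>\<^sub>F z in nbf n. f z = (\<Sum>i=2..<n. z i*q i z)"
  using germ_param_division[OF assms] by blast
 obtain R where R: "R > 0" "!!z. ALL i<n. abs(z i) < R ==> f z = (\<Sum>i=2..<n. z i*q i z)"
  using q(2) unfolding ev_nbf by blast
 have "\<forall>\<^sub>F r in at_right 0. r < R" using R(1) unfolding eventually_at_right_field by blast
 moreover have "\<forall>\<^sub>F r in at_right 0. ALL i:{..<n}. EX c. rep n r (q i) c"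
  using q(1) by (intro eventually_ball_finite) (auto simp: germ_iff_rep)
 ultimately show ?thesis using eventually_at_right_pos
 proof eventually_elim
  case (elim r)
  from elim(2) obtain c where c: "!!i. i < n ==> rep n r (q i) (c i)" by (metis lessThan_iff)
  define b where "b = (\<Sum>i=2..<n. norm (c i))"
  have b: "0 <= b" by (auto simp: b_def intro: sum_nonneg)
  show ?case
  proof (intro allI impI)
   fix ep :: real assume "ep > 0"
   have "\<forall>\<^sub>F ta in at_right 0. ta < min r (ep / (b + 1))"
    unfolding eventually_at_right_field
    by (rule exI[of _ "min r (ep / (b + 1))"]) (use \<open>ep > 0\<close> b elim in auto)
   then show "\<forall>\<^sub>F ta in at_right 0. EX c. rep2 n r ta f c & norm c <= ep"
    using eventually_at_right_pos
   proof eventually_elim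
    case (elim ta)
    have ta: "0 < ta" "ta < r" "ta*(b + 1) < ep" using elim b by (auto simp: field_simps)
    have "ALL i. EX c'. i < n --> rep2 n r ta (q i) c' & norm c' <= norm (c i)"
     using rep2I[OF c ta(1)] ta(2) by (meson less_imp_le)
    then obtain d where d: "!!i. i < n ==> rep2 n r ta (q i) (d i) & norm (d i) <= norm (c i)" by metis
    define C where "C = (\<Sum>i=2..<n. ta *\<^sub>R (Xv i*d i))"
    have "rep2 n r ta f C"
     unfolding rep2_def
    proof (intro allI impI)
     fix z w assume z: "ALL i<n. abs(z i) < (if i < 2 then r else ta)" and w: "ALL i<n + 2. abs(w i) <= 1"
      and wz: "ALL i<n. w i = z i / (if i < 2 then r else ta)"
     have wn: "norm (w i) <= 1" if "i < n + 2" for i using w that by simp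
     have "ev (n + 2) w C = (\<Sum>i=2..<n. ta*(ev (n + 2) w (Xv i)*ev (n + 2) w (d i)))"
      unfolding C_def using wn by (simp only: ev_sum ev_scaleR ev_mult real_scaleR_def)
     also have "\<dots> = (\<Sum>i=2..<n. z i*q i z)"
     proof (rule sum.cong[OF refl])
      fix i assume i: "i \<in> {2..<n}"
      then have "ev (n + 2) w (d i) = q i z" using d[of i] z w wz unfolding rep2_def by simp
      moreover have "ev (n + 2) w (Xv i) = z i / ta" using i wz by simp
      ultimately show "ta*(ev (n + 2) w (Xv i)*ev (n + 2) w (d i)) = z i*q i z" using ta by simp
     qed
     also have "\<dots> = f z"
      by (rule R(2)[symmetric]) (use z ta \<open>r < R\<close> in \<open>fastforce split: if_splits\<close>)
     finally show "f z = ev (n + 2) w C" by simp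
    qed
    moreover have "norm C <= ep"
    proof -
     have "norm C <= (\<Sum>i=2..<n. ta*norm (c i))"
      unfolding C_def
     proof (rule sum_norm_le)
      fix i assume "i \<in> {2..<n}"
      then have "norm (Xv i*d i) <= 1*norm (c i)" using d[of i] by (intro norm_mult_le) auto
      then show "norm (ta *\<^sub>R (Xv i*d i)) <= ta*norm (c i)" using ta by simp
     qed
     also have "\<dots> = ta*b" by (simp add: b_def sum_distrib_left)
     finally show ?thesis using ta by (simp add: algebra_simps)
    qed
    ultimately show ?case by blast
   qed
  qed
 qed
qed

definition I22v :: "nat => nat => nat => fnc" where
 "I22v l m i z = (if i = 0 then (z 0)\<^sup>2 + z 1 ^ (2*l + 1) else (z 1)\<^sup>2 + z 0 ^ (2*m + 1))"

text \<open>The parameter directions: \<open>y, y^3, ..., y^(2l-1)\<close> in the first component,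
  counted first, then \<open>x, x^3, ..., x^(2m-1)\<close> in the second. Together with the extended
  tangent space of \<open>I22v\<close> they span all germs.\<close>

definition I22vel :: "nat => nat => nat => fnc" where
 "I22vel l q i z = (if i = 0 & q < l then z 1 ^ (2*q + 1)
   else if i = 1 & \<not> q < l then z 0 ^ (2*(q - l) + 1) else 0)"

lemma pd_I22v:
 "pd 0 (I22v l m 0) z = 2*z 0" "pd 0 (I22v l m 1) z = real (2*m + 1)*z 0 ^ (2*m)"
 "pd 1 (I22v l m 0) z = real (2*l + 1)*z 1 ^ (2*l)" "pd 1 (I22v l m 1) z = 2*z 1"
proof -
 have p: "((%t::real. t ^ (2 * k + 1)) hrd real (2 * k + 1)*t ^ (2 * k)) (at t)" for k t
  using DERIV_pow[of "2 * k + 1" t] by simp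
 have s: "((%t::real. t^2) hrd 2*t) (at t)" for t
  using DERIV_pow[of 2 t] by simp
 show "pd 0 (I22v l m 0) z = 2*z 0" "pd 0 (I22v l m 1) z = real (2*m + 1)*z 0 ^ (2*m)"
  "pd 1 (I22v l m 0) z = real (2*l + 1)*z 1 ^ (2*l)" "pd 1 (I22v l m 1) z = 2*z 1"
  using DERIV_add[OF s[of "z 0"] DERIV_const] DERIV_add[OF DERIV_const p[of m "z 0"]]
   DERIV_add[OF DERIV_const p[of l "z 1"]] DERIV_add[OF s[of "z 1"] DERIV_const]
  by (intro pd_eqI; simp add: I22v_def del: power_Suc)+
qed

lemma germ_I22:
 assumes "2 <= n"
 shows "germ n (I22v l m i)" "germ n (I22vel l q i)"
proof -
 have g: "germ n (%z. z 0)" "germ n (%z. z 1)" using assms by (auto intro: germ_var)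
 show "germ n (I22v l m i)"
  unfolding I22v_def[abs_def]
  by (cases "i = 0") (auto intro!: germ_add germ_power g[unfolded One_nat_def])
 show "germ n (I22vel l q i)"
  unfolding I22vel_def[abs_def]
  by (cases "i = 0 & q < l"; cases "i = 1 & \<not> q < l") (auto intro!: germ_power g[unfolded One_nat_def]
   simp del: power_Suc)
qed

lemma pd_base:
 assumes "j < 2"
 shows "pd j f (base z) = pd j (%z. f (base z)) z"
proof -
 have "base z j = z j" using assms by (simp add: base_def)
 then show ?thesis using assms by (simp add: pd_def base_upd)
qed

lemma base_vanish_pd:
 assumes "\<forall>\<^sub>F z in nbf n. f (base z) = g z" "j < 2"
 shows "\<forall>\<^sub>F z in nbf n. pd j f (base z) = pd j g z"
 using pd_cong[OF assms(1), of j] by (simp add: pd_base[OF assms(2)])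

text \<open>A preparation theorem for this germ with explicit bounds.
  \<open>reduce_component\<close> is applied to both components, the second time with the roles of
  the two variables exchanged, and the errors of both applications form an operator \<open>D\<close>
  of norm at most 1/2. Decomposing the solution \<open>F\<close> of \<open>F = f + D F\<close>
  instead of \<open>f\<close> itself leaves exactly \<open>f\<close>.\<close>

theorem linear_lemma:
 fixes H f :: "nat => fnc" and v :: "nat => nat => fnc"
 assumes n: "2 <= n" and lm: "1 <= l" "1 <= m"
  and H: "!!i. i < 2 ==> germ n (H i)" and f: "!!i. i < 2 ==> germ n (f i)"
  and v: "!!q i. q < l + m ==> i < 2 ==> germ n (v q i)"
  and Hb: "!!i. i < 2 ==> \<forall>\<^sub>F z in nbf n. H i (base z) = I22v l m i z"
  and vb: "!!q i. q < l + m ==> i < 2 ==> \<forall>\<^sub>F z in nbf n. v q i (base z) = I22vel l q i z"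
 shows "EX xi et c. (ALL i<2. germ n (xi i) & germ n (et i)) & (ALL q<l + m. germ n (c q)) &
  (\<forall>\<^sub>F z in nbf n. ALL i<2. f i z = pd 0 (H i) z*xi 0 z + pd 1 (H i) z*xi 1 z
    + et i (z(0:=H 0 z, 1:=H 1 z)) + (\<Sum>q<l + m. c q (z(0:=0, 1:=0)) * v q i z))"
proof -
 \<comment> \<open>The deviations of \<open>H\<close>, of its first derivatives and of the
   velocities from their values at parameter zero. They vanish there, so \<open>rep2_small\<close>
   makes them small by shrinking the parameters alone.\<close>
 define S where "S k = (if k < 2 then (%z. H k z - I22v l m k z)
  else if k < 4 then (%z. pd 0 (H (k - 2)) z - pd 0 (I22v l m (k - 2)) z)
  else if k < 6 then (%z. pd 1 (H (k - 4)) z - pd 1 (I22v l m (k - 4)) z)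
  else (%z. v ((k - 6) div 2) ((k - 6) mod 2) z - I22vel l ((k - 6) div 2) ((k - 6) mod 2) z))" for k
 let ?N = "6 + 2*(l + m)"
 have n01: "0 < n" "1 < n" using n by auto
 have Sg: "germ n (S k)" if "k < ?N" for k
  using that H v n unfolding S_def
  by (auto intro!: germ_diff germ_I22 germ_chain(2) n01)
 have I_b: "I22v l m i (base z) = I22v l m i z" "I22vel l q i (base z) = I22vel l q i z"
  for i q z by (simp_all add: I22v_def I22vel_def)
 have I_p: "pd j (I22v l m i) (base z) = pd j (I22v l m i) z" if "j < 2" for i j z
  by (simp add: pd_base[OF that] I_b)
 have Sb: "\<forall>\<^sub>F z in nbf n. S k (base z) = 0" if "k < ?N" for k
 proof -
  consider "k < 2" | "\<not> k < 2" "k < 4" | "\<not> k < 4" "k < 6" | "\<not> k < 6" by linarith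
  then show ?thesis
  proof cases
   case 1
   then show ?thesis using Hb[of k] unfolding S_def by (simp add: I_b I_p)
  next
   case 2
   then show ?thesis using base_vanish_pd[OF Hb[of "k - 2"], of 0] unfolding S_def by (simp add: I_b I_p)
  next
   case 3
   then show ?thesis using base_vanish_pd[OF Hb[of "k - 4"], of 1] unfolding S_def by (simp add: I_b I_p)
  next
   case 4
   then have "(k - 6) div 2 < l + m" using that by simp
   then show ?thesis using vb[of "(k - 6) div 2" "(k - 6) mod 2"] 4 unfolding S_def by (simp add: I_b I_p)
  qed
 qed
 define K1 where "K1 = (real l + 5)*(64 ^ l*(6*real m + 2*real l + 72))"
 define K2 where "K2 = (real m + 5)*(64 ^ m*(6*real l + 2*real m + 72))"
 have K: "0 < K1" "0 < K2" unfolding K1_def K2_def by (intro mult_pos_pos add_nonneg_pos; simp)+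
 have "\<forall>\<^sub>F r in at_right 0. r < min (1 / (32*K1)) (1 / (32*K2))"
  unfolding eventually_at_right_field
  by (rule exI[of _ "min (1 / (32*K1)) (1 / (32*K2))"]) (use K in auto)
 moreover have "\<forall>\<^sub>F r in at_right 0. ALL k:{..<?N}. ALL ep>0. \<forall>\<^sub>F ta in at_right 0. EX c. rep2 n r ta (S k) c & norm c <= ep"
  using rep2_small[OF Sg n Sb] by (intro eventually_ball_finite) auto
 moreover have "\<forall>\<^sub>F r in at_right 0. ALL i:{..<2}. EX c. rep n r (f i) c"
  using f by (intro eventually_ball_finite) (auto simp: germ_iff_rep)
 ultimately have "\<forall>\<^sub>F r in at_right 0. r < min (1 / (32*K1)) (1 / (32*K2)) &
   (ALL k:{..<?N}. ALL ep>0. \<forall>\<^sub>F ta in at_right 0. EX c. rep2 n r ta (S k) c & norm c <= ep) &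
   (ALL i:{..<2}. EX c. rep n r (f i) c) & 0 < r"
  using eventually_at_right_pos by eventually_elim blast
 from eventually_happens[OF this] obtain r where r: "0 < r" "r < 1 / (32*K1)" "r < 1 / (32*K2)"
  and rS: "!!k ep. k < ?N ==> 0 < ep ==> \<forall>\<^sub>F ta in at_right 0. EX c. rep2 n r ta (S k) c & norm c <= ep"
  and rf: "!!i. i < 2 ==> EX c. rep n r (f i) c" by auto
 define ep where "ep = r ^ (2*l + 2*m + 4)"
 have ep: "0 < ep" using r by (simp add: ep_def)
 have "\<forall>\<^sub>F ta in at_right 0. ALL k:{..<?N}. EX c. rep2 n r ta (S k) c & norm c <= ep"
  using rS ep by (intro eventually_ball_finite) auto
 moreover have "\<forall>\<^sub>F ta in at_right 0. ta < r" using r(1) unfolding eventually_at_right_field by blast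
 ultimately have "\<forall>\<^sub>F ta in at_right 0. (ALL k:{..<?N}. EX c. rep2 n r ta (S k) c & norm c <= ep) & ta < r & 0 < ta"
  using eventually_at_right_pos by eventually_elim blast
 from eventually_happens[OF this] obtain ta where ta: "0 < ta" "ta < r"
  and "ALL k<?N. EX c. rep2 n r ta (S k) c & norm c <= ep" by auto
 then obtain cS where cS: "!!k. k < ?N ==> rep2 n r ta (S k) (cS k)" "!!k. k < ?N ==> norm (cS k) <= ep"
  by metis
 have "ALL i. EX c. i < 2 --> rep2 n r ta (f i) c" using rf rep2I ta by (meson less_imp_le)
 then obtain cf where cf: "!!i. i < 2 ==> rep2 n r ta (f i) (cf i)" by metis
 define rh where "rh = r^2 / 32"
 have rh: "0 < rh" using r by (simp add: rh_def)
 define x y where "x = r *\<^sub>R Xv 0" and "y = r *\<^sub>R Xv 1"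
 have ep': "r ^ (2*m + 2*l + 4) = ep" by (simp add: ep_def add.commute)
 have rK: "r*K1 <= 1/32" "r*K2 <= 1/32" using r K by (auto simp: field_simps)
 have d: "0 ~= (1::nat)" "0 ~= n" "0 ~= n + 1" "1 ~= n" "1 ~= n + 1" "n ~= n + 1"
  "1 ~= (0::nat)" "n + 1 ~= n" using n by auto
 have e6: "ALL q<l. norm (cS (6 + 2*q)) <= ep" "ALL q<l. norm (cS (6 + 2*q + 1)) <= ep"
  using cS(2) by auto
 have e7: "ALL q<m. norm (cS (6 + 2*(l + q) + 1)) <= ep" "ALL q<m. norm (cS (6 + 2*(l + q))) <= ep"
  using cS(2) by auto
 have e0: "norm (cS 0) <= ep" "norm (cS 1) <= ep" "norm (cS 2) <= ep" "norm (cS 3) <= ep"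
  "norm (cS 4) <= ep" "norm (cS 5) <= ep"
  using cS(2)[of 0] cS(2)[of 1] cS(2)[of 2] cS(2)[of 3] cS(2)[of 4] cS(2)[of 5] by auto
 note RC1 = reduce_component[of 0 1 n "n + 1" l m r "cS 0" "cS 1" "cS 2" "cS 3" "cS 4" "cS 5"
   "%q. cS (6 + 2*q)" "%q. cS (6 + 2*q + 1)", folded x_def y_def rh_def K1_def ep_def,
   OF d(1-6) lm r(1) rK(1) e0 e6]
 obtain D1 D2 A1 A2 B0 B1 C where all1: "bounded_linear D1 & bounded_linear D2 & (ALL F. norm (D1 F) <= 1/8*norm F & norm (D2 F) <= 1/8*norm F) & (ALL F j. j = 0 \<or> j = 1 --> Pop j (B0 F) = B0 F & Pop j (B1 F) = B1 F) & (ALL F j q. j = 0 \<or> j = 1 \<or> j = n \<or> j = n + 1 --> Pop j (C q F) = C q F) & (ALL F (Z :: mps => real). (ALL u v. Z (u + v) = Z u + Z v) --> (ALL u v. Z (u * v) = Z u*Z v) -->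
   (ALL k u. Z (k *\<^sub>R u) = k*Z u) --> Z 1 = 1 -->
   rh*Z (Xv n) = Z (x ^ 2 + y ^ (2*l + 1) + cS 0) -->
   rh*Z (Xv (n + 1)) = Z (y ^ 2 + x ^ (2*m + 1) + cS 1) -->
   Z F = Z (2 *\<^sub>R x + cS 2)*Z (A1 F) + Z (real (2*l + 1) *\<^sub>R y ^ (2*l) + cS 4)*Z (A2 F) + Z (B0 F)
     + (\<Sum>q<l. Z (C q F)*Z (y ^ (2*q + 1) + cS (6 + 2*q))) + Z (D1 F) &
   0 = Z (real (2*m + 1) *\<^sub>R x ^ (2*m) + cS 3)*Z (A1 F) + Z (2 *\<^sub>R y + cS 5)*Z (A2 F) + Z (B1 F)
     + (\<Sum>q<l. Z (C q F)*Z (cS (6 + 2*q + 1))) + Z (D2 F))"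
  using RC1 by (elim exE) (rule that)
 note bl1 = all1[THEN conjunct1] all1[THEN conjunct2, THEN conjunct1]
  and nD1 = all1[THEN conjunct2, THEN conjunct2, THEN conjunct1]
  and PB1 = all1[THEN conjunct2, THEN conjunct2, THEN conjunct2, THEN conjunct1]
  and PC1 = all1[THEN conjunct2, THEN conjunct2, THEN conjunct2, THEN conjunct2, THEN conjunct1]
  and main1 = all1[THEN conjunct2, THEN conjunct2, THEN conjunct2, THEN conjunct2, THEN conjunct2]
 note RC2 = reduce_component[of 1 0 "n + 1" n m l r "cS 1" "cS 0" "cS 5" "cS 4" "cS 3" "cS 2"
   "%q. cS (6 + 2*(l + q) + 1)" "%q. cS (6 + 2*(l + q))", folded x_def y_def rh_def K2_def, unfolded ep',
   OF d(7) d(5) d(4) d(3) d(2) d(8) lm(2,1) r(1) rK(2) e0(2) e0(1) e0(6) e0(5) e0(4) e0(3) e7]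
 obtain D1' D2' A1' A2' B0' B1' C' where all2: "bounded_linear D1' & bounded_linear D2' & (ALL F. norm (D1' F) <= 1/8*norm F & norm (D2' F) <= 1/8*norm F) & (ALL F j. j = 1 \<or> j = 0 --> Pop j (B0' F) = B0' F & Pop j (B1' F) = B1' F) & (ALL F j q. j = 1 \<or> j = 0 \<or> j = n + 1 \<or> j = n --> Pop j (C' q F) = C' q F) & (ALL F (Z :: mps => real). (ALL u v. Z (u + v) = Z u + Z v) --> (ALL u v. Z (u * v) = Z u*Z v) -->
   (ALL k u. Z (k *\<^sub>R u) = k*Z u) --> Z 1 = 1 -->
   rh*Z (Xv (n + 1)) = Z (y ^ 2 + x ^ (2*m + 1) + cS 1) -->
   rh*Z (Xv n) = Z (x ^ 2 + y ^ (2*l + 1) + cS 0) -->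
   Z F = Z (2 *\<^sub>R y + cS 5)*Z (A1' F) + Z (real (2*m + 1) *\<^sub>R x ^ (2*m) + cS 3)*Z (A2' F) + Z (B0' F)
     + (\<Sum>q<m. Z (C' q F)*Z (x ^ (2*q + 1) + cS (6 + 2*(l + q) + 1))) + Z (D1' F) &
   0 = Z (real (2*l + 1) *\<^sub>R y ^ (2*l) + cS 4)*Z (A1' F) + Z (2 *\<^sub>R x + cS 2)*Z (A2' F) + Z (B1' F)
     + (\<Sum>q<m. Z (C' q F)*Z (cS (6 + 2*(l + q)))) + Z (D2' F))"
  using RC2 by (elim exE) (rule that)
 note bl2 = all2[THEN conjunct1] all2[THEN conjunct2, THEN conjunct1]
  and nD2 = all2[THEN conjunct2, THEN conjunct2, THEN conjunct1]
  and PB2 = all2[THEN conjunct2, THEN conjunct2, THEN conjunct2, THEN conjunct1]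
  and PC2 = all2[THEN conjunct2, THEN conjunct2, THEN conjunct2, THEN conjunct2, THEN conjunct1]
  and main2 = all2[THEN conjunct2, THEN conjunct2, THEN conjunct2, THEN conjunct2, THEN conjunct2]
 define D where "D p = (D1 (fst p) + D2' (snd p), D2 (fst p) + D1' (snd p))" for p
 have "EX p. p = (cf 0, cf 1) + D p"
 proof (rule linear_fixpoint)
  show "bounded_linear D" unfolding D_def[abs_def]
   by (intro bounded_linear_Pair bounded_linear_add bounded_linear_compose[OF bl1(1)]
     bounded_linear_compose[OF bl1(2)] bounded_linear_compose[OF bl2(1)] bounded_linear_compose[OF bl2(2)]
     bounded_linear_fst bounded_linear_snd)
  fix p :: "mps \<times> mps"
  have "norm (D p) <= norm (D1 (fst p) + D2' (snd p)) + norm (D2 (fst p) + D1' (snd p))"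
   unfolding D_def by (rule norm_Pair_le)
  also have "\<dots> <= (norm (D1 (fst p)) + norm (D2' (snd p))) + (norm (D2 (fst p)) + norm (D1' (snd p)))"
   by (intro add_mono norm_triangle_ineq)
  also have "\<dots> <= 1/2*norm p"
   using nD1[rule_format, of "fst p"] nD2[rule_format, of "snd p"] norm_fst_le[of "fst p" "snd p"] norm_snd_le[of "snd p" "fst p"] by simp
  finally show "norm (D p) <= 1/2*norm p" .
 qed
 then obtain F0 F1 where F01: "F0 = cf 0 + (D1 F0 + D2' F1)" "F1 = cf 1 + (D2 F0 + D1' F1)"
  unfolding D_def by auto
 define w where "w z i = (if i < 2 then z i / r else if i < n then z i / ta else if i = n then H 0 z / rh else H 1 z / rh)" for z i
 define xi where "xi i z = ev (n + 2) (w z) (if i = 0 then A1 F0 + A2' F1 else A2 F0 + A1' F1)" for i :: nat and z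
 \<comment> \<open>\<open>et\<close> reads the target point from the coordinates 0 and 1 and feeds
   it to the variables \<open>n\<close> and \<open>n + 1\<close>. Series independent of the
   variables 0 and 1 thereby become functions of the target point and the parameters.\<close>
 define et where "et i z = ev (n + 2) (%k. if k < 2 then 0 else if k < n then z k / ta else if k = n then z 0 / rh else z 1 / rh)
   (if i = 0 then B0 F0 + B1' F1 else B1 F0 + B0' F1)" for i :: nat and z
 define c where "c q z = ev (n + 2) (%k. if 2 <= k & k < n then z k / ta else 0) (if q < l then C q F0 else C' (q - l) F1)" for q z
 have H0: "H i (%_. 0) = 0" if "i < 2" for i
  using ev_nbf_at_0[OF Hb[OF that]] by (simp add: I22v_def)
 have evg: "germ n (%z. ev (n + 2) (%k. g k z) u)"
  if "!!k. k < n + 2 ==> germ n (g k)" "!!k. k < n + 2 ==> g k (%_. 0) = 0"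
  for g :: "nat => fnc" and u
 proof -
  have "germ (n + 2) (%w. ev (n + 2) w u)"
   by (rule rep_imp_analytic_germ[of "n + 2" 1 _ u]) (auto simp: rep_def)
  from germ_compose[OF this that] show ?thesis .
 qed
 have germs: "germ n (xi i)" "germ n (et i)" "germ n (c q)" for i q
 proof -
  have ite: "germ n (%z. if b then g z else h z)" if "b ==> germ n g" "\<not> b ==> germ n h"
   for b and g h :: "fnc" using that by (cases b) auto
  show "germ n (xi i)" unfolding xi_def w_def
   by (rule evg) (use H H0 n in \<open>auto intro!: ite germ_divide_const germ_var\<close>)
  show "germ n (et i)" unfolding et_def
   by (rule evg) (use n01 in \<open>auto intro!: ite germ_divide_const germ_var\<close>)
  show "germ n (c q)" unfolding c_def
   by (rule evg) (auto intro!: ite germ_divide_const germ_var)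
 qed
 have "\<forall>\<^sub>F z in nbf n. ALL i<n. abs(z i) < ta" unfolding ev_nbf using ta by blast
 moreover have "\<forall>\<^sub>F z in nbf n. abs(H 0 z) < rh" "\<forall>\<^sub>F z in nbf n. abs(H 1 z) < rh"
  by (intro small_germ H H0 rh; simp)+
 ultimately have "\<forall>\<^sub>F z in nbf n. ALL i<2. f i z = pd 0 (H i) z*xi 0 z + pd 1 (H i) z*xi 1 z
    + et i (z(0:=H 0 z, 1:=H 1 z)) + (\<Sum>q<l + m. c q (z(0:=0, 1:=0)) * v q i z)"
 proof eventually_elim
  case (elim z)
  define Z where "Z = ev (n + 2) (w z)"
  have w1: "abs(w z i) <= 1" if "i < n + 2" for i
  proof -
   consider "i < 2" | "\<not> i < 2" "i < n" | "\<not> i < n" "\<not> i < 2" "i = n" | "\<not> i < n" "\<not> i < 2" "i ~= n" by blast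
   then show ?thesis
   proof cases
    case 1
    then have "abs(z i) < ta" using elim(1) n by simp
    then have "abs(z i / r) <= 1" using ta by (intro abs_divide_le_1) simp
    then show ?thesis using 1 unfolding w_def by (simp only: if_True)
   next
    case 2
    then have "abs(z i / ta) <= 1" using elim(1) by (intro abs_divide_le_1) simp
    then show ?thesis using 2 unfolding w_def by (simp only: if_True if_False)
   next
    case 3
    then show ?thesis using abs_divide_le_1[OF elim(2)] unfolding w_def by (simp only: if_True if_False refl)
   next
    case 4
    then show ?thesis using abs_divide_le_1[OF elim(3)] unfolding w_def by (simp only: if_False)
   qed
  qed
  have wn: "norm (w z i) <= 1" if "i < n + 2" for i using w1[OF that] by simp
  have Zh: "ALL u v. Z (u + v) = Z u + Z v" "ALL u v. Z (u * v) = Z u*Z v" "ALL k u. Z (k *\<^sub>R u) = k*Z u" "Z 1 = 1"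
   unfolding Z_def using wn by (simp_all only: ev_add ev_mult ev_scaleR ev_1 real_scaleR_def simp_thms)
  have Zpow: "Z (u ^ k) = Z u ^ k" for u k by (induction k) (auto simp: Zh)
  have zlt: "ALL i<n. abs(z i) < (if i < 2 then r else ta)" using elim(1) ta by force
  have Zrep: "Z u = g z" if "rep2 n r ta g u" for g u
  proof -
   have "g z = ev (n + 2) (w z) u"
   proof (rule that[unfolded rep2_def, rule_format])
    show "abs(z i) < (if i < 2 then r else ta)" if "i < n" for i using zlt that by blast
    show "w z i = z i / (if i < 2 then r else ta)" if "i < n" for i using that by (simp add: w_def)
   qed (rule w1)
   then show ?thesis by (simp add: Z_def)
  qed
  have Zxy: "Z x = z 0" "Z y = z 1" using r n01 by (auto simp: x_def y_def Zh Z_def[symmetric]) (auto simp: Z_def w_def)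
  have ZX: "rh*Z (Xv n) = H 0 z" "rh*Z (Xv (n + 1)) = H 1 z"
   using n rh unfolding Z_def by (simp_all add: w_def)
  have ZS: "Z (cS k) = S k z" if "k < ?N" for k by (rule Zrep[OF cS(1)[OF that]])
  have S012: "S 0 z = H 0 z - I22v l m 0 z" "S 1 z = H 1 z - I22v l m 1 z"
   "S 2 z = pd 0 (H 0) z - pd 0 (I22v l m 0) z" "S 3 z = pd 0 (H 1) z - pd 0 (I22v l m 1) z"
   "S 4 z = pd 1 (H 0) z - pd 1 (I22v l m 0) z" "S 5 z = pd 1 (H 1) z - pd 1 (I22v l m 1) z"
   by (simp_all add: S_def)
  have Zh0: "Z (x ^ 2 + y ^ (2*l + 1) + cS 0) = H 0 z" "Z (y ^ 2 + x ^ (2*m + 1) + cS 1) = H 1 z"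
   using ZS[of 0] ZS[of 1] S012(1,2) by (simp_all add: Zh Zpow Zxy I22v_def)
  have Zhd: "Z (2 *\<^sub>R x + cS 2) = pd 0 (H 0) z" "Z (real (2*m + 1) *\<^sub>R x ^ (2*m) + cS 3) = pd 0 (H 1) z"
   "Z (real (2*l + 1) *\<^sub>R y ^ (2*l) + cS 4) = pd 1 (H 0) z" "Z (2 *\<^sub>R y + cS 5) = pd 1 (H 1) z"
   using ZS[of 2] ZS[of 3] ZS[of 4] ZS[of 5] S012(3-6) by (simp_all only: Zh Zpow Zxy pd_I22v)
  have Sv: "S (6 + 2*q) z = v q 0 z - I22vel l q 0 z" "S (6 + 2*q + 1) z = v q 1 z - I22vel l q 1 z" for q
   by (simp_all add: S_def)
  have Zv1: "Z (y ^ (2*q + 1) + cS (6 + 2*q)) = v q 0 z" "Z (cS (6 + 2*q + 1)) = v q 1 z" if "q < l" for q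
   using ZS[of "6 + 2*q"] ZS[of "6 + 2*q + 1"] Sv[of q] that by (simp_all add: Zh Zpow Zxy I22vel_def)
  have Zv2: "Z (x ^ (2*q + 1) + cS (6 + 2*(l + q) + 1)) = v (l + q) 1 z" "Z (cS (6 + 2*(l + q))) = v (l + q) 0 z" if "q < m" for q
   using ZS[of "6 + 2*(l + q)"] ZS[of "6 + 2*(l + q) + 1"] Sv[of "l + q"] that by (simp_all add: Zh Zpow Zxy I22vel_def)
  have pu: "rh*Z (Xv n) = Z (x ^ 2 + y ^ (2*l + 1) + cS 0)"
   and pv: "rh*Z (Xv (n + 1)) = Z (y ^ 2 + x ^ (2*m + 1) + cS 1)" by (simp_all only: ZX Zh0)
  have s1: "(\<Sum>q<l. Z (C q F0)*Z (y ^ (2*q + 1) + cS (6 + 2*q))) = (\<Sum>q<l. Z (C q F0) * v q 0 z)"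
   "(\<Sum>q<l. Z (C q F0)*Z (cS (6 + 2*q + 1))) = (\<Sum>q<l. Z (C q F0) * v q 1 z)"
   by (rule sum.cong; simp only: Zv1 lessThan_iff)+
  have s2: "(\<Sum>q<m. Z (C' q F1)*Z (x ^ (2*q + 1) + cS (6 + 2*(l + q) + 1))) = (\<Sum>q<m. Z (C' q F1) * v (l + q) 1 z)"
   "(\<Sum>q<m. Z (C' q F1)*Z (cS (6 + 2*(l + q)))) = (\<Sum>q<m. Z (C' q F1) * v (l + q) 0 z)"
   by (rule sum.cong; simp only: Zv2 lessThan_iff)+
  note X1 = main1[THEN spec, THEN spec, THEN mp, THEN mp, THEN mp, THEN mp, THEN mp, THEN mp, OF Zh pu pv, of F0]
  have m1: "Z F0 = pd 0 (H 0) z*Z (A1 F0) + pd 1 (H 0) z*Z (A2 F0) + Z (B0 F0)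
     + (\<Sum>q<l. Z (C q F0) * v q 0 z) + Z (D1 F0)"
    "0 = pd 0 (H 1) z*Z (A1 F0) + pd 1 (H 1) z*Z (A2 F0) + Z (B1 F0)
     + (\<Sum>q<l. Z (C q F0) * v q 1 z) + Z (D2 F0)"
   by (rule X1[THEN conjunct1, unfolded Zhd s1], rule X1[THEN conjunct2, unfolded Zhd s1])
  note X2 = main2[THEN spec, THEN spec, THEN mp, THEN mp, THEN mp, THEN mp, THEN mp, THEN mp, OF Zh pv pu, of F1]
  have m2: "Z F1 = pd 1 (H 1) z*Z (A1' F1) + pd 0 (H 1) z*Z (A2' F1) + Z (B0' F1)
     + (\<Sum>q<m. Z (C' q F1) * v (l + q) 1 z) + Z (D1' F1)"
    "0 = pd 1 (H 0) z*Z (A1' F1) + pd 0 (H 0) z*Z (A2' F1) + Z (B1' F1)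
     + (\<Sum>q<m. Z (C' q F1) * v (l + q) 0 z) + Z (D2' F1)"
   by (rule X2[THEN conjunct1, unfolded Zhd s2], rule X2[THEN conjunct2, unfolded Zhd s2])
  have ZF: "Z F0 = f 0 z + (Z (D1 F0) + Z (D2' F1))" "Z F1 = f 1 z + (Z (D2 F0) + Z (D1' F1))"
   using arg_cong[OF F01(1), of Z] arg_cong[OF F01(2), of Z] Zrep[OF cf] by (simp_all add: Zh)
  have xiz: "xi 0 z = Z (A1 F0) + Z (A2' F1)" "xi 1 z = Z (A2 F0) + Z (A1' F1)"
   by (simp_all only: xi_def Z_def[symmetric] Zh refl if_True one_neq_zero if_False)
  have ZP: "Z (Pop j u) = ev (n + 2) ((w z)(j:=0)) u" if "j < n + 2" for j u
   unfolding Z_def by (rule ev_Pop) (use wn that in auto)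
  have ev0: "ev (n + 2) ((w z)(0:=0, 1:=0)) u = Z u" if "Pop 0 u = u" "Pop 1 u = u" for u
  proof -
   have "ev (n + 2) ((w z)(0:=0)) (Pop 1 u) = ev (n + 2) ((w z)(0:=0, 1:=0)) u"
    by (rule ev_Pop) (use wn n in auto)
   then show ?thesis using ZP[of 0 u] that n by simp
  qed
  have ev00: "ev (n + 2) ((w z)(0:=0, 1:=0, n:=0, n + 1:=0)) u = Z u"
   if "Pop 0 u = u" "Pop 1 u = u" "Pop n u = u" "Pop (n + 1) u = u" for u
  proof -
   have "ev (n + 2) ((w z)(0:=0, 1:=0, n:=0)) (Pop (n + 1) u) = ev (n + 2) ((w z)(0:=0, 1:=0, n:=0, n + 1:=0)) u"
    "ev (n + 2) ((w z)(0:=0, 1:=0)) (Pop n u) = ev (n + 2) ((w z)(0:=0, 1:=0, n:=0)) u"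
    by (rule ev_Pop; use wn n in auto)+
   then show ?thesis using ev0 that by simp
  qed
  have etz: "et 0 (z(0:=H 0 z, 1:=H 1 z)) = Z (B0 F0) + Z (B1' F1)"
   "et 1 (z(0:=H 0 z, 1:=H 1 z)) = Z (B1 F0) + Z (B0' F1)"
  proof -
   have "et i (z(0:=H 0 z, 1:=H 1 z)) = ev (n + 2) ((w z)(0:=0, 1:=0)) (if i = 0 then B0 F0 + B1' F1 else B1 F0 + B0' F1)" for i
    unfolding et_def by (rule ev_cong) (use n in \<open>auto simp: w_def\<close>)
   moreover have "Pop j (B0 F0 + B1' F1) = B0 F0 + B1' F1" "Pop j (B1 F0 + B0' F1) = B1 F0 + B0' F1" if "j = 0 \<or> j = 1" for j
    using PB1[rule_format, of j] PB2[rule_format, of j] that by (auto simp: Pop_simps)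
   ultimately show "et 0 (z(0:=H 0 z, 1:=H 1 z)) = Z (B0 F0) + Z (B1' F1)"
    "et 1 (z(0:=H 0 z, 1:=H 1 z)) = Z (B1 F0) + Z (B0' F1)"
    using ev0 by (simp_all add: Zh)
  qed
  have cz: "c q (z(0:=0, 1:=0)) = (if q < l then Z (C q F0) else Z (C' (q - l) F1))" for q
  proof -
   have "c q (z(0:=0, 1:=0)) = ev (n + 2) ((w z)(0:=0, 1:=0, n:=0, n + 1:=0)) (if q < l then C q F0 else C' (q - l) F1)"
    unfolding c_def by (rule ev_cong) (auto simp: w_def)
   then show ?thesis using ev00 PC1 PC2 by auto
  qed
  have sumc: "(\<Sum>q<l + m. c q (z(0:=0, 1:=0)) * v q i z)
    = (\<Sum>q<l. Z (C q F0) * v q i z) + (\<Sum>q<m. Z (C' q F1) * v (l + q) i z)" for i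
  proof -
   have "(\<Sum>q<l + m. g q) = (\<Sum>q<l. g q) + (\<Sum>q<m. g (l + q))" for g :: "pnt"
    by (induction m) auto
   from this[of "%q. c q (z(0:=0, 1:=0)) * v q i z"] show ?thesis
    by (simp add: cz[unfolded One_nat_def] cong: sum.cong_simp)
  qed
  show ?case
  proof (intro allI impI)
   fix i :: nat assume "i < 2"
   then consider "i = 0" | "i = 1" by linarith
   then show "f i z = pd 0 (H i) z*xi 0 z + pd 1 (H i) z*xi 1 z
     + et i (z(0:=H 0 z, 1:=H 1 z)) + (\<Sum>q<l + m. c q (z(0:=0, 1:=0)) * v q i z)"
   proof cases
    case 1
    show ?thesis unfolding 1 sumc xiz etz using m1(1) m2(2) ZF(1) by (simp add: ring_distribs)
   next
    case 2
    show ?thesis unfolding 2 sumc xiz etz using m1(2) m2(1) ZF(2) by (simp add: ring_distribs)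
   qed
  qed
 qed
 with germs show ?thesis by blast
qed

subsection \<open>Versality\<close>

text \<open>The parameter derivatives of the harmonic unfolding are known on the axes only, hence
  they agree with the odd powers only up to multiples of \<open>x y\<close>. Subtracting suitable
  multiples of the two source derivatives of \<open>H\<close> makes them agree exactly at parameter
  zero, and the subtracted fields are moved into \<open>xi\<close>.\<close>

lemma linear_lemma_axes:
 fixes H f :: "nat => fnc" and v R :: "nat => nat => fnc"
 assumes n: "2 <= n" and lm: "1 <= l" "1 <= m"
  and H: "!!i. i < 2 ==> germ n (H i)" and f: "!!i. i < 2 ==> germ n (f i)"
  and v: "!!q i. q < l + m ==> i < 2 ==> germ n (v q i)"
  and R: "!!q i. q < l + m ==> i < 2 ==> germ n (R q i)"
  and Hb: "!!i. i < 2 ==> \<forall>\<^sub>F z in nbf n. H i (base z) = I22v l m i z"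
  and vb: "!!q i. q < l + m ==> i < 2 ==>
   \<forall>\<^sub>F z in nbf n. v q i (base z) = I22vel l q i z + z 0*z 1*R q i (base z)"
 shows "EX xi et c. (ALL i<2. germ n (xi i) & germ n (et i)) & (ALL q<l + m. germ n (c q)) &
  (\<forall>\<^sub>F z in nbf n. ALL i<2. f i z = pd 0 (H i) z*xi 0 z + pd 1 (H i) z*xi 1 z
    + et i (z(0:=H 0 z, 1:=H 1 z)) + (\<Sum>q<l + m. c q (z(0:=0, 1:=0)) * v q i z))"
proof -
 have n01: "0 < n" "1 < n" using n by auto
 define a b :: real where "a = real (2*l + 1)" and "b = real (2*m + 1)"
 \<comment> \<open>\<open>xy R\<close> lies in the tangent space of the germ \<open>I\<^sub>2\<^sub>,\<^sub>2\<close>: solve a linear system with unit determinant\<close>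
 define Dt where "Dt z = inverse (4 - a*b*(z 0 ^ (2*m - 1)*z 1 ^ (2*l - 1)))" for z :: "pnt"
 define al where "al q z = (2*R q 0 z - a*z 1 ^ (2*l - 1)*R q 1 z)*Dt z" for q z
 define be where "be q z = (2*R q 1 z - b*z 0 ^ (2*m - 1)*R q 0 z)*Dt z" for q z
 have g01: "germ n (%z. z 0)" "germ n (%z. z 1)" using n01 by (auto intro: germ_var)
 have gDt: "germ n Dt" unfolding Dt_def[abs_def]
  by (intro germ_inverse germ_diff germ_mult germ_power germ_const g01)
   (use lm in \<open>simp add: power_0_left\<close>)
 have gal: "germ n (al q)" "germ n (be q)" if "q < l + m" for q
  unfolding al_def[abs_def] be_def[abs_def]
  by (intro germ_diff germ_mult germ_power germ_const g01 gDt R that; simp)+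
 have gpd: "germ n (pd 0 (H i))" "germ n (pd 1 (H i))" if "i < 2" for i
  using germ_chain(2)[OF H[OF that]] n01 by blast+
 define v' where "v' q i z = v q i z - pd 0 (H i) z*(z 1*al q z) - pd 1 (H i) z*(z 0*be q z)" for q i z
 have gv': "germ n (v' q i)" if "q < l + m" "i < 2" for q i
  unfolding v'_def[abs_def] by (intro germ_diff germ_mult v g01 gal gpd that)
 have evDt: "\<forall>\<^sub>F z in nbf n. abs(a*b*(z 0 ^ (2*m - 1)*z 1 ^ (2*l - 1))) < 1"
  by (rule small_germ) (use lm in \<open>auto intro!: germ_mult germ_power g01[unfolded One_nat_def] simp: power_0_left\<close>)
 have v'b: "\<forall>\<^sub>F z in nbf n. v' q i (base z) = I22vel l q i z" if "q < l + m" "i < 2" for q i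
  using vb[OF that] base_vanish_pd[OF Hb[OF that(2)], of 0, simplified] base_vanish_pd[OF Hb[OF that(2)], of 1, simplified] evDt
 proof eventually_elim
  case (elim z)
  define D where "D = 4 - a*b*(z 0 ^ (2*m - 1)*z 1 ^ (2*l - 1))"
  have D: "D ~= 0" using elim(4) by (auto simp: D_def)
  have Dt: "Dt (base z) = 1 / D" by (simp add: Dt_def D_def inverse_eq_divide)
  have pw: "z 0 ^ (2*m) = z 0*z 0 ^ (2*m - 1)" "z 1 ^ (2*l) = z 1*z 1 ^ (2*l - 1)"
   using lm by (simp_all flip: power_Suc)
  define X Y where "X = z 0 ^ (2*m - 1)" and "Y = z 1 ^ (2*l - 1)"
  have al: "al q (base z)*D = 2*R q 0 (base z) - a*Y*R q 1 (base z)"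
   "be q (base z)*D = 2*R q 1 (base z) - b*X*R q 0 (base z)"
   using D by (simp_all add: al_def be_def Dt X_def Y_def)
  have DXY: "D = 4 - a*b*(X*Y)" by (simp add: D_def X_def Y_def)
  have "(2*al q (base z) + a*Y*be q (base z))*D = 2*(al q (base z)*D) + a*Y*(be q (base z)*D)"
   by (simp add: algebra_simps)
  also have "\<dots> = R q 0 (base z)*D" unfolding al by (simp add: DXY algebra_simps)
  finally have e0: "2*al q (base z) + a*Y*be q (base z) = R q 0 (base z)" using D by simp
  have "(b*X*al q (base z) + 2*be q (base z))*D = b*X*(al q (base z)*D) + 2*(be q (base z)*D)"
   by (simp add: algebra_simps)
  also have "\<dots> = R q 1 (base z)*D" unfolding al by (simp add: DXY algebra_simps)
  finally have e1: "b*X*al q (base z) + 2*be q (base z) = R q 1 (base z)" using D by simp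
  consider "i = 0" | "i = 1" using \<open>i < 2\<close> by linarith
  then show ?case
  proof cases
   case 1
   have "pd 0 (H 0) (base z) = 2*z 0" "pd 1 (H 0) (base z) = a*(z 1*Y)"
    using elim(2,3) 1 pd_I22v[of l m z] pw by (auto simp: a_def Y_def)
   then show ?thesis using elim(1) unfolding 1 v'_def e0[symmetric] by (simp add: algebra_simps)
  next
   case 2
   have "pd 0 (H 1) (base z) = b*(z 0*X)" "pd 1 (H 1) (base z) = 2*z 1"
    using elim(2,3) 2 pd_I22v[of l m z] pw by (auto simp: b_def X_def)
   then show ?thesis using elim(1) unfolding 2 v'_def e1[symmetric] by (simp add: algebra_simps)
  qed
 qed
 have "EX xi et c. (ALL i<2. germ n (xi i) & germ n (et i)) & (ALL q<l + m. germ n (c q)) &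
  (\<forall>\<^sub>F z in nbf n. ALL i<2. f i z = pd 0 (H i) z*xi 0 z + pd 1 (H i) z*xi 1 z
    + et i (z(0:=H 0 z, 1:=H 1 z)) + (\<Sum>q<l + m. c q (z(0:=0, 1:=0)) * v' q i z))"
  by (rule linear_lemma[where H = H and f = f and v = v']; fact n lm H f gv' Hb v'b)
 then obtain xi et c where g: "!!i. i < (2::nat) ==> germ n (xi i)" "!!i. i < (2::nat) ==> germ n (et i)"
   "!!q. q < l + m ==> germ n (c q)"
  and eq: "\<forall>\<^sub>F z in nbf n. ALL i<2. f i z = pd 0 (H i) z*xi 0 z + pd 1 (H i) z*xi 1 z
    + et i (z(0:=H 0 z, 1:=H 1 z)) + (\<Sum>q<l + m. c q (z(0:=0, 1:=0)) * v' q i z)"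
  by blast
 define xi' where "xi' i z = xi i z - (\<Sum>q<l + m. c q (z(0:=0, 1:=0))*(if i = 0 then z 1*al q z else z 0*be q z))" for i :: nat and z
 have gc0: "germ n (%z. c q (z(0:=0, 1:=0)))" if "q < l + m" for q
 proof -
  have "germ n (%z. c q (%i. (%z. (z(0:=0, 1:=0)) i) z))"
  proof (rule germ_compose[OF g(3)[OF that]])
   show "germ n (%z. (z(0:=0, 1:=0)) i)" if "i < n" for i
    using that by (cases "i = 0"; cases "i = 1") (auto intro: germ_var)
  qed simp
  then show ?thesis .
 qed
 have gxi': "germ n (xi' i)" if "i < 2" for i
  unfolding xi'_def[abs_def]
  by (cases "i = 0") (auto intro!: germ_diff germ_sum germ_mult gc0[unfolded One_nat_def]
    g01[unfolded One_nat_def] gal g that)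
 have "\<forall>\<^sub>F z in nbf n. ALL i<2. f i z = pd 0 (H i) z*xi' 0 z + pd 1 (H i) z*xi' 1 z
    + et i (z(0:=H 0 z, 1:=H 1 z)) + (\<Sum>q<l + m. c q (z(0:=0, 1:=0)) * v q i z)"
  using eq
 proof eventually_elim
  case (elim z)
  show ?case
  proof (intro allI impI)
   fix i :: nat assume "i < 2"
   have "(\<Sum>q<l + m. c q (z(0:=0, 1:=0)) * v' q i z) = (\<Sum>q<l + m. c q (z(0:=0, 1:=0)) * v q i z)
     - pd 0 (H i) z*(\<Sum>q<l + m. c q (z(0:=0, 1:=0))*(z 1*al q z))
     - pd 1 (H i) z*(\<Sum>q<l + m. c q (z(0:=0, 1:=0))*(z 0*be q z))"
    unfolding v'_def sum_distrib_left sum_subtractf[symmetric] by (rule sum.cong) (auto simp: algebra_simps)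
   then show "f i z = pd 0 (H i) z*xi' 0 z + pd 1 (H i) z*xi' 1 z
     + et i (z(0:=H 0 z, 1:=H 1 z)) + (\<Sum>q<l + m. c q (z(0:=0, 1:=0)) * v q i z)"
    using elim \<open>i < 2\<close> unfolding xi'_def by (simp add: right_diff_distrib)
  qed
 qed
 then show ?thesis using g gxi' by blast
qed

text \<open>The factors \<open>z (N + j)\<close>, bounded by a small \<open>R\<close>, push the
  Lipschitz constant of the field so low that \<open>small_lipschitz_unique\<close> covers all of
  \<open>[0, 1]\<close> in one step.\<close>

lemma flow_unique:
 fixes Ph :: "nat => nat => fnc"
 assumes Ph: "!!j i. j < e ==> i < N ==> germ (N + e) (Ph j i)"
 shows "EX r>0. ALL z y y' t0. t0 \<in> {0..1} --> (ALL j<e. abs(z (N + j)) < r) -->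
  (ALL t:{0..1}. ALL i<N. abs(y t i) < r & abs(y' t i) < r &
   ((%s. y s i) hrd (\<Sum>j<e. z (N + j)*Ph j i (%k. if k < N then y t k else t*z k))) (at t within {0..1}) &
   ((%s. y' s i) hrd (\<Sum>j<e. z (N + j)*Ph j i (%k. if k < N then y' t k else t*z k))) (at t within {0..1})) -->
  (ALL i<N. y t0 i = y' t0 i) --> (ALL t:{0..1}. ALL i<N. y t i = y' t i)"
proof -
 define Q where "Q j i L r \<longleftrightarrow> 0 <= L & 0 < r & (ALL z z'. (ALL k<N + e. abs(z k) < r) -->
   (ALL k<N + e. abs(z' k) < r) --> abs(Ph j i z - Ph j i z') <= L*(\<Sum>k<N + e. abs(z k - z' k)))" for j i L r
 have "ALL j i. EX L r. j < e & i < N --> Q j i L r"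
  unfolding Q_def using germ_lipschitz[OF Ph] by meson
 then obtain L r where "!!j i. j < e ==> i < N ==> Q j i (L j i) (r j i)" by metis
 then have Lr: "!!j i. j < e ==> i < N ==> 0 <= L j i" "!!j i. j < e ==> i < N ==> 0 < r j i"
  "!!j i z z'. j < e ==> i < N ==> (ALL k<N + e. abs(z k) < r j i) ==> (ALL k<N + e. abs(z' k) < r j i) ==>
    abs(Ph j i z - Ph j i z') <= L j i*(\<Sum>k<N + e. abs(z k - z' k))" unfolding Q_def by blast+
 define M where "M = (\<Sum>p\<in>{..<e} \<times> {..<N}. L (fst p) (snd p))"
 have Mle: "L j i <= M" if "j < e" "i < N" for j i
  unfolding M_def using that Lr(1) member_le_sum[of "(j, i)" "{..<e} \<times> {..<N}" "%p. L (fst p) (snd p)"] by auto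
 have M0: "0 <= M" unfolding M_def using Lr(1) by (auto intro!: sum_nonneg)
 define rh where "rh = Min (insert 1 ((%p. r (fst p) (snd p)) ` ({..<e} \<times> {..<N})))"
 have rh0: "0 < rh" unfolding rh_def using Lr(2) by (subst Min_gr_iff) auto
 have rhr: "rh <= r j i" if "j < e" "i < N" for j i
  unfolding rh_def by (rule Min_le) (use that in force)+
 define R where "R = min rh (1 / (2*(real e*M*real N + 1)))"
 have eMN: "0 <= real e*M*real N" using M0 by simp
 have "0 < 2*(real e*M*real N + 1)" using add_nonneg_pos[OF eMN zero_less_one] by (rule mult_pos_pos[OF zero_less_numeral])
 then have R0: "0 < R" unfolding R_def using rh0 by (simp only: min_less_iff_conj zero_less_divide_1_iff simp_thms)
 have CR: "real e*R*M*real N < 1"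
 proof -
  have "R <= 1 / (2*(real e*M*real N + 1))" by (simp add: R_def)
  then have "(real e*M*real N)*R <= (real e*M*real N)*(1 / (2*(real e*M*real N + 1)))"
   using eMN by (intro mult_left_mono) auto
  also have "\<dots> < 1"
  proof -
   have "K*(1 / (2*(K + 1))) < 1" if "0 <= K" for K :: real using that by (simp add: divide_less_eq)
   from this[OF eMN] show ?thesis .
  qed
  finally show ?thesis by (simp add: mult_ac)
 qed
 show ?thesis
 proof (intro exI[of _ R] conjI R0 allI impI)
  fix z :: "pnt" and y y' :: "real => pnt" and t0 :: real
  assume t0: "t0 \<in> {0..1}" and z: "ALL j<e. abs(z (N + j)) < R"
   and D: "ALL t:{0..1}. ALL i<N. abs(y t i) < R & abs(y' t i) < R &
   ((%s. y s i) hrd (\<Sum>j<e. z (N + j)*Ph j i (%k. if k < N then y t k else t*z k))) (at t within {0..1}) &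
   ((%s. y' s i) hrd (\<Sum>j<e. z (N + j)*Ph j i (%k. if k < N then y' t k else t*z k))) (at t within {0..1})"
   and eq: "ALL i<N. y t0 i = y' t0 i"
  let ?x = "%y t k. if k < N then y t k else t*z k"
  have "y t i - y' t i = 0" if "t \<in> {0..1}" "i < N" for t i
  proof (rule small_lipschitz_unique[of 0 1 N "%t i. y t i - y' t i"
     "%t i. \<Sum>j<e. z (N + j)*(Ph j i (?x y t) - Ph j i (?x y' t))" "real e*R*M" t0 t i])
   fix t i assume t: "t \<in> {0..1::real}" and i: "i < N"
   show "((%s. y s i - y' s i) hrd (\<Sum>j<e. z (N + j)*(Ph j i (?x y t) - Ph j i (?x y' t)))) (at t within {0..1})"
    using DERIV_diff[OF D[rule_format, OF t i, THEN conjunct2, THEN conjunct2, THEN conjunct1]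
     D[rule_format, OF t i, THEN conjunct2, THEN conjunct2, THEN conjunct2]]
    by (simp add: sum_subtractf right_diff_distrib)
   have xlt: "abs(?x u t k) < R" if "ALL i<N. abs(u t i) < R" "k < N + e" for u k
   proof (cases "k < N")
    case False
    then have "abs(z k) < R" using z[rule_format, of "k - N"] that by simp
    moreover have "abs(t*z k) <= 1*abs(z k)" unfolding abs_mult using t by (intro mult_right_mono) auto
    ultimately show ?thesis using False by simp
   qed (use that in simp)
   have "abs(\<Sum>j<e. z (N + j)*(Ph j i (?x y t) - Ph j i (?x y' t))) <= (\<Sum>j<e. R*(M*(\<Sum>k<N. abs(y t k - y' t k))))"
   proof (rule order_trans[OF sum_abs], rule sum_mono)
    fix j assume "j \<in> {..<e}"
    then have j: "j < e" by simp
    have lt: "ALL k<N + e. abs(?x y t k) < r j i" "ALL k<N + e. abs(?x y' t k) < r j i"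
     using xlt[of y] xlt[of y'] D t rhr[OF j i] R_def by (fastforce intro: order_less_le_trans)+
    have "abs(Ph j i (?x y t) - Ph j i (?x y' t)) <= L j i*(\<Sum>k<N + e. abs(?x y t k - ?x y' t k))"
     by (rule Lr(3)[OF j i lt])
    also have "(\<Sum>k<N + e. abs(?x y t k - ?x y' t k)) = (\<Sum>k<N. abs(y t k - y' t k))"
     by (rule sum.mono_neutral_cong_right) auto
    also have "L j i*(\<Sum>k<N. abs(y t k - y' t k)) <= M*(\<Sum>k<N. abs(y t k - y' t k))"
     by (intro mult_right_mono Mle j i sum_nonneg) auto
    finally have "abs(Ph j i (?x y t) - Ph j i (?x y' t)) <= M*(\<Sum>k<N. abs(y t k - y' t k))" .
    then show "abs(z (N + j)*(Ph j i (?x y t) - Ph j i (?x y' t))) <= R*(M*(\<Sum>k<N. abs(y t k - y' t k)))"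
     unfolding abs_mult using z j R0 by (intro mult_mono) (auto intro: less_imp_le)
   qed
   then show "abs(\<Sum>j<e. z (N + j)*(Ph j i (?x y t) - Ph j i (?x y' t))) <= real e*R*M*(\<Sum>k<N. abs(y t k - y' t k))"
    by (simp add: mult_ac)
  qed (use t0 eq that CR R0 M0 in \<open>auto simp: mult_ac\<close>)
  then show "ALL t:{0..1}. ALL i<N. y t i = y' t i" by auto
 qed
qed

lemma flow_constant:
 assumes "!!t. t \<in> {0..1::real} ==> (y hrd 0) (at t within {0..1})" "s \<in> {0..1}" "t \<in> {0..1}"
 shows "y s = y t"
proof -
 have "norm (y s - y t) <= 0*norm (s - t)"
  by (rule field_differentiable_bound[of "{0..1}" y "%_. 0"]) (use assms in auto)
 then show ?thesis by simp
qed

lemma germ_lift: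
 fixes f :: "fnc"
 assumes "germ n f" "n <= n'"
 shows "germ n' f"
proof -
 have "germ n' (%z. z i)" if "i < n" for i
  using that assms(2) by (intro germ_var) linarith
 from germ_compose[OF assms(1) this] show ?thesis by simp
qed

text \<open>In the family \<open>H\<close> the parameters of \<open>Ft\<close> and of
  \<open>G\<close> coexist: the former alone give \<open>Ft\<close>, the latter alone
  \<open>G\<close>. By the infinitesimal equation there are curves of source points and
  \<open>Ft\<close>-parameters over the ray \<open>t s\<close> along which the value of
  \<open>H\<close> moves by a field of the target. Such a curve runs backwards from
  \<open>t = 1\<close>, where the \<open>Ft\<close>-parameters are zero, to \<open>t = 0\<close>,
  where they are \<open>ph s\<close>; the target field is integrated forwards.\<close>

theorem I22_versal:
 fixes Ft G :: "nat => fnc" and R :: "nat => nat => fnc"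
 assumes lm: "1 <= l" "1 <= m" and d_def: "d = l + m"
  and Ft: "!!i. i < 2 ==> germ (2 + d) (Ft i)"
  and R: "!!q i. q < d ==> i < 2 ==> germ (2 + d) (R q i)"
  and Fb: "!!i. i < 2 ==> \<forall>\<^sub>F z in nbf (2 + d). Ft i (base z) = I22v l m i z"
  and vb: "!!q i. q < d ==> i < 2 ==>
   \<forall>\<^sub>F z in nbf (2 + d). pd (2 + q) (Ft i) (base z) = I22vel l q i z + z 0*z 1*R q i (base z)"
  and G: "!!i. i < 2 ==> germ (2 + e) (G i)"
  and Gb: "!!i. i < 2 ==> \<forall>\<^sub>F z in nbf (2 + e). G i (base z) = I22v l m i z"
 shows "EX ph h k. (ALL q<d. germ e (%s. ph s q) & ph (%_. 0) q = 0) &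
  (ALL i<2. germ (2 + e) (h i) & germ (2 + e) (k i)) &
  (\<forall>\<^sub>F z in nbf (2 + e). ALL i<2. h i (base z) = z i & k i (base z) = z i &
   G i z = k i (%p. if p < 2 then Ft p (%p. if p < 2 then h p z else ph (%j. z (j + 2)) (p - 2)) else z p))"
proof -
 define N where "N = 2 + d"
 let ?n = "N + e"
 \<comment> \<open>The parameters of \<open>G\<close> are placed after the \<open>d\<close>
   parameters of \<open>Ft\<close>.\<close>
 define G' where "G' i z = G i (%k. if k < 2 then z k else z (k + d))" for i z
 define H where "H i z = Ft i z + G' i z - I22v l m i z" for i z
 have lift: "\<forall>\<^sub>F z in nbf ?n. P z" if "\<forall>\<^sub>F z in nbf (2 + d). P z" for P
  using that unfolding ev_nbf N_def by (meson trans_less_add1)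
 have lift': "\<forall>\<^sub>F z in nbf ?n. P (%k. if k < 2 then z k else z (k + d))" if "\<forall>\<^sub>F z in nbf (2 + e). P z" for P
 proof -
  obtain r where r: "r > 0" "!!z. ALL i<2 + e. abs(z i) < r ==> P z" using \<open>\<forall>\<^sub>F z in nbf (2 + e). P z\<close> unfolding ev_nbf by blast
  then show ?thesis unfolding ev_nbf N_def by (intro exI[of _ r]) (auto intro!: r(2))
 qed
 have n2: "2 <= ?n" "1 <= l" "1 <= m" using lm by (auto simp: N_def)
 have gFt: "germ ?n (Ft i)" if "i < 2" for i
  by (rule germ_lift[OF Ft[OF that]]) (simp add: N_def)
 have gG': "germ ?n (G' i)" if "i < 2" for i
  unfolding G'_def
 proof (rule germ_compose[OF G[OF that], of ?n "%k z. if k < 2 then z k else z (k + d)"])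
  show "germ ?n (%z. if k < 2 then z k else z (k + d))" if "k < 2 + e" for k
   using that by (cases "k < 2") (auto simp: N_def intro: germ_var)
 qed simp
 have gH: "germ ?n (H i)" if "i < 2" for i
  unfolding H_def[abs_def] by (intro germ_diff germ_add gFt gG' germ_I22 n2 that)
 have Hb: "\<forall>\<^sub>F z in nbf ?n. H i (base z) = I22v l m i z" if "i < 2" for i
  using lift[OF Fb[OF that]] lift'[OF Gb[OF that]]
 proof eventually_elim
  case (elim z)
  have "(%k. if k < 2 then base z k else base z (k + d)) = base (%k. if k < 2 then z k else z (k + d))"
   by (auto simp: base_def)
  then have "G' i (base z) = I22v l m i z" using elim(2) by (simp add: G'_def I22v_def)
  moreover have "I22v l m i (base z) = I22v l m i z" by (simp add: I22v_def)
  ultimately show ?case using elim(1) by (simp add: H_def)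
 qed
 have pdH: "\<forall>\<^sub>F z in nbf ?n. pd (2 + q) (H i) z = pd (2 + q) (Ft i) z" if "q < d" "i < 2" for q i
 proof -
  have "\<forall>\<^sub>F z in nbf ?n. ((%t. Ft i (z(2 + q:=t))) hrd pd (2 + q) (Ft i) z) (at (z (2 + q)))"
   by (rule germ_pd_DERIV[OF gFt]) (use that in \<open>auto simp: N_def\<close>)
  then show ?thesis
  proof eventually_elim
   case (elim z)
   have "G' i (z(2 + q:=t)) - I22v l m i (z(2 + q:=t)) = G' i z - I22v l m i z" for t
   proof -
    have "(%k. if k < 2 then (z(2 + q:=t)) k else (z(2 + q:=t)) (k + d)) = (%k. if k < 2 then z k else z (k + d))"
     using that by auto
    moreover have "(z(2 + q:=t)) 0 = z 0" "(z(2 + q:=t)) 1 = z 1" by auto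
    ultimately show ?thesis by (simp only: G'_def I22v_def)
   qed
   then have "(%t. H i (z(2 + q:=t))) = (%t. Ft i (z(2 + q:=t)) + (G' i z - I22v l m i z))"
    by (simp add: H_def algebra_simps fun_eq_iff)
   moreover have "((%t. Ft i (z(2 + q:=t)) + (G' i z - I22v l m i z)) hrd pd (2 + q) (Ft i) z + 0) (at (z (2 + q)))"
    by (intro DERIV_add elim DERIV_const)
   ultimately show ?case by (intro pd_eqI) simp
  qed
 qed
 have gv: "germ ?n (pd (2 + q) (H i))" if "q < l + m" "i < 2" for q i
  by (rule germ_chain(2)[OF gH]) (use that in \<open>auto simp: N_def d_def\<close>)
 have gf: "germ ?n (pd (N + j) (H i))" if "j < e" "i < 2" for j i
  by (rule germ_chain(2)[OF gH]) (use that in auto)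
 have gR: "germ ?n (R q i)" if "q < l + m" "i < 2" for q i
  by (rule germ_lift[OF R]) (use that in \<open>auto simp: N_def d_def\<close>)
 have base_ev: "\<forall>\<^sub>F z in nbf ?n. P (base z)" if "\<forall>\<^sub>F z in nbf ?n. P z" for P
 proof -
  from that[unfolded ev_nbf] obtain r where r: "r > 0" "ALL z. (ALL i<?n. abs(z i) < r) --> P z" by auto
  show ?thesis unfolding ev_nbf
  proof (intro exI[of _ r] conjI allI impI r(1))
   fix z :: "pnt" assume "ALL i<?n. abs(z i) < r"
   then show "P (base z)" using r by (intro r(2)[THEN spec, THEN mp]) (auto simp: base_def)
  qed
 qed
 have vb': "\<forall>\<^sub>F z in nbf ?n. pd (2 + q) (H i) (base z) = I22vel l q i z + z 0*z 1*R q i (base z)"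
  if "q < l + m" "i < 2" for q i
  using lift[OF vb[of q i]] base_ev[OF pdH[of q i]] that unfolding d_def by (auto elim: eventually_elim2)
 define Q where "Q j xi et c \<longleftrightarrow> (ALL i<2. germ ?n (xi i) & germ ?n (et i)) & (ALL q<l + m. germ ?n (c q)) &
  (\<forall>\<^sub>F z in nbf ?n. ALL i<2. pd (N + j) (H i) z = pd 0 (H i) z*xi 0 z + pd 1 (H i) z*xi 1 z
    + et i (z(0:=H 0 z, 1:=H 1 z)) + (\<Sum>q<l + m. c q (z(0:=0, 1:=0))*pd (2 + q) (H i) z))"
  for j and xi et c :: "nat => fnc"
 have "EX xi et c. Q j xi et c" if "j < e" for j
  unfolding Q_def
  by (rule linear_lemma_axes[of ?n l m H "%i. pd (N + j) (H i)" "%q i. pd (2 + q) (H i)" R])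
   (rule n2 | erule gH | erule gf[OF that] | erule (1) gv | erule (1) gR | erule Hb | erule (1) vb')+
 then have "ALL j. EX xi et c. j < e --> Q j xi et c" by blast
 then obtain xi et c where Q: "!!j. j < e ==> Q j (xi j) (et j) (c j)" by metis
 have gxi: "germ ?n (xi j i)" and get: "germ ?n (et j i)" if "j < e" "i < 2" for j i
  using Q[OF that(1)] that(2) unfolding Q_def by blast+
 have gc: "germ ?n (c j q)" if "j < e" "q < d" for j q
  using Q[OF that(1)] that(2) unfolding Q_def d_def by blast
 have LL: "\<forall>\<^sub>F z in nbf ?n. ALL i<2. pd (N + j) (H i) z = pd 0 (H i) z*xi j 0 z + pd 1 (H i) z*xi j 1 z
    + et j i (z(0:=H 0 z, 1:=H 1 z)) + (\<Sum>q<d. c j q (z(0:=0, 1:=0))*pd (2 + q) (H i) z)" if "j < e" for j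
  using Q[OF that] unfolding Q_def d_def by blast
 define C where "C j q z = - c j q (z(0:=0, 1:=0))" for j q z
 have gC: "germ ?n (C j q)" if "j < e" "q < d" for j q
 proof -
  have "germ ?n (%z. c j q (z(0:=0, 1:=0)))"
  proof (rule germ_compose[OF gc[OF that], of ?n "%i z. (z(0:=0, 1:=0)) i"])
   show "germ ?n (%z. (z(0:=0, 1:=0)) i)" if "i < ?n" for i
    using that by (cases "i = 0"; cases "i = 1") (auto intro: germ_var)
  qed simp
  from germ_minus[OF this] show ?thesis by (simp only: C_def[abs_def])
 qed
 \<comment> \<open>\<open>Ph1\<close> moves the source point, \<open>Ph2\<close> the target point;
   both carry the \<open>Ft\<close>-parameters along.\<close>
 define Ph1 where "Ph1 j i z = (if i < 2 then - xi j i z else C j (i - 2) z)" for j i z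
 define Ph2 where "Ph2 j i z = (if i < 2 then et j i z else C j (i - 2) z)" for j i z
 \<comment> \<open>The \<open>Ft\<close>-parameters satisfy a system of their own, since
   \<open>C\<close> ignores the first two coordinates. Its uniqueness will show that the base change
   \<open>ph\<close> does not depend on the source point.\<close>
 define Ph3 where "Ph3 j q u = C j q (%k. if k < 2 then 0 else u (k - 2))" for j q u
 have g1: "germ ?n (Ph1 j i)" and g2: "germ ?n (Ph2 j i)" if "j < e" "i < N" for j i
  unfolding Ph1_def[abs_def] Ph2_def[abs_def] using that gxi get gC[of j "i - 2"]
  by (cases "i < 2"; auto simp: N_def intro!: germ_minus)+
 have g3: "germ (d + e) (Ph3 j q)" if "j < e" "q < d" for j q
 proof -
  have "germ (d + e) (%u. C j q (%k. (%k u. if k < 2 then 0 else u (k - 2)) k u))"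
  proof (rule germ_compose[OF gC[OF that]])
   show "germ (d + e) (%u. if k < 2 then 0 else u (k - 2))" if "k < ?n" for k
    using that by (cases "k < 2") (auto simp: N_def intro!: germ_var)
  qed simp
  then show ?thesis by (simp add: Ph3_def[abs_def])
 qed
 obtain ru where ru: "ru > 0" and U2: "!!z y y' t0. t0 \<in> {0..1} ==> (ALL j<e. abs(z (N + j)) < ru) ==>
  (ALL t:{0..1}. ALL i<N. abs(y t i) < ru & abs(y' t i) < ru &
   ((%s. y s i) hrd (\<Sum>j<e. z (N + j)*Ph2 j i (%k. if k < N then y t k else t*z k))) (at t within {0..1}) &
   ((%s. y' s i) hrd (\<Sum>j<e. z (N + j)*Ph2 j i (%k. if k < N then y' t k else t*z k))) (at t within {0..1})) ==>
  (ALL i<N. y t0 i = y' t0 i) ==> (ALL t:{0..1}. ALL i<N. y t i = y' t i)"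
  using flow_unique[of e N Ph2, OF g2] by blast
 obtain rv where rv: "rv > 0" and U3: "!!z y y' t0. t0 \<in> {0..1} ==> (ALL j<e. abs(z (d + j)) < rv) ==>
  (ALL t:{0..1}. ALL i<d. abs(y t i) < rv & abs(y' t i) < rv &
   ((%s. y s i) hrd (\<Sum>j<e. z (d + j)*Ph3 j i (%k. if k < d then y t k else t*z k))) (at t within {0..1}) &
   ((%s. y' s i) hrd (\<Sum>j<e. z (d + j)*Ph3 j i (%k. if k < d then y' t k else t*z k))) (at t within {0..1})) ==>
  (ALL i<d. y t0 i = y' t0 i) ==> (ALL t:{0..1}. ALL i<d. y t i = y' t i)"
  using flow_unique[of e d Ph3, OF g3] by blast
 have z01: "(0::real) \<in> {0..1}" "(1::real) \<in> {0..1}" by auto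
 obtain Y2 where gY2: "!!t i. t \<in> {0..1} ==> i < N ==> germ ?n (Y2 t i)"
  and eY2: "\<forall>\<^sub>F z in nbf ?n. ALL i<N. Y2 0 i z = z i & (ALL t:{0..1}. abs(Y2 t i z) < ru &
   ((%s. Y2 s i z) hrd
    (\<Sum>j<e. z (N + j)*Ph2 j i (%k. if k < N then Y2 t k z else t*z k))) (at t within {0..1}))"
  using analytic_flow[of e N Ph2 0 ru, OF g2 z01(1) ru] by blast
 obtain rh2 where rh2: "rh2 > 0" and Y2: "!!z i. ALL i<?n. abs(z i) < rh2 ==> i < N ==> Y2 0 i z = z i & (ALL t:{0..1}. abs(Y2 t i z) < ru &
   ((%s. Y2 s i z) hrd
    (\<Sum>j<e. z (N + j)*Ph2 j i (%k. if k < N then Y2 t k z else t*z k))) (at t within {0..1}))"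
  using eY2 unfolding ev_nbf by blast
 have H00: "H i (%_. 0) = 0" if "i < 2" for i
  using ev_nbf_at_0[OF Hb[OF that]] by (simp add: I22v_def)
 have e1: "\<forall>\<^sub>F z in nbf ?n. ALL j:{..<e}. ALL i<2. pd (N + j) (H i) z = pd 0 (H i) z*xi j 0 z + pd 1 (H i) z*xi j 1 z
    + et j i (z(0:=H 0 z, 1:=H 1 z)) + (\<Sum>q<d. c j q (z(0:=0, 1:=0))*pd (2 + q) (H i) z)"
  using LL by (intro eventually_ball_finite) auto
 have e2: "\<forall>\<^sub>F z in nbf ?n. ALL i:{..<2}. ALL gm gm' t S. gm t = z -->
   (ALL k<?n. ((%s. gm s k) hrd gm' k) (at t within S)) -->
   ((%s. H i (gm s)) hrd (\<Sum>k<?n. pd k (H i) z*gm' k)) (at t within S)"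
  using germ_chain(1)[OF gH] by (intro eventually_ball_finite) auto
 have e3: "\<forall>\<^sub>F z in nbf ?n. ALL i:{..<2}. abs(H i z) < min ru rh2"
  using small_germ[OF gH H00, of _ "min ru rh2"] ru rh2 by (intro eventually_ball_finite) auto
 have e4: "\<forall>\<^sub>F z in nbf ?n. ALL i:{..<2}. (ALL z'. (ALL k<2 + d. z' k = z k) --> Ft i z' = Ft i z) & Ft i (base z) = I22v l m i z &
   G i (base (%k. if k < 2 then z k else z (k + d))) = I22v l m i (%k. if k < 2 then z k else z (k + d))"
  using lift[OF germ_depends[OF Ft]] lift[OF Fb] lift'[OF Gb]
  by (intro eventually_ball_finite ballI eventually_conj) auto
 obtain r1 where r1: "r1 > 0" and P: "!!z. ALL i<?n. abs(z i) < r1 ==>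
   (ALL j:{..<e}. ALL i<2. pd (N + j) (H i) z = pd 0 (H i) z*xi j 0 z + pd 1 (H i) z*xi j 1 z
    + et j i (z(0:=H 0 z, 1:=H 1 z)) + (\<Sum>q<d. c j q (z(0:=0, 1:=0))*pd (2 + q) (H i) z)) &
   (ALL i:{..<2}. ALL gm gm' t S. gm t = z -->
   (ALL k<?n. ((%s. gm s k) hrd gm' k) (at t within S)) -->
   ((%s. H i (gm s)) hrd (\<Sum>k<?n. pd k (H i) z*gm' k)) (at t within S)) &
   (ALL i:{..<2}. abs(H i z) < min ru rh2) &
   (ALL i:{..<2}. (ALL z'. (ALL k<2 + d. z' k = z k) --> Ft i z' = Ft i z) & Ft i (base z) = I22v l m i z &
   G i (base (%k. if k < 2 then z k else z (k + d))) = I22v l m i (%k. if k < 2 then z k else z (k + d)))"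
  using eventually_conj[OF e1 eventually_conj[OF e2 eventually_conj[OF e3 e4]]] unfolding ev_nbf by blast
 define R0 where "R0 = min (min r1 ru) (min rv rh2)"
 have R0: "R0 > 0" "R0 <= r1" "R0 <= ru" "R0 <= rv" "R0 <= rh2" using r1 ru rv rh2 by (auto simp: R0_def)
 obtain Y1 where gY1: "!!t i. t \<in> {0..1} ==> i < N ==> germ ?n (Y1 t i)"
  and eY1: "\<forall>\<^sub>F z in nbf ?n. ALL i<N. Y1 1 i z = z i & (ALL t:{0..1}. abs(Y1 t i z) < R0 &
   ((%s. Y1 s i z) hrd
    (\<Sum>j<e. z (N + j)*Ph1 j i (%k. if k < N then Y1 t k z else t*z k))) (at t within {0..1}))"
  using analytic_flow[of e N Ph1 1 R0, OF g1 z01(2) R0(1)] by blast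
 obtain rh1 where rh1: "rh1 > 0" and Y1: "!!z i. ALL i<?n. abs(z i) < rh1 ==> i < N ==> Y1 1 i z = z i & (ALL t:{0..1}. abs(Y1 t i z) < R0 &
   ((%s. Y1 s i z) hrd
    (\<Sum>j<e. z (N + j)*Ph1 j i (%k. if k < N then Y1 t k z else t*z k))) (at t within {0..1}))"
  using eY1 unfolding ev_nbf by blast
 define dl where "dl = min rh1 R0"
 have dl: "dl > 0" "dl <= rh1" "dl <= R0" using rh1 R0 by (auto simp: dl_def)
 have N2: "2 <= N" "0 < N" "1 < N" "Suc 0 < N" by (auto simp: N_def)
 \<comment> \<open>The starting point at time 1: source point and \<open>G\<close>-parameters as
   given, \<open>Ft\<close>-parameters zero.\<close>
 define ini where "ini z = (%k. if k < 2 then z k else if k < N then 0 else z (k - d))" for z :: "pnt"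
 define ph where "ph s q = Y1 0 (2 + q) (%k. if k < N then 0 else s (k - N))" for s q
 define h where "h i z = Y1 0 i (ini z)" for i z
 define kk where "kk i z = Y2 1 i (%k. if k < 2 then z k else if k < N then ph (%j. z (j + 2)) (k - 2) else z (k - d))" for i z
 have iniN: "ini z (N + j) = z (2 + j)" for z j by (simp add: ini_def N_def)
 have const1: "Y1 t i z = z i" if "ALL i<?n. abs(z i) < rh1" "ALL j<e. z (N + j) = 0" "i < N" "t \<in> {0..1}" for z t i
 proof -
  have "Y1 t i z = Y1 1 i z"
   by (rule flow_constant[of "%t. Y1 t i z"]) (use Y1[OF that(1,3)] that(2,4) in \<open>auto\<close>)
  then show ?thesis using Y1[OF that(1,3)] by simp
 qed
 have const2: "Y2 t i z = z i" if "ALL i<?n. abs(z i) < rh2" "ALL j<e. z (N + j) = 0" "i < N" "t \<in> {0..1}" for z t i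
 proof -
  have "Y2 t i z = Y2 0 i z"
   by (rule flow_constant[of "%t. Y2 t i z"]) (use Y2[OF that(1,3)] that(2,4) in \<open>auto\<close>)
  then show ?thesis using Y2[OF that(1,3)] by simp
 qed
 have ph0: "ph (%_. 0) q = 0" if "q < d" for q
  unfolding ph_def by (subst const1) (use rh1 that in \<open>auto simp: N_def\<close>)
 have gph: "germ e (%s. ph s q)" if "q < d" for q
  unfolding ph_def
 proof (rule germ_compose[of ?n "Y1 0 (2 + q)" e "%k s. if k < N then 0 else s (k - N)"])
  show "germ ?n (Y1 0 (2 + q))" by (rule gY1) (use that in \<open>auto simp: N_def\<close>)
  show "germ e (%s. if k < N then 0 else s (k - N))" if "k < ?n" for k
   using that by (cases "k < N") (auto intro: germ_var)
 qed simp
 have gini: "germ (2 + e) (%z. ini z k)" if "k < ?n" for k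
  unfolding ini_def using that by (cases "k < 2"; cases "k < N") (auto simp: N_def intro!: germ_var)
 have gh: "germ (2 + e) (h i)" if "i < 2" for i
  unfolding h_def[abs_def]
  by (rule germ_compose[of ?n "Y1 0 i" "2 + e" "%k z. ini z k"])
   (use gY1[of 0 i] gini that N2 in \<open>auto simp: ini_def\<close>)
 have gphz: "germ (2 + e) (%z. ph (%j. z (j + 2)) q)" if "q < d" for q
  by (rule germ_compose[OF gph[OF that], of "2 + e" "%j z. z (j + 2)"]) (auto intro: germ_var)
 have gk: "germ (2 + e) (kk i)" if "i < 2" for i
  unfolding kk_def[abs_def]
 proof (rule germ_compose[of ?n "Y2 1 i" "2 + e" "%k z. if k < 2 then z k else if k < N then ph (%j. z (j + 2)) (k - 2) else z (k - d)"])
  show "germ (2 + e) (%z. if k < 2 then z k else if k < N then ph (%j. z (j + 2)) (k - 2) else z (k - d))" if "k < ?n" for k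
   using that gphz[of "k - 2"] by (cases "k < 2"; cases "k < N") (auto simp: N_def intro!: germ_var)
  show "(if k < 2 then 0 else if k < N then ph (%j. 0) (k - 2) else (0::real)) = 0" for k
   using ph0[of "k - 2"] by (auto simp: N_def)
 qed (use gY2[of 1 i] that N2 in auto)
 have main: "h i (base z) = z i & kk i (base z) = z i &
   G i z = kk i (%p. if p < 2 then Ft p (%p. if p < 2 then h p z else ph (%j. z (j + 2)) (p - 2)) else z p)"
  if z: "ALL k<2 + e. abs(z k) < dl" and i2: "i < 2" for z i
 proof (intro conjI)
  have ini_lt: "abs(ini u k) < dl" if "ALL k<2 + e. abs(u k) < dl" "k < ?n" for u k
   using that dl by (auto simp: ini_def N_def)
  have zb: "ALL k<2 + e. abs(base z k) < dl" using z dl by (auto simp: base_def)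
  have "h i (base z) = ini (base z) i"
   unfolding h_def using ini_lt[OF zb] dl i2 N2
   by (intro const1) (fastforce simp: iniN)+
  then show "h i (base z) = z i" using i2 by (auto simp: ini_def base_def)
  have b0: "(%j. base z (j + 2)) = (%_. 0)" by (auto simp: base_def)
  let ?u = "%k. if k < 2 then base z k else if k < N then ph (%j. base z (j + 2)) (k - 2) else base z (k - d)"
  have u: "?u = base z"
  proof
   fix k
   have "k - 2 < d" if "k < N" "\<not> k < 2" using that by (auto simp: N_def)
   then show "?u k = base z k" unfolding b0 using ph0[of "k - 2"] by (auto simp: base_def N_def)
  qed
  have "kk i (base z) = Y2 1 i (base z)" unfolding kk_def u ..
  also have "\<dots> = base z i"
  proof (rule const2)
   have "abs(base z k) < rh2" for k
   proof (cases "k < 2")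
    case True
    then have "abs(z k) < dl" using z by simp
    then show ?thesis using True dl R0 by (simp add: base_def)
   qed (use rh2 in \<open>simp add: base_def\<close>)
   then show "ALL k<?n. abs(base z k) < rh2" by blast
  qed (use i2 N2 in \<open>auto simp: base_def\<close>)
  finally show "kk i (base z) = z i" using i2 by (auto simp: base_def)
  define z0 where "z0 = ini z"
  have z0: "abs(z0 k) < dl" if "k < ?n" for k unfolding z0_def by (rule ini_lt[OF z that])
  define y where "y t k = Y1 t k z0" for t k
  define gm where "gm t = (%k. if k < N then y t k else t*z0 k)" for t
  have z0rh: "ALL k<?n. abs(z0 k) < rh1" using z0 dl by force
  have y: "y 1 k = z0 k" "!!t. t \<in> {0..1} ==> abs(y t k) < R0"
   "!!t. t \<in> {0..1} ==> ((%s. y s k) hrd (\<Sum>j<e. z0 (N + j)*Ph1 j k (gm t))) (at t within {0..1})"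
   if "k < N" for k
   using Y1[OF z0rh that] unfolding y_def gm_def by auto
  have gmlt: "abs(gm t k) < R0" if t: "t \<in> {0..1}" and "k < ?n" for t k
  proof (cases "k < N")
   case False
   have "abs(t*z0 k) <= 1*abs(z0 k)" unfolding abs_mult using t by (intro mult_right_mono) auto
   then show ?thesis using False z0[OF that(2)] dl by (simp add: gm_def)
  qed (use y(2) t in \<open>simp add: gm_def\<close>)
  have Pgm: "ALL k<?n. abs(gm t k) < r1" if "t \<in> {0..1}" for t using gmlt[OF that] R0 by force
  note PL = P[OF Pgm, THEN conjunct1] and PC = P[OF Pgm, THEN conjunct2, THEN conjunct1]
   and PH = P[OF Pgm, THEN conjunct2, THEN conjunct2, THEN conjunct1]
   and PF = P[OF Pgm, THEN conjunct2, THEN conjunct2, THEN conjunct2]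
  \<comment> \<open>\<open>T\<close> follows the image of the curve \<open>gm\<close> under
    \<open>H\<close>, together with the \<open>Ft\<close>-parameters. It solves the equation of the
    target flow \<open>Y2\<close>, and uniqueness identifies the two.\<close>
  define T where "T t k = (if k < 2 then H k (gm t) else y t k)" for t k
  have extT: "(%k. if k < N then T t k else t*z0 k) = (gm t)(0:=H 0 (gm t), 1:=H 1 (gm t))" for t
  proof
   fix k :: nat
   consider "k = 0" | "k = 1" | "2 <= k" by linarith
   then show "(if k < N then T t k else t*z0 k) = ((gm t)(0:=H 0 (gm t), 1:=H 1 (gm t))) k"
    by cases (use N2 in \<open>auto simp: T_def gm_def\<close>)
  qed
  have C_ext: "C j q ((gm t)(0:=u, 1:=v)) = C j q (gm t)" for j q t u v
  proof -
   have "((gm t)(0:=u, 1:=v))(0:=0, 1:=0) = (gm t)(0:=0, 1:=0)" by auto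
   then show ?thesis by (simp only: C_def)
  qed
  have sum_split: "(\<Sum>k<?n. f k) = f 0 + f 1 + (\<Sum>q<d. f (2 + q)) + (\<Sum>j<e. f (N + j))" for f :: "pnt"
  proof -
   have s: "(\<Sum>k<a + b. f k) = (\<Sum>k<a. f k) + (\<Sum>k<b. f (a + k))" for a b
    by (induction b) auto
   have "(\<Sum>k<2. f k) = f 0 + f 1" by (simp add: numeral_2_eq_2)
   then show ?thesis using s[of N e] s[of 2 d] by (simp add: N_def)
  qed
  have TD: "((%s. T s k) hrd (\<Sum>j<e. z0 (N + j)*Ph2 j k (%k. if k < N then T t k else t*z0 k))) (at t within {0..1})"
   if t: "t \<in> {0..1}" and k: "k < N" for t k
  proof (cases "k < 2")
   case False
   then show ?thesis using y(3)[OF k t] unfolding extT by (simp add: T_def Ph1_def Ph2_def C_ext[unfolded One_nat_def])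
  next
   case True
   define gm' where "gm' p = (if p < N then (\<Sum>j<e. z0 (N + j)*Ph1 j p (gm t)) else z0 p)" for p
   have "((%s. gm s p) hrd gm' p) (at t within {0..1})" if "p < ?n" for p
   proof (cases "p < N")
    case False
    then show ?thesis unfolding gm_def gm'_def by (auto intro!: derivative_eq_intros)
   qed (use y(3)[OF _ t] in \<open>simp add: gm_def gm'_def\<close>)
   then have D: "((%s. H k (gm s)) hrd (\<Sum>p<?n. pd p (H k) (gm t)*gm' p)) (at t within {0..1})"
    using PC[OF t] True by blast
   let ?g = "gm t"
   have a0: "gm' 0 = (\<Sum>j<e. z0 (N + j) * - xi j 0 ?g)" "gm' 1 = (\<Sum>j<e. z0 (N + j) * - xi j 1 ?g)"
    "!!j. gm' (N + j) = z0 (N + j)"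
    using N2 by (simp_all add: gm'_def Ph1_def)
   have a2: "gm' (2 + q) = (\<Sum>j<e. z0 (N + j) * - c j q (?g(0:=0, 1:=0)))" if "q < d" for q
    using that by (simp add: gm'_def Ph1_def C_def N_def)
   have "(\<Sum>p<?n. pd p (H k) ?g*gm' p) = pd 0 (H k) ?g*(\<Sum>j<e. z0 (N + j) * - xi j 0 ?g)
     + pd 1 (H k) ?g*(\<Sum>j<e. z0 (N + j) * - xi j 1 ?g)
     + (\<Sum>q<d. pd (2 + q) (H k) ?g*(\<Sum>j<e. z0 (N + j) * - c j q (?g(0:=0, 1:=0))))
     + (\<Sum>j<e. pd (N + j) (H k) ?g*z0 (N + j))"
    unfolding sum_split a0 using a2 by simp
   also have "(\<Sum>q<d. pd (2 + q) (H k) ?g*(\<Sum>j<e. z0 (N + j) * - c j q (?g(0:=0, 1:=0))))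
     = (\<Sum>j<e. \<Sum>q<d. pd (2 + q) (H k) ?g*(z0 (N + j) * - c j q (?g(0:=0, 1:=0))))"
    unfolding sum_distrib_left by (rule sum.swap)
   also have "pd 0 (H k) ?g*(\<Sum>j<e. z0 (N + j) * - xi j 0 ?g) + pd 1 (H k) ?g*(\<Sum>j<e. z0 (N + j) * - xi j 1 ?g)
     + (\<Sum>j<e. \<Sum>q<d. pd (2 + q) (H k) ?g*(z0 (N + j) * - c j q (?g(0:=0, 1:=0))))
     + (\<Sum>j<e. pd (N + j) (H k) ?g*z0 (N + j))
     = (\<Sum>j<e. z0 (N + j)*et j k (?g(0:=H 0 ?g, 1:=H 1 ?g)))"
    unfolding sum_distrib_left sum.distrib[symmetric]
   proof (rule sum.cong[OF refl])
    fix j assume "j \<in> {..<e}"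
    then have L: "pd (N + j) (H k) ?g = pd 0 (H k) ?g*xi j 0 ?g + pd 1 (H k) ?g*xi j 1 ?g
      + et j k (?g(0:=H 0 ?g, 1:=H 1 ?g)) + (\<Sum>q<d. c j q (?g(0:=0, 1:=0))*pd (2 + q) (H k) ?g)"
     using PL[OF t] True by blast
    have "(\<Sum>q<d. pd (2 + q) (H k) ?g*(z0 (N + j) * - c j q (?g(0:=0, 1:=0))))
      = - z0 (N + j)*(\<Sum>q<d. c j q (?g(0:=0, 1:=0))*pd (2 + q) (H k) ?g)"
     unfolding sum_distrib_left by (rule sum.cong) (auto simp: algebra_simps)
    then show "pd 0 (H k) ?g*(z0 (N + j) * - xi j 0 ?g) + pd 1 (H k) ?g*(z0 (N + j) * - xi j 1 ?g)
      + (\<Sum>q<d. pd (2 + q) (H k) ?g*(z0 (N + j) * - c j q (?g(0:=0, 1:=0)))) + pd (N + j) (H k) ?g*z0 (N + j)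
      = z0 (N + j)*et j k (?g(0:=H 0 ?g, 1:=H 1 ?g))"
     unfolding L by (simp only:) (simp add: algebra_simps)
   qed
   finally show ?thesis using D True unfolding extT by (simp add: T_def Ph2_def)
  qed
  define z2 where "z2 = (%k. if k < N then T 0 k else z0 k)"
  have T_lt: "abs(T t k) < min ru rh2" if "t \<in> {0..1}" "k < N" for t k
   using PH[OF that(1)] y(2)[OF that(2) that(1)] R0 unfolding T_def by (cases "k < 2") auto
  have z2: "ALL k<?n. abs(z2 k) < rh2"
   using T_lt[of 0] z0 dl R0 unfolding z2_def by (fastforce intro: order_less_le_trans)
  have z0s: "abs(z0 (N + j)) < ru" "abs(z0 (N + j)) < rv" if "j < e" for j
  proof -
   have "N + j < ?n" using that by simp
   then have "abs(z0 (N + j)) < dl" using z0 by blast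
   then show "abs(z0 (N + j)) < ru" "abs(z0 (N + j)) < rv" using dl R0 by linarith+
  qed
  have z2N: "z2 (N + j) = z0 (N + j)" for j by (simp add: z2_def)
  have z2e: "(%k. if k < N then Y2 t k z2 else t*z2 k) = (%k. if k < N then Y2 t k z2 else t*z0 k)" for t
   by (auto simp: z2_def)
  have TY: "ALL t:{0..1}. ALL k<N. T t k = Y2 t k z2"
  proof (rule U2[of 0 z0 T "%t k. Y2 t k z2"])
   show "ALL j<e. abs(z0 (N + j)) < ru" using z0s by blast
   show "ALL t:{0..1}. ALL k<N. abs(T t k) < ru & abs(Y2 t k z2) < ru &
    ((%s. T s k) hrd (\<Sum>j<e. z0 (N + j)*Ph2 j k (%k. if k < N then T t k else t*z0 k))) (at t within {0..1}) &
    ((%s. Y2 s k z2) hrd (\<Sum>j<e. z0 (N + j)*Ph2 j k (%k. if k < N then Y2 t k z2 else t*z0 k))) (at t within {0..1})"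
   proof (intro ballI allI impI conjI)
    fix t :: real and k assume t: "t \<in> {0..1}" and k: "k < N"
    show "abs(T t k) < ru" using T_lt[OF t k] by simp
    show "abs(Y2 t k z2) < ru" using Y2[OF z2 k] t by blast
    show "((%s. Y2 s k z2) hrd (\<Sum>j<e. z0 (N + j)*Ph2 j k (%k. if k < N then Y2 t k z2 else t*z0 k))) (at t within {0..1})"
     using Y2[OF z2 k] t unfolding z2e z2N by blast
   qed (rule TD)
   show "ALL k<N. T 0 k = Y2 0 k z2" using Y2[OF z2] by (auto simp: z2_def)
  qed auto
  have "gm 1 = z0" using y(1) by (auto simp: gm_def)
  have G1: "T 1 i = G i z"
  proof -
   have 1: "(%k. if k < 2 then z0 k else z0 (k + d)) = z" by (auto simp: z0_def ini_def N_def)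
   have "base z0 k = z0 k" if "k < 2 + d" for k using that by (auto simp: base_def z0_def ini_def N_def)
   note b = this
   have PF1: "(ALL z'. (ALL k<2 + d. z' k = z0 k) --> Ft i z' = Ft i z0) & Ft i (base z0) = I22v l m i z0"
    using PF[OF z01(2)] i2 unfolding \<open>gm 1 = z0\<close> by blast
   then have "Ft i (base z0) = Ft i z0" using b by blast
   moreover have "Ft i (base z0) = I22v l m i z0" using PF1 by blast
   ultimately show ?thesis using i2 unfolding T_def \<open>gm 1 = z0\<close> by (simp add: H_def G'_def 1)
  qed
  have T0: "T 0 p = Ft p (gm 0)" if p: "p < 2" for p
  proof -
   have gm0: "gm 0 k = 0" if "N <= k" for k using that by (simp add: gm_def)
   let ?v = "%k. if k < 2 then gm 0 k else gm 0 (k + d)"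
   have bv: "base ?v = ?v" using gm0 by (auto simp: base_def N_def)
   have "G p (base ?v) = I22v l m p ?v" using PF[OF z01(1)] p by blast
   then have "G' p (gm 0) = I22v l m p ?v" unfolding G'_def bv .
   also have "\<dots> = I22v l m p (gm 0)" by (simp add: I22v_def)
   finally show ?thesis using p by (simp add: T_def H_def)
  qed
  define z00 where "z00 = (%k. if k < N then 0 else z0 k)"
  have z00rh: "ALL k<?n. abs(z00 k) < rh1" using z0rh rh1 by (auto simp: z00_def)
  have phz: "ph (%j. z (j + 2)) q = Y1 0 (2 + q) z00" for q
  proof -
   have "(%k. if k < N then 0 else z (k - N + 2)) = z00"
   proof
    fix k
    show "(if k < N then 0 else z (k - N + 2)) = z00 k"
    proof (cases "k < N")
     case False
     then have "k - N + 2 = k - d" "\<not> k < 2" by (auto simp: N_def)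
     then show ?thesis using False by (simp only: z00_def z0_def ini_def if_False)
    qed (simp add: z00_def)
   qed
   then show ?thesis by (simp only: ph_def)
  qed
  have Aeq: "ALL t:{0..1}. ALL q<d. y t (2 + q) = Y1 t (2 + q) z00"
  proof (rule U3[of 1 "%k. z0 (k + 2)" "%t q. y t (2 + q)" "%t q. Y1 t (2 + q) z00"])
   have dj: "d + j + 2 = N + j" for j by (simp add: N_def)
   show "ALL j<e. abs(z0 (d + j + 2)) < rv" unfolding dj using z0s by blast
   have key: "((%s. Y1 s (2 + q) u) hrd
     (\<Sum>j<e. z0 (d + j + 2)*Ph3 j q (%k. if k < d then Y1 t (2 + k) u else t*z0 (k + 2)))) (at t within {0..1})
     & abs(Y1 t (2 + q) u) < rv"
    if u: "ALL k<?n. abs(u k) < rh1" "ALL k>=N. u k = z0 k" and q: "q < d" and t: "t \<in> {0..1}" for u q t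
   proof -
    have qN: "2 + q < N" using q by (simp add: N_def)
    have "Ph3 j q (%k. if k < d then Y1 t (2 + k) u else t*z0 (k + 2))
      = Ph1 j (2 + q) (%k. if k < N then Y1 t k u else t*u k)" for j
    proof -
     have "(%k. if k < 2 then 0 else if k - 2 < d then Y1 t (2 + (k - 2)) u else t*z0 (k - 2 + 2))(0:=0, 1:=0)
       = (%k. if k < N then Y1 t k u else t*u k)(0:=0, 1:=0)"
     proof
      fix k
      have "2 + (k - 2) = k" "k - 2 + 2 = k" "k - 2 < d \<longleftrightarrow> k < N" if "\<not> k < 2" using that by (auto simp: N_def)
      then show "((%k. if k < 2 then 0 else if k - 2 < d then Y1 t (2 + (k - 2)) u else t*z0 (k - 2 + 2))(0:=0, 1:=0)) k
       = ((%k. if k < N then Y1 t k u else t*u k)(0:=0, 1:=0)) k"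
       using u(2) by (cases "k < 2") auto
     qed
     then show ?thesis by (simp add: Ph3_def Ph1_def C_def)
    qed
    moreover have "u (N + j) = z0 (d + j + 2)" for j unfolding dj using u(2) by simp
    moreover have "abs(Y1 t (2 + q) u) < R0" "((%s. Y1 s (2 + q) u) hrd
      (\<Sum>j<e. u (N + j)*Ph1 j (2 + q) (%k. if k < N then Y1 t k u else t*u k))) (at t within {0..1})"
     using Y1[OF u(1) qN] t by blast+
    ultimately show ?thesis using R0 by (simp del: add_2_eq_Suc add_2_eq_Suc')
   qed
   show "ALL t:{0..1}. ALL q<d. abs(y t (2 + q)) < rv & abs(Y1 t (2 + q) z00) < rv &
    ((%s. y s (2 + q)) hrd (\<Sum>j<e. z0 (d + j + 2)*Ph3 j q (%k. if k < d then y t (2 + k) else t*z0 (k + 2)))) (at t within {0..1}) &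
    ((%s. Y1 s (2 + q) z00) hrd (\<Sum>j<e. z0 (d + j + 2)*Ph3 j q (%k. if k < d then Y1 t (2 + k) z00 else t*z0 (k + 2)))) (at t within {0..1})"
    using key[OF z0rh] key[OF z00rh] unfolding y_def by (simp add: z00_def)
   show "ALL q<d. y 1 (2 + q) = Y1 1 (2 + q) z00"
    using y(1) Y1[OF z00rh] by (auto simp: z00_def z0_def ini_def N_def)
  qed auto
  have Fth: "Ft p (%p. if p < 2 then h p z else ph (%j. z (j + 2)) (p - 2)) = Ft p (gm 0)" if p: "p < 2" for p
  proof -
   have "(if k < 2 then h k z else ph (%j. z (j + 2)) (k - 2)) = gm 0 k" if "k < 2 + d" for k
   proof (cases "k < 2")
    case True
    then show ?thesis using N2 by (simp add: gm_def h_def y_def z0_def)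
   next
    case False
    then have "k - 2 < d" "2 + (k - 2) = k" "k < N" using that by (auto simp: N_def)
    moreover have "ph (%j. z (j + 2)) (k - 2) = Y1 0 k z00" using phz[of "k - 2"] \<open>2 + (k - 2) = k\<close> by (simp only:)
    moreover have "y 0 k = Y1 0 k z00" using Aeq[rule_format, of 0 "k - 2"] \<open>k - 2 < d\<close> \<open>2 + (k - 2) = k\<close> by simp
    ultimately show ?thesis using False by (simp add: gm_def del: add_2_eq_Suc add_2_eq_Suc')
   qed
   note b = this
   have X: "ALL k<2 + d. z' k = gm 0 k ==> Ft p z' = Ft p (gm 0)" for z'
    using PF[OF z01(1)] p by blast
   show ?thesis by (rule X) (intro allI impI, rule b)
  qed
  let ?w = "%p. if p < 2 then Ft p (%p. if p < 2 then h p z else ph (%j. z (j + 2)) (p - 2)) else z p"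
  have wz: "(%j. ?w (j + 2)) = (%j. z (j + 2))" by auto
  have "(%k. if k < 2 then ?w k else if k < N then ph (%j. ?w (j + 2)) (k - 2) else ?w (k - d)) = z2"
  proof
   fix k
   consider "k < 2" | "\<not> k < 2" "k < N" | "\<not> k < N" by blast
   then show "(if k < 2 then ?w k else if k < N then ph (%j. ?w (j + 2)) (k - 2) else ?w (k - d)) = z2 k"
   proof cases
    case 1
    then show ?thesis using N2 Fth[OF 1] T0[OF 1] by (simp add: z2_def)
   next
    case 2
    then have "k - 2 < d" "2 + (k - 2) = k" by (auto simp: N_def)
    moreover have "ph (%j. z (j + 2)) (k - 2) = Y1 0 k z00" using phz[of "k - 2"] \<open>2 + (k - 2) = k\<close> by (simp only:)
    moreover have "y 0 k = Y1 0 k z00" using Aeq[rule_format, of 0 "k - 2"] \<open>k - 2 < d\<close> \<open>2 + (k - 2) = k\<close> by simp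
    ultimately show ?thesis using 2 unfolding wz by (simp add: z2_def T_def del: add_2_eq_Suc add_2_eq_Suc')
   next
    case 3
    then show ?thesis by (auto simp: z2_def z0_def ini_def N_def)
   qed
  qed
  then have "kk i ?w = Y2 1 i z2" by (simp only: kk_def)
  also have "\<dots> = T 1 i" using TY i2 N2 by auto
  finally show "G i z = kk i ?w" using G1 by simp
 qed
 show ?thesis
 proof (rule exI[of _ ph], rule exI[of _ h], rule exI[of _ kk], intro conjI)
  show "\<forall>\<^sub>F z in nbf (2 + e). ALL i<2. h i (base z) = z i & kk i (base z) = z i &
   G i z = kk i (%p. if p < 2 then Ft p (%p. if p < 2 then h p z else ph (%j. z (j + 2)) (p - 2)) else z p)"
   unfolding ev_nbf using main dl(1) by blast
 qed (use gph ph0 gh gk in auto)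
qed

subsection \<open>The harmonic unfolding\<close>

lemma ev_nbf_map:
 fixes g :: "nat => fnc"
 assumes "!!i. i < n ==> germ n' (g i)" "!!i. i < n ==> g i (%_. 0) = 0" "eventually P (nbf n)"
 shows "\<forall>\<^sub>F z in nbf n'. P (%i. g i z)"
proof -
 obtain r where r: "r > 0" "!!z. ALL i<n. abs(z i) < r ==> P z" using assms(3) unfolding ev_nbf by blast
 have "\<forall>\<^sub>F z in nbf n'. ALL i:{..<n}. abs(g i z) < r"
  by (intro eventually_ball_finite ballI small_germ) (use assms r in auto)
 then show ?thesis by eventually_elim (use r in auto)
qed

lemma ev_nbf_upd0:
 assumes "eventually P (nbf n)"
 shows "\<forall>\<^sub>F z in nbf n. P (z(j:=0))"
proof -
 obtain r where r: "r > 0" "!!z. ALL i<n. abs(z i) < r ==> P z" using assms unfolding ev_nbf by blast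
 have "P (z(j:=0))" if "ALL i<n. abs(z i) < r" for z by (rule r(2)) (use that r(1) in auto)
 then show ?thesis unfolding ev_nbf using r(1) by blast
qed

lemma ev_nbf_base:
 assumes "eventually P (nbf n)"
 shows "NEAR z. P (base z)"
proof -
 obtain r where r: "r > 0" "!!z. ALL i<n. abs(z i) < r ==> P z" using assms unfolding ev_nbf by blast
 have "P (base z)" if "ALL i<2. abs(z i) < r" for z by (rule r(2)) (use that r(1) in \<open>auto simp: base_def\<close>)
 then show ?thesis unfolding ev_nbf using r(1) by blast
qed

lemma ev_nbf_mono:
 assumes "eventually P (nbf n)" "n <= n'"
 shows "eventually P (nbf n')"
proof -
 obtain r where r: "r > 0" "!!z. ALL i<n. abs(z i) < r ==> P z" using assms unfolding ev_nbf by blast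
 have "P z" if "ALL i<n'. abs(z i) < r" for z by (rule r(2)) (use that assms(2) in auto)
 then show ?thesis unfolding ev_nbf using r(1) by blast
qed

lemma germ_upd0:
 fixes f :: "fnc"
 assumes "germ n f"
 shows "germ n (%z. f (z(j:=0)))"
proof -
 have "germ n (%z. f (%i. (%i z. if i = j then 0 else z i) i z))"
 proof (rule germ_compose[OF assms])
  show "germ n (%z. if i = j then 0 else z i :: real)" if "i < n" for i
   using that by (cases "i = j") (auto intro: germ_var)
 qed simp
 then show ?thesis by (simp only: fun_upd_def)
qed

lemma germ_base:
 fixes f :: "fnc"
 assumes "germ n f"
 shows "germ 2 (%z. f (base z))"
proof -
 have "germ 2 (%z. f (%i. (%i z. if i < 2 then z i else 0) i z))"
 proof (rule germ_compose[OF assms])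
  show "germ 2 (%z. if i < 2 then z i else 0 :: real)" if "i < n" for i
   by (cases "i < 2") (auto intro: germ_var)
 qed simp
 then show ?thesis by (simp only: base_def)
qed

section \<open>Divisibility by the source coordinates\<close>

lemma pd_diff:
 fixes f g :: "fnc"
 assumes "germ n f" "germ n g" "j < n"
 shows "\<forall>\<^sub>F z in nbf n. pd j (%z. f z - g z) z = pd j f z - pd j g z"
 using germ_pd_DERIV[OF assms(1,3)] germ_pd_DERIV[OF assms(2,3)]
 by eventually_elim (intro pd_eqI DERIV_diff)

lemma pd_upd: "p ~= j ==> pd p (%z. f (z(j:=c))) z = pd p f (z(j:=c))"
 by (simp add: pd_def fun_upd_twist)

lemma pd_times_axis:
 fixes f q :: "fnc"
 assumes q: "germ n q" and j: "j < n" and e: "\<forall>\<^sub>F z in nbf n. f z = z j*q z"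
 shows "\<forall>\<^sub>F z in nbf n. pd j f (z(j:=0)) = q (z(j:=0))"
 using ev_nbf_upd0[OF pd_cong[OF e, of j], of j] ev_nbf_upd0[OF germ_pd_DERIV[OF q j], of j]
proof eventually_elim
 case (elim z)
 have d: "((%t. q (z(j:=t))) hrd pd j q (z(j:=0))) (at 0)" using elim(2) by simp
 have "((%t. t*q (z(j:=t))) hrd 1*q (z(j:=0)) + pd j q (z(j:=0))*0) (at 0)"
  by (rule DERIV_mult[OF DERIV_ident d])
 then have "pd j (%z. z j*q z) (z(j:=0)) = q (z(j:=0))" by (intro pd_eqI) simp
 with elim(1) show ?case by simp
qed

text \<open>Off the hyperplane \<open>z j = 0\<close> plain division works; on it the value of
  \<open>q\<close> is the derivative of \<open>z j * q\<close> in the direction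
  \<open>j\<close>.\<close>

lemma germ_cancel_var:
 fixes q :: "fnc"
 assumes q: "germ n q" and j: "j < n" and e: "\<forall>\<^sub>F z in nbf n. z j*q z = 0"
 shows "\<forall>\<^sub>F z in nbf n. q z = 0"
proof -
 have "\<forall>\<^sub>F z in nbf n. 0 = z j*q z" using e by eventually_elim simp
 from pd_times_axis[OF q j this] e show ?thesis
 proof eventually_elim
  case (elim z)
  have "pd j (%_. 0) (z(j:=0)) = 0" by (rule pd_eqI) simp
  then show ?case using elim by (cases "z j = 0") (auto simp: fun_upd_idem)
 qed
qed

lemma germ_vanish_axes:
 fixes f :: "fnc"
 assumes f: "germ n f" and n: "2 <= n"
  and f0: "\<forall>\<^sub>F z in nbf n. f (z(0:=0)) = 0" and f1: "\<forall>\<^sub>F z in nbf n. f (z(1:=0)) = 0"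
 shows "EX r. germ n r & (\<forall>\<^sub>F z in nbf n. f z = z 0*z 1*r z)"
proof -
 have n01: "0 < n" "1 < n" using n by auto
 obtain q where q: "germ n q" "\<forall>\<^sub>F z in nbf n. f z = f (z(0:=0)) + z 0*q z"
  using germ_division[OF f n01(1)] by blast
 obtain r where r: "germ n r" "\<forall>\<^sub>F z in nbf n. q z = q (z(1:=0)) + z 1*r z"
  using germ_division[OF q(1) n01(2)] by blast
 have e: "\<forall>\<^sub>F z in nbf n. f z = z 0*q z" using q(2) f0 by eventually_elim simp
 have "\<forall>\<^sub>F z in nbf n. f z = z 0*z 1*r z" using e r(2) ev_nbf_upd0[OF e, of 1] f1
 proof eventually_elim
  case (elim z)
  have "f z = z 0*q (z(1:=0)) + z 0*z 1*r z" unfolding elim(1) by (subst elim(2)) (simp add: algebra_simps)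
  also have "z 0*q (z(1:=0)) = f (z(1:=0))" using elim(3) by simp
  finally show ?case unfolding elim(4) by simp
 qed
 then show ?thesis using r(1) by blast
qed

lemma germ_vanish_axes_twice:
 fixes f :: "fnc"
 assumes f: "germ n f" and n: "2 <= n"
  and f0: "\<forall>\<^sub>F z in nbf n. f (z(0:=0)) = 0" and f1: "\<forall>\<^sub>F z in nbf n. f (z(1:=0)) = 0"
  and d0: "\<forall>\<^sub>F z in nbf n. pd 0 f (z(0:=0)) = 0" and d1: "\<forall>\<^sub>F z in nbf n. pd 1 f (z(1:=0)) = 0"
 shows "EX r. germ n r & (\<forall>\<^sub>F z in nbf n. f z = (z 0)^2*(z 1)^2*r z)"
proof -
 have n01: "0 < n" "1 < n" using n by auto
 obtain r where r: "germ n r" "\<forall>\<^sub>F z in nbf n. f z = z 0*z 1*r z"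
  using germ_vanish_axes[OF f n f0 f1] by blast
 have e: "\<forall>\<^sub>F z in nbf n. f z = z 0*(z 1*r z)" "\<forall>\<^sub>F z in nbf n. f z = z 1*(z 0*r z)"
  using r(2) by (eventually_elim, simp)+
 have g: "germ n (%z. z 1*r z)" "germ n (%z. z 0*r z)"
  using n01 r(1) by (auto intro!: germ_mult germ_var)
 have "\<forall>\<^sub>F z in nbf n. z 1*r (z(0:=0)) = 0" using pd_times_axis[OF g(1) n01(1) e(1)] d0 by eventually_elim simp
 then have r0: "\<forall>\<^sub>F z in nbf n. r (z(0:=0)) = 0" by (rule germ_cancel_var[OF germ_upd0[OF r(1)] n01(2)])
 have "\<forall>\<^sub>F z in nbf n. z 0*r (z(1:=0)) = 0" using pd_times_axis[OF g(2) n01(2) e(2)] d1 by eventually_elim simp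
 then have r1: "\<forall>\<^sub>F z in nbf n. r (z(1:=0)) = 0" by (rule germ_cancel_var[OF germ_upd0[OF r(1)] n01(1)])
 obtain s where s: "germ n s" "\<forall>\<^sub>F z in nbf n. r z = z 0*z 1 * s z"
  using germ_vanish_axes[OF r(1) n r0 r1] by blast
 have "\<forall>\<^sub>F z in nbf n. f z = (z 0)^2*(z 1)^2 * s z"
  using r(2) s(2) by eventually_elim (simp add: power2_eq_square)
 then show ?thesis using s(1) by blast
qed

text \<open>Maps of this form fix both axes pointwise. Harmonic germs are prescribed by their values
  on the axes, so such a change leaves the data untouched. The coordinates from 2 on are set to
  zero, which keeps the result in the source plane.\<close>

definition axmap :: "(fnc) => (fnc) => (pnt) => pnt" where
 "axmap a b z k = (if k = 0 then z 0*(1 + z 1*a (base z)) else if k = 1 then z 1*(1 + z 0*b (base z)) else 0)"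

lemma axmap_simps: "axmap a b (base z) = axmap a b z" "base (axmap a b z) = axmap a b z" "axmap a b (%_. 0) k = 0"
 by (simp_all add: axmap_def fun_eq_iff base_def[of "axmap a b z"])

lemma germ_axmap:
 assumes "germ 2 a" "germ 2 b"
 shows "germ 2 (%z. axmap a b z k)"
proof -
 have gv: "germ 2 (%z. z 0)" "germ 2 (%z. z 1)" by (intro germ_var; simp)+
 have g: "germ 2 (%z. z 0*(1 + z 1*a (base z)))" "germ 2 (%z. z 1*(1 + z 0*b (base z)))"
  by (intro germ_mult germ_add germ_const gv germ_base[OF assms(1)] germ_base[OF assms(2)])+
 consider "k = 0" | "k = 1" | "2 <= k" by linarith
 then show ?thesis using g by cases (simp_all add: axmap_def)
qed

lemma axmap_right_inverse:
 assumes a: "germ 2 a" and b: "germ 2 b"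
 shows "EX al be. germ 2 al & germ 2 be & (NEAR z. axmap a b (axmap al be z) = base z)"
proof -
 define w where "w k u = (if k = 0 then u 0*(1 + u 2) else if k = 1 then u 1*(1 + u 3) else 0)"
  for k :: nat and u :: "pnt"
 \<comment> \<open>With \<open>A = 1 + y Y0\<close> and \<open>B = 1 + x Y1\<close> the inverse
   property reads \<open>A (1 + y B a) = 1\<close> and \<open>B (1 + x A b) = 1\<close>, that is
   \<open>Y0 = - A B a\<close> and \<open>Y1 = - A B b\<close>. The unknowns occur only as
   \<open>y Y0\<close> and \<open>x Y1\<close>, the form that \<open>germ_implicit\<close>
   accepts.\<close>
 define Ps where "Ps k u = - ((1 + u 2)*(1 + u 3)*(if k = 0 then a else b) (%i. w i u))" for k :: nat and u :: "pnt"
 have gv: "germ 4 (%z. z 0)" "germ 4 (%z. z 1)" "germ 4 (%z. z 2)" "germ 4 (%z. z 3)"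
  by (intro germ_var; simp)+
 have gw: "germ 4 (w k)" for k
 proof -
  have g: "germ 4 (%u. u 0*(1 + u 2))" "germ 4 (%u. u 1*(1 + u 3))"
   by (intro germ_mult germ_add germ_const gv)+
  consider "k = 0" | "k = 1" | "2 <= k" by linarith
  then show ?thesis by cases (use g in \<open>simp_all add: w_def[abs_def]\<close>)
 qed
 have "germ 4 (%u. a (%i. w i u))" "germ 4 (%u. b (%i. w i u))"
  by (rule germ_compose[OF a gw], simp add: w_def) (rule germ_compose[OF b gw], simp add: w_def)
 then have gk: "germ 4 (%u. (if k = 0 then a else b) (%i. w i u))" for k :: nat
  by (cases "k = 0") simp_all
 have "germ 4 (Ps k)" for k
  unfolding Ps_def[abs_def] by (intro germ_minus germ_mult germ_add germ_const gv gk)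
 then have gPs: "germ (2 + 2) (Ps k)" for k by simp
 have "EX Y. (ALL k<2. germ 2 (Y k)) &
  (NEAR z. ALL k<2. Y k z = Ps k (%i. if i < 2 then z i else z (1 - (i - 2))*Y (i - 2) z))"
  by (rule germ_implicit[where sg = "%k. 1 - k", OF gPs]) simp
 then obtain Y where gY: "ALL k<2. germ 2 (Y k)"
  and eY: "NEAR z. ALL k<2. Y k z = Ps k (%i. if i < 2 then z i else z (1 - (i - 2))*Y (i - 2) z)"
  by blast
 have Y: "germ 2 (Y 0)" "germ 2 (Y 1)" using gY by simp_all
 have "NEAR z. axmap a b (axmap (Y 0) (Y 1) z) = base z"
  using ev_nbf_base[OF eY]
 proof eventually_elim
  case (elim z)
  define A B where "A = 1 + z 1*Y 0 (base z)" and "B = 1 + z 0*Y 1 (base z)"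
  let ?W = "axmap (Y 0) (Y 1) z"
  let ?u = "%i. if i < 2 then base z i else base z (1 - (i - 2))*Y (i - 2) (base z)"
  have u: "?u 0 = z 0" "?u 1 = z 1" "?u 2 = z 1*Y 0 (base z)" "?u 3 = z 0*Y 1 (base z)" by simp_all
  have w: "(%i. w i ?u) = ?W"
  proof
   fix i
   show "w i ?u = ?W i" unfolding w_def u by (simp add: axmap_def)
  qed
  have y: "Y 0 (base z) = - (A*B*a ?W)" "Y 1 (base z) = - (A*B*b ?W)"
   using elim[rule_format, of 0] elim[rule_format, of 1] unfolding Ps_def w u A_def B_def by simp_all
  have W: "?W 0 = z 0*A" "?W 1 = z 1*B" by (simp_all add: axmap_def A_def B_def)
  have A1: "A*(1 + z 1*B*a ?W) = 1"
  proof -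
   have "A*(1 + z 1*B*a ?W) = A - z 1*(- (A*B*a ?W))" by (simp add: algebra_simps)
   also have "\<dots> = 1" unfolding y(1)[symmetric] by (simp add: A_def)
   finally show ?thesis .
  qed
  have B1: "B*(1 + z 0*A*b ?W) = 1"
  proof -
   have "B*(1 + z 0*A*b ?W) = B - z 0*(- (A*B*b ?W))" by (simp add: algebra_simps)
   also have "\<dots> = 1" unfolding y(2)[symmetric] by (simp add: B_def)
   finally show ?thesis .
  qed
  show ?case
  proof
   fix k :: nat
   consider "k = 0" | "k = 1" | "2 <= k" by linarith
   then show "axmap a b ?W k = base z k"
   proof cases
    case 1
    have "axmap a b ?W 0 = z 0*(A*(1 + z 1*B*a ?W))"
     unfolding axmap_def[of a b ?W] axmap_simps W by (simp add: mult_ac)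
    then show ?thesis using 1 A1 by simp
   next
    case 2
    have "axmap a b ?W 1 = z 1*(B*(1 + z 0*A*b ?W))"
     unfolding axmap_def[of a b ?W] axmap_simps W by (simp add: mult_ac)
    then show ?thesis using 2 B1 by simp
   qed (simp add: axmap_def base_def)
  qed
 qed
 then show ?thesis using Y by blast
qed

text \<open>A right inverse has a right inverse of its own, which must be the original map; so the
  one-sided construction is enough.\<close>

lemma axmap_inverse:
 assumes a: "germ 2 a" and b: "germ 2 b"
 shows "EX al be. germ 2 al & germ 2 be &
  (NEAR z. axmap a b (axmap al be z) = base z & axmap al be (axmap a b z) = base z)"
proof -
 obtain al be where g: "germ 2 al" "germ 2 be"
  and e: "NEAR z. axmap a b (axmap al be z) = base z" using axmap_right_inverse[OF a b] by blast
 obtain al' be' where g': "germ 2 al'" "germ 2 be'"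
  and e': "NEAR z. axmap al be (axmap al' be' z) = base z" using axmap_right_inverse[OF g] by blast
 have "NEAR z. axmap a b (axmap al be (%i. axmap al' be' z i)) = base (%i. axmap al' be' z i)"
  by (rule ev_nbf_map[OF _ _ e]) (auto simp: axmap_simps intro: germ_axmap g')
 with e e' have "NEAR z. axmap a b (axmap al be z) = base z & axmap al be (axmap a b z) = base z"
  by eventually_elim (simp add: axmap_simps)
 then show ?thesis using g by blast
qed

text \<open>Since \<open>(x (1 + y a))^2\<close> starts with \<open>x^2 + 2 x^2 y a\<close>, the
  choice \<open>a = y R1 / 2\<close> produces the wanted term. What it creates in higher order is
  again divisible by \<open>x^2 y^2\<close>, with a quotient that has a further factor
  \<open>y\<close> (for the other component \<open>x\<close>), so the correction is found by
  \<open>germ_implicit\<close>.\<close>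

lemma I22_absorb:
 assumes lm: "1 <= l" "1 <= m" and R: "germ 2 R1" "germ 2 R2"
 shows "EX a b. germ 2 a & germ 2 b &
  (NEAR z. ALL i<2. I22v l m i (axmap a b z) = I22v l m i z + (z 0)^2*(z 1)^2*(if i = 0 then R1 (base z) else R2 (base z)))"
proof -
 define P Q where "P u = R1 (base u) / 2 + u 2" and "Q u = R2 (base u) / 2 + u 3" for u :: "pnt"
 \<comment> \<open>\<open>S k t\<close> is \<open>((1 + t)^(2 k + 1) - 1) / t\<close>, written as a
   geometric sum.\<close>
 define S where "S k t = (\<Sum>i<2 * k + 1. (1 + t) ^ i)" for k and t :: real
 have S: "(1 + t) ^ (2 * k + 1) = 1 + t*S k t" for k t
  using power_diff_1_eq[of "1 + t" "2 * k + 1"] by (simp add: S_def algebra_simps)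
 define Ps where "Ps k u = (if k = 0 then - (u 1*(P u)^2 + u 1 ^ (2*l - 2)*Q u*S l ((u 0)^2*Q u)) / 2
  else - (u 0*(Q u)^2 + u 0 ^ (2*m - 2)*P u*S m ((u 1)^2*P u)) / 2)" for k :: nat and u :: "pnt"
 have gv: "germ 4 (%z. z 0)" "germ 4 (%z. z 1)" "germ 4 (%z. z 2)" "germ 4 (%z. z 3)"
  by (intro germ_var; simp)+
 have "germ 4 (%u. R1 (base u))" "germ 4 (%u. R2 (base u))"
  by (rule germ_lift[OF germ_base[OF R(1)]], simp) (rule germ_lift[OF germ_base[OF R(2)]], simp)
 note gR = this
 have gPQ: "germ 4 P" "germ 4 Q"
  unfolding P_def[abs_def] Q_def[abs_def] by (intro germ_add germ_divide_const gv gR)+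
 have gPs: "germ (2 + 2) (Ps k)" for k
  unfolding Ps_def[abs_def] S_def
  by (cases "k = 0"; simp; intro germ_divide_const germ_minus germ_diff germ_add germ_mult germ_power
    germ_sum germ_const gv[unfolded One_nat_def] gPQ)
 have "EX Y. (ALL k<2. germ 2 (Y k)) &
  (NEAR z. ALL k<2. Y k z = Ps k (%i. if i < 2 then z i else z (1 - (i - 2))*Y (i - 2) z))"
  by (rule germ_implicit[where sg = "%k. 1 - k", OF gPs]) simp
 then obtain Y where gY: "ALL k<2. germ 2 (Y k)"
  and eY: "NEAR z. ALL k<2. Y k z = Ps k (%i. if i < 2 then z i else z (1 - (i - 2))*Y (i - 2) z)"
  by blast
 have Y: "germ 2 (Y 0)" "germ 2 (Y 1)" using gY by simp_all
 define a b where "a z = z 1*(R1 z / 2 + z 1*Y 0 z)" and "b z = z 0*(R2 z / 2 + z 0*Y 1 z)" for z :: "pnt"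
 have gv2: "germ 2 (%z. z 0)" "germ 2 (%z. z 1)" by (intro germ_var; simp)+
 have gab: "germ 2 a" "germ 2 b"
  unfolding a_def[abs_def] b_def[abs_def]
  by (intro germ_mult germ_add germ_divide_const gv2 R Y)+
 have key: "(x*(1 + y*(y*p)))^2 + (y*(1 + x*(x*q))) ^ (2 * k + 1) = x^2 + y ^ (2 * k + 1) + x^2*y^2*r"
  if p: "p = r / 2 + y*w" and w: "w = - (y*p^2 + y ^ (2 * k - 2)*q*S k (x^2*q)) / 2" and k: "1 <= k"
  for x y p q r w :: real and k
 proof -
  define s where "s = S k (x^2*q)"
  have yk: "y ^ (2 * k + 1) = y^2*(y*y ^ (2 * k - 2))"
  proof -
   have "2 * k + 1 = 2 + (1 + (2 * k - 2))" using k by simp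
   then show ?thesis by (simp only: power_add power_one_right)
  qed
  have "(y*(1 + x*(x*q))) ^ (2 * k + 1) = y ^ (2 * k + 1)*(1 + x^2*q) ^ (2 * k + 1)"
   by (simp only: power_mult_distrib power2_eq_square mult.assoc)
  also have "\<dots> = y ^ (2 * k + 1) + x^2*q * s*y ^ (2 * k + 1)"
   unfolding S s_def[symmetric] by (simp only: distrib_left mult_1_right mult_ac)
  also have "x^2*q * s*y ^ (2 * k + 1) = x^2*y^2*(y*y ^ (2 * k - 2)*q * s)"
   unfolding yk by (simp only: mult_ac)
  finally have 1: "(y*(1 + x*(x*q))) ^ (2 * k + 1) = y ^ (2 * k + 1) + x^2*y^2*(y*y ^ (2 * k - 2)*q * s)" .
  have 2: "(x*(1 + y*(y*p)))^2 = x^2 + x^2*y^2*(2*p + y^2*p^2)"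
   by (simp add: power2_eq_square algebra_simps)
  have "2*w = - (y*p^2 + y ^ (2 * k - 2)*q * s)" using w by (simp add: s_def)
  then have "2*(y*w) = - (y^2*p^2 + y*y ^ (2 * k - 2)*q * s)"
   using arg_cong[of "2*w" "- (y*p^2 + y ^ (2 * k - 2)*q * s)" "(*) y"] by (simp add: power2_eq_square algebra_simps)
  then have 3: "2*p + y^2*p^2 + y*y ^ (2 * k - 2)*q * s = r" using p by linarith
  have "x^2*y^2*r = x^2*y^2*(2*p + y^2*p^2) + x^2*y^2*(y*y ^ (2 * k - 2)*q * s)"
   unfolding 3[symmetric] by (simp only: distrib_left)
  then show ?thesis unfolding 1 2 by linarith
 qed
 have "NEAR z. ALL i<2. I22v l m i (axmap a b z) = I22v l m i z + (z 0)^2*(z 1)^2*(if i = 0 then R1 (base z) else R2 (base z))"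
  using ev_nbf_base[OF eY]
 proof eventually_elim
  case (elim z)
  let ?u = "%i. if i < 2 then base z i else base z (1 - (i - 2))*Y (i - 2) (base z)"
  have u: "?u 0 = z 0" "?u 1 = z 1" "?u 2 = z 1*Y 0 (base z)" "?u 3 = z 0*Y 1 (base z)" by simp_all
  have bu: "base ?u = base z" by (auto simp: base_def)
  define p q where "p = P ?u" and "q = Q ?u"
  have pq: "p = R1 (base z) / 2 + z 1*Y 0 (base z)" "q = R2 (base z) / 2 + z 0*Y 1 (base z)"
   unfolding p_def q_def P_def Q_def bu u by simp_all
  have y0: "Y 0 (base z) = - (z 1*p^2 + z 1 ^ (2*l - 2)*q*S l ((z 0)^2*q)) / 2"
   using elim[rule_format, of 0] unfolding Ps_def p_def[symmetric] q_def[symmetric] u by simp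
  have y1: "Y 1 (base z) = - (z 0*q^2 + z 0 ^ (2*m - 2)*p*S m ((z 1)^2*p)) / 2"
   using elim[rule_format, of 1] unfolding Ps_def p_def[symmetric] q_def[symmetric] u by simp
  have ab: "axmap a b z 0 = z 0*(1 + z 1*(z 1*p))" "axmap a b z 1 = z 1*(1 + z 0*(z 0*q))"
   by (simp_all add: axmap_def a_def b_def pq)
  have "I22v l m 0 (axmap a b z) = I22v l m 0 z + (z 0)^2*(z 1)^2*R1 (base z)"
   using key[OF pq(1) y0 lm(1)] unfolding I22v_def ab by simp
  moreover have "I22v l m 1 (axmap a b z) = I22v l m 1 z + (z 0)^2*(z 1)^2*R2 (base z)"
   using key[OF pq(2) y1 lm(2)] unfolding I22v_def ab by (simp add: mult_ac)
  ultimately show ?case by (auto simp: less_2_cases_iff)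
 qed
 then show ?thesis using gab by blast
qed

text \<open>For nonzero parameters only the values on the axes are under control, and that is
  enough. The source change fixes the axes, so on them the parameter derivatives of the transformed
  family are still the prescribed odd powers, and elsewhere they deviate by multiples of
  \<open>x y\<close>. Only the member at parameter zero has to be brought to the exact form
  \<open>I22v\<close>.\<close>

theorem harmonic_unfolding:
 assumes lm: "1 <= l" "1 <= m" and d: "d = l + m"
 shows "EX F a b al be R. (ALL i<2. germ (2 + d) (F i)) &
  (\<forall>\<^sub>F z in nbf (2 + d). ALL i<2. pd 1 (pd 0 (F i)) z = hrhs (%k. F k z) (%k. pd 0 (F k) z) (%k. pd 1 (F k) z) i) &
  germ 2 a & germ 2 b & germ 2 al & germ 2 be &
  (NEAR z. axmap a b (axmap al be z) = base z & axmap al be (axmap a b z) = base z) &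
  (NEAR z. ALL i<2. F i (base z) = I22v l m i (axmap a b z)) &
  (ALL i<2. germ (2 + d) (%z. F i (%k. if k < 2 then axmap al be z k else z k)) &
   (\<forall>\<^sub>F z in nbf (2 + d). (%z. F i (%k. if k < 2 then axmap al be z k else z k)) (base z) = I22v l m i z)) &
  (ALL q<d. ALL i<2. germ (2 + d) (R q i) & (\<forall>\<^sub>F z in nbf (2 + d).
   pd (2 + q) (%z. F i (%k. if k < 2 then axmap al be z k else z k)) (base z) = I22vel l q i z + z 0*z 1*R q i (base z)))"
proof -
 let ?n = "2 + d"
 have n: "2 <= ?n" "0 < ?n" "1 < ?n" by auto
 \<comment> \<open>Only the restrictions of \<open>W\<close> to the two axes are used as data. They
   fit together at the origin, where \<open>W\<close> is zero for all parameters.\<close>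
 define W where "W i z = I22v l m i z + (\<Sum>q<d. z (2 + q)*I22vel l q i z)" for i and z :: "pnt"
 have gW: "germ ?n (W i)" for i
  unfolding W_def[abs_def]
  by (intro germ_add germ_sum germ_mult germ_I22 n germ_var) simp
 have W00: "W i (z(0:=0, 1:=0)) = 0" "W i (z(1:=0, 0:=0)) = 0" for i z
  by (simp_all add: W_def I22v_def I22vel_def if_distrib[of "%x. _*x"] cong: if_cong)
 have W0: "W i (%_. 0) = 0" for i using W00(1)[of i "%_. 0"] by (simp add: fun_upd_idem)
 have Wb: "W i (base z) = I22v l m i z" for i z by (simp add: W_def I22v_def)
 have Wvel: "pd (2 + q) (W i) z = I22vel l q i z" if "q < d" for q i z
 proof (rule pd_eqI)
  have "W i (z(2 + q:=t)) = I22v l m i z + (\<Sum>p<d. (if p = q then t else z (2 + p))*I22vel l p i z)" for t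
   unfolding W_def by (simp add: I22v_def I22vel_def if_distrib[of "%x. x*_"] cong: if_cong sum.cong)
  moreover have "((%t. I22v l m i z + (\<Sum>p<d. (if p = q then t else z (2 + p))*I22vel l p i z)) hrd
    0 + (\<Sum>p<d. if p = q then I22vel l p i z else 0)) (at (z (2 + q)))"
   by (intro DERIV_add DERIV_const DERIV_sum) (auto intro!: derivative_eq_intros)
  ultimately show "((%t. W i (z(2 + q:=t))) hrd I22vel l q i z) (at (z (2 + q)))"
   using that by simp
 qed
 define U V where "U i z = W i (z(1:=0))" and "V i z = W i (z(0:=0))" for i and z :: "pnt"
 have ax0: "I22v l m i ((%_. 0)(0:=t)) = (if i = 0 then t\<^sup>2 else t ^ (2*m + 1))"
  and ax1: "I22v l m i ((%_. 0)(1:=t)) = (if i = 0 then t ^ (2*l + 1) else t\<^sup>2)" for i t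
  by (simp_all add: I22v_def)
 have dpow: "((%t::real. t ^ (2 * k + 1)) hrd 0) (at 0)" if "1 <= k" for k
  using DERIV_pow[of "2 * k + 1" 0] that by (simp add: power_0_left)
 have dsq: "((%t::real. t^2) hrd 0) (at 0)" using DERIV_pow[of 2 0] by simp
 have dax: "((%t. I22v l m i ((%_. 0)(0:=t))) hrd 0) (at 0)"
  "((%t. I22v l m i ((%_. 0)(1:=t))) hrd 0) (at 0)" for i
  unfolding ax0 ax1 using dpow[OF lm(1)] dpow[OF lm(2)] dsq by (cases "i = 0"; simp)+
 have upd0: "((%_::nat. 0)(0:=t))(1:=0) = (%_. 0)(0:=t)" "((%_::nat. 0)(1:=t))(0:=0) = (%_. 0)(1:=t)"
  "base ((%_. 0)(0:=t)) = (%_. 0)(0:=t)" "base ((%_. 0)(1:=t)) = (%_. 0)(1:=t)" for t :: real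
  by (auto simp: base_def fun_eq_iff)
 have Wax: "W i ((%_. 0)(0:=t)) = I22v l m i ((%_. 0)(0:=t))" "W i ((%_. 0)(1:=t)) = I22v l m i ((%_. 0)(1:=t))" for i t
  using Wb[of i "(%_. 0)(0:=t)"] Wb[of i "(%_. 0)(1:=t)"] unfolding upd0 by simp_all
 have pU: "pd 0 (U i) (%_. 0) = 0" for i by (rule pd_eqI) (use dax(1)[of i] in \<open>simp only: U_def upd0 Wax\<close>)
 have pV: "pd 1 (V i) (%_. 0) = 0" for i by (rule pd_eqI) (use dax(2)[of i] in \<open>simp only: V_def upd0 Wax\<close>)
 have gU: "germ ?n (U i)" and gV: "germ ?n (V i)" for i
  unfolding U_def[abs_def] V_def[abs_def] by (intro germ_upd0 gW)+
 have "EX F. (ALL i<2. germ ?n (F i)) & (\<forall>\<^sub>F z in nbf ?n. ALL i<2.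
   pd 1 (pd 0 (F i)) z = (%i u. hrhs (%k. u k) (%k. u (k + 2)) (%k. u (k + 4)) i) i (jet1 F z) &
   pd 0 (pd 1 (F i)) z = (%i u. hrhs (%k. u k) (%k. u (k + 2)) (%k. u (k + 4)) i) i (jet1 F z) &
   F i (z(1:=0)) = U i z + V i (z(1:=0)) & F i (z(0:=0)) = U i (z(0:=0)) + V i z)"
 proof (rule analytic_goursat[OF n(1)])
  show "U i (z(1:=t)) = U i z" "V i (z(0:=t)) = V i z" for i z t by (simp_all add: U_def V_def)
  show "U i (%_. 0) = 0" "V i (%_. 0) = 0" for i using W0 by (simp_all add: U_def V_def fun_upd_idem)
 qed (use gU gV pU pV germ_hrhs in auto)
 then obtain F where gF: "!!i. i < 2 ==> germ ?n (F i)"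
  and eF: "\<forall>\<^sub>F z in nbf ?n. ALL i<2.
   pd 1 (pd 0 (F i)) z = hrhs (%k. jet1 F z k) (%k. jet1 F z (k + 2)) (%k. jet1 F z (k + 4)) i &
   pd 0 (pd 1 (F i)) z = hrhs (%k. jet1 F z k) (%k. jet1 F z (k + 2)) (%k. jet1 F z (k + 4)) i &
   F i (z(1:=0)) = U i z + V i (z(1:=0)) & F i (z(0:=0)) = U i (z(0:=0)) + V i z"
  by force
 have jet: "hrhs (%k. jet1 F z k) (%k. jet1 F z (k + 2)) (%k. jet1 F z (k + 4)) i
   = hrhs (%k. F k z) (%k. pd 0 (F k) z) (%k. pd 1 (F k) z) i" if "i < 2" for z i
  using that by (auto simp: hrhs_def jet1_def)
 have harm: "\<forall>\<^sub>F z in nbf ?n. ALL i<2. pd 1 (pd 0 (F i)) z = hrhs (%k. F k z) (%k. pd 0 (F k) z) (%k. pd 1 (F k) z) i &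
   pd 0 (pd 1 (F i)) z = hrhs (%k. F k z) (%k. pd 0 (F k) z) (%k. pd 1 (F k) z) i"
  using eF
 proof eventually_elim
  case (elim z)
  show ?case
  proof (intro allI impI)
   fix i :: nat assume "i < 2"
   then show "pd 1 (pd 0 (F i)) z = hrhs (%k. F k z) (%k. pd 0 (F k) z) (%k. pd 1 (F k) z) i &
     pd 0 (pd 1 (F i)) z = hrhs (%k. F k z) (%k. pd 0 (F k) z) (%k. pd 1 (F k) z) i"
    using elim jet[of i z] by simp
  qed
 qed
 have bd: "\<forall>\<^sub>F z in nbf ?n. ALL i<2. F i (z(1:=0)) = W i (z(1:=0)) & F i (z(0:=0)) = W i (z(0:=0))"
  using eF by eventually_elim (simp add: U_def V_def W00[unfolded One_nat_def])
 define f where "f i z = F i (base z)" for i and z :: "pnt"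
 have gf: "germ 2 (f i)" if "i < 2" for i unfolding f_def[abs_def] by (rule germ_base[OF gF[OF that]])
 have pf: "pd j (f i) = (%z. pd j (F i) (base z))" if "j < 2" for i j
  unfolding f_def[abs_def] by (rule ext) (rule pd_base[OF that, symmetric])
 have ppf: "pd k (pd j (f i)) z = pd k (pd j (F i)) (base z)" if "j < 2" "k < 2" for i j k z
  unfolding pf[OF that(1)] by (rule pd_base[OF that(2), symmetric])
 have bdf: "NEAR z. ALL i<2. f i (z(1:=0)) = I22v l m i (z(1:=0)) & f i (z(0:=0)) = I22v l m i (z(0:=0))"
  using ev_nbf_base[OF bd]
  by eventually_elim (simp add: f_def base_upd Wb[symmetric] del: One_nat_def)
 have harmf: "NEAR z. ALL i<2. pd 1 (pd 0 (f i)) z = hrhs (%k. f k z) (%k. pd 1 (f k) z) (%k. pd 0 (f k) z) i &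
   pd 0 (pd 1 (f i)) z = hrhs (%k. f k z) (%k. pd 0 (f k) z) (%k. pd 1 (f k) z) i"
  using ev_nbf_base[OF harm]
 proof eventually_elim
  case (elim z)
  have p: "pd 1 (pd 0 (f i)) z = pd 1 (pd 0 (F i)) (base z)" "pd 0 (pd 1 (f i)) z = pd 0 (pd 1 (F i)) (base z)"
   "pd 0 (f i) z = pd 0 (F i) (base z)" "pd 1 (f i) z = pd 1 (F i) (base z)" for i
   using pf[of 0 i] pf[of 1 i] ppf[of 0 1 i z] ppf[of 1 0 i z] by simp_all
  show ?case unfolding p f_def using elim hrhs_commute[of _ "%k. pd 1 (F k) (base z)"] by simp
 qed
 have gpf: "germ 2 (pd j (f i))" if "i < 2" "j < 2" for i j
  by (rule germ_chain(2)[OF gf[OF that(1)] that(2)])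
 have f0: "f i (%_. 0) = 0" if "i < 2" for i
  using ev_nbf_at_0[OF bdf] that by (auto simp: fun_upd_idem I22v_def)
 have pf0: "pd 0 (f i) (%_. 0) = 0" "pd 1 (f i) (%_. 0) = 0" if i: "i < 2" for i
 proof -
  obtain dl where dl: "dl > 0" "!!t. abs(t) < dl ==> f i ((%_. 0)(0:=t)) = I22v l m i ((%_. 0)(0:=t))"
   using ev_nbf_axis[OF bdf, of 0] i unfolding upd0 by blast
  obtain dl' where dl': "dl' > 0" "!!t. abs(t) < dl' ==> f i ((%_. 0)(1:=t)) = I22v l m i ((%_. 0)(1:=t))"
   using ev_nbf_axis[OF bdf, of 1] i unfolding upd0 by blast
  have "\<forall>\<^sub>F t in nhds 0. f i ((%_. 0)(0:=t)) = I22v l m i ((%_. 0)(0:=t))"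
   unfolding eventually_nhds_metric using dl by (intro exI[of _ dl]) (auto simp: dist_real_def)
  from DERIV_cong_ev[OF refl this refl] show "pd 0 (f i) (%_. 0) = 0" by (intro pd_eqI) (use dax(1)[of i] in simp)
  have "\<forall>\<^sub>F t in nhds 0. f i ((%_. 0)(1:=t)) = I22v l m i ((%_. 0)(1:=t))"
   unfolding eventually_nhds_metric using dl' by (intro exI[of _ dl']) (auto simp: dist_real_def)
  from DERIV_cong_ev[OF refl this refl] show "pd 1 (f i) (%_. 0) = 0" by (intro pd_eqI) (use dax(2)[of i] in simp)
 qed
 have axis0: "NEAR z. ALL i<2. pd 0 (f i) (z(0:=0)) = 0"
 proof -
  have "EX dl>0. ALL t. abs(t) < dl --> (ALL i<2. (%i. pd 0 (f i)) i ((%_. 0)(1:=t)) = 0)"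
  proof (rule harmonic_axis_vanish[of 2 f "%i. pd 1 (f i)"])
   show "NEAR z. ALL i<2. pd 1 (pd 0 (f i)) z = hrhs (%k. f k z) (%k. pd 1 (f k) z) (%k. pd 0 (f k) z) i"
    using harmf by eventually_elim blast
  qed (use gf gpf f0 pf0 in auto)
  then obtain dl where dl: "dl > 0" "!!t i. abs(t) < dl ==> i < 2 ==> pd 0 (f i) ((%_. 0)(1:=t)) = 0" by blast
  have "pd 0 (f i) (z(0:=0)) = 0" if "ALL i<2. abs(z i) < dl" "i < 2" for z i
  proof -
   have "base (z(0:=0)) = base ((%_. 0)(1:=z 1))" by (auto simp: base_def)
   moreover have "abs(z 1) < dl" using that by simp
   ultimately show ?thesis using dl(2)[OF _ that(2), of "z 1"] by (simp add: pf)
  qed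
  then show ?thesis unfolding ev_nbf using dl(1) by blast
 qed
 have axis1: "NEAR z. ALL i<2. pd 1 (f i) (z(1:=0)) = 0"
 proof -
  have "EX dl>0. ALL t. abs(t) < dl --> (ALL i<2. (%i. pd 1 (f i)) i ((%_. 0)(0:=t)) = 0)"
  proof (rule harmonic_axis_vanish[of 2 f "%i. pd 0 (f i)"])
   show "NEAR z. ALL i<2. pd 0 (pd 1 (f i)) z = hrhs (%k. f k z) (%k. pd 0 (f k) z) (%k. pd 1 (f k) z) i"
    using harmf by eventually_elim blast
  qed (use gf gpf f0 pf0 in auto)
  then obtain dl where dl: "dl > 0" "!!t i. abs(t) < dl ==> i < 2 ==> pd 1 (f i) ((%_. 0)(0:=t)) = 0" by blast
  have "pd 1 (f i) (z(1:=0)) = 0" if "ALL i<2. abs(z i) < dl" "i < 2" for z i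
  proof -
   have "base (z(1:=0)) = base ((%_. 0)(0:=z 0))" by (auto simp: base_def)
   moreover have "abs(z 0) < dl" using that by simp
   ultimately show ?thesis using dl(2)[OF _ that(2), of "z 0"] by (simp add: pf del: One_nat_def)
  qed
  then show ?thesis unfolding ev_nbf using dl(1) by blast
 qed
 have "EX r. germ 2 r & (NEAR z. f i z - I22v l m i z = (z 0)^2*(z 1)^2*r z)" if i: "i < 2" for i
 proof (rule germ_vanish_axes_twice[where f = "%z. f i z - I22v l m i z"])
  have gI: "germ 2 (I22v l m i)" by (rule germ_I22) simp
  show "germ 2 (%z. f i z - I22v l m i z)" by (intro germ_diff gf i gI)
  show "NEAR z. f i (z(0:=0)) - I22v l m i (z(0:=0)) = 0" "NEAR z. f i (z(1:=0)) - I22v l m i (z(1:=0)) = 0"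
   using bdf by (eventually_elim, use i in simp)+
  have pI: "pd 0 (I22v l m i) (z(0:=0)) = 0" "pd 1 (I22v l m i) (z(1:=0)) = 0" for z
   using i lm pd_I22v by (auto simp: less_2_cases_iff)
  have lt2: "0 < (2::nat)" "1 < (2::nat)" by simp_all
  have PD: "NEAR z. pd j (%z. f i z - I22v l m i z) (z(j:=0)) = pd j (f i) (z(j:=0)) - pd j (I22v l m i) (z(j:=0))"
   if "j < 2" for j using ev_nbf_upd0[OF pd_diff[OF gf[OF i] gI that]] .
  show "NEAR z. pd 0 (%z. f i z - I22v l m i z) (z(0:=0)) = 0"
   using PD[OF lt2(1)] axis0 by eventually_elim (simp add: i pI)
  show "NEAR z. pd 1 (%z. f i z - I22v l m i z) (z(1:=0)) = 0"
   using PD[OF lt2(2)] axis1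
   by eventually_elim (simp add: i pI[unfolded One_nat_def])
 qed simp
 from this[of 0] this[of 1] obtain r0 r1 where r: "germ 2 r0" "germ 2 r1"
  "NEAR z. f 0 z - I22v l m 0 z = (z 0)^2*(z 1)^2*r0 z"
  "NEAR z. f 1 z - I22v l m 1 z = (z 0)^2*(z 1)^2*r1 z" by auto
 obtain a b where ab: "germ 2 a" "germ 2 b" "NEAR z. ALL i<2. I22v l m i (axmap a b z) =
   I22v l m i z + (z 0)^2*(z 1)^2*(if i = 0 then r0 (base z) else r1 (base z))"
  using I22_absorb[OF lm r(1,2)] by blast
 have Fb: "NEAR z. ALL i<2. F i (base z) = I22v l m i (axmap a b z)"
  using ab(3) ev_nbf_base[OF r(3)] ev_nbf_base[OF r(4)]
 proof eventually_elim
  case (elim z)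
  have "I22v l m i (base z) = I22v l m i z" for i by (simp add: I22v_def)
  then show ?case using elim by (auto simp: less_2_cases_iff f_def)
 qed
 obtain al be where albe: "germ 2 al" "germ 2 be"
  and inv: "NEAR z. axmap a b (axmap al be z) = base z & axmap al be (axmap a b z) = base z"
  using axmap_inverse[OF ab(1,2)] by blast
 define Ft where "Ft i z = F i (%k. if k < 2 then axmap al be z k else z k)" for i and z :: "pnt"
 have gFt: "germ ?n (Ft i)" if "i < 2" for i
  unfolding Ft_def[abs_def]
 proof (rule germ_compose[OF gF[OF that], where g = "%k z. if k < 2 then axmap al be z k else z k"])
  show "germ ?n (%z. if k < 2 then axmap al be z k else z k)" if "k < ?n" for k
  proof (cases "k < 2")
   case True
   then show ?thesis using germ_lift[OF germ_axmap[OF albe, of k] n(1)] by simp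
  next
   case False
   then show ?thesis using germ_var[OF that] by simp
  qed
 qed (simp add: axmap_simps)
 have Ftb: "\<forall>\<^sub>F z in nbf ?n. Ft i (base z) = I22v l m i z" if "i < 2" for i
 proof -
  have "NEAR z. ALL i<2. F i (base (%k. axmap al be z k)) = I22v l m i (axmap a b (%k. axmap al be z k))"
   by (rule ev_nbf_map[OF _ _ Fb]) (auto simp: axmap_simps intro: germ_axmap albe)
  with inv have "NEAR z. Ft i (base z) = I22v l m i z"
  proof eventually_elim
   case (elim z)
   have "(%k. if k < 2 then axmap al be (base z) k else base z k) = axmap al be z"
    by (auto simp: axmap_def)
   then have "Ft i (base z) = F i (axmap al be z)" by (simp only: Ft_def)
   also have "\<dots> = I22v l m i (axmap a b (axmap al be z))" using elim(2) that by (simp add: axmap_simps)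
   also have "\<dots> = I22v l m i z" using elim(1) by (simp add: I22v_def)
   finally show ?case .
  qed
  then show ?thesis by (rule ev_nbf_mono) simp
 qed
 have ax: "Ft i (z(0:=0)) = F i (z(0:=0))" "Ft i (z(1:=0)) = F i (z(1:=0))" for i z
 proof -
  have "(%k. if k < 2 then axmap al be (z(0:=0)) k else (z(0:=0)) k) = z(0:=0)"
   "(%k. if k < 2 then axmap al be (z(1:=0)) k else (z(1:=0)) k) = z(1:=0)"
   by (auto simp: axmap_def fun_eq_iff less_2_cases_iff)
  then show "Ft i (z(0:=0)) = F i (z(0:=0))" "Ft i (z(1:=0)) = F i (z(1:=0))" by (simp_all only: Ft_def)
 qed
 have "EX R. germ ?n R & (\<forall>\<^sub>F z in nbf ?n. pd (2 + q) (Ft i) (base z) = I22vel l q i z + z 0*z 1*R (base z))"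
  if q: "q < d" and i: "i < 2" for q i
 proof -
  let ?D = "%z. pd (2 + q) (Ft i) z - I22vel l q i z"
  have vj: "\<forall>\<^sub>F z in nbf ?n. ?D (z(j:=0)) = 0" if e: "\<forall>\<^sub>F z in nbf ?n. Ft i (z(j:=0)) = W i (z(j:=0))" and j: "j < 2" for j
   using pd_cong[OF e, of "2 + q"]
  proof eventually_elim
   case (elim z)
   have "2 + q ~= j" using j by simp
   from elim show ?case unfolding pd_upd[OF \<open>2 + q \<noteq> j\<close>] Wvel[OF q] by simp
  qed
  have gD: "germ ?n ?D"
   by (intro germ_diff germ_I22 n germ_chain(2)[OF gFt[OF i]]) (use q in simp)
  have "EX r. germ ?n r & (\<forall>\<^sub>F z in nbf ?n. ?D z = z 0*z 1*r z)"
  proof (rule germ_vanish_axes[OF gD n(1)])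
   show "\<forall>\<^sub>F z in nbf ?n. ?D (z(0:=0)) = 0" by (rule vj) (use bd i in \<open>auto elim!: eventually_mono simp: ax\<close>)
   show "\<forall>\<^sub>F z in nbf ?n. ?D (z(1:=0)) = 0" by (rule vj) (use bd i in \<open>auto elim!: eventually_mono simp: ax[unfolded One_nat_def]\<close>)
  qed
  then obtain r where r: "germ ?n r" "\<forall>\<^sub>F z in nbf ?n. ?D z = z 0*z 1*r z" by blast
  have "NEAR z. pd (2 + q) (Ft i) (base z) = I22vel l q i z + z 0*z 1*r (base z)"
   using ev_nbf_base[OF r(2)]
  proof eventually_elim
   case (elim z)
   have "I22vel l q i (base z) = I22vel l q i z" by (simp add: I22vel_def)
   then show ?case using elim by simp
  qed
  from ev_nbf_mono[OF this n(1)] show ?thesis using r(1) by blast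
 qed
 note ex = this
 define R where "R q i = (SOME R. germ ?n R &
   (\<forall>\<^sub>F z in nbf ?n. pd (2 + q) (Ft i) (base z) = I22vel l q i z + z 0*z 1*R (base z)))" for q i
 have R: "germ ?n (R q i) &
   (\<forall>\<^sub>F z in nbf ?n. pd (2 + q) (Ft i) (base z) = I22vel l q i z + z 0*z 1*R q i (base z))"
  if "q < d" "i < 2" for q i unfolding R_def by (rule someI_ex[OF ex[OF that]])
 have h1: "\<forall>\<^sub>F z in nbf ?n. ALL i<2. pd 1 (pd 0 (F i)) z = hrhs (%k. F k z) (%k. pd 0 (F k) z) (%k. pd 1 (F k) z) i"
  using harm by eventually_elim blast
 show ?thesis
  apply (rule exI[of _ F], rule exI[of _ a], rule exI[of _ b], rule exI[of _ al], rule exI[of _ be], rule exI[of _ R])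
  apply (intro conjI)
  using gF h1 ab(1,2) albe inv Fb gFt Ftb R unfolding Ft_def[abs_def] by blast+
qed

subsection \<open>Germs of maps of the plane\<close>

definition cmp :: "nat => real \<times> real => real" where
 "cmp i p = (if i = 0 then fst p else snd p)"

text \<open>The inverse of splitting a coordinate vector into parameters and source point, see
  \<open>zp_inv\<close>. The source coordinates come first, as in
  \<open>analytic_family\<close>.\<close>

definition zp :: "(pnt) => real \<times> real => pnt" where
 "zp s p = (%k. if k = 0 then fst p else if k = 1 then snd p else s (k - 2))"

lemma zp_simps [simp]: "zp s p 0 = fst p" "zp s p (Suc 0) = snd p" "zp s p 1 = snd p" "zp s p (Suc (Suc k)) = s k"
 "zp s p (k + 2) = s k" "zp s p (2 + k) = s k"
 by (simp_all add: zp_def)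

lemma zp_inv: "zp (%k. z (k + 2)) (z 0, z 1) = z"
proof
 fix k :: nat
 have "k - 2 + 2 = k" if "2 <= k" using that by simp
 moreover consider "k = 0" | "k = 1" | "2 <= k" by linarith
 then show "zp (%k. z (k + 2)) (z 0, z 1) k = z k"
  by cases (use calculation in \<open>auto simp: zp_def simp del: add_2_eq_Suc'\<close>)
qed

lemma zp_upd: "zp (%k. z (k + 2)) p = z(0:=fst p, 1:=snd p)"
 using zp_inv[of "z(0:=fst p, 1:=snd p)"] by simp

lemma all_less_2: "(ALL i<2. P i) \<longleftrightarrow> P 0 & P (1 :: nat)"
 by (auto simp: less_2_cases_iff)

lemma cmp_Pair [simp]: "cmp 0 (a, b) = a" "cmp 1 (a, b) = b" "cmp (Suc 0) (a, b) = b"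
 by (simp_all add: cmp_def)

lemma pair_eq_iff_cmp: "p = q \<longleftrightarrow> (ALL i<2. cmp i p = cmp i q)"
 by (simp add: all_less_2 cmp_def prod_eq_iff)

lemma cmp_linear: "cmp i (p + q) = cmp i p + cmp i q" "cmp i (p - q) = cmp i p - cmp i q" "cmp i (c *\<^sub>R p) = c*cmp i p"
 "cmp i (sum f A) = (\<Sum>x\<in>A. cmp i (f x))" "cmp i 0 = 0"
 by (simp_all add: cmp_def fst_sum snd_sum)

lemma base_zp: "base (zp s p) = zp (%_. 0) p" "zp (%_. 0) (z 0, z 1) = base z" "zp (%_. 0) (z 0, z (Suc 0)) = base z"
 by (auto simp: zp_def base_def fun_eq_iff less_2_cases_iff)

lemma zp_0 [simp]: "zp (%_. 0) 0 = (%_. 0)" "zp (%_. 0) (0, 0) = (%_. 0)"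
 by (auto simp: zp_def)

lemma germ_bounded_linear:
 assumes "bounded_linear T" "germ n f"
 shows "germ n (%z. T (f z))"
proof -
 interpret bounded_linear T by fact
 obtain c r where "r > 0" and
  s: "!!z. ALL i<n. abs(z i) < r ==> ((%al. (\<Prod>i<n. z i ^ al i) *\<^sub>R c al) has_sum f z) (multi_indices n)"
  using assms(2) unfolding analytic_germ_def by blast
 have "((%al. (\<Prod>i<n. z i ^ al i) *\<^sub>R T (c al)) has_sum T (f z)) (multi_indices n)" if "ALL i<n. abs(z i) < r" for z
  using has_sum_bounded_linear[OF assms(1) s[OF that]] by (simp add: scaleR o_def)
 then show ?thesis unfolding analytic_germ_def using \<open>r > 0\<close> by (intro exI[of _ "%al. T (c al)"] exI[of _ r]) blast
qed

lemma germ_pair: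
 fixes f :: "(pnt) => real \<times> real"
 shows "germ n f \<longleftrightarrow> (ALL i<2. germ n (%z. cmp i (f z)))"
proof
 assume f: "germ n f"
 show "ALL i<2. germ n (%z. cmp i (f z))"
  using germ_bounded_linear[OF bounded_linear_fst f] germ_bounded_linear[OF bounded_linear_snd f]
  by (simp add: cmp_def all_less_2)
next
 assume "ALL i<2. germ n (%z. cmp i (f z))"
 from this[rule_format, of 0] this[rule_format, of 1]
 have g: "germ n (%z. fst (f z))" "germ n (%z. snd (f z))" by (simp_all add: cmp_def)
 obtain c r where c: "r > 0" "!!z. ALL i<n. abs(z i) < r ==> ((%al. (\<Prod>i<n. z i ^ al i) *\<^sub>R c al) has_sum fst (f z)) (multi_indices n)"
  using g(1) unfolding analytic_germ_def by blast
 obtain c' r' where c': "r' > 0" "!!z. ALL i<n. abs(z i) < r' ==> ((%al. (\<Prod>i<n. z i ^ al i) *\<^sub>R c' al) has_sum snd (f z)) (multi_indices n)"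
  using g(2) unfolding analytic_germ_def by blast
 have bl: "bounded_linear (%x::real. (x, 0::real))" "bounded_linear (%x::real. (0::real, x))"
  by (intro bounded_linear_Pair bounded_linear_ident bounded_linear_zero)+
 have "((%al. (\<Prod>i<n. z i ^ al i) *\<^sub>R (c al, c' al)) has_sum f z) (multi_indices n)" if "ALL i<n. abs(z i) < min r r'" for z
 proof -
  have "((%al. ((\<Prod>i<n. z i ^ al i) *\<^sub>R c al, 0) + (0, (\<Prod>i<n. z i ^ al i) *\<^sub>R c' al)) has_sum (fst (f z), 0) + (0, snd (f z))) (multi_indices n)"
   using has_sum_add[OF has_sum_bounded_linear[OF bl(1) c(2)[of z]] has_sum_bounded_linear[OF bl(2) c'(2)[of z]]] that by (simp add: o_def)
  then show ?thesis by simp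
 qed
 then show "germ n f"
  unfolding analytic_germ_def using c(1) c'(1) by (intro exI[of _ "%al. (c al, c' al)"] exI[of _ "min r r'"]) auto
qed

lemma abs_le_norm_pair: "abs(fst p) <= norm p" "abs(snd p) <= norm (p :: real \<times> real)"
 using norm_fst_le[of "fst p" "snd p"] norm_snd_le[of "snd p" "fst p"] by simp_all

lemma near0_iff: "near0 e P \<longleftrightarrow> (\<forall>\<^sub>F z in nbf (2 + e). P (%k. z (k + 2)) (z 0, z 1))"
proof
 assume "near0 e P"
 then obtain r where r: "r > 0" "!!s p. ALL i<e. abs(s i) < r ==> p \<in> ball 0 r ==> P s p" unfolding near0_def by blast
 have "P (%k. z (k + 2)) (z 0, z 1)" if z: "ALL i<2 + e. abs(z i) < r / 2" for z
 proof (rule r(2))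
  show "ALL i<e. abs(z (i + 2)) < r"
  proof (intro allI impI)
   fix i assume "i < e"
   then have "abs(z (i + 2)) < r / 2" using z by auto
   then show "abs(z (i + 2)) < r" using r(1) by linarith
  qed
  have "norm (z 0, z 1) <= abs(z 0) + abs(z 1)" using norm_Pair_le[of "z 0" "z 1"] by simp
  moreover have "abs(z 0) < r / 2" "abs(z 1) < r / 2" using z by auto
  ultimately show "(z 0, z 1) \<in> ball 0 r" by simp
 qed
 then show "\<forall>\<^sub>F z in nbf (2 + e). P (%k. z (k + 2)) (z 0, z 1)"
  unfolding ev_nbf using r(1) by (intro exI[of _ "r / 2"]) auto
next
 assume "\<forall>\<^sub>F z in nbf (2 + e). P (%k. z (k + 2)) (z 0, z 1)"
 then obtain r where r: "r > 0" "!!z. ALL i<2 + e. abs(z i) < r ==> P (%k. z (k + 2)) (z 0, z 1)" unfolding ev_nbf by blast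
 have "P s p" if s: "ALL i<e. abs(s i) < r" and p: "p \<in> ball 0 r" for s p
 proof -
  have "abs(zp s p i) < r" if "i < 2 + e" for i
   using abs_le_norm_pair[of p] p s that unfolding zp_def by (auto intro: order_le_less_trans)
  from r(2)[of "zp s p"] this show ?thesis by simp
 qed
 then show "near0 e P" unfolding near0_def using r(1) by blast
qed

lemma eventually_nhds_0_iff:
 "(\<forall>\<^sub>F p in nhds 0. P p) \<longleftrightarrow> (NEAR z. P (z 0, z 1 :: real))"
proof -
 have "(\<forall>\<^sub>F p in nhds 0. P p) \<longleftrightarrow> near0 0 (%_ p. P p)"
  unfolding near0_def eventually_nhds_metric by (simp add: Ball_def dist_norm del: split_paired_All)
 then show ?thesis unfolding near0_iff by simp
qed

lemma analytic_germ2_iff: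
 fixes f :: "real \<times> real => real \<times> real"
 shows "analytic_germ2 f \<longleftrightarrow> (ALL i<2. germ 2 (%z. cmp i (f (z 0, z 1))))"
 unfolding analytic_germ2_def by (rule germ_pair)

lemma analytic_family_iff:
 fixes F :: "(pnt) => real \<times> real => real \<times> real"
 shows "analytic_family d F \<longleftrightarrow> (ALL i<2. germ (2 + d) (%z. cmp i (F (%k. z (k + 2)) (z 0, z 1))))"
 unfolding analytic_family_def add.commute[of d 2] by (rule germ_pair)

subsection \<open>The harmonic map equation in gnomonic coordinates\<close>

lemma vector_3_expand: "(vector [a, b, c] :: real ^ 3) = a *\<^sub>R vector [1, 0, 0] + b *\<^sub>R vector [0, 1, 0] + c *\<^sub>R vector [0, 0, 1]"
 by (simp add: vec_eq_iff forall_3 vector_3)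

lemma has_vector_derivative_vector_3:
 assumes "(a hrd a') (at t)" "(b hrd b') (at t)" "(c hrd c') (at t)"
 shows "((%t. vector [a t, b t, c t] :: real ^ 3) has_vector_derivative vector [a', b', c']) (at t)"
proof -
 have "((%t. f t *\<^sub>R v) has_vector_derivative f' *\<^sub>R v) (at t)" if "(f hrd f') (at t)" for f f' and v :: "real ^ 3"
  using has_vector_derivative_scaleR[OF that has_vector_derivative_const[of v]] by simp
 from has_vector_derivative_add[OF has_vector_derivative_add[OF this[OF assms(1)] this[OF assms(2)]] this[OF assms(3)]]
 show ?thesis by (subst (1 2) vector_3_expand)
qed

lemma DERIV_inverse_sqrt:
 assumes "(f hrd f') (at t)" "f t > 0"
 shows "((%s. 1 / sqrt (f s)) hrd - (f' / 2)*(1 / sqrt (f t)) ^ 3) (at t)"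
proof -
 have "((%s. inverse (sqrt (f s))) hrd - (inverse (sqrt (f t))*(inverse (sqrt (f t)) / 2*f')*inverse (sqrt (f t)))) (at t)"
  using DERIV_inverse'[OF DERIV_chain2[OF DERIV_real_sqrt[OF assms(2)] assms(1)]] assms(2) by simp
 moreover have "- (r*(r / 2*f')*r) = - (f' / 2)*r ^ 3" for r :: real by (simp add: power3_eq_cube)
 ultimately have "((%s. inverse (sqrt (f s))) hrd - (f' / 2)*inverse (sqrt (f t)) ^ 3) (at t)" by (simp only:)
 then show ?thesis by (simp only: inverse_eq_divide)
qed

lemma DERIV_inverse_sqrt_double:
 assumes "(f hrd 2*d) (at t)" "f t > 0"
 shows "((%s. 1 / sqrt (f s)) hrd - d*(1 / sqrt (f t)) ^ 3) (at t)"
 using DERIV_inverse_sqrt[OF assms] by simp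

lemma cross3_lift_eq_0_iff:
 assumes "W ~= 0"
 shows "cross3 (W *\<^sub>R vector [u, v, 1]) (vector [a, b, c]) = 0 \<longleftrightarrow> a = u*c & b = v * c"
 using assms by (auto simp: cross3_def vec_eq_iff forall_3 vector_3 algebra_simps)

text \<open>The lift is a factor \<open>W\<close> times \<open>(u, v, 1)\<close>, and the cross
  product with it vanishes exactly if the mixed derivative is proportional to
  \<open>(u, v, 1)\<close>. In the two resulting scalar equations the second derivative of the
  factor cancels, and what is left can be divided by \<open>W\<close>.\<close>

lemma lorentz_harmonic_at_iff_derivatives:
 assumes dl: "dl > 0"
  and ux: "!!t. abs(t - y0) < dl ==> ((%s. fst (g (s, t))) hrd ux t) (at x0)"
   "!!t. abs(t - y0) < dl ==> ((%s. snd (g (s, t))) hrd vx t) (at x0)"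
  and uy: "((%t. fst (g (x0, t))) hrd uy) (at y0)" "((%t. snd (g (x0, t))) hrd vy) (at y0)"
  and uxy: "(ux hrd uxy) (at y0)" "(vx hrd vxy) (at y0)"
  and uv: "u = fst (g (x0, y0))" "v = snd (g (x0, y0))"
 shows "lorentz_harmonic_at (sphere_lift g) (x0, y0) \<longleftrightarrow>
  uxy = ((u*ux y0 + v * vx y0)*uy + (u*uy + v * vy)*ux y0) / (1 + u^2 + v^2) &
  vxy = ((u*ux y0 + v * vx y0) * vy + (u*uy + v * vy) * vx y0) / (1 + u^2 + v^2)"
proof -
 define U V where "U t = fst (g (x0, t))" and "V t = snd (g (x0, t))" for t
 define om where "om t = 1 / sqrt (1 + (U t)^2 + (V t)^2)" for t
 define c where "c t = - (U t*ux t + V t * vx t) * om t ^ 3" for t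
 have pos: "1 + a^2 + b^2 > (0::real)" for a b using sum_power2_ge_zero[of a b] by linarith
 have px: "partial_x (sphere_lift g) (x0, t) = vector [c t*U t + ux t * om t, c t*V t + vx t * om t, c t]"
  if t: "abs(t - y0) < dl" for t
 proof -
  let ?w = "%s. 1 / sqrt (1 + (fst (g (s, t)))^2 + (snd (g (s, t)))^2)"
  have "((%s. 1 + (fst (g (s, t)))^2 + (snd (g (s, t)))^2) hrd 2*(U t*ux t + V t * vx t)) (at x0)"
   by (rule derivative_eq_intros ux[OF t] refl)+ (simp add: U_def V_def algebra_simps)
  from DERIV_inverse_sqrt_double[OF this pos] have w: "(?w hrd c t) (at x0)"
   by (simp only: c_def om_def U_def V_def)
  have "((%s. vector [?w s*fst (g (s, t)), ?w s * snd (g (s, t)), ?w s] :: real ^ 3) has_vector_derivative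
    vector [c t*U t + ux t * om t, c t*V t + vx t * om t, c t]) (at x0)"
   unfolding U_def V_def om_def by (intro has_vector_derivative_vector_3 DERIV_mult w ux[OF t])
  moreover have "sphere_lift g (s, t) = vector [?w s*fst (g (s, t)), ?w s * snd (g (s, t)), ?w s]" for s
   by (simp add: sphere_lift_def case_prod_beta vec_eq_iff forall_3 vector_3)
  ultimately show ?thesis unfolding partial_x_def by (simp add: vector_derivative_at)
 qed
 define D where "D = 1 + u^2 + v^2"
 define W where "W = 1 / sqrt D"
 have D: "D > 0" unfolding D_def by (rule pos)
 have W: "W ~= 0" "W^2 = 1 / D" using D by (auto simp: W_def power_divide)
 have UV: "U y0 = u" "V y0 = v" "om y0 = W" by (simp_all add: U_def V_def uv om_def W_def D_def)
 define wy where "wy = - (u*uy + v * vy)*W ^ 3"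
 have dU: "(U hrd uy) (at y0)" "(V hrd vy) (at y0)"
  using uy unfolding U_def[abs_def] V_def[abs_def] .
 have "((%t. 1 + (U t)^2 + (V t)^2) hrd 2*(u*uy + v * vy)) (at y0)"
  by (rule derivative_eq_intros dU refl)+ (simp add: UV algebra_simps)
 from DERIV_inverse_sqrt_double[OF this pos] have dw: "(om hrd wy) (at y0)"
  unfolding om_def[abs_def] by (simp only: wy_def W_def D_def UV(1,2))
 \<comment> \<open>Existence suffices: \<open>c'\<close> is the mixed derivative of the normalising
   factor and cancels in \<open>a = u c'\<close> and \<open>b = v c'\<close>.\<close>
 have "EX c'. (c hrd c') (at y0)"
  unfolding c_def[abs_def] by (intro exI) (rule derivative_eq_intros dU dw uxy refl)+
 then obtain c' where dc: "(c hrd c') (at y0)" by blast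
 define a where "a = c' * u + uy*c y0 + (uxy*W + wy*ux y0)"
 define b where "b = c' * v + vy*c y0 + (vxy*W + wy * vx y0)"
 have "((%t. vector [c t*U t + ux t * om t, c t*V t + vx t * om t, c t] :: real ^ 3) has_vector_derivative vector [a, b, c']) (at y0)"
  unfolding a_def b_def
  using has_vector_derivative_vector_3[OF DERIV_add[OF DERIV_mult[OF dc dU(1)] DERIV_mult[OF uxy(1) dw]]
   DERIV_add[OF DERIV_mult[OF dc dU(2)] DERIV_mult[OF uxy(2) dw]] dc] by (simp add: UV)
 then have "((%t. partial_x (sphere_lift g) (x0, t)) has_vector_derivative vector [a, b, c']) (at y0)"
  by (rule has_vector_derivative_transform_within[OF _ dl]) (auto simp: px dist_real_def)
 then have "partial_y (partial_x (sphere_lift g)) (x0, y0) = vector [a, b, c']"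
  unfolding partial_y_def by (simp add: vector_derivative_at)
 moreover have "sphere_lift g (x0, y0) = W *\<^sub>R vector [u, v, 1]"
  by (simp add: sphere_lift_def case_prod_beta W_def D_def uv)
 ultimately have "lorentz_harmonic_at (sphere_lift g) (x0, y0) \<longleftrightarrow> a = u*c' & b = v * c'"
  unfolding lorentz_harmonic_at_def by (simp add: cross3_lift_eq_0_iff[OF W(1)])
 also have "\<dots> \<longleftrightarrow> W*(uxy - W^2*((u*ux y0 + v * vx y0)*uy + (u*uy + v * vy)*ux y0)) = 0
   & W*(vxy - W^2*((u*ux y0 + v * vx y0) * vy + (u*uy + v * vy) * vx y0)) = 0"
  by (simp add: a_def b_def c_def UV wy_def power3_eq_cube power2_eq_square algebra_simps)
 also have "\<dots> \<longleftrightarrow> uxy - W^2*((u*ux y0 + v * vx y0)*uy + (u*uy + v * vy)*ux y0) = 0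
   & vxy - W^2*((u*ux y0 + v * vx y0) * vy + (u*uy + v * vy) * vx y0) = 0"
  by (simp only: mult_eq_0_iff W(1) simp_thms)
 also have "\<dots> \<longleftrightarrow> uxy = ((u*ux y0 + v * vx y0)*uy + (u*uy + v * vy)*ux y0) / D
   & vxy = ((u*ux y0 + v * vx y0) * vy + (u*uy + v * vy) * vx y0) / D"
  unfolding W(2) by (simp only: right_minus_eq mult_1_left times_divide_eq_left)
 finally show ?thesis unfolding D_def .
qed

lemma lorentz_harmonic_iff:
 assumes G: "!!i. i < 2 ==> germ n (G i)" and n: "2 <= n"
 shows "\<forall>\<^sub>F z in nbf n. lorentz_harmonic_at (sphere_lift (%p. (G 0 (z(0:=fst p, 1:=snd p)), G 1 (z(0:=fst p, 1:=snd p))))) (z 0, z 1)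
  \<longleftrightarrow> (ALL i<2. pd 1 (pd 0 (G i)) z = hrhs (%k. G k z) (%k. pd 0 (G k) z) (%k. pd 1 (G k) z) i)"
proof -
 have n01: "0 < n" "1 < n" using n by auto
 have "\<forall>\<^sub>F z in nbf n. ALL i:{..<2}. ((%t. G i (z(0:=t))) hrd pd 0 (G i) z) (at (z 0)) &
   ((%t. G i (z(1:=t))) hrd pd 1 (G i) z) (at (z 1)) &
   ((%t. pd 0 (G i) (z(1:=t))) hrd pd 1 (pd 0 (G i)) z) (at (z 1))"
  by (intro eventually_ball_finite ballI eventually_conj germ_pd_DERIV germ_chain(2) n01 G) auto
 then obtain r where r: "r > 0" and R: "!!z i. ALL i<n. abs(z i) < r ==> i \<in> {..<2} ==>
   ((%t. G i (z(0:=t))) hrd pd 0 (G i) z) (at (z 0)) &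
   ((%t. G i (z(1:=t))) hrd pd 1 (G i) z) (at (z 1)) &
   ((%t. pd 0 (G i) (z(1:=t))) hrd pd 1 (pd 0 (G i)) z) (at (z 1))"
  unfolding ev_nbf by blast
 have "lorentz_harmonic_at (sphere_lift (%p. (G 0 (z(0:=fst p, 1:=snd p)), G 1 (z(0:=fst p, 1:=snd p))))) (z 0, z 1)
  \<longleftrightarrow> (ALL i<2. pd 1 (pd 0 (G i)) z = hrhs (%k. G k z) (%k. pd 0 (G k) z) (%k. pd 1 (G k) z) i)"
  (is "lorentz_harmonic_at (sphere_lift ?g) _ \<longleftrightarrow> ?R")
  if z: "ALL i<n. abs(z i) < r" for z
 proof -
  have z1: "abs(z 1) < r" using z n01 by blast
  have zt: "ALL i<n. abs((z(1:=t)) i) < r" if "abs(t - z 1) < r - abs(z 1)" for t using z that by auto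
  have e: "z(0:=z 0, 1:=t) = z(1:=t)" for t by auto
  have e': "z(0:=s, 1:=t) = z(1:=t, 0:=s)" for s t by auto
  have "lorentz_harmonic_at (sphere_lift ?g) (z 0, z 1) \<longleftrightarrow>
   pd 1 (pd 0 (G 0)) z = ((G 0 z*pd 0 (G 0) (z(1:=z 1)) + G 1 z*pd 0 (G 1) (z(1:=z 1)))*pd 1 (G 0) z
    + (G 0 z*pd 1 (G 0) z + G 1 z*pd 1 (G 1) z)*pd 0 (G 0) (z(1:=z 1))) / (1 + (G 0 z)^2 + (G 1 z)^2) &
   pd 1 (pd 0 (G 1)) z = ((G 0 z*pd 0 (G 0) (z(1:=z 1)) + G 1 z*pd 0 (G 1) (z(1:=z 1)))*pd 1 (G 1) z
    + (G 0 z*pd 1 (G 0) z + G 1 z*pd 1 (G 1) z)*pd 0 (G 1) (z(1:=z 1))) / (1 + (G 0 z)^2 + (G 1 z)^2)"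
  proof (rule lorentz_harmonic_at_iff_derivatives[where dl = "r - abs(z 1)"
     and ux = "%t. pd 0 (G 0) (z(1:=t))" and vx = "%t. pd 0 (G 1) (z(1:=t))"])
   show "((%s. fst (?g (s, t))) hrd pd 0 (G 0) (z(1:=t))) (at (z 0))"
    "((%s. snd (?g (s, t))) hrd pd 0 (G 1) (z(1:=t))) (at (z 0))" if "abs(t - z 1) < r - abs(z 1)" for t
    using R[of "z(1:=t)" 0, OF zt[OF that]] R[of "z(1:=t)" 1, OF zt[OF that]] by (simp_all add: e'[unfolded One_nat_def])
  qed (use R[OF z, of 0] R[OF z, of 1] z1 in \<open>simp_all add: e[unfolded One_nat_def]\<close>)
  also have "\<dots> \<longleftrightarrow> ?R" by (simp add: hrhs_def all_less_2)
  finally show ?thesis .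
 qed
 then show ?thesis unfolding ev_nbf using r by blast
qed

lemma partial_pair:
 fixes g :: "real \<times> real => real \<times> real"
 assumes "!!i. i < 2 ==> germ 2 (f i)" "NEAR z. ALL i<2. cmp i (g (z 0, z 1)) = f i z"
 shows "NEAR z. partial_x g (z 0, z 1) = (pd 0 (f 0) z, pd 0 (f 1) z) &
  partial_y g (z 0, z 1) = (pd 1 (f 0) z, pd 1 (f 1) z)"
proof -
 have "NEAR z. ALL i:{..<2}. ((%t. f i (z(0:=t))) hrd pd 0 (f i) z) (at (z 0)) &
   ((%t. f i (z(1:=t))) hrd pd 1 (f i) z) (at (z 1))"
  by (intro eventually_ball_finite ballI eventually_conj germ_pd_DERIV assms(1)) auto
 from eventually_conj[OF this assms(2)] obtain r where r: "r > 0" and R: "!!z. ALL i<2. abs(z i) < r ==>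
   (ALL i:{..<2}. ((%t. f i (z(0:=t))) hrd pd 0 (f i) z) (at (z 0)) &
   ((%t. f i (z(1:=t))) hrd pd 1 (f i) z) (at (z 1))) & (ALL i<2. cmp i (g (z 0, z 1)) = f i z)"
  unfolding ev_nbf by blast
 have "partial_x g (z 0, z 1) = (pd 0 (f 0) z, pd 0 (f 1) z) & partial_y g (z 0, z 1) = (pd 1 (f 0) z, pd 1 (f 1) z)"
  if z: "ALL i<2. abs(z i) < r" for z
 proof -
  have z01: "abs(z 0) < r" "abs(z 1) < r" using z by auto
  have g: "g (w 0, w 1) = (f 0 w, f 1 w)" if "ALL i<2. abs(w i) < r" for w
   using R[OF that] unfolding all_less_2 by (simp add: cmp_def prod_eq_iff)
  have "((%t. (f 0 (z(0:=t)), f 1 (z(0:=t)))) has_vector_derivative (pd 0 (f 0) z, pd 0 (f 1) z)) (at (z 0))"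
   "((%t. (f 0 (z(1:=t)), f 1 (z(1:=t)))) has_vector_derivative (pd 1 (f 0) z, pd 1 (f 1) z)) (at (z 1))"
   using R[OF z] by (intro has_vector_derivative_Pair; simp add: has_real_derivative_iff_has_vector_derivative[symmetric])+
  then have "((%t. g (t, z 1)) has_vector_derivative (pd 0 (f 0) z, pd 0 (f 1) z)) (at (z 0))"
   "((%t. g (z 0, t)) has_vector_derivative (pd 1 (f 0) z, pd 1 (f 1) z)) (at (z 1))"
   by - (rule has_vector_derivative_transform_within[where d = "r - abs(z 0)"],
     (use z01 g[of "z(0:=t)" for t] in \<open>auto simp: dist_real_def less_2_cases_iff\<close>)[4],
    rule has_vector_derivative_transform_within[where d = "r - abs(z 1)"],
     (use z01 g[of "z(1:=t)" for t] in \<open>auto simp: dist_real_def less_2_cases_iff\<close>)[4])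
  then show ?thesis unfolding partial_x_def partial_y_def by (simp add: vector_derivative_at)
 qed
 then show ?thesis unfolding ev_nbf using r by blast
qed

lemma pd_compose:
 fixes f :: "fnc" and g :: "nat => fnc"
 assumes f: "germ m f" and g: "!!k. k < m ==> germ n (g k)" "!!k. k < m ==> g k (%_. 0) = 0" and j: "j < n"
 shows "\<forall>\<^sub>F z in nbf n. pd j (%z. f (%k. g k z)) z = (\<Sum>k<m. pd k f (%k. g k z)*pd j (g k) z)"
proof -
 have "\<forall>\<^sub>F z in nbf n. ALL k:{..<m}. ((%t. g k (z(j:=t))) hrd pd j (g k) z) (at (z j))"
  by (intro eventually_ball_finite ballI germ_pd_DERIV g j) auto
 moreover have "\<forall>\<^sub>F z in nbf n. ALL gm gm' t S. gm t = (%k. g k z) -->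
   (ALL i<m. ((%s. gm s i) hrd gm' i) (at t within S)) -->
   ((%s. f (gm s)) hrd (\<Sum>i<m. pd i f (%k. g k z)*gm' i)) (at t within S)"
  by (rule ev_nbf_map[where g = g, OF _ _ germ_chain(1)[OF f]]) (use g in auto)
 ultimately show ?thesis
 proof eventually_elim
  case (elim z)
  have "((%s. f ((%t k. g k (z(j:=t))) s)) hrd (\<Sum>k<m. pd k f (%k. g k z)*pd j (g k) z)) (at (z j))"
   by (rule elim(2)[rule_format]) (use elim(1) in auto)
  then show ?case by (intro pd_eqI) simp
 qed
qed

lemma lorentz_harmonic_germ_pd:
 assumes "lorentz_harmonic_germ g"
 defines "G \<equiv> %i z. cmp i (g (z 0, z 1))"
 shows "!!i. i < 2 ==> germ 2 (G i)" "!!i. G i (%_. 0) = 0"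
  "NEAR z. ALL i<2. pd 1 (pd 0 (G i)) z = hrhs (%k. G k z) (%k. pd 0 (G k) z) (%k. pd 1 (G k) z) i"
proof -
 have g: "g 0 = 0" "analytic_germ2 g" and h: "\<forall>\<^sub>F p in nhds 0. lorentz_harmonic_at (sphere_lift g) p"
  using assms(1) by (simp_all add: lorentz_harmonic_germ_def map_germ_def)
 show G: "germ 2 (G i)" if "i < 2" for i using g(2) that unfolding analytic_germ2_iff G_def by blast
 show "G i (%_. 0) = 0" for i using g(1) by (simp add: G_def cmp_linear zero_prod_def[symmetric])
 have e: "(%p. (G 0 (z(0:=fst p, 1:=snd p)), G 1 (z(0:=fst p, 1:=snd p)))) = g" for z
  by (simp add: G_def cmp_def)
 show "NEAR z. ALL i<2. pd 1 (pd 0 (G i)) z = hrhs (%k. G k z) (%k. pd 0 (G k) z) (%k. pd 1 (G k) z) i"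
 proof -
  have "NEAR z. lorentz_harmonic_at (sphere_lift (%p. (G 0 (z(0:=fst p, 1:=snd p)), G 1 (z(0:=fst p, 1:=snd p))))) (z 0, z 1)
   \<longleftrightarrow> (ALL i<2. pd 1 (pd 0 (G i)) z = hrhs (%k. G k z) (%k. pd 0 (G k) z) (%k. pd 1 (G k) z) i)"
   by (rule lorentz_harmonic_iff) (simp_all add: G)
  then show ?thesis using h unfolding eventually_nhds_0_iff e by eventually_elim blast
 qed
qed

subsection \<open>Versality of the harmonic unfolding\<close>

definition axp :: "(fnc) => (fnc) => real \<times> real => real \<times> real" where
 "axp a b p = (axmap a b (zp (%_. 0) p) 0, axmap a b (zp (%_. 0) p) 1)"

lemma axmap_cong: "w 0 = w' 0 ==> w 1 = w' 1 ==> axmap a b w = axmap a b w'"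
proof -
 assume w: "w 0 = w' 0" "w 1 = w' 1"
 then have "base w = base w'" by (auto simp: base_def fun_eq_iff less_2_cases_iff)
 then show "axmap a b w = axmap a b w'" by (intro ext) (use w in \<open>simp add: axmap_def\<close>)
qed

lemma axp_simps: "axp a b (z 0, z 1) = (axmap a b z 0, axmap a b z 1)"
 "zp (%_. 0) (axp a b (z 0, z 1)) = axmap a b z" "zp (%_. 0) (axmap a b z 0, axmap a b z 1) = axmap a b z"
 "cmp i (axp a b (z 0, z 1)) = axmap a b z (if i = 0 then 0 else 1)"
proof -
 show 1: "axp a b (z 0, z 1) = (axmap a b z 0, axmap a b z 1)"
  by (simp add: axp_def base_zp axmap_simps)
 show 2: "zp (%_. 0) (axmap a b z 0, axmap a b z 1) = axmap a b z" by (simp only: base_zp(2)[of "axmap a b z"] axmap_simps)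
 show "zp (%_. 0) (axp a b (z 0, z 1)) = axmap a b z" unfolding 1 2 ..
 show "cmp i (axp a b (z 0, z 1)) = axmap a b z (if i = 0 then 0 else 1)" unfolding 1 by (simp add: cmp_def)
qed

lemma map_germ_axp:
 assumes "germ 2 a" "germ 2 b"
 shows "map_germ (axp a b)"
 unfolding map_germ_def analytic_germ2_iff axp_simps(4)
proof (intro conjI allI impI)
 show "axp a b 0 = 0" by (simp add: axp_def axmap_simps zero_prod_def)
 show "germ 2 (%z. axmap a b z (if i = 0 then 0 else 1))" for i :: nat by (rule germ_axmap[OF assms])
qed

lemma I22_lm_cmp: "i < 2 ==> cmp i (I22_lm l m (z 0, z 1)) = I22v l m i z"
 by (auto simp: I22_lm_def I22v_def less_2_cases_iff)

lemma diffeo_germ_id: "diffeo_germ (%p. p)"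
proof -
 have "map_germ (%p. p)" unfolding map_germ_def analytic_germ2_iff
  by (auto simp: less_2_cases_iff intro!: germ_var)
 then show ?thesis unfolding diffeo_germ_def inverse_germs_def by (intro exI[of _ "%p. p"]) auto
qed

text \<open>\<open>I22_versal\<close> speaks of an unfolding whose member at parameter zero is
  \<open>I22v\<close> itself, whereas the harmonic member is \<open>I22v\<close> after the source
  change \<open>axmap a b\<close>. Both versality conditions are therefore obtained for
  \<open>I22v\<close> and carried back through that change.\<close>

theorem I22_lm_lorentz_versal:
 assumes lm: "1 <= l" "1 <= m"
 shows "EX g d F. A_equivalent (I22_lm l m) g & lorentz_harmonic_germ g & lorentz_versal_deformation g d F"
proof -
 define d where "d = l + m"
 let ?n = "2 + d"
 obtain F a b al be R where gF: "ALL i<2. germ ?n (F i)"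
  and harm: "\<forall>\<^sub>F z in nbf ?n. ALL i<2. pd 1 (pd 0 (F i)) z = hrhs (%k. F k z) (%k. pd 0 (F k) z) (%k. pd 1 (F k) z) i"
  and gab: "germ 2 a" "germ 2 b" and gal: "germ 2 al" "germ 2 be"
  and inv: "NEAR z. axmap a b (axmap al be z) = base z & axmap al be (axmap a b z) = base z"
  and Fb: "NEAR z. ALL i<2. F i (base z) = I22v l m i (axmap a b z)"
  and FtH: "ALL i<2. germ ?n (%z. F i (%k. if k < 2 then axmap al be z k else z k)) &
   (\<forall>\<^sub>F z in nbf ?n. (%z. F i (%k. if k < 2 then axmap al be z k else z k)) (base z) = I22v l m i z)"
  and RH: "ALL q<d. ALL i<2. germ ?n (R q i) & (\<forall>\<^sub>F z in nbf ?n.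
   pd (2 + q) (%z. F i (%k. if k < 2 then axmap al be z k else z k)) (base z) = I22vel l q i z + z 0*z 1*R q i (base z))"
  using harmonic_unfolding[OF lm d_def] by (elim exE conjE) (rule that)
 define Ft where "Ft i z = F i (%k. if k < 2 then axmap al be z k else z k)" for i and z :: "pnt"
 have gFt: "germ ?n (Ft i)" if "i < 2" for i using FtH that unfolding Ft_def[abs_def] by blast
 have Ftb: "\<forall>\<^sub>F z in nbf ?n. Ft i (base z) = I22v l m i z" if "i < 2" for i using FtH that unfolding Ft_def[abs_def] by blast
 have gR: "germ ?n (R q i)" if "q < d" "i < 2" for q i using RH that by blast
 have vel: "\<forall>\<^sub>F z in nbf ?n. pd (2 + q) (Ft i) (base z) = I22vel l q i z + z 0*z 1*R q i (base z)"
  if "q < d" "i < 2" for q i using RH that unfolding Ft_def[abs_def] by blast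
 have Ftb0: "Ft i (base z) = F i (axmap al be z)" for i z
 proof -
  have "(%k. if k < 2 then axmap al be (base z) k else base z k) = axmap al be z" by (auto simp: axmap_def)
  then show ?thesis by (simp only: Ft_def)
 qed
 have Fax: "NEAR z. ALL i<2. F i (axmap al be z) = I22v l m i z"
 proof -
  have Ib: "I22v l m i (base z) = I22v l m i z" for i z by (simp add: I22v_def)
  have *: "NEAR z. F i (axmap al be z) = I22v l m i z" if "i < 2" for i
   using ev_nbf_base[OF Ftb[OF that]] by (simp only: Ftb0 Ib axmap_simps)
  have "NEAR z. F 0 (axmap al be z) = I22v l m 0 z" "NEAR z. F 1 (axmap al be z) = I22v l m 1 z"
   by (rule *; simp)+
  then show ?thesis unfolding all_less_2 by (rule eventually_conj)
 qed
 have inv\<^sub>n: "\<forall>\<^sub>F z in nbf (2 + e). axmap al be (axmap a b z) = base z" for e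
  using ev_nbf_mono[OF inv, of "2 + e"] by (auto elim: eventually_mono)
 define Fam where "Fam s p = (F 0 (zp s p), F 1 (zp s p))" for s p
 define g where "g = Fam (%_. 0)"
 have g_cmp: "cmp i (g (z 0, z 1)) = F i (base z)" if "i < 2" for i z
  using that by (auto simp: g_def Fam_def base_zp less_2_cases_iff)
 have g_eq: "g (z 0, z 1) = (F 0 (base z), F 1 (base z))" for z by (simp add: g_def Fam_def base_zp)
 have mg: "map_germ g"
 proof -
  have "F i (%_. 0) = 0" if "i < 2" for i using ev_nbf_at_0[OF Fb] that by (simp add: axmap_simps I22v_def)
  then have "g 0 = 0" by (simp add: g_def Fam_def zero_prod_def)
  moreover have "germ 2 (%z. cmp i (g (z 0, z 1)))" if "i < 2" for i
   unfolding g_cmp[OF that] by (rule germ_base[of ?n]) (use gF that in blast)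
  ultimately show ?thesis unfolding map_germ_def analytic_germ2_iff by blast
 qed
 have invg: "inverse_germs (axp al be) (axp a b)"
  unfolding inverse_germs_def eventually_nhds_0_iff
 proof (intro conjI map_germ_axp gab gal)
  show "NEAR z. axp a b (axp al be (z 0, z 1)) = (z 0, z 1) & axp al be (axp a b (z 0, z 1)) = (z 0, z 1)"
   using inv
  proof eventually_elim
   case (elim z)
   have "axp a b (axp al be (z 0, z 1)) = (base z 0, base z 1)" "axp al be (axp a b (z 0, z 1)) = (base z 0, base z 1)"
    unfolding axp_simps(1)[of _ _ z] axp_simps(1)[of _ _ "axmap _ _ z"] using elim by simp_all
   then show ?case by simp
  qed
 qed
 have Aeq: "A_equivalent (I22_lm l m) g"
  unfolding A_equivalent_def
 proof (intro exI conjI)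
  show "\<forall>\<^sub>F p in nhds 0. g p = (%p. p) (I22_lm l m (axp a b p))"
   unfolding eventually_nhds_0_iff using Fb
  proof eventually_elim
   case (elim z)
   show ?case unfolding axp_simps(1) pair_eq_iff_cmp
   proof (intro allI impI)
    fix i :: nat assume i: "i < 2"
    show "cmp i (g (z 0, z 1)) = cmp i (I22_lm l m (axmap a b z 0, axmap a b z 1))"
     unfolding g_cmp[OF i] I22_lm_cmp[OF i] using elim i by blast
   qed
  qed
 qed (rule invg diffeo_germ_id)+
 have zpu: "(%p. (F 0 (z(0:=fst p, 1:=snd p)), F 1 (z(0:=fst p, 1:=snd p)))) = Fam (%k. z (k + 2))" for z
  unfolding Fam_def[abs_def] zp_upd ..
 have hF: "\<forall>\<^sub>F z in nbf ?n. lorentz_harmonic_at (sphere_lift (Fam (%k. z (k + 2)))) (z 0, z 1)"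
 proof -
  have "\<forall>\<^sub>F z in nbf ?n. lorentz_harmonic_at (sphere_lift (%p. (F 0 (z(0:=fst p, 1:=snd p)), F 1 (z(0:=fst p, 1:=snd p))))) (z 0, z 1)
   \<longleftrightarrow> (ALL i<2. pd 1 (pd 0 (F i)) z = hrhs (%k. F k z) (%k. pd 0 (F k) z) (%k. pd 1 (F k) z) i)"
   by (rule lorentz_harmonic_iff) (use gF in simp_all)
  then show ?thesis using harm unfolding zpu by eventually_elim blast
 qed
 have nearF: "near0 d (%s p. lorentz_harmonic_at (sphere_lift (Fam s)) p)"
  unfolding near0_iff by (rule hF)
 have hg: "lorentz_harmonic_germ g"
 proof -
  have "(%k. base z (k + 2)) = (%_. 0)" for z by (auto simp: base_def)
  then have "NEAR z. lorentz_harmonic_at (sphere_lift g) (z 0, z 1)"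
   using ev_nbf_base[OF hF] unfolding g_def by simp
  then show ?thesis unfolding lorentz_harmonic_germ_def eventually_nhds_0_iff using mg by blast
 qed
 have Famc: "cmp i (Fam (%k. z (k + 2)) (z 0, z 1)) = F i z" if "i < 2" for i z
  using that unfolding Fam_def zp_inv by (auto simp: less_2_cases_iff)
 have defF: "deformation g d Fam"
  unfolding deformation_def analytic_family_iff g_def using gF by (simp add: Famc del: One_nat_def add_2_eq_Suc add_2_eq_Suc')
 have univ: "induced_from d Fam e G" if defG: "deformation g e G" for e G
 proof -
  define G' where "G' i z = cmp i (G (%k. z (k + 2)) (z 0, z 1))" for i and z :: "pnt"
  have gG': "germ (2 + e) (G' i)" if "i < 2" for i
   using defG that unfolding deformation_def analytic_family_iff G'_def[abs_def] by blast
  \<comment> \<open>The deformation \<open>G\<close> of \<open>g\<close>, precomposed with the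
    inverse source change, becomes a deformation of \<open>I22v\<close>.\<close>
  define Gc where "Gc i z = cmp i (G (%k. z (k + 2)) (axp al be (z 0, z 1)))" for i and z :: "pnt"
  have gax: "germ (2 + e) (%z. if k < 2 then axmap a b z k else z k)"
   if "k < 2 + e" "germ 2 a" "germ 2 b" for k a b
   using germ_lift[OF germ_axmap[OF that(2,3), of k], of "2 + e"] germ_var[OF that(1)] by (cases "k < 2") simp_all
  have ax0: "(if k < 2 then axmap a b (%_. 0) k else 0) = (0::real)" for k a b by (simp add: axmap_simps)
  have gGc: "germ (2 + e) (Gc i)" if "i < 2" for i
  proof -
   have "germ (2 + e) (%z. G' i (%k. (%k z. if k < 2 then axmap al be z k else z k) k z))"
    by (rule germ_compose[OF gG'[OF that]]) (use gax gal ax0 in auto)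
   then show ?thesis unfolding G'_def Gc_def[abs_def] axp_simps(1) by simp
  qed
  have Gcb: "\<forall>\<^sub>F z in nbf (2 + e). Gc i (base z) = I22v l m i z" if "i < 2" for i
  proof (rule ev_nbf_mono)
   have "NEAR z. G (%_. 0) (z 0, z 1) = g (z 0, z 1)"
    using defG unfolding deformation_def eventually_nhds_0_iff by blast
   then have "NEAR z. G (%_. 0) (axmap al be z 0, axmap al be z 1) = g (axmap al be z 0, axmap al be z 1)"
    by (rule ev_nbf_map[where g = "%k z. axmap al be z k", rotated 2]) (auto simp: axmap_simps intro: germ_axmap gal)
   then show "NEAR z. Gc i (base z) = I22v l m i z"
    using Fax
   proof eventually_elim
    case (elim z)
    have "(%k. base z (k + 2)) = (%_. 0)" by (auto simp: base_def)
    then have "Gc i (base z) = cmp i (g (axmap al be z 0, axmap al be z 1))"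
     using elim(1) unfolding Gc_def axp_simps(1) by (simp add: axmap_simps)
    then show ?case using elim(2) that by (simp only: g_cmp axmap_simps)
   qed
  qed simp
  have "EX ph h k. (ALL q<d. germ e (%s. ph s q) & ph (%_. 0) q = 0) &
   (ALL i<2. germ (2 + e) (h i) & germ (2 + e) (k i)) &
   (\<forall>\<^sub>F z in nbf (2 + e). ALL i<2. h i (base z) = z i & k i (base z) = z i &
    Gc i z = k i (%p. if p < 2 then Ft p (%p. if p < 2 then h p z else ph (%j. z (j + 2)) (p - 2)) else z p))"
   by (rule I22_versal[where Ft = Ft and G = Gc and R = R]; fact lm d_def gFt gR Ftb vel gGc Gcb)
  then obtain ph h k where ph: "ALL q<d. germ e (%s. ph s q) & ph (%_. 0) q = 0"
   and ghk: "ALL i<2. germ (2 + e) (h i) & germ (2 + e) (k i)"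
   and H: "\<forall>\<^sub>F z in nbf (2 + e). ALL i<2. h i (base z) = z i & k i (base z) = z i &
    Gc i z = k i (%p. if p < 2 then Ft p (%p. if p < 2 then h p z else ph (%j. z (j + 2)) (p - 2)) else z p)"
   by (elim exE conjE) (rule that)
  have gh: "germ (2 + e) (h i)" and gk: "germ (2 + e) (k i)" if "i < 2" for i
   using ghk that by blast+
  have h0: "h i (%_. 0) = 0" if "i < (2::nat)" for i using ev_nbf_at_0[OF H] that by simp
  have H2: "NEAR z. ALL i<2. h i (base z) = z i & k i (base z) = z i"
   using ev_nbf_base[OF H] by eventually_elim (simp add: all_less_2 del: One_nat_def)
  define w where "w z = (%k. if k < 2 then axmap a b z k else z k)" for z
  have w_zp: "zp s (axp a b p) = w (zp s p)" for s p
   by (auto simp: w_def zp_def axp_def fun_eq_iff less_2_cases_iff intro!: fun_cong[OF axmap_cong])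
  have w2: "(%j. w z (j + 2)) = (%j. z (j + 2))" for z by (simp add: w_def)
  \<comment> \<open>The source family conjugated back: first the change \<open>axmap a b\<close>,
    then \<open>h\<close>, then the inverse change.\<close>
  define hh where "hh s p = axp al be (h 0 (zp s (axp a b p)), h 1 (zp s (axp a b p)))" for s p
  define kk where "kk s p = (k 0 (zp s p), k 1 (zp s p))" for s p
  have hh: "hh (%k. z (k + 2)) (z 0, z 1) = (axmap al be (%q. h q (w z)) 0, axmap al be (%q. h q (w z)) 1)" for z
   using axp_simps(1)[of al be "%q. h q (w z)"] unfolding hh_def w_zp zp_inv .
  have kk: "cmp i (kk (%k. z (k + 2)) (z 0, z 1)) = k i z" if "i < 2" for i z
   using that unfolding kk_def zp_inv by (auto simp: less_2_cases_iff)
  have ghh: "germ (2 + e) (%z. axmap al be (%q. h q (w z)) i)" for i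
  proof -
   have "germ (2 + e) (%z. h q (w z))" if "q < 2" for q
    unfolding w_def
    by (rule germ_compose[OF gh[OF that], where g = "%k z. if k < 2 then axmap a b z k else z k"]) (use gax gab ax0 in auto)
   moreover have "h q (w (%_. 0)) = 0" if "q < 2" for q using h0[OF that] by (simp add: w_def axmap_simps cong: if_cong)
   ultimately show ?thesis
    by (intro germ_compose[OF germ_axmap[OF gal], where g = "%q z. h q (w z)"]) auto
  qed
  show ?thesis unfolding induced_from_def
  proof (rule exI[of _ ph], rule exI[of _ hh], rule exI[of _ kk], intro conjI)
   show "ALL i<d. germ e (%s. ph s i) & ph (%_. 0) i = 0" by (rule ph)
   show "deformation (%p. p) e hh" unfolding deformation_def analytic_family_iff hh
   proof (intro conjI allI impI)
    show "germ (2 + e) (%z. cmp i (axmap al be (%q. h q (w z)) 0, axmap al be (%q. h q (w z)) 1))" for i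
     unfolding cmp_def fst_conv snd_conv using ghh by (cases "i = 0") simp_all
    have "NEAR z. ALL i<2. h i (base (axmap a b z)) = axmap a b z i & k i (base (axmap a b z)) = axmap a b z i"
     by (rule ev_nbf_map[where g = "%k z. axmap a b z k", OF _ _ H2]) (auto simp: axmap_simps intro: germ_axmap gab)
    then show "\<forall>\<^sub>F p in nhds 0. hh (%_. 0) p = p" unfolding eventually_nhds_0_iff using inv
    proof eventually_elim
     case (elim z)
     have "hh (%_. 0) (z 0, z 1) = axp al be (h 0 (axmap a b z), h 1 (axmap a b z))" unfolding hh_def axp_simps ..
     also have "\<dots> = axp al be (axmap a b z 0, axmap a b z 1)" using elim(1) by (simp only: axmap_simps all_less_2)
     also have "\<dots> = (z 0, z 1)" unfolding axp_simps(1) using elim(2) by simp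
     finally show ?case .
    qed
   qed
   show "deformation (%p. p) e kk" unfolding deformation_def analytic_family_iff eventually_nhds_0_iff
   proof (intro conjI allI impI)
    show "germ (2 + e) (%z. cmp i (kk (%k. z (k + 2)) (z 0, z 1)))" if "i < 2" for i
     unfolding kk[OF that] by (rule gk[OF that])
    show "NEAR z. kk (%_. 0) (z 0, z 1) = (z 0, z 1)" using H2
     by eventually_elim (simp only: kk_def base_zp all_less_2)
   qed
   have "\<forall>\<^sub>F z in nbf (2 + e). ALL i<2. h i (base (w z)) = w z i & k i (base (w z)) = w z i &
    Gc i (w z) = k i (%p. if p < 2 then Ft p (%p. if p < 2 then h p (w z) else ph (%j. w z (j + 2)) (p - 2)) else w z p)"
    unfolding w_def
    by (rule ev_nbf_map[where g = "%k z. if k < 2 then axmap a b z k else z k", OF _ _ H]) (use gax gab ax0 in auto)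
   then show "near0 e (%s p. G s p = kk s (Fam (ph s) (hh s p)))" unfolding near0_iff
    using inv\<^sub>n[of e]
   proof eventually_elim
    case (elim z)
    let ?s = "%k. z (k + 2)"
    let ?V = "%p. if p < 2 then h p (w z) else ph ?s (p - 2)"
    have wax: "axmap al be (w z) = base z"
     using elim(2) axmap_cong[of "w z" "axmap a b z" al be] by (simp add: w_def)
    have V: "axmap al be ?V = axmap al be (%q. h q (w z))" by (rule axmap_cong) simp_all
    have Y: "zp (ph ?s) (hh ?s (z 0, z 1)) = (%k. if k < 2 then axmap al be ?V k else ?V k)"
     unfolding hh V by (auto simp: zp_def fun_eq_iff less_2_cases_iff)
    have Fa: "Fam (ph ?s) (hh ?s (z 0, z 1)) = (Ft 0 ?V, Ft 1 ?V)" unfolding Fam_def Y Ft_def ..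
    have "(%p. if p < 2 then Ft p ?V else w z p) = zp ?s (Fam (ph ?s) (hh ?s (z 0, z 1)))"
    proof
     fix p :: nat
     consider "p = 0" | "p = 1" | "2 <= p" by linarith
     then show "(if p < 2 then Ft p ?V else w z p) = zp ?s (Fam (ph ?s) (hh ?s (z 0, z 1))) p"
     proof cases
      case 3
      then have "p - 2 + 2 = p" "\<not> p < 2" "p ~= 0" "p ~= 1" by auto
      then show ?thesis by (simp only: zp_def w_def if_False)
     qed (unfold Fa, simp_all)
    qed
    then have "Gc i (w z) = cmp i (kk ?s (Fam (ph ?s) (hh ?s (z 0, z 1))))" if "i < 2" for i
     using elim(1) that unfolding w2 by (auto simp: kk_def less_2_cases_iff)
    moreover have "Gc i (w z) = cmp i (G ?s (z 0, z 1))" for i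
     unfolding Gc_def w2 axp_simps(1) wax by simp
    ultimately show ?case unfolding pair_eq_iff_cmp by simp
   qed
  qed
 qed
 have infin: "EX c. (%p. xi p - (\<Sum>q<d. c q *\<^sub>R initial_velocity Fam q p)) \<in> extended_tangent_space g" if xi: "analytic_germ2 xi" for xi
 proof -
  define f where "f i z = F i (base z)" for i and z :: "pnt"
  have gf: "germ 2 (f i)" if "i < 2" for i unfolding f_def[abs_def] using germ_base gF that by blast
  have pf: "pd j (f i) (base z) = pd j (f i) z" if "j < 2" for j i z
  proof -
   have "(%z. f i (base z)) = f i" by (simp add: f_def[abs_def])
   then show ?thesis using pd_base[OF that, of "f i" z] by (simp only:)
  qed
  define xic where "xic i z = cmp i (xi (z 0, z 1))" for i and z :: "pnt"
  have gxi: "germ 2 (xic i)" if "i < 2" for i using xi that unfolding analytic_germ2_iff xic_def[abs_def] by blast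
  have ga: "germ 2 (%z. axmap al be z k)" "germ 2 (%z. axmap a b z k)" for k
   by (rule germ_axmap gal gab)+
  have gpF: "germ ?n (pd (2 + q) (F i))" "germ ?n (pd (2 + q) (Ft i))" if "q < d" "i < 2" for q i
   using that gF gFt by (auto intro!: germ_chain(2) simp del: add_2_eq_Suc add_2_eq_Suc')
  define v where "v q i z = pd (2 + q) (Ft i) (base z)" for q i and z :: "pnt"
  have v: "v q i z = pd (2 + q) (F i) (axmap al be z)" for q i z
  proof -
   have "(%k. if k < 2 then axmap al be ((base z)(2 + q:=t)) k else ((base z)(2 + q:=t)) k) = (axmap al be z)(2 + q:=t)" for t
   proof -
    have "axmap al be ((base z)(2 + q:=t)) = axmap al be z" by (rule axmap_cong) simp_all
    then show ?thesis by (intro ext) (simp add: axmap_def[of _ _ z] base_def[of z])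
   qed
   moreover have "base z (2 + q) = 0" "axmap al be z (2 + q) = 0" by (simp_all add: axmap_def)
   ultimately show ?thesis unfolding v_def pd_def Ft_def by simp
  qed
  \<comment> \<open>The case \<open>n = 2\<close>, without parameters, is the infinitesimal
    versality of \<open>I22v\<close>.\<close>
  have "EX X et c. (ALL i<2. germ 2 (X i) & germ 2 (et i)) & (ALL q<l + m. germ 2 (c q)) &
   (NEAR z. ALL i<2. (%i z. xic i (%k. axmap al be z k)) i z = pd 0 (I22v l m i) z*X 0 z + pd 1 (I22v l m i) z*X 1 z
    + et i (z(0:=I22v l m 0 z, 1:=I22v l m 1 z)) + (\<Sum>q<l + m. c q (z(0:=0, 1:=0)) * v q i z))"
  proof (rule linear_lemma_axes[where R = "%q i z. R q i (base z)", OF order_refl lm])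
   show "germ 2 (%z. xic i (%k. axmap al be z k))" if "i < 2" for i
    by (rule germ_compose[OF gxi[OF that]]) (auto simp: axmap_simps ga)
   show "NEAR z. v q i (base z) = I22vel l q i z + z 0*z 1*R q i (base (base z))" if "q < l + m" "i < 2" for q i
   proof -
    have q: "q < d" using that d_def by simp
    have "I22vel l q i (base z) = I22vel l q i z" for z by (simp add: I22vel_def)
    then show ?thesis using ev_nbf_base[OF vel[OF q that(2)]] by (simp only: v_def base_simps)
   qed
   show "germ 2 (v q i)" "germ 2 (%z. R q i (base z))" if "q < l + m" "i < 2" for q i
    using germ_base[OF gpF(2)] germ_base[OF gR] that unfolding v_def[abs_def] d_def by blast+
  qed (auto simp: I22v_def intro: germ_I22)
  then obtain X et c where gXet: "ALL i<2. germ 2 (X i) & germ 2 (et i)"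
   and gcd: "ALL q<l + m. germ 2 (c q)"
   and E0: "NEAR z. ALL i<2. xic i (axmap al be z) = pd 0 (I22v l m i) z*X 0 z + pd 1 (I22v l m i) z*X 1 z
    + et i (z(0:=I22v l m 0 z, 1:=I22v l m 1 z)) + (\<Sum>q<l + m. c q (z(0:=0, 1:=0)) * v q i z)"
   by (elim exE conjE) (rule that)
  note E = E0[folded d_def]
  have gX: "germ 2 (X i)" and get: "germ 2 (et i)" if "i < 2" for i using gXet that by blast+
  have gc: "germ 2 (c q)" if "q < d" for q using gcd that unfolding d_def by blast
  have ext2: "NEAR z. ALL i<2. P i z" if "!!i. i < (2::nat) ==> NEAR z. P i z" for P :: "nat => (pnt) => bool"
   unfolding all_less_2 using that[of 0] that[of 1] by (intro eventually_conj) simp_all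
  define P where "P j k z = pd j (%z. axmap al be z k) z" for j k z
  have gP: "germ 2 (P j k)" if "j < 2" for j k unfolding P_def[abs_def] by (rule germ_chain(2)[OF ga(1) that])
  have pI: "NEAR z. pd j (I22v l m i) z = (\<Sum>k<2. pd k (f i) (axmap al be z)*P j k z)" if "i < 2" "j < 2" for i j
  proof -
   have e: "NEAR z. I22v l m i z = f i (%k. axmap al be z k)"
    using Fax by eventually_elim (use that in \<open>simp add: f_def axmap_simps\<close>)
   have "NEAR z. pd j (%z. f i (%k. axmap al be z k)) z = (\<Sum>k<2. pd k (f i) (%k. axmap al be z k)*pd j (%z. axmap al be z k) z)"
    by (rule pd_compose[OF gf[OF that(1)]]) (auto simp: axmap_simps ga that)
   with pd_cong[OF e, of j] show ?thesis unfolding P_def by eventually_elim simp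
  qed
  have etdep: "NEAR z. ALL z'. (ALL k<2. z' k = I22v l m k z) --> et i z' = et i (%k. I22v l m k z)" if "i < 2" for i
   by (rule ev_nbf_map[where g = "%k z. I22v l m k z", OF _ _ germ_depends[OF get[OF that]]])
    (auto simp: I22v_def intro!: germ_I22[unfolded I22v_def])
  have c0: "c q z' = c q (%_. 0)" if "q < d" "z' 0 = 0" "z' 1 = 0" for q z'
   by (rule ev_nbf_at_0[OF germ_depends[OF gc[OF that(1)]], rule_format]) (use that in \<open>auto simp: less_2_cases_iff\<close>)
  have pI0: "NEAR z. ALL i<2. pd 0 (I22v l m i) z = (\<Sum>k<2. pd k (f i) (axmap al be z)*P 0 k z)"
   and pI1: "NEAR z. ALL i<2. pd 1 (I22v l m i) z = (\<Sum>k<2. pd k (f i) (axmap al be z)*P 1 k z)"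
   by (rule ext2, rule pI, assumption, simp)+
  have etdep2: "NEAR z. ALL i<2. ALL z'. (ALL k<2. z' k = I22v l m k z) --> et i z' = et i (%k. I22v l m k z)"
   by (rule ext2, rule etdep)
  have all: "NEAR z. ALL i<2. xic i (axmap al be z) = (\<Sum>k<2. pd k (f i) (axmap al be z)*P 0 k z)*X 0 z
    + (\<Sum>k<2. pd k (f i) (axmap al be z)*P 1 k z)*X 1 z
    + et i (%k. if k < 2 then I22v l m k z else 0) + (\<Sum>q<d. c q (%_. 0)*pd (2 + q) (F i) (axmap al be z))"
   using E pI0 pI1 etdep2
  proof eventually_elim
   case (elim z)
   show ?case
   proof (intro allI impI)
    fix i :: nat assume i: "i < 2"
    have 1: "et i (z(0:=I22v l m 0 z, 1:=I22v l m 1 z)) = et i (%k. if k < 2 then I22v l m k z else 0)"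
    proof -
     have "et i (z(0:=I22v l m 0 z, 1:=I22v l m 1 z)) = et i (%k. I22v l m k z)"
      by (rule elim(4)[rule_format, OF i]) (auto simp: less_2_cases_iff)
     moreover have "et i (%k. if k < 2 then I22v l m k z else 0) = et i (%k. I22v l m k z)"
      by (rule elim(4)[rule_format, OF i]) simp
     ultimately show ?thesis by (simp only:)
    qed
    have 2: "(\<Sum>q<d. c q (z(0:=0, 1:=0)) * v q i z) = (\<Sum>q<d. c q (%_. 0)*pd (2 + q) (F i) (axmap al be z))"
     unfolding v
    proof (rule sum.cong[OF refl])
     fix q assume "q \<in> {..<d}"
     then have "c q (z(0:=0, 1:=0)) = c q (%_. 0)" by (intro c0) auto
     then show "c q (z(0:=0, 1:=0))*pd (2 + q) (F i) (axmap al be z) = c q (%_. 0)*pd (2 + q) (F i) (axmap al be z)"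
      by (simp only:)
    qed
    have 3: "pd 0 (I22v l m i) z = (\<Sum>k<2. pd k (f i) (axmap al be z)*P 0 k z)"
     "pd 1 (I22v l m i) z = (\<Sum>k<2. pd k (f i) (axmap al be z)*P 1 k z)" using elim(2,3) i by blast+
    show "xic i (axmap al be z) = (\<Sum>k<2. pd k (f i) (axmap al be z)*P 0 k z)*X 0 z
     + (\<Sum>k<2. pd k (f i) (axmap al be z)*P 1 k z)*X 1 z
     + et i (%k. if k < 2 then I22v l m k z else 0) + (\<Sum>q<d. c q (%_. 0)*pd (2 + q) (F i) (axmap al be z))"
     using elim(1)[rule_format, OF i] unfolding 1 2 3 .
   qed
  qed
  \<comment> \<open>The push-forward of the source field \<open>X\<close> under the change
    \<open>axmap al be\<close>.\<close>
  define A where "A k z = P 0 k (axmap a b z)*X 0 (axmap a b z) + P 1 k (axmap a b z)*X 1 (axmap a b z)" for k z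
  have gA: "germ 2 (A k)" for k
  proof -
   have "germ 2 (%z. u (%k. axmap a b z k))" if "germ 2 u" for u :: "fnc"
    by (rule germ_compose[OF that]) (auto simp: axmap_simps ga)
   then show ?thesis unfolding A_def[abs_def] by (intro germ_add germ_mult) (use gP gX in auto)
  qed
  have A_base: "A k (base z) = A k z" for k z by (simp add: A_def axmap_simps)
  have "NEAR z. ALL i<2. xic i (axmap al be (axmap a b z)) = (\<Sum>k<2. pd k (f i) (axmap al be (axmap a b z))*P 0 k (axmap a b z))*X 0 (axmap a b z)
    + (\<Sum>k<2. pd k (f i) (axmap al be (axmap a b z))*P 1 k (axmap a b z))*X 1 (axmap a b z)
    + et i (%k. if k < 2 then I22v l m k (axmap a b z) else 0) + (\<Sum>q<d. c q (%_. 0)*pd (2 + q) (F i) (axmap al be (axmap a b z)))"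
   by (rule ev_nbf_map[where g = "%k z. axmap a b z k", OF _ _ all]) (auto simp: axmap_simps ga)
  then have fin: "NEAR z. ALL i<2. xic i z = A 0 z*pd 0 (f i) z + A 1 z*pd 1 (f i) z
    + et i (zp (%_. 0) (g (z 0, z 1))) + (\<Sum>q<d. c q (%_. 0)*pd (2 + q) (F i) (base z))"
   using inv Fb
  proof eventually_elim
   case (elim z)
   have "(%k. if k < 2 then I22v l m k (axmap a b z) else 0) = zp (%_. 0) (g (z 0, z 1))"
   proof -
    have e: "F 0 (base z) = I22v l m 0 (axmap a b z)" "F 1 (base z) = I22v l m 1 (axmap a b z)"
     using elim(3) unfolding all_less_2 by blast+
    show ?thesis unfolding g_eq e by (auto simp: zp_def fun_eq_iff less_2_cases_iff)
   qed
   moreover have "xic i (base z) = xic i z" for i by (simp add: xic_def)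
   ultimately show ?case using elim(1,2) by (simp add: all_less_2 numeral_2_eq_2 A_def pf algebra_simps)
  qed
  have iv: "NEAR z. ALL q:{..<d}. initial_velocity Fam q (z 0, z 1) = (pd (2 + q) (F 0) (base z), pd (2 + q) (F 1) (base z))"
  proof (intro eventually_ball_finite ballI)
   fix q assume "q \<in> {..<d}"
   then have q: "2 + q < ?n" by simp
   have "0 < (2::nat)" "1 < (2::nat)" by auto
   then have "germ ?n (F 0)" "germ ?n (F 1)" using gF by blast+
   from ev_nbf_base[OF germ_pd_DERIV[OF this(1) q]] ev_nbf_base[OF germ_pd_DERIV[OF this(2) q]]
   show "NEAR z. initial_velocity Fam q (z 0, z 1) = (pd (2 + q) (F 0) (base z), pd (2 + q) (F 1) (base z))"
   proof eventually_elim
    case (elim z)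
    have e: "zp ((%_. 0)(q:=t)) (z 0, z 1) = (base z)(2 + q:=t)" for t
     by (auto simp: zp_def base_def fun_eq_iff less_2_cases_iff)
    have b: "base z (2 + q) = 0" by simp
    have "((%t. Fam ((%_. 0)(q:=t)) (z 0, z 1)) has_vector_derivative (pd (2 + q) (F 0) (base z), pd (2 + q) (F 1) (base z))) (at 0)"
     unfolding Fam_def e using elim unfolding b
     by (intro has_vector_derivative_Pair; simp only: has_real_derivative_iff_has_vector_derivative)
    then show ?case unfolding initial_velocity_def by (rule vector_derivative_at)
   qed
  qed simp
  let ?D = "%p. xi p - (\<Sum>q<d. c q (%_. 0) *\<^sub>R initial_velocity Fam q p)"
  have Dc: "NEAR z. ALL i<2. cmp i (?D (z 0, z 1)) = xic i z - (\<Sum>q<d. c q (%_. 0)*pd (2 + q) (F i) (base z))"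
   using iv
  proof eventually_elim
   case (elim z)
   show ?case
   proof (intro allI impI)
    fix i :: nat assume i: "i < 2"
    have "(\<Sum>q<d. c q (%_. 0)*cmp i (initial_velocity Fam q (z 0, z 1))) = (\<Sum>q<d. c q (%_. 0)*pd (2 + q) (F i) (base z))"
     by (rule sum.cong[OF refl]) (use elim i in \<open>auto simp: less_2_cases_iff\<close>)
    then show "cmp i (?D (z 0, z 1)) = xic i z - (\<Sum>q<d. c q (%_. 0)*pd (2 + q) (F i) (base z))"
     by (simp only: cmp_linear xic_def)
   qed
  qed
  have "?D \<in> extended_tangent_space g" unfolding extended_tangent_space_def mem_Collect_eq
  proof (intro conjI exI)
   show "analytic_germ2 ?D" unfolding analytic_germ2_iff
   proof (intro allI impI)
    fix i :: nat assume i: "i < 2"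
    have "germ 2 (%z. xic i z - (\<Sum>q<d. c q (%_. 0)*pd (2 + q) (F i) (base z)))"
     by (intro germ_diff germ_sum germ_mult germ_const germ_base[OF gpF(1)] gxi i) simp
    then show "germ 2 (%z. cmp i (?D (z 0, z 1)))"
     by (rule germ_cong) (use Dc i in \<open>auto elim: eventually_mono\<close>)
   qed
   show "analytic_germ2 (%p. A 0 (zp (%_. 0) p))" "analytic_germ2 (%p. A 1 (zp (%_. 0) p))"
    "analytic_germ2 (%p. et 0 (zp (%_. 0) p))" "analytic_germ2 (%p. et 1 (zp (%_. 0) p))"
    unfolding analytic_germ2_def base_zp
    using germ_base[OF gA[of 0]] germ_base[OF gA[of 1]] germ_base[OF get[of 0]] germ_base[OF get[of 1]]
    by simp_all
   have "NEAR z. ALL i<2. cmp i (g (z 0, z 1)) = f i z" by (simp add: g_cmp f_def del: One_nat_def)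
   with gf have "NEAR z. partial_x g (z 0, z 1) = (pd 0 (f 0) z, pd 0 (f 1) z) &
     partial_y g (z 0, z 1) = (pd 1 (f 0) z, pd 1 (f 1) z)" by (rule partial_pair)
   from this Dc fin
   show "\<forall>\<^sub>F p in nhds 0. ?D p = A 0 (zp (%_. 0) p) *\<^sub>R partial_x g p + A 1 (zp (%_. 0) p) *\<^sub>R partial_y g p
     + (et 0 (zp (%_. 0) (g p)), et 1 (zp (%_. 0) (g p)))"
    unfolding eventually_nhds_0_iff
   proof eventually_elim
    case (elim z)
    show ?case unfolding pair_eq_iff_cmp
    proof (intro allI impI)
     fix i :: nat assume i: "i < 2"
     have "cmp i (?D (z 0, z 1)) = A 0 z*pd 0 (f i) z + A 1 z*pd 1 (f i) z + et i (zp (%_. 0) (g (z 0, z 1)))"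
      using elim(2,3) i by simp
     also have "\<dots> = cmp i (A 0 (zp (%_. 0) (z 0, z 1)) *\<^sub>R partial_x g (z 0, z 1) + A 1 (zp (%_. 0) (z 0, z 1)) *\<^sub>R partial_y g (z 0, z 1)
       + (et 0 (zp (%_. 0) (g (z 0, z 1))), et 1 (zp (%_. 0) (g (z 0, z 1)))))"
      using elim(1) i unfolding cmp_linear base_zp A_base by (auto simp: less_2_cases_iff)
     finally show "cmp i (?D (z 0, z 1)) = cmp i (A 0 (zp (%_. 0) (z 0, z 1)) *\<^sub>R partial_x g (z 0, z 1) + A 1 (zp (%_. 0) (z 0, z 1)) *\<^sub>R partial_y g (z 0, z 1)
       + (et 0 (zp (%_. 0) (g (z 0, z 1))), et 1 (zp (%_. 0) (g (z 0, z 1)))))" .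
    qed
   qed
  qed
  then show ?thesis by (rule exI[of _ "%q. c q (%_. 0)"])
 qed
 have "lorentz_versal_deformation g d Fam"
  unfolding lorentz_versal_deformation_def Ae_versal_def using defF univ infin nearF by blast
 then show ?thesis using Aeq hg by blast
qed

subsection \<open>The singularities \<open>I\<^sub>2\<^sub>,\<^sub>2\<^sup>l\<close>\<close>

text \<open>The derivative at the origin, tested along curves with an arbitrary scale
  \<open>c\<close>. The scale is \<open>t\<close> for a source change applied to a ray and
  \<open>t^2\<close> for a target change applied to quadratic terms, so one notion serves
  both.\<close>

definition tangent_map :: "(real \<times> real => real \<times> real) => (real \<times> real => real \<times> real) => bool" where
 "tangent_map f L \<longleftrightarrow> linear L & (ALL gm c v. (gm \<longlongrightarrow> 0) (at (0::real)) -->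
   ((%t. inverse (c t) *\<^sub>R gm t) \<longlongrightarrow> v) (at 0) --> ((%t. inverse (c t) *\<^sub>R f (gm t)) \<longlongrightarrow> L v) (at 0))"

lemma tangent_mapD:
 assumes "tangent_map f L" "(gm \<longlongrightarrow> 0) (at (0::real))" "((%t. inverse (c t) *\<^sub>R gm t) \<longlongrightarrow> v) (at 0)"
 shows "((%t. inverse (c t) *\<^sub>R f (gm t)) \<longlongrightarrow> L v) (at 0)"
 using assms unfolding tangent_map_def by blast

lemma germ_tendsto:
 assumes "germ 2 q"
 shows "((%p. q (zp (%_. 0) p)) \<longlongrightarrow> (q (%_. 0) :: real)) (nhds 0)"
proof (rule tendstoI)
 fix e :: real assume e: "e > 0"
 have "NEAR z. abs(q z - q (%_. 0)) < e"
  by (rule small_germ[OF germ_diff[OF assms germ_const]]) (use e in auto)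
 from ev_nbf_base[OF this] show "\<forall>\<^sub>F p in nhds 0. dist (q (zp (%_. 0) p)) (q (%_. 0)) < e"
  unfolding eventually_nhds_0_iff base_zp(2) dist_real_def .
qed

lemma germ_hadamard:
 fixes f :: "fnc"
 assumes f: "germ 2 f" and f0: "f (%_. 0) = 0"
 shows "EX q r. germ 2 q & germ 2 r &
  (\<forall>\<^sub>F p in nhds 0. f (zp (%_. 0) p) = fst p*q (zp (%_. 0) p) + snd p*r (zp (%_. 0) p))"
proof -
 have l: "0 < (2::nat)" "1 < (2::nat)" by auto
 obtain q where q: "germ 2 q" "NEAR z. f z = f (z(0:=0)) + z 0*q z"
  using germ_division[OF f l(1)] by blast
 obtain r where r: "germ 2 r" "NEAR z. f z = f (z(1:=0)) + z 1*r z"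
  using germ_division[OF f l(2)] by blast
 have "NEAR z. f (base z) = z 0*q (base z) + z 1*r ((base z)(0:=0))"
  using ev_nbf_base[OF q(2)] ev_nbf_base[OF ev_nbf_upd0[OF r(2), of 0]]
 proof eventually_elim
  case (elim z)
  have e: "((base z)(0:=0))(1:=0) = (%_. 0)" by (auto simp: base_def)
  have "f ((base z)(0:=0)) = z 1*r ((base z)(0:=0))" using elim(2) unfolding e f0 by simp
  then show ?case using elim(1) by simp
 qed
 then have "\<forall>\<^sub>F p in nhds 0. f (zp (%_. 0) p) = fst p*q (zp (%_. 0) p) + snd p*(%z. r (z(0:=0))) (zp (%_. 0) p)"
  unfolding eventually_nhds_0_iff base_zp(2) fst_conv snd_conv .
 then show ?thesis using q(1) germ_upd0[OF r(1)] by blast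
qed

lemma map_germ_tangent:
 assumes "map_germ f"
 shows "EX L. tangent_map f L"
proof -
 define fi where "fi i z = cmp i (f (z 0, z 1))" for i and z :: "pnt"
 have gf: "germ 2 (fi i)" if "i < 2" for i
  using assms that unfolding map_germ_def analytic_germ2_iff fi_def[abs_def] by blast
 have f0: "fi i (%_. 0) = 0" for i using assms by (simp add: map_germ_def fi_def cmp_linear zero_prod_def[symmetric])
 have fz: "fi i (zp (%_. 0) p) = cmp i (f p)" for i p by (simp add: fi_def)
 obtain q0 r0 where 0: "germ 2 q0" "germ 2 r0"
  "\<forall>\<^sub>F p in nhds 0. fi 0 (zp (%_. 0) p) = fst p*q0 (zp (%_. 0) p) + snd p*r0 (zp (%_. 0) p)"
  using germ_hadamard[OF gf[of 0] f0] by auto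
 obtain q1 r1 where 1: "germ 2 q1" "germ 2 r1"
  "\<forall>\<^sub>F p in nhds 0. fi 1 (zp (%_. 0) p) = fst p*q1 (zp (%_. 0) p) + snd p*r1 (zp (%_. 0) p)"
  using germ_hadamard[OF gf[of 1] f0] by auto
 define z where "z = (%_::nat. 0::real)"
 define L where "L v = (fst v * q0 z + snd v * r0 z, fst v * q1 z + snd v * r1 z)" for v :: "real \<times> real"
 have lin: "linear L" by (rule linearI) (auto simp: L_def algebra_simps)
 have lim: "((%t. inverse (c t)*u (gm t)) \<longlongrightarrow> fst v * q z + snd v * r z) (at 0)"
  if g: "(gm \<longlongrightarrow> 0) (at (0::real))" "((%t. inverse (c t) *\<^sub>R gm t) \<longlongrightarrow> v) (at 0)"
   and q: "germ 2 q" "germ 2 r" "\<forall>\<^sub>F p in nhds 0. u p = fst p*q (zp (%_. 0) p) + snd p*r (zp (%_. 0) p)"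
  for gm :: "real => real \<times> real" and c v q r u
 proof (rule Lim_transform_eventually)
  show "((%t. fst (inverse (c t) *\<^sub>R gm t)*q (zp (%_. 0) (gm t)) + snd (inverse (c t) *\<^sub>R gm t)*r (zp (%_. 0) (gm t)))
    \<longlongrightarrow> fst v * q z + snd v * r z) (at 0)"
   unfolding z_def by (intro tendsto_add tendsto_mult tendsto_fst tendsto_snd g(2) filterlim_compose[OF germ_tendsto[OF q(1)] g(1)] filterlim_compose[OF germ_tendsto[OF q(2)] g(1)])
  show "\<forall>\<^sub>F t in at 0. fst (inverse (c t) *\<^sub>R gm t)*q (zp (%_. 0) (gm t)) + snd (inverse (c t) *\<^sub>R gm t)*r (zp (%_. 0) (gm t)) = inverse (c t)*u (gm t)"
   using eventually_compose_filterlim[OF q(3) g(1)] by eventually_elim (simp add: algebra_simps)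
 qed
 have "((%t. inverse (c t) *\<^sub>R f (gm t)) \<longlongrightarrow> L v) (at 0)"
  if g: "(gm \<longlongrightarrow> 0) (at (0::real))" "((%t. inverse (c t) *\<^sub>R gm t) \<longlongrightarrow> v) (at 0)" for gm c v
  using tendsto_Pair[OF lim[OF g 0] lim[OF g 1]] unfolding fz L_def by (simp add: cmp_def scaleR_prod_def)
 then show ?thesis unfolding tangent_map_def using lin by blast
qed

lemma tangent_map_tendsto_0:
 assumes "tangent_map f L" "(gm \<longlongrightarrow> 0) (at (0::real))"
 shows "((%t. f (gm t)) \<longlongrightarrow> 0) (at 0)"
proof -
 have "((%t. f (gm t)) \<longlongrightarrow> L 0) (at 0)"
  using tangent_mapD[OF assms, of "%_. 1" 0] assms(2) by simp
 then show ?thesis using assms(1) by (simp add: tangent_map_def linear_0)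
qed

lemma tangent_map_ray:
 assumes "tangent_map f L"
 shows "((%t. inverse t *\<^sub>R f (t *\<^sub>R v)) \<longlongrightarrow> L v) (at 0)" "((%t. f (t *\<^sub>R v)) \<longlongrightarrow> 0) (at 0)"
proof -
 have 1: "((%t. t *\<^sub>R v) \<longlongrightarrow> 0) (at (0::real))" by (auto intro!: tendsto_eq_intros)
 have 2: "((%t. inverse t *\<^sub>R (t *\<^sub>R v)) \<longlongrightarrow> v) (at (0::real))"
  by (rule tendsto_eventually) (simp add: eventually_at_filter)
 show "((%t. inverse t *\<^sub>R f (t *\<^sub>R v)) \<longlongrightarrow> L v) (at 0)"
  by (rule tangent_mapD[OF assms 1 2])
 show "((%t. f (t *\<^sub>R v)) \<longlongrightarrow> 0) (at 0)" by (rule tangent_map_tendsto_0[OF assms 1])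
qed

lemma tangent_map_inverse:
 assumes "tangent_map f L" "tangent_map f' L'" "\<forall>\<^sub>F p in nhds 0. f' (f p) = p"
 shows "L' (L v) = v"
proof -
 have "((%t. inverse t *\<^sub>R f' (f (t *\<^sub>R v))) \<longlongrightarrow> L' (L v)) (at 0)"
  by (rule tangent_mapD[OF assms(2) tangent_map_ray(2)[OF assms(1)] tangent_map_ray(1)[OF assms(1)]])
 moreover have "((%t. inverse t *\<^sub>R f' (f (t *\<^sub>R v))) \<longlongrightarrow> v) (at 0)"
 proof (rule tendsto_eventually)
  have "((%t. t *\<^sub>R v) \<longlongrightarrow> 0) (at (0::real))" by (auto intro!: tendsto_eq_intros)
  from eventually_compose_filterlim[OF assms(3) this] have "\<forall>\<^sub>F t in at 0. f' (f (t *\<^sub>R v)) = t *\<^sub>R v" .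
  moreover have "\<forall>\<^sub>F t in at (0::real). t ~= 0" by (simp add: eventually_at_filter)
  ultimately show "\<forall>\<^sub>F t in at 0. inverse t *\<^sub>R f' (f (t *\<^sub>R v)) = v" by eventually_elim simp
 qed
 ultimately show ?thesis by (rule LIM_unique)
qed

text \<open>After subtraction of the restrictions to the axes a quotient by \<open>x y\<close>
  exists, and its value at the origin is the mixed derivative, here zero.\<close>

lemma mixed_remainder:
 fixes G :: "fnc"
 assumes G: "germ 2 G" and G0: "G (%_. 0) = 0" and m: "pd 1 (pd 0 G) (%_. 0) = 0"
 shows "EX r. germ 2 r & r (%_. 0) = 0 & (NEAR z. G z - G (z(0:=0)) - G (z(1:=0)) = z 0*z 1*r z)"
proof -
 have l: "0 < (2::nat)" "1 < (2::nat)" by auto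
 have G00: "G z' = 0" if "z' 0 = 0" "z' 1 = 0" for z'
 proof -
  have "G z' = G (%_. 0)"
   by (rule ev_nbf_at_0[OF germ_depends[OF G], rule_format]) (use that in \<open>auto simp: less_2_cases_iff\<close>)
  then show ?thesis using G0 by simp
 qed
 define D where "D z = G z - G (z(0:=0)) - G (z(1:=0))" for z
 have gu: "germ 2 (%z. G (z(0:=0)))" "germ 2 (%z. G (z(1:=0)))" by (rule germ_upd0[OF G])+
 have gD: "germ 2 D" unfolding D_def[abs_def] by (intro germ_diff G gu)
 obtain r where r: "germ 2 r" "NEAR z. D z = z 0*z 1*r z"
  using germ_vanish_axes[OF gD order_refl] by (auto simp: D_def G00)
 have e: "NEAR z. D z = z 0*(z 1*r z)" using r(2) by eventually_elim simp
 have g1r: "germ 2 (%z. z 1*r z)" using germ_var[OF l(2)] r(1) by (rule germ_mult)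
 have pD: "NEAR z. pd 0 D z = pd 0 G z - pd 0 G (z(1:=0))"
  using pd_diff[OF germ_diff[OF G gu(1)] gu(2) l(1)] pd_diff[OF G gu(1) l(1)]
 proof eventually_elim
  case (elim z)
  have "pd 0 (%z. G (z(0:=0))) z = 0" by (rule pd_eqI) simp
  moreover have "pd 0 (%z. G (z(1:=0))) z = pd 0 G (z(1:=0))" by (rule pd_upd) simp
  ultimately show ?case using elim unfolding D_def[abs_def] by simp
 qed
 define f where "f z = pd 0 G (z(0:=0)) - pd 0 G (z(0:=0, 1:=0))" for z
 have "NEAR z. f z = z 1*r (z(0:=0))"
  using pd_times_axis[OF g1r l(1) e] ev_nbf_upd0[OF pD, of 0] by eventually_elim (simp add: f_def)
 from pd_times_axis[OF germ_upd0[OF r(1)] l(2) this]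
 have "pd 1 f ((%_. 0)(1:=0)) = r ((%_. 0)(1:=0, 0:=0))" by (rule ev_nbf_at_0)
 then have 1: "pd 1 f (%_. 0) = r (%_. 0)" by (simp add: fun_upd_idem)
 have "((%t. pd 0 G ((%_. 0)(1:=t))) hrd pd 1 (pd 0 G) (%_. 0)) (at 0)"
  using ev_nbf_at_0[OF germ_pd_DERIV[OF germ_chain(2)[OF G l(1)] l(2)]] .
 then have "((%t. pd 0 G ((%_. 0)(1:=t)) - pd 0 G (%_. 0)) hrd 0 - 0) (at 0)"
  unfolding m by (intro DERIV_diff DERIV_const)
 moreover have "f ((%_. 0)(1:=t)) = pd 0 G ((%_. 0)(1:=t)) - pd 0 G (%_. 0)" for t
 proof -
  have "((%_. 0)(1:=t))(0:=0) = (%_::nat. 0::real)(1:=t)" "((%_. 0)(1:=t))(0:=0, 1:=0) = (%_::nat. 0::real)"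
   by (auto simp: fun_eq_iff)
  then show ?thesis by (simp only: f_def)
 qed
 ultimately have "pd 1 f (%_. 0) = 0" by (intro pd_eqI) simp
 then show ?thesis using r 1 unfolding D_def by auto
qed

text \<open>Harmonicity removes the mixed term of the leading quadratic map \<open>K q0 L'\<close>,
  so the polar form of \<open>q0\<close> vanishes on the two columns of \<open>L'\<close>. But
  \<open>q0\<close> is complex squaring up to a factor in the imaginary part, and its polar form is
  complex multiplication: two nonzero complex numbers would have product zero.\<close>

theorem I22_l_not_representable:
 assumes l: "1 <= l"
 shows "\<not> lorentz_representable (I22_l l)"
proof
 assume "lorentz_representable (I22_l l)"
 then obtain g h h' k k' where hg: "lorentz_harmonic_germ g" and h: "inverse_germs h h'" and k: "inverse_germs k k'"
  and gk: "\<forall>\<^sub>F p in nhds 0. g p = k (I22_l l (h' p))"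
  unfolding lorentz_representable_def A_equivalent_def diffeo_germ_def by blast
 obtain L L' K K' where L: "tangent_map h L" "tangent_map h' L'" and K: "tangent_map k K" "tangent_map k' K'"
  using h k map_germ_tangent unfolding inverse_germs_def by metis
 have LL: "L (L' v) = v" for v
  by (rule tangent_map_inverse[OF L(2,1)]) (use h in \<open>auto simp: inverse_germs_def elim: eventually_mono\<close>)
 have KK: "K' (K v) = v" for v
  by (rule tangent_map_inverse[OF K]) (use k in \<open>auto simp: inverse_germs_def elim: eventually_mono\<close>)
 define q0 where "q0 p = ((fst p)^2 - (snd p)^2, fst p * snd p)" for p :: "real \<times> real"
 define ph where "ph v = K (q0 (L' v))" for v
 \<comment> \<open>Only the quadratic part of \<open>I22_l\<close> survives division by
   \<open>t^2\<close>, because the exponent \<open>2 l + 1\<close> is at least 3.\<close>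
 have lim: "((%t. inverse (t^2) *\<^sub>R g (t *\<^sub>R v)) \<longlongrightarrow> ph v) (at 0)" for v
 proof -
  define gm where "gm t = h' (t *\<^sub>R v)" for t
  have gm: "((%t. inverse t *\<^sub>R gm t) \<longlongrightarrow> L' v) (at 0)" "(gm \<longlongrightarrow> 0) (at 0)"
   using tangent_map_ray[OF L(2), of v] unfolding gm_def by auto
  have x0: "((%t. fst (gm t)) \<longlongrightarrow> 0) (at 0)" "((%t. snd (gm t)) \<longlongrightarrow> 0) (at 0)"
   using tendsto_fst[OF gm(2)] tendsto_snd[OF gm(2)] by simp_all
  have I: "I22_l l p = ((fst p)^2 - (snd p)^2 + (fst p)^2*fst p ^ (2*l - 1), fst p * snd p)" for p
  proof -
   have "2*l + 1 = 2 + (2*l - 1)" using l by simp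
   then have "fst p ^ (2*l + 1) = (fst p)^2*fst p ^ (2*l - 1)" by (simp only: power_add)
   then show ?thesis by (simp add: I22_l_def case_prod_beta)
  qed
  have "((%t. ((fst (gm t))^2 - (snd (gm t))^2 + (fst (gm t))^2*fst (gm t) ^ (2*l - 1), fst (gm t) * snd (gm t))) \<longlongrightarrow>
    (0^2 - 0^2 + 0^2*0 ^ (2*l - 1), 0*0)) (at 0)"
   by (intro tendsto_intros x0)
  then have I0: "((%t. I22_l l (gm t)) \<longlongrightarrow> 0) (at 0)" unfolding I by (simp add: zero_prod_def)
  have "((%t. ((fst (inverse t *\<^sub>R gm t))^2 - (snd (inverse t *\<^sub>R gm t))^2 + (fst (inverse t *\<^sub>R gm t))^2*fst (gm t) ^ (2*l - 1),
     fst (inverse t *\<^sub>R gm t) * snd (inverse t *\<^sub>R gm t))) \<longlongrightarrow>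
    ((fst (L' v))^2 - (snd (L' v))^2 + (fst (L' v))^2*0 ^ (2*l - 1), fst (L' v) * snd (L' v))) (at 0)"
   by (intro tendsto_intros x0 gm(1))
  note lim0 = this
  have z: "0 ^ (2*l - 1) = (0::real)" using l by (simp add: power_0_left)
  have e: "inverse (t^2) *\<^sub>R I22_l l (gm t) = ((fst (inverse t *\<^sub>R gm t))^2 - (snd (inverse t *\<^sub>R gm t))^2
    + (fst (inverse t *\<^sub>R gm t))^2*fst (gm t) ^ (2*l - 1), fst (inverse t *\<^sub>R gm t) * snd (inverse t *\<^sub>R gm t))" for t
   unfolding I by (simp add: scaleR_prod_def power_mult_distrib power2_eq_square algebra_simps)
  have q0: "((%t. inverse (t^2) *\<^sub>R I22_l l (gm t)) \<longlongrightarrow> q0 (L' v)) (at 0)"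
   using lim0 unfolding z e q0_def mult_zero_right add_0_right .
  have "((%t. inverse (t^2) *\<^sub>R k (I22_l l (gm t))) \<longlongrightarrow> ph v) (at 0)"
   unfolding ph_def by (rule tangent_mapD[OF K(1) I0 q0])
  moreover have "((%t. t *\<^sub>R v) \<longlongrightarrow> 0) (at (0::real))" by (auto intro!: tendsto_eq_intros)
  from eventually_compose_filterlim[OF gk this]
  have "\<forall>\<^sub>F t in at 0. inverse (t^2) *\<^sub>R k (I22_l l (gm t)) = inverse (t^2) *\<^sub>R g (t *\<^sub>R v)"
   by eventually_elim (simp add: gm_def)
  ultimately show ?thesis by (rule Lim_transform_eventually)
 qed
 note G = lorentz_harmonic_germ_pd[OF hg]
 have mix: "cmp i (ph (1, 1) - ph (0, 1) - ph (1, 0)) = 0" if i: "i < 2" for i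
 proof -
  let ?G = "%z. cmp i (g (z 0, z 1))"
  \<comment> \<open>Every term on the right hand side of the equation contains a component of the
    map itself, which vanishes at the origin.\<close>
  have "pd 1 (pd 0 ?G) (%_. 0) = 0" using ev_nbf_at_0[OF G(3)] i G(2) by (simp add: hrhs_def)
  then obtain r where r: "germ 2 r" "r (%_. 0) = 0"
   "NEAR z. ?G z - ?G (z(0:=0)) - ?G (z(1:=0)) = z 0*z 1*r z"
   using mixed_remainder[OF G(1)[OF i] G(2)] by blast
  have "NEAR z. cmp i (g (z 0, z 1) - g (0, z 1) - g (z 0, 0)) = z 0*z 1*r (base z)"
   using ev_nbf_base[OF r(3)] by eventually_elim (simp add: cmp_linear)
  then have ev: "\<forall>\<^sub>F p in nhds 0. cmp i (g p - g (0, snd p) - g (fst p, 0)) = fst p * snd p*r (zp (%_. 0) p)"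
   unfolding eventually_nhds_0_iff base_zp(2) fst_conv snd_conv .
  have t0: "((%t. (t, t)) \<longlongrightarrow> 0) (at (0::real))"
   using tendsto_Pair[OF tendsto_ident_at tendsto_ident_at, of "0::real" UNIV] by (simp add: zero_prod_def)
  have "((%t. r (zp (%_. 0) (t, t))) \<longlongrightarrow> 0) (at 0)" using filterlim_compose[OF germ_tendsto[OF r(1)] t0] r(2) by simp
  moreover have "\<forall>\<^sub>F t in at 0. r (zp (%_. 0) (t, t)) = cmp i (inverse (t^2) *\<^sub>R g (t *\<^sub>R (1, 1))
    - inverse (t^2) *\<^sub>R g (t *\<^sub>R (0, 1)) - inverse (t^2) *\<^sub>R g (t *\<^sub>R (1, 0)))"
   using eventually_compose_filterlim[OF ev t0] eventually_at_filter[of "%t. t ~= (0::real)" 0 UNIV, simplified]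
  proof eventually_elim
   case (elim t)
   have "cmp i (g (t, t)) - cmp i (g (0, t)) - cmp i (g (t, 0)) = t^2*r (zp (%_. 0) (t, t))"
    using elim(1) by (simp add: cmp_linear power2_eq_square)
   then have "inverse (t^2)*(cmp i (g (t, t)) - cmp i (g (0, t)) - cmp i (g (t, 0))) = r (zp (%_. 0) (t, t))" using elim(2) by simp
   then show ?case by (simp add: cmp_linear right_diff_distrib)
  qed
  ultimately have "((%t. cmp i (inverse (t^2) *\<^sub>R g (t *\<^sub>R (1, 1))
    - inverse (t^2) *\<^sub>R g (t *\<^sub>R (0, 1)) - inverse (t^2) *\<^sub>R g (t *\<^sub>R (1, 0)))) \<longlongrightarrow> 0) (at 0)"
   by (rule Lim_transform_eventually)
  moreover have tc: "((%t. cmp i (u t)) \<longlongrightarrow> cmp i v) (at 0)" if "(u \<longlongrightarrow> v) (at (0::real))" for u v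
   using tendsto_fst[OF that] tendsto_snd[OF that] by (simp add: cmp_def)
  have "((%t. cmp i (inverse (t^2) *\<^sub>R g (t *\<^sub>R (1, 1))
    - inverse (t^2) *\<^sub>R g (t *\<^sub>R (0, 1)) - inverse (t^2) *\<^sub>R g (t *\<^sub>R (1, 0)))) \<longlongrightarrow> cmp i (ph (1, 1) - ph (0, 1) - ph (1, 0))) (at 0)"
   by (intro tc tendsto_diff lim)
  ultimately show ?thesis by (rule LIM_unique[symmetric])
 qed
 have "ph (1, 1) - ph (0, 1) - ph (1, 0) = 0" unfolding pair_eq_iff_cmp using mix by (simp add: cmp_linear)
 then have "ph (1, 1) = ph (0, 1) + ph (1, 0)" by (simp add: algebra_simps)
 then have "K' (ph (1, 1)) = K' (ph (0, 1)) + K' (ph (1, 0))" using K(2) by (simp add: tangent_map_def linear_add)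
 then have q: "q0 (L' (1, 1)) = q0 (L' (0, 1)) + q0 (L' (1, 0))" unfolding ph_def KK .
 have linL: "linear L" "linear L'" using L by (simp_all add: tangent_map_def)
 obtain a c where ac: "L' (1, 0) = (a, c)" by (cases "L' (1, 0)")
 obtain b d where bd: "L' (0, 1) = (b, d)" by (cases "L' (0, 1)")
 have "L' (1, 1) = (a + b, c + d)" using linear_add[OF linL(2), of "(1, 0)" "(0, 1)"] by (simp add: ac bd)
 with q have e: "(a + b)^2 - (c + d)^2 = b^2 - d^2 + (a^2 - c^2)" "(a + b)*(c + d) = b*d + a*c"
  by (simp_all add: q0_def ac bd)
 \<comment> \<open>Together with the next line these are the real and the imaginary part of
   \<open>(a + i c) (b + i d) = 0\<close>.\<close>
 have 1: "a*b = c*d" using e(1) by (simp add: power2_eq_square algebra_simps)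
 have 2: "a*d = - (b*c)" using e(2) by (simp add: algebra_simps)
 have "d*(a*a + c*c) = a*(a*d) + c*(c*d)" by (simp add: algebra_simps)
 also have "\<dots> = a*(- (b*c)) + c*(a*b)" by (simp only: 1 2)
 finally have d0: "d*(a*a + c*c) = 0" by (simp add: algebra_simps)
 have "b*(a*a + c*c) = a*(a*b) - c*(- (b*c))" by (simp add: algebra_simps)
 also have "\<dots> = a*(c*d) - c*(a*d)" by (simp only: 1 2)
 finally have b0: "b*(a*a + c*c) = 0" by (simp add: algebra_simps)
 have "a*a + c*c ~= 0"
 proof
  assume "a*a + c*c = 0"
  then have "a = 0" "c = 0" by (simp_all add: sum_squares_eq_zero_iff)
  then have "L' (1, 0) = 0" by (simp add: ac zero_prod_def)
  then have "(1::real, 0::real) = 0" using LL[of "(1, 0)"] linear_0[OF linL(1)] by simp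
  then show False by (simp add: zero_prod_def)
 qed
 then have "b = 0" "d = 0" using b0 d0 unfolding mult_eq_0_iff by blast+
 then have "L' (0, 1) = 0" by (simp add: bd zero_prod_def)
 then have "(0::real, 1::real) = 0" using LL[of "(0, 1)"] linear_0[OF linL(1)] by simp
 then show False by (simp add: zero_prod_def)
qed

subsection \<open>Jets of order two\<close>

text \<open>The second order difference of \<open>G\<close> is symmetric in the two directions.
  Hence the same quotient \<open>r\<close> computes the mixed derivative in either order, at the
  points where both coordinates vanish.\<close>

lemma mixed_pd:
 fixes G r :: "fnc"
 assumes G: "germ n G" and r: "germ n r" and ij: "i < n" "j < n" "i ~= j"
  and e: "\<forall>\<^sub>F z in nbf n. G z - G (z(i:=0)) - G (z(j:=0)) + G (z(i:=0, j:=0)) = z i*z j*r z"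
 shows "\<forall>\<^sub>F z in nbf n. pd j (pd i G) (z(i:=0, j:=0)) = r (z(i:=0, j:=0))"
proof -
 define D where "D z = (G z - G (z(i:=0))) - (G (z(j:=0)) - G (z(i:=0, j:=0)))" for z
 note g1 = germ_upd0[OF G, of i] and g2 = germ_upd0[OF G, of j]
 note g3 = germ_upd0[OF g2, of i]
 have De: "\<forall>\<^sub>F z in nbf n. D z = z i*(z j*r z)" using e by eventually_elim (simp add: D_def algebra_simps)
 have pD: "\<forall>\<^sub>F z in nbf n. pd i D z = pd i G z - pd i G (z(j:=0))"
  using pd_diff[OF germ_diff[OF G g1] germ_diff[OF g2 g3] ij(1)] pd_diff[OF G g1 ij(1)] pd_diff[OF g2 g3 ij(1)]
 proof eventually_elim
  case (elim z)
  have "pd i (%z. G (z(i:=0))) z = 0" "pd i (%z. G (z(i:=0, j:=0))) z = 0" by (rule pd_eqI, simp)+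
  moreover have "pd i (%z. G (z(j:=0))) z = pd i G (z(j:=0))" by (rule pd_upd[OF ij(3)])
  ultimately show ?case using elim unfolding D_def[abs_def] by linarith
 qed
 define f where "f z = pd i G (z(i:=0)) - pd i G (z(i:=0, j:=0))" for z
 have gjr: "germ n (%z. z j*r z)" using germ_var[OF ij(2)] r by (rule germ_mult)
 have fe: "\<forall>\<^sub>F z in nbf n. f z = z j*r (z(i:=0))"
  using pd_times_axis[OF gjr ij(1) De] ev_nbf_upd0[OF pD, of i]
  by eventually_elim (use ij(3) in \<open>simp add: f_def\<close>)
 have gi: "germ n (pd i G)" by (rule germ_chain(2)[OF G ij(1)])
 note h1 = germ_upd0[OF gi, of i] and h2 = germ_upd0[OF germ_upd0[OF gi, of j], of i]
 have "\<forall>\<^sub>F z in nbf n. pd j f z = pd j (pd i G) (z(i:=0))"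
  using pd_diff[OF h1 h2 ij(2)]
 proof eventually_elim
  case (elim z)
  have "z(j:=t, i:=0, j:=0) = z(i:=0, j:=0)" for t using ij(3) by (auto simp: fun_eq_iff)
  then have "pd j (%z. pd i G (z(i:=0, j:=0))) z = 0" by (intro pd_eqI) simp
  moreover have "pd j (%z. pd i G (z(i:=0))) z = pd j (pd i G) (z(i:=0))" by (rule pd_upd) (use ij(3) in simp)
  ultimately show ?case using elim unfolding f_def[abs_def] by linarith
 qed
 from pd_times_axis[OF germ_upd0[OF r] ij(2) fe] ev_nbf_upd0[OF this, of j]
 show ?thesis
 proof eventually_elim
  case (elim z)
  have "z(j:=0, i:=0) = z(i:=0, j:=0)" using ij(3) by (simp add: fun_upd_twist)
  then show ?case using elim by simp
 qed
qed

text \<open>\<open>mixed_pd\<close> compares the two orders only where the differentiated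
  coordinates vanish. With two further variables, in \<open>f (x + s, y + t)\<close>, every point
  near the origin turns into such a place.\<close>

lemma pd_commute:
 fixes f :: "fnc"
 assumes f: "germ 2 f"
 shows "NEAR z. pd 1 (pd 0 f) (base z) = pd 0 (pd 1 f) (base z)"
proof -
 define sh where "sh z k = (if k < 2 then z k + z (k + 2) else 0)" for z :: "pnt" and k :: nat
 have psh: "pd i (%z. u (sh z)) z = pd i u (sh z)" if "i < 2" for u i z
 proof -
  have 1: "sh (z(i:=t)) = (sh z)(i:=t + z (i + 2))" for t using that by (auto simp: sh_def fun_eq_iff)
  have 2: "sh z i = z i + z (i + 2)" using that by (simp add: sh_def)
  have 3: "((%t. u ((sh z)(i:=t + z (i + 2)))) hrd D) (at (z i)) \<longleftrightarrow>
    ((%t. u ((sh z)(i:=t))) hrd D) (at (z i + z (i + 2)))" for D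
   by (rule DERIV_shift[symmetric])
  show ?thesis unfolding pd_def deriv_def 1 2 3 ..
 qed
 define G where "G z = f (sh z)" for z
 have G: "germ 4 G" unfolding G_def[abs_def]
 proof (rule germ_compose[OF f, where g = "%k z. sh z k"])
  show "germ 4 (%z. sh z k)" if "k < 2" for k
   using that unfolding sh_def by (simp, intro germ_add germ_var) auto
 qed (simp add: sh_def)
 have tw: "z(1:=0, 0:=0) = z(0:=0, 1:=0)" for z :: "pnt" by auto
 have l: "0 < (4::nat)" "1 < (4::nat)" "(0::nat) ~= 1" "(1::nat) ~= 0" "2 <= (4::nat)" by auto
 define D where "D z = G z - G (z(0:=0)) - G (z(1:=0)) + G (z(0:=0, 1:=0))" for z
 have "EX r. germ 4 r & (\<forall>\<^sub>F z in nbf 4. D z = z 0*z 1*r z)"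
 proof (rule germ_vanish_axes[OF _ l(5)])
  show "germ 4 D" unfolding D_def[abs_def]
   by (intro germ_add germ_diff G germ_upd0[OF G] germ_upd0[OF germ_upd0[OF G]])
  have "(z(1:=0))(0:=0, 1:=0) = z(1:=0, 0:=0)" for z :: "pnt" by auto
  then show "\<forall>\<^sub>F z in nbf 4. D (z(0:=0)) = 0" "\<forall>\<^sub>F z in nbf 4. D (z(1:=0)) = 0" by (simp_all add: D_def)
 qed
 then obtain r where r: "germ 4 r" "\<forall>\<^sub>F z in nbf 4. D z = z 0*z 1*r z" by blast
 have 1: "\<forall>\<^sub>F z in nbf 4. pd 1 (pd 0 G) (z(0:=0, 1:=0)) = r (z(0:=0, 1:=0))"
  by (rule mixed_pd[OF G r(1) l(1,2,3)]) (use r(2) in \<open>unfold D_def\<close>)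
 have 2: "\<forall>\<^sub>F z in nbf 4. pd 0 (pd 1 G) (z(1:=0, 0:=0)) = r (z(1:=0, 0:=0))"
 proof (rule mixed_pd[OF G r(1) l(2,1,4)])
  show "\<forall>\<^sub>F z in nbf 4. G z - G (z(1:=0)) - G (z(0:=0)) + G (z(1:=0, 0:=0)) = z 1*z 0*r z"
   using r(2) unfolding D_def tw by eventually_elim (simp only: diff_right_commute mult.commute[of _ "_ 0"])
 qed
 have lt: "0 < (2::nat)" "1 < (2::nat)" by auto
 have p: "pd 0 G = (%z. pd 0 f (sh z))" "pd 1 G = (%z. pd 1 f (sh z))"
  unfolding G_def[abs_def] by (rule ext, rule psh[OF lt(1)]) (rule ext, rule psh[OF lt(2)])
 have pp: "pd 1 (pd 0 G) z = pd 1 (pd 0 f) (sh z)" "pd 0 (pd 1 G) z = pd 0 (pd 1 f) (sh z)" for z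
  unfolding p by (rule psh[OF lt(2)]) (rule psh[OF lt(1)])
 obtain dl where dl: "dl > 0" and H: "!!z. ALL i<4. abs(z i) < dl ==>
   pd 1 (pd 0 G) (z(0:=0, 1:=0)) = r (z(0:=0, 1:=0)) & pd 0 (pd 1 G) (z(1:=0, 0:=0)) = r (z(1:=0, 0:=0))"
  using eventually_conj[OF 1 2] unfolding ev_nbf by blast
 have "pd 1 (pd 0 f) (base s) = pd 0 (pd 1 f) (base s)" if s: "ALL i<2. abs(s i) < dl" for s
 proof -
  define z where "z k = (if k = 2 then s 0 else if k = 3 then s 1 else 0)" for k :: nat
  have z: "z(0:=0, 1:=0) = z" "z(1:=0, 0:=0) = z" by (auto simp: z_def fun_eq_iff)
  have "sh z = base s" by (auto simp: sh_def z_def base_def fun_eq_iff less_2_cases_iff)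
  moreover have "ALL i<4. abs(z i) < dl" using s dl by (auto simp: z_def all_less_2)
  ultimately show ?thesis using H[of z] unfolding z pp by simp
 qed
 then show ?thesis unfolding ev_nbf using dl by blast
qed

abbreviation pt :: "real \<times> real => pnt" where "pt \<equiv> zp (%_. 0)"

text \<open>Total differentiability is what the theorem on negligible images of lower-dimensional
  sets requires.\<close>

lemma germ_differentiable:
 fixes q :: "fnc"
 assumes "germ 2 q"
 shows "\<forall>\<^sub>F p in nhds 0. (%p. q (pt p)) differentiable (at p)"
proof -
 obtain r K D where r: "r > 0" and est: "!!z h. (ALL i<2. abs(z i) < r) ==> (ALL i<2. abs(h i) < r) ==>
    abs(q (%i. z i + h i) - q z - (\<Sum>i<2. h i*D i z)) <= K*(\<Sum>i<2. abs(h i))^2"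
  using germ_derivatives[OF assms] by blast
 have "(%p. q (pt p)) differentiable (at p)" if p: "dist p 0 < r" for p
 proof -
  define A where "A h = fst h*D 0 (pt p) + snd h*D 1 (pt p)" for h :: "real \<times> real"
  have "((%p. q (pt p)) has_derivative A) (at p)" unfolding has_derivative_at_alt
  proof (intro conjI allI impI)
   show "bounded_linear A" unfolding A_def[abs_def]
    by (intro bounded_linear_add bounded_linear_mult_const bounded_linear_fst bounded_linear_snd)
   fix e :: real assume e: "e > 0"
   define d where "d = min r (e / (4*(abs(K) + 1)))"
   have d: "d > 0" using r e by (simp add: d_def)
   have "norm (q (pt y) - q (pt p) - A (y - p)) <= e*norm (y - p)" if y: "norm (y - p) < d" for y
   proof -
    let ?h = "pt (y - p)" and ?N = "norm (y - p)"
    have h: "abs(?h 0) <= ?N" "abs(?h 1) <= ?N" using abs_le_norm_pair[of "y - p"] by simp_all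
    have sm: "ALL i<2. abs(pt p i) < r" "ALL i<2. abs(?h i) < r"
     using abs_le_norm_pair[of p] p h y unfolding all_less_2 d_def by (auto simp: dist_norm)
    have py: "pt y = (%i. pt p i + ?h i)" by (auto simp: zp_def)
    have s2: "(\<Sum>i<2. F i) = F 0 + F 1" for F :: "pnt" by (simp add: numeral_2_eq_2)
    have "norm (q (pt y) - q (pt p) - A (y - p)) <= K*(abs(?h 0) + abs(?h 1))^2"
     using est[OF sm] unfolding py[symmetric] s2 by (simp add: A_def)
    also have "\<dots> <= (abs(K) + 1)*(2*?N)^2"
     using h by (intro mult_mono power_mono) auto
    also have "\<dots> = (4*(abs(K) + 1)*?N)*?N" by (simp add: power2_eq_square)
    also have "\<dots> <= e*?N"
    proof (rule mult_right_mono)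
     have "?N <= e / (4*(abs(K) + 1))" using y by (simp add: d_def)
     then have "4*(abs(K) + 1)*?N <= 4*(abs(K) + 1)*(e / (4*(abs(K) + 1)))" by (intro mult_left_mono) auto
     also have "\<dots> = e" using abs_ge_zero[of K] by (simp add: field_simps)
     finally show "4*(abs(K) + 1)*?N <= e" .
    qed simp
    finally show ?thesis .
   qed
   then show "EX d>0. ALL y. norm (y - p) < d --> norm (q (pt y) - q (pt p) - A (y - p)) <= e*norm (y - p)" using d by blast
  qed
  then show ?thesis unfolding differentiable_def by blast
 qed
 then show ?thesis unfolding eventually_nhds_metric using r by blast
qed

text \<open>A 2-jet lists the value and the derivatives \<open>x, y, xx, xy, yy\<close>.\<close>

definition jt :: "(fnc) => (pnt) => pnt" where
 "jt ph z k = (if k = 0 then ph z else if k = 1 then pd 0 ph z else if k = 2 then pd 1 ph z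
  else if k = 3 then pd 0 (pd 0 ph) z else if k = 4 then pd 1 (pd 0 ph) z else pd 1 (pd 1 ph) z)"

text \<open>The Leibniz rule for 2-jets.\<close>

definition jmul :: "(pnt) => (pnt) => pnt" where
 "jmul w p k = (if k = 0 then w 0*p 0 else if k = 1 then w 1*p 0 + w 0*p 1 else if k = 2 then w 2*p 0 + w 0*p 2
  else if k = 3 then w 3*p 0 + 2*(w 1*p 1) + w 0*p 3
  else if k = 4 then (w 4*p 0 + w 1*p 2) + (w 2*p 1 + w 0*p 4) else w 5*p 0 + 2*(w 2*p 2) + w 0*p 5)"

type_synonym coeffs = "real \<times> real \<times> real \<times> real \<times> real \<times> real"

text \<open>The 2-jet at \<open>(x, y)\<close> of the quadratic polynomial with coefficients
  \<open>c\<close>.\<close>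

definition qjet :: "coeffs => real => real => pnt" where
 "qjet c x y k = (case c of (c0, c1, c2, c3, c4, c5) =>
  if k = 0 then c0 + c1*x + c2*y + c3*(x*x) + c4*(x*y) + c5*(y*y)
  else if k = 1 then c1 + 2*c3*x + c4*y else if k = 2 then c2 + c4*x + 2*c5*y
  else if k = 3 then 2*c3 else if k = 4 then c4 else 2*c5)"

text \<open>The relations that make a family of tables the 2-jets of its entry 0. The mixed entry
  must be reached from both first derivatives, for which \<open>pd_commute\<close> is
  invoked.\<close>

definition dtab :: "((pnt) => pnt) => (pnt) => bool" where
 "dtab J z \<longleftrightarrow> ((%t. J (z(0:=t)) 0) hrd J z 1) (at (z 0)) &
  ((%t. J (z(0:=t)) 1) hrd J z 3) (at (z 0)) &
  ((%t. J (z(0:=t)) 2) hrd J z 4) (at (z 0)) &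
  ((%t. J (z(1:=t)) 0) hrd J z 2) (at (z 1)) &
  ((%t. J (z(1:=t)) 1) hrd J z 4) (at (z 1)) &
  ((%t. J (z(1:=t)) 2) hrd J z 5) (at (z 1))"

lemma germ_jt:
 assumes "germ 2 ph"
 shows "germ 2 (%z. jt ph z k)"
proof -
 have l: "0 < (2::nat)" "1 < (2::nat)" by auto
 note c = germ_chain(2)
 have "germ 2 ph" "germ 2 (pd 0 ph)" "germ 2 (pd 1 ph)" "germ 2 (pd 0 (pd 0 ph))"
  "germ 2 (pd 1 (pd 0 ph))" "germ 2 (pd 1 (pd 1 ph))"
  by (rule assms c[OF assms l(1)] c[OF assms l(2)] c[OF c[OF assms l(1)] l(1)] c[OF c[OF assms l(1)] l(2)] c[OF c[OF assms l(2)] l(2)])+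
 then show ?thesis unfolding jt_def
  by (cases "k = 0"; cases "k = 1"; cases "k = 2"; cases "k = 3"; cases "k = 4") simp_all
qed

lemma dtab_jt:
 assumes "germ 2 ph"
 shows "\<forall>\<^sub>F p in nhds 0. dtab (jt ph) (pt p)"
proof -
 have l: "0 < (2::nat)" "1 < (2::nat)" by auto
 note c = germ_chain(2) and d = germ_pd_DERIV
 note gx = c[OF assms l(1)] and gy = c[OF assms l(2)]
 have e: "jt ph z 0 = ph z" "jt ph z 1 = pd 0 ph z" "jt ph z 2 = pd 1 ph z" "jt ph z 3 = pd 0 (pd 0 ph) z"
  "jt ph z 4 = pd 1 (pd 0 ph) z" "jt ph z 5 = pd 1 (pd 1 ph) z" for z
  by (simp_all add: jt_def)
 have "NEAR z. dtab (jt ph) (base z)"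
  using ev_nbf_base[OF d[OF assms l(1)]] ev_nbf_base[OF d[OF gx l(1)]] ev_nbf_base[OF d[OF gy l(1)]]
   ev_nbf_base[OF d[OF assms l(2)]] ev_nbf_base[OF d[OF gx l(2)]] ev_nbf_base[OF d[OF gy l(2)]]
   pd_commute[OF assms]
  unfolding dtab_def e by eventually_elim (intro conjI; simp only:)
 then show ?thesis unfolding eventually_nhds_0_iff base_zp(2) .
qed

lemma dtab_qjet: "dtab (%z. qjet c (z 0) (z 1)) z"
proof -
 obtain c0 c1 c2 c3 c4 c5 where c: "c = (c0, c1, c2, c3, c4, c5)" by (cases c)
 show ?thesis unfolding dtab_def qjet_def c by (intro conjI) (auto intro!: derivative_eq_intros simp: algebra_simps)
qed

lemma dtab_add:
 assumes "dtab A z" "dtab B z"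
 shows "dtab (%z k. A z k + B z k) z"
 using assms unfolding dtab_def by (intro conjI DERIV_add) blast+

lemma dtab_jmul:
 assumes "dtab A z" "dtab B z"
 shows "dtab (%z. jmul (A z) (B z)) z"
proof -
 note a = assms(1)[unfolded dtab_def] and b = assms(2)[unfolded dtab_def]
 note a1 = a[THEN conjunct1] and a2 = a[THEN conjunct2, THEN conjunct1] and a3 = a[THEN conjunct2, THEN conjunct2, THEN conjunct1]
  and a4 = a[THEN conjunct2, THEN conjunct2, THEN conjunct2, THEN conjunct1]
  and a5 = a[THEN conjunct2, THEN conjunct2, THEN conjunct2, THEN conjunct2, THEN conjunct1]
  and a6 = a[THEN conjunct2, THEN conjunct2, THEN conjunct2, THEN conjunct2, THEN conjunct2]
 note b1 = b[THEN conjunct1] and b2 = b[THEN conjunct2, THEN conjunct1] and b3 = b[THEN conjunct2, THEN conjunct2, THEN conjunct1]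
  and b4 = b[THEN conjunct2, THEN conjunct2, THEN conjunct2, THEN conjunct1]
  and b5 = b[THEN conjunct2, THEN conjunct2, THEN conjunct2, THEN conjunct2, THEN conjunct1]
  and b6 = b[THEN conjunct2, THEN conjunct2, THEN conjunct2, THEN conjunct2, THEN conjunct2]
 have e: "jmul w p 0 = w 0*p 0" "jmul w p 1 = w 1*p 0 + w 0*p 1" "jmul w p 2 = w 2*p 0 + w 0*p 2"
  "jmul w p 3 = w 3*p 0 + 2*(w 1*p 1) + w 0*p 3" "jmul w p 4 = (w 4*p 0 + w 1*p 2) + (w 2*p 1 + w 0*p 4)"
  "jmul w p 5 = w 5*p 0 + 2*(w 2*p 2) + w 0*p 5" for w p
  by (simp_all add: jmul_def)
 show ?thesis unfolding dtab_def e
 proof (intro conjI)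
  show "((%t. A (z(0:=t)) 0*B (z(0:=t)) 0) hrd A z 1*B z 0 + A z 0*B z 1) (at (z 0))"
   by (rule DERIV_cong[OF DERIV_mult[OF a1 b1]]) (simp add: algebra_simps)
  show "((%t. A (z(0:=t)) 1*B (z(0:=t)) 0 + A (z(0:=t)) 0*B (z(0:=t)) 1) hrd
    A z 3*B z 0 + 2*(A z 1*B z 1) + A z 0*B z 3) (at (z 0))"
   by (rule DERIV_cong[OF DERIV_add[OF DERIV_mult[OF a2 b1] DERIV_mult[OF a1 b2]]]) (simp add: algebra_simps)
  show "((%t. A (z(0:=t)) 2*B (z(0:=t)) 0 + A (z(0:=t)) 0*B (z(0:=t)) 2) hrd
    (A z 4*B z 0 + A z 1*B z 2) + (A z 2*B z 1 + A z 0*B z 4)) (at (z 0))"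
   by (rule DERIV_cong[OF DERIV_add[OF DERIV_mult[OF a3 b1] DERIV_mult[OF a1 b3]]]) (simp add: algebra_simps)
  show "((%t. A (z(1:=t)) 0*B (z(1:=t)) 0) hrd A z 2*B z 0 + A z 0*B z 2) (at (z 1))"
   by (rule DERIV_cong[OF DERIV_mult[OF a4 b4]]) (simp add: algebra_simps)
  show "((%t. A (z(1:=t)) 1*B (z(1:=t)) 0 + A (z(1:=t)) 0*B (z(1:=t)) 1) hrd
    (A z 4*B z 0 + A z 1*B z 2) + (A z 2*B z 1 + A z 0*B z 4)) (at (z 1))"
   by (rule DERIV_cong[OF DERIV_add[OF DERIV_mult[OF a5 b4] DERIV_mult[OF a4 b5]]]) (simp add: algebra_simps)
  show "((%t. A (z(1:=t)) 2*B (z(1:=t)) 0 + A (z(1:=t)) 0*B (z(1:=t)) 2) hrd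
    A z 5*B z 0 + 2*(A z 2*B z 2) + A z 0*B z 5) (at (z 1))"
   by (rule DERIV_cong[OF DERIV_add[OF DERIV_mult[OF a6 b4] DERIV_mult[OF a4 b6]]]) (simp add: algebra_simps)
 qed
qed

text \<open>Inverse of the linear map that sends a quadratic polynomial \<open>p\<close> to the 2-jet of \<open>w p\<close> at \<open>(x, y)\<close>.\<close>

definition sol :: "real => real => (pnt) => (pnt) => coeffs" where
 "sol x y N w = (let q0 = N 0 / w 0; q1 = (N 1 - w 1*q0) / w 0; q2 = (N 2 - w 2*q0) / w 0;
   q3 = (N 3 - w 3*q0 - 2*(w 1*q1)) / w 0; q4 = (N 4 - w 4*q0 - w 1*q2 - w 2*q1) / w 0;
   q5 = (N 5 - w 5*q0 - 2*(w 2*q2)) / w 0; c1 = q1 - q3*x - q4*y; c2 = q2 - q4*x - q5*y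
  in (q0 - c1*x - c2*y - q3 / 2*(x*x) - q4*(x*y) - q5 / 2*(y*y), c1, c2, q3 / 2, q4, q5 / 2))"

lemma sol_jmul:
 assumes w: "w 0 ~= 0" and N: "!!k. k < 6 ==> N k = jmul w (qjet c x y) k"
 shows "sol x y N w = c"
proof -
 let ?q = "qjet c x y"
 have n: "N 0 = w 0*?q 0" "N 1 = w 1*?q 0 + w 0*?q 1" "N 2 = w 2*?q 0 + w 0*?q 2"
  "N 3 = w 3*?q 0 + 2*(w 1*?q 1) + w 0*?q 3" "N 4 = (w 4*?q 0 + w 1*?q 2) + (w 2*?q 1 + w 0*?q 4)"
  "N 5 = w 5*?q 0 + 2*(w 2*?q 2) + w 0*?q 5"
  using N[of 0] N[of 1] N[of 2] N[of 3] N[of 4] N[of 5] by (simp_all add: jmul_def)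
 have q0: "N 0 / w 0 = ?q 0" using w by (simp add: n)
 have q1: "(N 1 - w 1*?q 0) / w 0 = ?q 1" unfolding n(2) using w by simp
 have q2: "(N 2 - w 2*?q 0) / w 0 = ?q 2" unfolding n(3) using w by simp
 have q3: "(N 3 - w 3*?q 0 - 2*(w 1*?q 1)) / w 0 = ?q 3" unfolding n(4) using w by simp
 have q4: "(N 4 - w 4*?q 0 - w 1*?q 2 - w 2*?q 1) / w 0 = ?q 4" unfolding n(5) using w by simp
 have q5: "(N 5 - w 5*?q 0 - 2*(w 2*?q 2)) / w 0 = ?q 5" unfolding n(6) using w by simp
 obtain c0 c1 c2 c3 c4 c5 where c: "c = (c0, c1, c2, c3, c4, c5)" by (cases c)
 show ?thesis unfolding sol_def Let_def q0 q1 q2 q3 q4 q5 by (simp add: qjet_def c algebra_simps)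
qed

lemma sol_differentiable:
 fixes x y :: "'e::real_normed_vector => real"
 assumes x: "x differentiable (at e)" and y: "y differentiable (at e)" and N: "!!k. k < 6 ==> (%e. N e k) differentiable (at e)"
  and W: "!!k. k < 6 ==> (%e. W e k) differentiable (at e)" and nz: "W e 0 ~= 0"
 shows "(%e. sol (x e) (y e) (N e) (W e)) differentiable (at e)"
proof -
 note i = differentiable_diff differentiable_mult differentiable_divide differentiable_const
 have n: "(%e. N e 0) differentiable (at e)" "(%e. N e 1) differentiable (at e)" "(%e. N e 2) differentiable (at e)"
  "(%e. N e 3) differentiable (at e)" "(%e. N e 4) differentiable (at e)" "(%e. N e 5) differentiable (at e)"
  by (rule N; simp)+
 have w: "(%e. W e 0) differentiable (at e)" "(%e. W e 1) differentiable (at e)" "(%e. W e 2) differentiable (at e)"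
  "(%e. W e 3) differentiable (at e)" "(%e. W e 4) differentiable (at e)" "(%e. W e 5) differentiable (at e)"
  by (rule W; simp)+
 define q0 where "q0 e = N e 0 / W e 0" for e
 have d0: "q0 differentiable (at e)" unfolding q0_def[abs_def] by (intro i n w nz)
 define q1 where "q1 e = (N e 1 - W e 1*q0 e) / W e 0" for e
 have d1: "q1 differentiable (at e)" unfolding q1_def[abs_def] by (intro i n w nz d0)
 define q2 where "q2 e = (N e 2 - W e 2*q0 e) / W e 0" for e
 have d2: "q2 differentiable (at e)" unfolding q2_def[abs_def] by (intro i n w nz d0)
 define q3 where "q3 e = (N e 3 - W e 3*q0 e - 2*(W e 1*q1 e)) / W e 0" for e
 have d3: "q3 differentiable (at e)" unfolding q3_def[abs_def] by (intro i n w nz d0 d1)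
 define q4 where "q4 e = (N e 4 - W e 4*q0 e - W e 1*q2 e - W e 2*q1 e) / W e 0" for e
 have d4: "q4 differentiable (at e)" unfolding q4_def[abs_def] by (intro i n w nz d0 d1 d2)
 define q5 where "q5 e = (N e 5 - W e 5*q0 e - 2*(W e 2*q2 e)) / W e 0" for e
 have d5: "q5 differentiable (at e)" unfolding q5_def[abs_def] by (intro i n w nz d0 d2)
 define c1 where "c1 e = q1 e - q3 e*x e - q4 e*y e" for e
 have e1: "c1 differentiable (at e)" unfolding c1_def[abs_def] by (intro i d1 d3 d4 x y)
 define c2 where "c2 e = q2 e - q4 e*x e - q5 e*y e" for e
 have e2: "c2 differentiable (at e)" unfolding c2_def[abs_def] by (intro i d2 d4 d5 x y)
 have h: "(%e. q3 e / 2) differentiable (at e)" "(%e. q5 e / 2) differentiable (at e)" by (intro i d3 d5; simp)+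
 define c0 where "c0 e = q0 e - c1 e*x e - c2 e*y e - q3 e / 2*(x e*x e) - q4 e*(x e*y e) - q5 e / 2*(y e*y e)" for e
 have e0: "c0 differentiable (at e)" unfolding c0_def[abs_def] by (intro differentiable_diff differentiable_mult d0 e1 e2 d4 h x y)
 have "sol (x e) (y e) (N e) (W e) = (c0 e, c1 e, c2 e, q3 e / 2, q4 e, q5 e / 2)" for e
  unfolding sol_def Let_def c0_def c1_def c2_def q5_def q4_def q3_def q2_def q1_def q0_def ..
 then show ?thesis using e0 e1 e2 h d4 by (simp add: differentiable_Pair)
qed

text \<open>The first three hypotheses say that the determinant of \<open>Du\<close> and
  \<open>Dv\<close> and its gradient vanish at a point. If \<open>Du\<close> is nonzero there,
  \<open>v\<close> agrees to second order with a function of \<open>u\<close> whose first and second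
  derivative are \<open>a\<close> and \<open>b\<close>.\<close>

lemma jet_relation:
 fixes u v :: "pnt"
 assumes J: "u 1 * v 2 - u 2 * v 1 = 0"
  and J0: "(u 3 * v 2 + v 4*u 1) - (u 4 * v 1 + v 3*u 2) = 0"
  and J1: "(u 4 * v 2 + v 5*u 1) - (u 5 * v 1 + v 4*u 2) = 0"
  and nz: "u 1 ~= 0 \<or> u 2 ~= 0"
 shows "EX a b. v 1 = a*u 1 & v 2 = a*u 2 & v 3 = a*u 3 + b*(u 1*u 1) & v 4 = a*u 4 + b*(u 1*u 2) &
  v 5 = a*u 5 + b*(u 2*u 2)"
proof (cases "u 1 = 0")
 case False
 define a b where "a = v 1 / u 1" and "b = (v 3 - v 1 / u 1*u 3) / (u 1*u 1)"
 have 1: "v 1 = a*u 1" using False by (simp add: a_def)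
 have 3: "v 3 = a*u 3 + b*(u 1*u 1)" using False by (simp add: a_def b_def)
 have "u 1 * v 2 = u 1*(a*u 2)" using J unfolding 1 by (simp add: algebra_simps)
 then have 2: "v 2 = a*u 2" using False by simp
 have "u 1 * v 4 = u 1*(a*u 4 + b*(u 1*u 2))" using J0 unfolding 1 2 3 by (simp add: algebra_simps)
 then have 4: "v 4 = a*u 4 + b*(u 1*u 2)" using False by simp
 have "u 1 * v 5 = u 1*(a*u 5 + b*(u 2*u 2))" using J1 unfolding 1 2 4 by (simp add: algebra_simps)
 then have "v 5 = a*u 5 + b*(u 2*u 2)" using False by simp
 with 1 2 3 4 show ?thesis by blast
next
 case True
 then have nz: "u 2 ~= 0" using nz by simp
 define a b where "a = v 2 / u 2" and "b = (v 5 - v 2 / u 2*u 5) / (u 2*u 2)"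
 have 2: "v 2 = a*u 2" using nz by (simp add: a_def)
 have 5: "v 5 = a*u 5 + b*(u 2*u 2)" using nz by (simp add: a_def b_def)
 have 1: "v 1 = a*u 1" using J True nz by simp
 have "u 2 * v 4 = u 2*(a*u 4 + b*(u 1*u 2))" using J1 unfolding 1 2 5 by (simp add: algebra_simps)
 then have 4: "v 4 = a*u 4 + b*(u 1*u 2)" using nz by simp
 have "u 2 * v 3 = u 2*(a*u 3 + b*(u 1*u 1))" using J0 unfolding 1 2 4 by (simp add: algebra_simps)
 then have "v 3 = a*u 3 + b*(u 1*u 1)" using nz by simp
 with 1 2 4 5 show ?thesis by blast
qed

subsection \<open>Harmonic germs with vanishing 2-jet are not finitely determined\<close>

definition Jdet :: "(nat => fnc) => fnc" where
 "Jdet F z = pd 0 (F 0) z*pd 1 (F 1) z - pd 1 (F 0) z*pd 0 (F 1) z"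

lemma germ_bounded:
 fixes f :: "fnc"
 assumes "germ n f"
 shows "EX C>=0. \<forall>\<^sub>F z in nbf n. abs(f z) <= C"
proof -
 obtain L r where "L >= 0" "r > 0" and L: "!!z z'. (ALL i<n. abs(z i) < r) ==> (ALL i<n. abs(z' i) < r) ==>
   abs(f z) <= L & abs(f z - f z') <= L*(\<Sum>i<n. abs(z i - z' i))"
  using germ_lipschitz[OF assms] by blast
 have "abs(f z) <= L" if "ALL i<n. abs(z i) < r" for z using L[OF that that] by blast
 then show ?thesis unfolding ev_nbf using \<open>L \<ge> 0\<close> \<open>r > 0\<close> by blast
qed

section \<open>Iterated partial derivatives and flat perturbations\<close>

lemma pd_funpow_germ: "germ 2 f ==> j < 2 ==> germ 2 ((pd j ^^ a) f)"
 by (induction a) (auto intro: germ_chain(2))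

lemma partial_funpow:
 assumes f: "!!i. i < 2 ==> germ 2 (f i)" and g: "NEAR z. ALL i<2. cmp i (g (z 0, z 1)) = f i z"
 shows "NEAR z. ALL i<2. cmp i ((partial_x ^^ a) g (z 0, z 1)) = (pd 0 ^^ a) (f i) z"
  and "NEAR z. ALL i<2. cmp i ((partial_y ^^ a) g (z 0, z 1)) = (pd 1 ^^ a) (f i) z"
proof -
 have l: "0 < (2::nat)" "1 < (2::nat)" by auto
 show "NEAR z. ALL i<2. cmp i ((partial_x ^^ a) g (z 0, z 1)) = (pd 0 ^^ a) (f i) z"
 proof (induction a)
  case (Suc a)
  have "NEAR z. partial_x ((partial_x ^^ a) g) (z 0, z 1) = (pd 0 ((%i. (pd 0 ^^ a) (f i)) 0) z, pd 0 ((%i. (pd 0 ^^ a) (f i)) 1) z) &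
    partial_y ((partial_x ^^ a) g) (z 0, z 1) = (pd 1 ((%i. (pd 0 ^^ a) (f i)) 0) z, pd 1 ((%i. (pd 0 ^^ a) (f i)) 1) z)"
   by (rule partial_pair) (use pd_funpow_germ[OF f l(1)] Suc.IH in auto)
  then show ?case by eventually_elim (simp add: all_less_2)
 qed (use g in simp)
 show "NEAR z. ALL i<2. cmp i ((partial_y ^^ a) g (z 0, z 1)) = (pd 1 ^^ a) (f i) z"
 proof (induction a)
  case (Suc a)
  have "NEAR z. partial_x ((partial_y ^^ a) g) (z 0, z 1) = (pd 0 ((%i. (pd 1 ^^ a) (f i)) 0) z, pd 0 ((%i. (pd 1 ^^ a) (f i)) 1) z) &
    partial_y ((partial_y ^^ a) g) (z 0, z 1) = (pd 1 ((%i. (pd 1 ^^ a) (f i)) 0) z, pd 1 ((%i. (pd 1 ^^ a) (f i)) 1) z)"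
   by (rule partial_pair) (use pd_funpow_germ[OF f l(2)] Suc.IH in auto)
  then show ?case by eventually_elim (simp add: all_less_2)
 qed (use g in simp)
qed

lemma partial_iter_0:
 assumes f: "!!i. i < 2 ==> germ 2 (f i)" and g: "NEAR z. ALL i<2. cmp i (g (z 0, z 1)) = f i z" and i: "i < 2"
 shows "cmp i ((partial_x ^^ a) ((partial_y ^^ b) g) 0) = (pd 0 ^^ a) ((pd 1 ^^ b) (f i)) (%_. 0)"
proof -
 have l: "1 < (2::nat)" by simp
 have "NEAR z. ALL i<2. cmp i ((partial_x ^^ a) ((partial_y ^^ b) g) (z 0, z 1)) = (pd 0 ^^ a) ((%i. (pd 1 ^^ b) (f i)) i) z"
  by (rule partial_funpow(1)) (use pd_funpow_germ[OF f l] partial_funpow(2)[OF f g] in auto)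
 from ev_nbf_at_0[OF this] i show ?thesis by (simp add: zero_prod_def)
qed

lemma partial_zero: "(partial_x ^^ a) (%_. 0 :: real \<times> real) = (%_. 0)" "(partial_y ^^ a) (%_. 0 :: real \<times> real) = (%_. 0)"
proof -
 have "partial_x (%_. 0 :: real \<times> real) = (%_. 0)" "partial_y (%_. 0 :: real \<times> real) = (%_. 0)"
  by (simp_all add: partial_x_def partial_y_def fun_eq_iff)
 then show "(partial_x ^^ a) (%_. 0 :: real \<times> real) = (%_. 0)" "(partial_y ^^ a) (%_. 0 :: real \<times> real) = (%_. 0)"
  by (induction a) simp_all
qed

text \<open>Polynomial, and zero at the origin only: high powers do not disturb the jets at the
  origin, yet are invertible at every other point.\<close>

definition rho :: "fnc" where "rho z = (z 0)^2 + (z 1)^2"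

lemma germ_rho: "germ 2 rho"
 unfolding rho_def[abs_def] by (intro germ_add germ_power germ_var) auto

text \<open>Each derivative takes away at most one power of \<open>rho\<close>, so that
  \<open>rho ^ Suc K\<close> outlives \<open>K\<close> derivatives.\<close>

lemma flat_pd:
 fixes ph gm h :: "fnc"
 assumes gm: "germ 2 gm" and h: "germ 2 h" and e: "NEAR z. ph z = gm z + rho z ^ Suc m*h z" and j: "j < 2"
 shows "EX h'. germ 2 h' & (NEAR z. pd j ph z = pd j gm z + rho z ^ m*h' z)"
proof -
 define h' where "h' z = real (Suc m)*(2*z j)*h z + rho z*pd j h z" for z
 have "germ 2 h'" unfolding h'_def[abs_def]
  by (intro germ_add germ_mult germ_const germ_rho h germ_var j germ_chain(2)[OF h j])
 moreover have "NEAR z. pd j ph z = pd j gm z + rho z ^ m*h' z"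
  using pd_cong[OF e, of j] germ_pd_DERIV[OF gm j] germ_pd_DERIV[OF h j]
 proof eventually_elim
  case (elim z)
  have "((%t. rho (z(j:=t))) hrd 2*z j) (at (z j))"
   using j by (auto simp: less_2_cases_iff rho_def intro!: derivative_eq_intros)
  from DERIV_power[OF this, of "Suc m"]
  have r: "((%t. rho (z(j:=t)) ^ Suc m) hrd real (Suc m)*(2*z j*rho z ^ m)) (at (z j))"
   by simp
  from DERIV_add[OF elim(2) DERIV_mult[OF r elim(3)]]
  have "pd j (%z. gm z + rho z ^ Suc m*h z) z = pd j gm z + rho z ^ m*h' z"
   by (intro pd_eqI) (simp add: h'_def algebra_simps)
  then show ?case using elim(1) by simp
 qed
 ultimately show ?thesis by blast
qed

lemma flat_pd_funpow:
 fixes ph gm :: "fnc"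
 assumes gm: "germ 2 gm" and e: "EX h. germ 2 h & (NEAR z. ph z = gm z + rho z ^ M*h z)" and j: "j < 2" and a: "a <= M"
 shows "EX h. germ 2 h & (NEAR z. (pd j ^^ a) ph z = (pd j ^^ a) gm z + rho z ^ (M - a)*h z)"
 using a
proof (induction a)
 case (Suc a)
 have "M - a = Suc (M - Suc a)" using Suc.prems by simp
 with Suc obtain h where h: "germ 2 h" "NEAR z. (pd j ^^ a) ph z = (pd j ^^ a) gm z + rho z ^ Suc (M - Suc a)*h z" by auto
 from flat_pd[OF pd_funpow_germ[OF gm j] h j] show ?case by simp
qed (use e in simp)

lemma flat_jets:
 fixes ph gm h :: "fnc"
 assumes gm: "germ 2 gm" and h: "germ 2 h" and e: "NEAR z. ph z = gm z + rho z ^ Suc K*h z" and ab: "a + b <= K"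
 shows "(pd 0 ^^ a) ((pd 1 ^^ b) ph) (%_. 0) = (pd 0 ^^ a) ((pd 1 ^^ b) gm) (%_. 0)"
proof -
 have l: "0 < (2::nat)" "1 < (2::nat)" by auto
 have a: "a <= Suc K - b" using ab by simp
 have "EX h. germ 2 h & (NEAR z. (pd 1 ^^ b) ph z = (pd 1 ^^ b) gm z + rho z ^ (Suc K - b)*h z)"
  by (rule flat_pd_funpow[OF gm _ l(2)]) (use h e ab in auto)
 from flat_pd_funpow[OF pd_funpow_germ[OF gm l(2)] this l(1) a]
 obtain h where "NEAR z. (pd 0 ^^ a) ((pd 1 ^^ b) ph) z = (pd 0 ^^ a) ((pd 1 ^^ b) gm) z + rho z ^ (Suc K - b - a)*h z"
  by blast
 from ev_nbf_at_0[OF this] show ?thesis using ab by (simp add: rho_def power_0_left)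
qed

text \<open>If the 2-jet of a harmonic germ vanishes, then \<open>F\<^sub>x\<close> solves a linear equation along the axis \<open>x = 0\<close>, so
 \<open>F\<^sub>x = x q\<close>; dividing the equation by \<open>x\<close> shows that \<open>q\<close> vanishes on that axis as well.\<close>

lemma zero_jet_bound:
 assumes hg: "lorentz_harmonic_germ g" and j: "same_jet 2 g (%_. 0)"
 defines "G \<equiv> %i z. cmp i (g (z 0, z 1))"
 shows "EX C. NEAR z. abs(Jdet G z) <= C*(z 0)^2"
proof -
 have l: "0 < (2::nat)" "1 < (2::nat)" by auto
 have gG: "germ 2 (G i)" if "i < 2" for i unfolding G_def by (rule lorentz_harmonic_germ_pd(1)[OF hg that])
 have G0: "G i (%_. 0) = 0" for i unfolding G_def by (rule lorentz_harmonic_germ_pd(2)[OF hg])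
 have harm: "NEAR z. ALL i<2. pd 1 (pd 0 (G i)) z = hrhs (%k. G k z) (%k. pd 0 (G k) z) (%k. pd 1 (G k) z) i"
  unfolding G_def by (rule lorentz_harmonic_germ_pd(3)[OF hg])
 have gp: "germ 2 (pd 0 (G i))" "germ 2 (pd 1 (G i))" if "i < 2" for i
  by (rule germ_chain(2)[OF gG[OF that]], simp)+
 have jets: "(pd 0 ^^ a) ((pd 1 ^^ b) (G i)) (%_. 0) = 0" if "a + b <= 2" "i < 2" for a b i
 proof -
  have "(partial_x ^^ a) ((partial_y ^^ b) g) 0 = 0" using j that(1) unfolding same_jet_def partial_zero by blast
  moreover have "cmp i ((partial_x ^^ a) ((partial_y ^^ b) g) 0) = (pd 0 ^^ a) ((pd 1 ^^ b) (G i)) (%_. 0)"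
   by (rule partial_iter_0[OF gG _ that(2)]) (simp_all add: G_def)
  ultimately show ?thesis by (simp add: cmp_linear)
 qed
 have j0: "pd 0 (G i) (%_. 0) = 0" "pd 1 (G i) (%_. 0) = 0" "pd 0 (pd 0 (G i)) (%_. 0) = 0" if "i < 2" for i
  using jets[OF _ that, of 1 0] jets[OF _ that, of 0 1] jets[OF _ that, of 2 0] by (simp_all add: numeral_2_eq_2)
 have pb: "pd j (G i) (base z) = pd j (G i) z" if "j < 2" for i j z
 proof -
  have "(%z. G i (base z)) = G i" by (simp add: G_def)
  then show ?thesis using pd_base[OF that, of "G i" z] by (simp only:)
 qed
 have axis: "NEAR z. ALL i<2. Q i ((base z)(0:=0)) = 0"
  if "EX dl>0. ALL t. abs(t) < dl --> (ALL i<2. Q i ((%_. 0)(1:=t)) = 0)" for Q :: "nat => fnc"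
 proof -
  from that obtain dl where dl: "dl > 0" "!!t i. abs(t) < dl ==> i < 2 ==> Q i ((%_. 0)(1:=t)) = 0" by blast
  have "ALL i<2. Q i ((base z)(0:=0)) = 0" if "ALL i<2. abs(z i) < dl" for z
  proof -
   have "(base z)(0:=0) = (%_. 0)(1:=z 1)" by (auto simp: base_def fun_eq_iff less_2_cases_iff)
   moreover have "abs(z 1) < dl" using that by simp
   ultimately show ?thesis using dl(2) by simp
  qed
  then show ?thesis unfolding ev_nbf using dl(1) by blast
 qed
 have "EX dl>0. ALL t. abs(t) < dl --> (ALL i<2. (%i. pd 0 (G i)) i ((%_. 0)(1:=t)) = 0)"
 proof (rule harmonic_axis_vanish[of 2 G "%i. pd 1 (G i)"])
  show "NEAR z. ALL i<2. pd 1 (pd 0 (G i)) z = hrhs (%k. G k z) (%k. pd 1 (G k) z) (%k. pd 0 (G k) z) i"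
   using harm by eventually_elim (simp only: hrhs_commute)
 qed (use gG gp G0 j0 in auto)
 from axis[OF this] have Q0: "NEAR z. ALL i<2. pd 0 (G i) (z(0:=0)) = 0"
 proof eventually_elim
  case (elim z)
  have "pd 0 (G i) ((base z)(0:=0)) = pd 0 (G i) (z(0:=0))" for i
   using pb[OF l(1), of i "z(0:=0)"] by (simp add: base_upd)
  then show ?case using elim by (simp only:)
 qed
 define q where "q i = (SOME q. germ 2 q & (NEAR z. pd 0 (G i) z = z 0*q z))" for i
 have q: "germ 2 (q i) & (NEAR z. pd 0 (G i) z = z 0*q i z)" if i: "i < 2" for i
 proof -
  obtain r where r: "germ 2 r" "NEAR z. pd 0 (G i) z = pd 0 (G i) (z(0:=0)) + z 0*r z"
   using germ_division[OF gp(1)[OF i] l(1)] by blast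
  from r(2) Q0 have "NEAR z. pd 0 (G i) z = z 0*r z" by eventually_elim (use i in simp)
  then have "EX q. germ 2 q & (NEAR z. pd 0 (G i) z = z 0*q z)" using r(1) by blast
  from someI_ex[OF this] show ?thesis unfolding q_def .
 qed
 have gq: "germ 2 (q i)" and qe: "NEAR z. pd 0 (G i) z = z 0*q i z" if "i < 2" for i using q[OF that] by auto
 have qe2: "NEAR z. ALL i<2. pd 0 (G i) z = z 0*q i z"
  unfolding all_less_2 by (intro eventually_conj qe l)
 \<comment> \<open>The value of \<open>q\<close> at the origin is the pure second derivative in
   \<open>x\<close>; here the vanishing of the 2-jet, and not just of the 1-jet, enters.\<close>
 have q0: "q i (%_. 0) = 0" if "i < 2" for i
  using ev_nbf_at_0[OF pd_times_axis[OF gq[OF that] l(1) qe[OF that]]] j0(3)[OF that] by (simp add: fun_upd_idem)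
 have qeq: "NEAR z. pd 1 (q i) z = hrhs (%k. G k z) (%k. q k z) (%k. pd 1 (G k) z) i" if i: "i < 2" for i
 proof -
  define u where "u k = (if k < 2 then G k else if k < 4 then q (k - 2) else pd 1 (G (k - 4)))" for k
  have "germ 2 (%z. (%u. hrhs (%k. u k) (%k. u (k + 2)) (%k. u (k + 4)) i) (%k. u k z))"
  proof (rule germ_compose[OF germ_hrhs[OF i]])
   show "germ 2 (u k)" if "k < 6" for k
    unfolding u_def using gG[of k] gq[of "k - 2"] gp(2)[of "k - 4"] that by (cases "k < 2"; cases "k < 4") auto
   show "u k (%_. 0) = 0" if "k < 6" for k
    unfolding u_def using G0 q0[of "k - 2"] j0(2)[of "k - 4"] that by (cases "k < 2"; cases "k < 4") auto
  qed
  moreover have "hrhs (%k. u k z) (%k. u (k + 2) z) (%k. u (k + 4) z) i = hrhs (%k. G k z) (%k. q k z) (%k. pd 1 (G k) z) i" for z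
   using i by (auto simp: hrhs_def u_def)
  ultimately have gh: "germ 2 (%z. hrhs (%k. G k z) (%k. q k z) (%k. pd 1 (G k) z) i)" by (simp only:)
  have gd: "germ 2 (%z. pd 1 (q i) z - hrhs (%k. G k z) (%k. q k z) (%k. pd 1 (G k) z) i)"
   by (rule germ_diff[OF germ_chain(2)[OF gq[OF i] l(2)] gh])
  have "NEAR z. z 0*(pd 1 (q i) z - hrhs (%k. G k z) (%k. q k z) (%k. pd 1 (G k) z) i) = 0"
   using pd_cong[OF qe[OF i], of 1] germ_pd_DERIV[OF gq[OF i] l(2)] harm qe2
  proof eventually_elim
   case (elim z)
   have "pd 1 (%z. z 0*q i z) z = z 0*pd 1 (q i) z"
    by (rule pd_eqI) (use DERIV_cmult[OF elim(2), of "z 0"] in simp)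
   then have "pd 1 (pd 0 (G i)) z = z 0*pd 1 (q i) z" using elim(1) by simp
   moreover have "pd 1 (pd 0 (G i)) z = hrhs (%k. G k z) (%k. pd 0 (G k) z) (%k. pd 1 (G k) z) i" using elim(3) i by blast
   moreover have "hrhs (%k. G k z) (%k. pd 0 (G k) z) (%k. pd 1 (G k) z) i = z 0*hrhs (%k. G k z) (%k. q k z) (%k. pd 1 (G k) z) i"
   proof -
    have e: "pd 0 (G 0) z = z 0*q 0 z" "pd 0 (G 1) z = z 0*q 1 z" "pd 0 (G i) z = z 0*q i z"
     using elim(4) i l by blast+
    show ?thesis unfolding hrhs_def e times_divide_eq_right
     by (rule arg_cong[of _ _ "%n. n / _"]) (simp add: algebra_simps)
   qed
   ultimately show ?case by (simp add: right_diff_distrib)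
  qed
  from germ_cancel_var[OF gd l(1) this] show ?thesis by eventually_elim simp
 qed
 have "EX dl>0. ALL t. abs(t) < dl --> (ALL i<2. q i ((%_. 0)(1:=t)) = 0)"
 proof (rule harmonic_axis_vanish[of 2 G "%i. pd 1 (G i)"])
  show "NEAR z. ALL i<2. pd 1 (q i) z = hrhs (%k. G k z) (%k. pd 1 (G k) z) (%k. q k z) i"
   unfolding all_less_2 hrhs_commute[of _ "%k. pd 1 (G k) _"] by (intro eventually_conj qeq l)
 qed (use gG gp gq G0 j0 q0 in auto)
 note qa = axis[OF this]
 obtain s0 where s0: "germ 2 s0" "NEAR z. q 0 z = q 0 (z(0:=0)) + z 0 * s0 z"
  using germ_division[OF gq[OF l(1)] l(1)] by blast
 obtain s1 where s1: "germ 2 s1" "NEAR z. q 1 z = q 1 (z(0:=0)) + z 0 * s1 z"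
  using germ_division[OF gq[OF l(2)] l(1)] by blast
 define w where "w z = s0 (base z)*pd 1 (G 1) z - pd 1 (G 0) z * s1 (base z)" for z
 have "germ 2 w" unfolding w_def[abs_def]
  by (intro germ_diff germ_mult germ_base[OF s0(1)] germ_base[OF s1(1)] gp l)
 then obtain C where C: "NEAR z. abs(w z) <= C" using germ_bounded by blast
 have "NEAR z. abs(Jdet G z) <= C*(z 0)^2"
  using C ev_nbf_base[OF s0(2)] ev_nbf_base[OF s1(2)] qa ev_nbf_base[OF qe2]
 proof eventually_elim
  case (elim z)
  have p: "pd 0 (G 0) z = (z 0)^2 * s0 (base z)" "pd 0 (G 1) z = (z 0)^2 * s1 (base z)"
   using elim(2-5) pb[OF l(1), of 0 z] pb[OF l(1), of 1 z] by (auto simp: all_less_2 power2_eq_square)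
  have "Jdet G z = (z 0)^2*w z" unfolding Jdet_def p w_def by (simp add: algebra_simps)
  then have "abs(Jdet G z) = (z 0)^2*abs(w z)" by (simp add: abs_mult)
  also have "\<dots> <= (z 0)^2*C" by (rule mult_left_mono[OF elim(1)]) simp
  finally show ?case by (simp add: mult.commute)
 qed
 then show ?thesis by blast
qed

text \<open>The double zero of the Jacobian along a curve survives \<open>\<A>\<close>-equivalence.\<close>

lemma A_equivalent_Jdet:
 assumes mg: "map_germ g" and eqv: "A_equivalent g f" and ep: "ep > 0"
  and C: "NEAR z. abs(Jdet (%i z. cmp i (g (z 0, z 1))) z) <= C*(z 0)^2"
 shows "EX p C. p ~= 0 & norm p < ep & (\<forall>\<^sub>F q in nhds p. abs(Jdet (%i z. cmp i (f (z 0, z 1))) (pt q)) <= C*(norm (q - p))^2)"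
proof -
 have l: "0 < (2::nat)" "1 < (2::nat)" by auto
 obtain h h' k where h: "inverse_germs h h'" and k: "diffeo_germ k" and gk: "\<forall>\<^sub>F p in nhds 0. f p = k (g (h' p))"
  using eqv unfolding A_equivalent_def by blast
 have mh: "map_germ h" "map_germ h'" and mk: "map_germ k" using h k unfolding diffeo_germ_def inverse_germs_def by blast+
 define cc where "cc F i z = cmp i (F (z 0, z 1))" for F :: "real \<times> real => real \<times> real" and i and z :: "pnt"
 have gc: "germ 2 (cc F i)" if "map_germ F" "i < 2" for F i
  using that unfolding map_germ_def analytic_germ2_iff cc_def[abs_def] by blast
 have c0: "cc F i (%_. 0) = 0" if "map_germ F" for F i using that by (simp add: cc_def map_germ_def cmp_linear zero_prod_def[symmetric])
 have ct: "(cc F 0 z, cc F 1 z) = F (z 0, z 1)" for F z by (simp add: cc_def cmp_def)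
 define M where "M i z = cc g i (%l. cc h' l z)" for i z
 have gM: "germ 2 (M i)" if "i < 2" for i unfolding M_def[abs_def]
  by (rule germ_compose[OF gc[OF mg that]]) (auto intro: gc mh c0)
 have M0: "M i (%_. 0) = 0" for i unfolding M_def c0[OF mh(2)] using c0[OF mg] by simp
 have fM: "NEAR z. cc f i z = cc k i (%l. M l z)" for i
  using gk unfolding eventually_nhds_0_iff
 proof eventually_elim
  case (elim z)
  have "(M 0 z, M 1 z) = g (cc h' 0 z, cc h' 1 z)" unfolding M_def cc_def[of g] by (simp add: cmp_def)
  then have "cc k i (%l. M l z) = cmp i (k (g (h' (z 0, z 1))))" unfolding cc_def[of k] ct by (simp only:)
  then show ?case using elim by (simp only: cc_def[of f])
 qed
 have s2: "(\<Sum>i<2. F i) = F 0 + F 1" for F :: "pnt" by (simp add: numeral_2_eq_2)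
 have pf: "NEAR z. pd j (cc f i) z = pd 0 (cc k i) (%l. M l z)*pd j (M 0) z + pd 1 (cc k i) (%l. M l z)*pd j (M 1) z"
  if "i < 2" "j < 2" for i j
 proof -
  have "NEAR z. pd j (%z. cc k i (%l. M l z)) z = (\<Sum>l<2. pd l (cc k i) (%l. M l z)*pd j (M l) z)"
   by (rule pd_compose[OF gc[OF mk that(1)]]) (use gM M0 that(2) in auto)
  with pd_cong[OF fM[of i], of j] show ?thesis by eventually_elim (simp only: s2)
 qed
 have pM: "NEAR z. pd j (M i) z = pd 0 (cc g i) (%l. cc h' l z)*pd j (cc h' 0) z + pd 1 (cc g i) (%l. cc h' l z)*pd j (cc h' 1) z"
  if "i < 2" "j < 2" for i j
 proof -
  have "NEAR z. pd j (%z. cc g i (%l. cc h' l z)) z = (\<Sum>l<2. pd l (cc g i) (%l. cc h' l z)*pd j (cc h' l) z)"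
   by (rule pd_compose[OF gc[OF mg that(1)]]) (use gc[OF mh(2)] c0[OF mh(2)] that(2) in auto)
  then show ?thesis unfolding M_def[abs_def] by eventually_elim (simp only: s2)
 qed
 have J: "NEAR z. Jdet (cc f) z = Jdet (cc k) (%l. M l z)*Jdet (cc h') z*Jdet (cc g) (%l. cc h' l z)"
  using pf[OF l(1) l(1)] pf[OF l(1) l(2)] pf[OF l(2) l(1)] pf[OF l(2) l(2)]
   pM[OF l(1) l(1)] pM[OF l(1) l(2)] pM[OF l(2) l(1)] pM[OF l(2) l(2)]
 proof eventually_elim
  case (elim z)
  show ?case unfolding Jdet_def elim by (simp only: algebra_simps)
 qed
 have gJ: "germ 2 (Jdet (cc F))" if "map_germ F" for F unfolding Jdet_def[abs_def]
  by (intro germ_diff germ_mult germ_chain(2)[OF gc[OF that l(1)]] germ_chain(2)[OF gc[OF that l(2)]] l)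
 have "germ 2 (%z. Jdet (cc k) (%l. M l z)*Jdet (cc h') z)"
  by (rule germ_mult[OF germ_compose[OF gJ[OF mk] gM M0] gJ[OF mh(2)]])
 then obtain B where B: "B >= 0" "NEAR z. abs(Jdet (cc k) (%l. M l z)*Jdet (cc h') z) <= B" using germ_bounded by blast
 have "NEAR z. abs(Jdet (cc g) z) <= C*(z 0)^2" using C unfolding cc_def[abs_def] .
 then have "NEAR z. abs(Jdet (cc g) (%l. cc h' l z)) <= C*(cc h' 0 z)^2"
  by (rule ev_nbf_map[where g = "cc h'", rotated 2]) (auto intro: gc mh c0)
 with J B(2) have bd: "NEAR z. abs(Jdet (cc f) z) <= B*abs(C)*(cc h' 0 z)^2"
 proof eventually_elim
  case (elim z)
  have "C*(cc h' 0 z)^2 <= abs(C)*(cc h' 0 z)^2" by (intro mult_right_mono) auto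
  then have "abs(Jdet (cc g) (%l. cc h' l z)) <= abs(C)*(cc h' 0 z)^2" using elim(3) by linarith
  then have "abs(Jdet (cc k) (%l. M l z)*Jdet (cc h') z)*abs(Jdet (cc g) (%l. cc h' l z)) <= B*(abs(C)*(cc h' 0 z)^2)"
   using elim(2) B(1) by (intro mult_mono) auto
  then show ?case unfolding elim(1) abs_mult by (simp only: mult.assoc)
 qed
 obtain L r1 where r1: "r1 > 0" "L >= 0" and L: "!!z z'. (ALL i<2. abs(z i) < r1) ==> (ALL i<2. abs(z' i) < r1) ==>
   abs(cc h' 0 z) <= L & abs(cc h' 0 z - cc h' 0 z') <= L*(\<Sum>i<2. abs(z i - z' i))"
  using germ_lipschitz[OF gc[OF mh(2) l(1)]] by blast
 obtain r2 where r2: "r2 > 0" and bd: "!!z. ALL i<2. abs(z i) < r2 ==> abs(Jdet (cc f) z) <= B*abs(C)*(cc h' 0 z)^2"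
  using bd unfolding ev_nbf by blast
 define r where "r = min ep (min r1 r2)"
 have r: "r > 0" "r <= ep" "r <= r1" "r <= r2" using r1 r2 ep by (auto simp: r_def)
 obtain T where T: "tangent_map h T" using map_germ_tangent[OF mh(1)] by blast
 have ray: "((%t. t *\<^sub>R (0::real, 1::real)) \<longlongrightarrow> 0) (at (0::real))" by (auto intro!: tendsto_eq_intros simp: zero_prod_def)
 have "\<forall>\<^sub>F t in at 0. norm (h (t *\<^sub>R (0, 1))) < r"
  using tendstoD[OF tangent_map_ray(2)[OF T, of "(0, 1)"] r(1)] by (simp add: dist_norm)
 moreover have "\<forall>\<^sub>F p in nhds 0. h' (h p) = p" using h unfolding inverse_germs_def by (auto elim: eventually_mono)
 from eventually_compose_filterlim[OF this ray] have "\<forall>\<^sub>F t in at 0. h' (h (t *\<^sub>R (0, 1))) = t *\<^sub>R (0, 1)" .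
 moreover have "\<forall>\<^sub>F t in at (0::real). t ~= 0" by (simp add: eventually_at_filter)
 ultimately have "\<forall>\<^sub>F t in at (0::real). norm (h (t *\<^sub>R (0, 1))) < r & h' (h (t *\<^sub>R (0, 1))) = t *\<^sub>R (0, 1) & t ~= 0"
  by eventually_elim blast
 then obtain t where t: "norm (h (t *\<^sub>R (0, 1))) < r" "h' (h (t *\<^sub>R (0, 1))) = t *\<^sub>R (0, 1)" "t ~= (0::real)"
  using eventually_happens[of _ "at (0::real)"] by auto
 \<comment> \<open>A point on the image under \<open>h\<close> of the axis \<open>x = 0\<close>, on
   which the first component of \<open>h'\<close> vanishes; it is not the origin because
   \<open>t\<close> is nonzero.\<close>
 define p where "p = h (t *\<^sub>R (0, 1))"
 have p: "norm p < r" "h' p = (0, t)" using t by (simp_all add: p_def)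
 have "p ~= 0"
 proof
  assume "p = 0"
  then have "h' 0 = (0, t)" using p(2) by simp
  then show False using mh(2) t(3) by (simp add: map_germ_def zero_prod_def)
 qed
 have cp: "cc h' 0 (pt p) = 0" using p(2) by (simp add: cc_def)
 have lt: "ALL i<2. abs(pt q i) < r" if "norm q < r" for q
  using abs_le_norm_pair[of q] that by (auto simp: all_less_2)
 have "abs(Jdet (cc f) (pt q)) <= (B*abs(C)*(2*L)^2)*(norm (q - p))^2" if q: "norm q < r" for q
 proof -
  have "ALL i<2. abs(pt q i) < r1" "ALL i<2. abs(pt p i) < r1" "ALL i<2. abs(pt q i) < r2"
   using lt[OF q] lt[OF p(1)] r by (auto intro: order_less_le_trans)
  note lts = this
  have "abs(cc h' 0 (pt q)) <= L*(abs(fst q - fst p) + abs(snd q - snd p))"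
   using L[OF lts(1,2)] unfolding cp s2 by simp
  also have "\<dots> <= L*(2*norm (q - p))"
   using abs_le_norm_pair[of "q - p"] by (intro mult_left_mono r1) auto
  finally have "abs(cc h' 0 (pt q)) <= 2*L*norm (q - p)" by simp
  from power_mono[OF this, of 2] have "(cc h' 0 (pt q))^2 <= (2*L)^2*(norm (q - p))^2" by (simp add: power_mult_distrib)
  then have "B*abs(C)*(cc h' 0 (pt q))^2 <= B*abs(C)*((2*L)^2*(norm (q - p))^2)" using B(1) by (intro mult_left_mono) auto
  then show ?thesis using bd[OF lts(3)] by (simp only: mult.assoc)
 qed
 moreover have "\<forall>\<^sub>F q in nhds p. norm q < r"
  using eventually_nhds_in_open[of "ball 0 r" p] p(1) by simp
 ultimately have "\<forall>\<^sub>F q in nhds p. abs(Jdet (cc f) (pt q)) <= (B*abs(C)*(2*L)^2)*(norm (q - p))^2"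
  by (auto elim: eventually_mono)
 moreover have "norm p < ep" using p(1) r(2) by simp
 ultimately show ?thesis using \<open>p \<noteq> 0\<close> unfolding cc_def[abs_def] by blast
qed

lemma quadratic_bound_vanish:
 assumes e: "\<forall>\<^sub>F q in nhds p. abs(J (pt q)) <= C*(norm (q - p))^2"
 shows "J (pt p) = (0::real)"
  and "i < 2 ==> ((%t. J ((pt p)(i:=t))) hrd D) (at (pt p i)) ==> D = 0"
proof -
 show J0: "J (pt p) = 0" using eventually_nhds_x_imp_x[OF e] by simp
 assume i: "i < 2" and D: "((%t. J ((pt p)(i:=t))) hrd D) (at (pt p i))"
 define c where "c t = (if i = 0 then (t, snd p) else (fst p, t))" for t
 let ?x = "pt p i"
 have pc: "(pt p)(i:=t) = pt (c t)" for t using i by (auto simp: c_def zp_def fun_eq_iff less_2_cases_iff)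
 have nc: "(norm (c t - p))^2 = (t - ?x)^2" for t
  using i by (cases p) (auto simp: c_def norm_prod_def less_2_cases_iff)
 have "(c \<longlongrightarrow> p) (at ?x)"
 proof (cases "i = 0")
  case True
  have "((%t. (t, snd p)) \<longlongrightarrow> (fst p, snd p)) (at (fst p))" by (intro tendsto_intros)
  then show ?thesis using True by (simp add: c_def[abs_def])
 next
  case False
  have "((%t. (fst p, t)) \<longlongrightarrow> (fst p, snd p)) (at (snd p))" by (intro tendsto_intros)
  then show ?thesis using False i by (simp add: c_def[abs_def] less_2_cases_iff)
 qed
 from eventually_compose_filterlim[OF e this] have ev: "\<forall>\<^sub>F t in at ?x. abs(J ((pt p)(i:=t))) <= C*(t - ?x)^2"
  unfolding pc nc .
 have lim: "((%t. (J ((pt p)(i:=t)) - J ((pt p)(i:=?x))) / (t - ?x)) \<longlongrightarrow> D) (at ?x)"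
  using D unfolding has_field_derivative_iff .
 have "((%t. (J ((pt p)(i:=t)) - J ((pt p)(i:=?x))) / (t - ?x)) \<longlongrightarrow> 0) (at ?x)"
 proof (rule Lim_null_comparison)
  have "\<forall>\<^sub>F t in at ?x. t ~= ?x" by (simp add: eventually_at_filter)
  with ev show "\<forall>\<^sub>F t in at ?x. norm ((J ((pt p)(i:=t)) - J ((pt p)(i:=?x))) / (t - ?x)) <= C*abs(t - ?x)"
  proof eventually_elim
   case (elim t)
   have sq: "C*(t - ?x)^2 = C*abs(t - ?x)*abs(t - ?x)" by (simp add: power2_eq_square abs_mult_self_eq mult.assoc)
   have pos: "abs(t - ?x) > 0" using elim(2) by simp
   have "abs(J ((pt p)(i:=t))) <= C*abs(t - ?x)*abs(t - ?x)" using elim(1) unfolding sq .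
   then have "abs(J ((pt p)(i:=t))) / abs(t - ?x) <= C*abs(t - ?x)" using pos by (simp only: pos_divide_le_eq)
   then show ?case by (simp only: fun_upd_triv J0 diff_zero real_norm_def abs_divide)
  qed
  have "((%t. C*abs(t - ?x)) \<longlongrightarrow> C*abs(?x - ?x)) (at ?x)" by (intro tendsto_intros)
  then show "((%t. C*abs(t - ?x)) \<longlongrightarrow> 0) (at ?x)" by simp
 qed
 with lim show "D = 0" by (rule LIM_unique)
qed

section \<open>The dimension count for the perturbation coefficients\<close>

lemma differentiable_fst: "f differentiable (at e) ==> (%e. fst (f e)) differentiable (at e)"
 and differentiable_snd: "f differentiable (at e) ==> (%e. snd (f e)) differentiable (at e)"
 unfolding differentiable_def by (blast intro: has_derivative_fst has_derivative_snd)+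

lemma differentiable_qjet:
 fixes x y :: "'e::real_normed_vector => real"
 assumes c: "c differentiable (at e)" and x: "x differentiable (at e)" and y: "y differentiable (at e)"
 shows "(%e. qjet (c e) (x e) (y e) k) differentiable (at e)"
proof -
 note i = differentiable_fst differentiable_snd
 note d = i(1)[OF c] i(1)[OF i(2)[OF c]] i(1)[OF i(2)[OF i(2)[OF c]]] i(1)[OF i(2)[OF i(2)[OF i(2)[OF c]]]]
  i(1)[OF i(2)[OF i(2)[OF i(2)[OF i(2)[OF c]]]]] i(2)[OF i(2)[OF i(2)[OF i(2)[OF i(2)[OF c]]]]]
 show ?thesis unfolding qjet_def case_prod_beta
  by (cases "k = 0"; cases "k = 1"; cases "k = 2"; cases "k = 3"; cases "k = 4") (simp_all add: d x y)
qed

lemma differentiable_jmul: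
 fixes w p :: "'e::real_normed_vector => pnt"
 assumes w: "!!k. k < 6 ==> (%e. w e k) differentiable (at e)" and p: "!!k. k < 6 ==> (%e. p e k) differentiable (at e)"
 shows "(%e. jmul (w e) (p e) k) differentiable (at e)"
proof -
 have w: "(%e. w e 0) differentiable (at e)" "(%e. w e (Suc 0)) differentiable (at e)" "(%e. w e 2) differentiable (at e)"
  "(%e. w e 3) differentiable (at e)" "(%e. w e 4) differentiable (at e)" "(%e. w e 5) differentiable (at e)"
  by (rule w; simp)+
 have p: "(%e. p e 0) differentiable (at e)" "(%e. p e (Suc 0)) differentiable (at e)" "(%e. p e 2) differentiable (at e)"
  "(%e. p e 3) differentiable (at e)" "(%e. p e 4) differentiable (at e)" "(%e. p e 5) differentiable (at e)"
  by (rule p; simp)+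
 show ?thesis unfolding jmul_def
  by (cases "k = 0"; cases "k = 1"; cases "k = 2"; cases "k = 3"; cases "k = 4") (simp_all add: w p)
qed

lemma less_6_cases: "k < 6 ==> k = 0 \<or> k = 1 \<or> k = 2 \<or> k = 3 \<or> k = 4 \<or> k = (5::nat)"
 by linarith

text \<open>A perturbation \<open>g + \<rho>\<^sup>K\<^sup>+\<^sup>1 (P\<^sub>c, P\<^sub>d)\<close> with generic quadratic polynomials has no point near \<open>0\<close> other than \<open>0\<close> itself
 at which the Jacobian vanishes to second order: at such a point the 2-jets of the two components
 are related by \<open>Dv = a Du\<close>, \<open>D\<^sup>2v = a D\<^sup>2u + b Du Du\<close> (up to exchanging them), or both are critical. This
 confines the 12 coefficients to images of manifolds of dimension at most 11.\<close>

theorem zero_jet_not_finitely_determined: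
 assumes hg: "lorentz_harmonic_germ g" and jet: "same_jet 2 g (%_. 0)"
 shows "\<not> finitely_A_determined g"
proof
 assume "finitely_A_determined g"
 then obtain K where K: "!!f. map_germ f ==> same_jet K g f ==> A_equivalent g f" unfolding finitely_A_determined_def by blast
 have l: "0 < (2::nat)" "1 < (2::nat)" by auto
 have mg: "map_germ g" using hg by (simp add: lorentz_harmonic_germ_def)
 define G where "G i z = cmp i (g (z 0, z 1))" for i and z :: "pnt"
 have gG: "germ 2 (G i)" if "i < 2" for i using mg that unfolding map_germ_def analytic_germ2_iff G_def[abs_def] by blast
 define W where "W z = rho z ^ Suc K" for z
 have gW: "germ 2 W" unfolding W_def[abs_def] by (intro germ_power germ_rho)
 have dj: "\<forall>\<^sub>F p in nhds 0. ALL k:{..<6}. (%p. jt ph (pt p) k) differentiable (at p)" if "germ 2 ph" for ph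
  by (intro eventually_ball_finite ballI germ_differentiable germ_jt that) simp
 have "\<forall>\<^sub>F p in nhds 0. dtab (jt (G 0)) (pt p) & dtab (jt (G 1)) (pt p) & dtab (jt W) (pt p) &
   (ALL k:{..<6}. (%p. jt (G 0) (pt p) k) differentiable (at p)) & (ALL k:{..<6}. (%p. jt (G 1) (pt p) k) differentiable (at p)) &
   (ALL k:{..<6}. (%p. jt W (pt p) k) differentiable (at p))"
  by (intro eventually_conj dtab_jt dj gG gW l)
 then obtain r0 where r0: "r0 > 0" and R: "!!p. dist p 0 < r0 ==> dtab (jt (G 0)) (pt p) & dtab (jt (G 1)) (pt p) & dtab (jt W) (pt p) &
   (ALL k:{..<6}. (%p. jt (G 0) (pt p) k) differentiable (at p)) & (ALL k:{..<6}. (%p. jt (G 1) (pt p) k) differentiable (at p)) &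
   (ALL k:{..<6}. (%p. jt W (pt p) k) differentiable (at p))"
  unfolding eventually_nhds_metric by blast
 have tabG: "dtab (jt (G i)) (pt p)" if "norm p < r0" "i < 2" for i p using R[of p] that by (auto simp: less_2_cases_iff)
 have tabW: "dtab (jt W) (pt p)" if "norm p < r0" for p using R[of p] that by simp
 have difG: "(%p. jt (G i) (pt p) k) differentiable (at p)" if "norm p < r0" "i < 2" "k < 6" for i p k
  using R[of p] that by (auto simp: less_2_cases_iff)
 have difW: "(%p. jt W (pt p) k) differentiable (at p)" if "norm p < r0" "k < 6" for p k using R[of p] that by auto
 have W0: "jt W (pt p) 0 ~= 0" if "p ~= 0" for p
  using that by (auto simp: jt_def W_def rho_def sum_power2_eq_zero_iff prod_eq_iff)
 have comp: "(%e. F (fst e)) differentiable (at e)" if "F differentiable (at (fst e))"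
  for F :: "real \<times> real => real" and e :: "(real \<times> real) \<times> 'e::real_normed_vector"
  using differentiable_chain_at[OF bounded_linear_imp_differentiable[OF bounded_linear_fst] that] by (simp add: o_def)
 have lin: "(%e. e) differentiable (at e)" for e :: "'e::real_normed_vector" by simp
 \<comment> \<open>Here \<open>e\<close> consists of the point, the six coefficients of one
   component, the value of the other component and the numbers \<open>a\<close>, \<open>b\<close> of
   \<open>jet_relation\<close>: 2 + 6 + 3 = 11 dimensions. \<open>uj\<close> is the 2-jet of the
   component whose coefficients are given.\<close>
 define uj where "uj i e k = jt (G i) (pt (fst e)) k + jmul (jt W (pt (fst e))) (qjet (fst (snd e)) (fst (fst e)) (snd (fst e))) k"
  for i and e :: "(real \<times> real) \<times> coeffs \<times> real \<times> real \<times> real" and k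
 define sj where "sj u k = (if k = 3 then u 1*u 1 else if k = 4 then u 1*u 2 else if k = 5 then u 2*u 2 else (0::real))"
  for u :: "pnt" and k :: nat
 define Nj where "Nj i e k = (if k = 0 then fst (snd (snd e)) else fst (snd (snd (snd e)))*uj i e k + snd (snd (snd (snd e))) * sj (uj i e) k)
   - jt (G (1 - i)) (pt (fst e)) k" for i e k
 \<comment> \<open>From these data the 2-jet of the other component is known, and \<open>sol\<close>
   recovers its six coefficients.\<close>
 define Th where "Th i e = sol (fst (fst e)) (snd (fst e)) (Nj i e) (jt W (pt (fst e)))" for i e
 define S1 where "S1 = {e :: (real \<times> real) \<times> coeffs \<times> real \<times> real \<times> real. fst e ~= 0 & norm (fst e) < r0}"
 have dTh: "Th i differentiable (at e)" if e: "e \<in> S1" and i: "i < 2" for i e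
 proof -
  have n: "norm (fst e) < r0" "fst e ~= 0" using e by (auto simp: S1_def)
  note f = differentiable_fst differentiable_snd
  have xy: "(%e. fst (fst e)) differentiable (at e)" "(%e. snd (fst e)) differentiable (at e)"
   "(%e. fst (snd e)) differentiable (at e)" "(%e. fst (snd (snd e))) differentiable (at e)"
   "(%e. fst (snd (snd (snd e)))) differentiable (at e)" "(%e. snd (snd (snd (snd e)))) differentiable (at e)"
   by (intro f lin)+
  have dW: "(%e. jt W (pt (fst e)) k) differentiable (at e)" if "k < 6" for k by (rule comp[OF difW[OF n(1) that]])
  have dG: "(%e. jt (G j) (pt (fst e)) k) differentiable (at e)" if "k < 6" "j < 2" for k j by (rule comp[OF difG[OF n(1) that(2,1)]])
  have du: "(%e. uj i e k) differentiable (at e)" if "k < 6" for k unfolding uj_def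
   by (intro differentiable_add dG that i differentiable_jmul dW differentiable_qjet xy)
  have ds: "(%e. sj (uj i e) k) differentiable (at e)" for k
  proof -
   have "(%e. uj i e 1) differentiable (at e)" "(%e. uj i e 2) differentiable (at e)" by (rule du; simp)+
   then show ?thesis unfolding sj_def by (cases "k = 3"; cases "k = 4"; cases "k = 5") simp_all
  qed
  have dN: "(%e. Nj i e k) differentiable (at e)" if "k < 6" for k
  proof -
   have d: "(%e. jt (G (1 - i)) (pt (fst e)) k) differentiable (at e)" by (rule dG[OF that]) simp
   show ?thesis
   proof (cases "k = 0")
    case True
    then show ?thesis unfolding Nj_def using differentiable_diff[OF xy(4) d] by simp
   next
    case False
    then show ?thesis unfolding Nj_def
     using differentiable_diff[OF differentiable_add[OF differentiable_mult[OF xy(5) du[OF that]] differentiable_mult[OF xy(6) ds]] d] by simp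
   qed
  qed
  show ?thesis unfolding Th_def[abs_def]
   by (rule sol_differentiable[where N = "Nj i" and W = "%e. jt W (pt (fst e))", OF xy(1,2)]; fact dN dW W0[OF n(2)])
 qed
 \<comment> \<open>The case of a point that is critical for both components: of each jet only the
   value and the three second derivatives are free, so point and jets make up 2 + 4 + 4 = 10
   dimensions.\<close>
 define Mj where "Mj i ta p k = (if k = 0 then fst ta else if k < 3 then 0 else if k = 3 then fst (snd ta) else if k = 4 then fst (snd (snd ta)) else snd (snd (snd ta)))
   - jt (G i) (pt p) k" for i and ta :: "real \<times> real \<times> real \<times> real" and p k
 define Z where "Z i ta p = sol (fst p) (snd p) (Mj i ta p) (jt W (pt p))" for i ta p
 define S2 where "S2 = {e :: (real \<times> real) \<times> (real \<times> real \<times> real \<times> real) \<times> (real \<times> real \<times> real \<times> real). fst e ~= 0 & norm (fst e) < r0}"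
 have dZ: "(%e. Z i (t e) (fst e)) differentiable (at e)" if e: "e \<in> S2" and i: "i < 2" and t: "t differentiable (at e)" for i e t
 proof -
  have n: "norm (fst e) < r0" "fst e ~= 0" using e by (auto simp: S2_def)
  note f = differentiable_fst differentiable_snd
  have xy: "(%e. fst (fst e)) differentiable (at e)" "(%e. snd (fst e)) differentiable (at e)"
   "(%e. fst (t e)) differentiable (at e)" "(%e. fst (snd (t e))) differentiable (at e)"
   "(%e. fst (snd (snd (t e)))) differentiable (at e)" "(%e. snd (snd (snd (t e)))) differentiable (at e)"
   by (intro f lin t)+
  have dW: "(%e. jt W (pt (fst e)) k) differentiable (at e)" if "k < 6" for k by (rule comp[OF difW[OF n(1) that]])
  have dG: "(%e. jt (G j) (pt (fst e)) k) differentiable (at e)" if "k < 6" "j < 2" for k j by (rule comp[OF difG[OF n(1) that(2,1)]])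
  have dN: "(%e. Mj i (t e) (fst e) k) differentiable (at e)" if "k < 6" for k
  proof -
   have "(%e. if k = 0 then fst (t e) else if k < 3 then 0 else if k = 3 then fst (snd (t e))
     else if k = 4 then fst (snd (snd (t e))) else snd (snd (snd (t e)))) differentiable (at e)"
    by (cases "k = 0"; cases "k < 3"; cases "k = 3"; cases "k = 4") (simp_all add: xy)
   from differentiable_diff[OF this dG[OF that i]] show ?thesis unfolding Mj_def .
  qed
  show ?thesis unfolding Z_def
   by (rule sol_differentiable[where N = "%e. Mj i (t e) (fst e)" and W = "%e. jt W (pt (fst e))", OF xy(1,2)]; fact dN dW W0[OF n(2)])
 qed
 \<comment> \<open>The bad pairs of coefficients. Each of the three sets is a differentiable image
   of a space of fewer than 12 dimensions in the 12-dimensional space of pairs, hence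
   negligible.\<close>
 define A1 where "A1 = (%e. (fst (snd e), Th 0 e)) ` S1"
 define A2 where "A2 = (%e. (Th 1 e, fst (snd e))) ` S1"
 define A3 where "A3 = (%e. (Z 0 (fst (snd e)) (fst e), Z 1 (snd (snd e)) (fst e))) ` S2"
 have "negligible A1" unfolding A1_def
 proof (rule negligible_differentiable_image_lowdim)
  show "(%e. (fst (snd e), Th 0 e)) differentiable_on S1" unfolding differentiable_on_def
  proof
   fix e assume e: "e \<in> S1"
   have "(%e. fst (snd e)) differentiable (at e)" "(%e. snd (snd e)) differentiable (at e)"
    by (intro differentiable_fst differentiable_snd lin)+
   note s = this
   show "(%e. (fst (snd e), Th 0 e)) differentiable (at e within S1)"
    by (rule differentiable_at_withinI, rule differentiable_Pair) (rule s(1) dTh[OF e l(1)])+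
  qed
 qed simp
 moreover have "negligible A2" unfolding A2_def
 proof (rule negligible_differentiable_image_lowdim)
  show "(%e. (Th 1 e, fst (snd e))) differentiable_on S1" unfolding differentiable_on_def
  proof
   fix e assume e: "e \<in> S1"
   have "(%e. fst (snd e)) differentiable (at e)" "(%e. snd (snd e)) differentiable (at e)"
    by (intro differentiable_fst differentiable_snd lin)+
   note s = this
   show "(%e. (Th 1 e, fst (snd e))) differentiable (at e within S1)"
    by (rule differentiable_at_withinI, rule differentiable_Pair) (rule s(1) dTh[OF e l(2)])+
  qed
 qed simp
 moreover have "negligible A3" unfolding A3_def
 proof (rule negligible_differentiable_image_lowdim)
  show "(%e. (Z 0 (fst (snd e)) (fst e), Z 1 (snd (snd e)) (fst e))) differentiable_on S2" unfolding differentiable_on_def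
  proof
   fix e assume e: "e \<in> S2"
   have "(%e. fst (snd e)) differentiable (at e)" "(%e. snd (snd e)) differentiable (at e)"
    by (intro differentiable_fst differentiable_snd lin)+
   note s = this
   show "(%e. (Z 0 (fst (snd e)) (fst e), Z 1 (snd (snd e)) (fst e))) differentiable (at e within S2)"
    by (rule differentiable_at_withinI, rule differentiable_Pair) (rule dZ[OF e l(1) s(1)] dZ[OF e l(2) s(2)])+
  qed
 qed simp
 ultimately have "negligible (A1 \<union> A2 \<union> A3)" by (intro negligible_Un)
 then have "A1 \<union> A2 \<union> A3 ~= UNIV" using non_negligible_UNIV by metis
 then obtain c where c: "c \<notin> A1" "c \<notin> A2" "c \<notin> A3" by blast
 define cf where "cf i = (if i = 0 then fst c else snd c)" for i :: nat
 define jf where "jf i z k = jt (G i) z k + jmul (jt W z) (qjet (cf i) (z 0) (z 1)) k" for i z k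
 define fi where "fi i z = jf i z 0" for i z
 have fi: "fi i z = G i z + rho z ^ Suc K*qjet (cf i) (z 0) (z 1) 0" for i z
  by (simp add: fi_def jf_def jt_def jmul_def W_def)
 have gq: "germ 2 (%z. qjet (cf i) (z 0) (z 1) 0)" for i
 proof -
  have v: "germ 2 (%z. z 0)" "germ 2 (%z. z 1)" by (rule germ_var; simp)+
  obtain c0 c1 c2 c3 c4 c5 where c: "cf i = (c0, c1, c2, c3, c4, c5)" by (cases "cf i")
  have "germ 2 (%z. c0 + c1*z 0 + c2*z 1 + c3*(z 0*z 0) + c4*(z 0*z 1) + c5*(z 1*z 1))"
   by (intro germ_add germ_mult germ_const v)
  then show ?thesis by (simp add: qjet_def c)
 qed
 have gfi: "germ 2 (fi i)" if "i < 2" for i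
  unfolding fi[abs_def] by (intro germ_add germ_mult germ_power germ_rho gq gG that)
 define f where "f p = (fi 0 (pt p), fi 1 (pt p))" for p
 have fb: "fi i (base z) = fi i z" for i z by (simp add: fi G_def rho_def)
 have fc: "(%i z. cmp i (f (z 0, z 1))) i = fi i" if "i < 2" for i
  using that by (auto simp: f_def base_zp fb less_2_cases_iff fun_eq_iff)
 have mf: "map_germ f" unfolding map_germ_def analytic_germ2_iff
 proof (intro conjI allI impI)
  have "G i (%_. 0) = 0" for i using mg by (simp add: G_def map_germ_def cmp_linear zero_prod_def[symmetric])
  then show "f 0 = 0" by (simp add: f_def fi rho_def zero_prod_def)
  show "germ 2 (%z. cmp i (f (z 0, z 1)))" if "i < 2" for i using gfi[OF that] fc[OF that] by simp
 qed
 have "same_jet K g f" unfolding same_jet_def pair_eq_iff_cmp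
 proof (intro allI impI)
  fix a b i :: nat assume ab: "a + b <= K" and i: "i < 2"
  have "cmp i ((partial_x ^^ a) ((partial_y ^^ b) g) 0) = (pd 0 ^^ a) ((pd 1 ^^ b) (G i)) (%_. 0)"
   by (rule partial_iter_0[OF gG _ i]) (simp_all add: G_def)
  also have "\<dots> = (pd 0 ^^ a) ((pd 1 ^^ b) (fi i)) (%_. 0)"
   by (rule flat_jets[OF gG[OF i] gq[of i] _ ab, symmetric]) (simp add: fi)
  also have "\<dots> = cmp i ((partial_x ^^ a) ((partial_y ^^ b) f) 0)"
  proof (rule partial_iter_0[OF gfi _ i, symmetric])
   have "cmp i (f (z 0, z 1)) = fi i z" if "i < 2" for i z using fun_cong[OF fc[OF that], of z] by simp
   then show "NEAR z. ALL i<2. cmp i (f (z 0, z 1)) = fi i z" by simp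
  qed
  finally show "cmp i ((partial_x ^^ a) ((partial_y ^^ b) g) 0) = cmp i ((partial_x ^^ a) ((partial_y ^^ b) f) 0)" .
 qed
 then have eqv: "A_equivalent g f" by (rule K[OF mf])
 obtain C0 where C0: "NEAR z. abs(Jdet (%i z. cmp i (g (z 0, z 1))) z) <= C0*(z 0)^2"
  using zero_jet_bound[OF hg jet] by blast
 obtain p C where p: "p ~= 0" "norm p < r0"
  and bad: "\<forall>\<^sub>F q in nhds p. abs(Jdet (%i z. cmp i (f (z 0, z 1))) (pt q)) <= C*(norm (q - p))^2"
  using A_equivalent_Jdet[OF mg eqv r0 C0] by blast
 have tab: "dtab (jf i) (pt q)" if "norm q < r0" "i < 2" for i q
  unfolding jf_def[abs_def] by (intro dtab_add dtab_jmul tabG tabW dtab_qjet that)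
 define JJ where "JJ z = jf 0 z 1*jf 1 z 2 - jf 0 z 2*jf 1 z 1" for z
 have "\<forall>\<^sub>F q in nhds p. norm q < r0" using eventually_nhds_in_open[of "ball 0 r0" p] p(2) by simp
 with bad have bad': "\<forall>\<^sub>F q in nhds p. abs(JJ (pt q)) <= C*(norm (q - p))^2"
 proof eventually_elim
  case (elim q)
  have pdf: "pd 0 (fi i) (pt q) = jf i (pt q) 1" "pd 1 (fi i) (pt q) = jf i (pt q) 2" if "i < 2" for i
   using tab[OF elim(2) that] unfolding dtab_def fi_def[abs_def] by (auto intro!: pd_eqI)
  have "Jdet (%i z. cmp i (f (z 0, z 1))) (pt q) = JJ (pt q)"
   unfolding Jdet_def JJ_def using fc[OF l(1)] fc[OF l(2)] pdf[OF l(1)] pdf[OF l(2)] by simp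
  then show ?case using elim(1) by simp
 qed
 define u v where "u = jf 0 (pt p)" and "v = jf 1 (pt p)"
 have t0: "((%t. jf i ((pt p)(0:=t)) 1) hrd jf i (pt p) 3) (at (pt p 0))"
   "((%t. jf i ((pt p)(0:=t)) 2) hrd jf i (pt p) 4) (at (pt p 0))"
   "((%t. jf i ((pt p)(1:=t)) 1) hrd jf i (pt p) 4) (at (pt p 1))"
   "((%t. jf i ((pt p)(1:=t)) 2) hrd jf i (pt p) 5) (at (pt p 1))" if "i < 2" for i
  using tab[OF p(2) that] unfolding dtab_def by blast+
 have J: "u 1 * v 2 - u 2 * v 1 = 0" using quadratic_bound_vanish(1)[OF bad'] by (simp add: JJ_def u_def v_def)
 have D0: "((%t. JJ ((pt p)(0:=t))) hrd (u 3 * v 2 + v 4*u 1) - (u 4 * v 1 + v 3*u 2)) (at (pt p 0))"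
  using DERIV_diff[OF DERIV_mult[OF t0(1)[OF l(1)] t0(2)[OF l(2)]] DERIV_mult[OF t0(2)[OF l(1)] t0(1)[OF l(2)]]]
  unfolding JJ_def u_def v_def fun_upd_triv .
 have D1: "((%t. JJ ((pt p)(1:=t))) hrd (u 4 * v 2 + v 5*u 1) - (u 5 * v 1 + v 4*u 2)) (at (pt p 1))"
  using DERIV_diff[OF DERIV_mult[OF t0(3)[OF l(1)] t0(4)[OF l(2)]] DERIV_mult[OF t0(4)[OF l(1)] t0(3)[OF l(2)]]]
  unfolding JJ_def u_def v_def fun_upd_triv .
 have J0: "(u 3 * v 2 + v 4*u 1) - (u 4 * v 1 + v 3*u 2) = 0" by (rule quadratic_bound_vanish(2)[OF bad' l(1) D0])
 have J1: "(u 4 * v 2 + v 5*u 1) - (u 5 * v 1 + v 4*u 2) = 0" by (rule quadratic_bound_vanish(2)[OF bad' l(2) D1])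
 have uq: "jf i (pt p) k - jt (G i) (pt p) k = jmul (jt W (pt p)) (qjet (cf i) (fst p) (snd p)) k" for i k by (simp add: jf_def)
 consider "u 1 ~= 0 \<or> u 2 ~= 0" | "v 1 ~= 0 \<or> v 2 ~= 0" | "u 1 = 0" "u 2 = 0" "v 1 = 0" "v 2 = 0" by blast
 then show False
 proof cases
  case 1
  obtain a b where ab: "v 1 = a*u 1" "v 2 = a*u 2" "v 3 = a*u 3 + b*(u 1*u 1)" "v 4 = a*u 4 + b*(u 1*u 2)"
   "v 5 = a*u 5 + b*(u 2*u 2)" using jet_relation[OF J J0 J1 1] by blast
  let ?e = "(p, fst c, v 0, a, b)"
  have ue: "uj 0 ?e = u" by (simp add: uj_def u_def jf_def cf_def fun_eq_iff)
  have "Nj 0 ?e k = jmul (jt W (pt p)) (qjet (cf 1) (fst p) (snd p)) k" if "k < 6" for k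
  proof -
   have "Nj 0 ?e k = v k - jt (G 1) (pt p) k" using less_6_cases[OF that] ab unfolding Nj_def ue sj_def by auto
   then show ?thesis unfolding v_def uq .
  qed
  then have "Th 0 ?e = cf 1" unfolding Th_def fst_conv snd_conv by (rule sol_jmul[where w = "jt W (pt p)", OF W0[OF p(1)]])
  moreover have "?e \<in> S1" using p by (simp add: S1_def)
  ultimately have "(fst c, cf 1) \<in> A1" unfolding A1_def by (intro image_eqI[of _ _ ?e]) simp_all
  then show False using c(1) by (simp add: cf_def)
 next
  case 2
  have J': "v 1*u 2 - v 2*u 1 = 0" "(v 3*u 2 + u 4 * v 1) - (v 4*u 1 + u 3 * v 2) = 0"
   "(v 4*u 2 + u 5 * v 1) - (v 5*u 1 + u 4 * v 2) = 0" using J J0 J1 by (simp_all add: mult.commute)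
  obtain a b where ab: "u 1 = a * v 1" "u 2 = a * v 2" "u 3 = a * v 3 + b*(v 1 * v 1)" "u 4 = a * v 4 + b*(v 1 * v 2)"
   "u 5 = a * v 5 + b*(v 2 * v 2)" using jet_relation[OF J' 2] by blast
  let ?e = "(p, snd c, u 0, a, b)"
  have ue: "uj 1 ?e = v" by (simp add: uj_def v_def jf_def cf_def fun_eq_iff)
  have "Nj 1 ?e k = jmul (jt W (pt p)) (qjet (cf 0) (fst p) (snd p)) k" if "k < 6" for k
  proof -
   have "Nj 1 ?e k = u k - jt (G 0) (pt p) k" using less_6_cases[OF that] ab unfolding Nj_def ue sj_def by auto
   then show ?thesis unfolding u_def uq .
  qed
  then have "Th 1 ?e = cf 0" unfolding Th_def fst_conv snd_conv by (rule sol_jmul[where w = "jt W (pt p)", OF W0[OF p(1)]])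
  moreover have "?e \<in> S1" using p by (simp add: S1_def)
  ultimately have "(cf 0, snd c) \<in> A2" unfolding A2_def by (intro image_eqI[of _ _ ?e]) simp_all
  then show False using c(2) by (simp add: cf_def)
 next
  case 3
  have "Mj 0 (u 0, u 3, u 4, u 5) p k = jmul (jt W (pt p)) (qjet (cf 0) (fst p) (snd p)) k" if "k < 6" for k
  proof -
   have "Mj 0 (u 0, u 3, u 4, u 5) p k = u k - jt (G 0) (pt p) k" using less_6_cases[OF that] 3 unfolding Mj_def by auto
   then show ?thesis unfolding u_def uq .
  qed
  then have z0: "Z 0 (u 0, u 3, u 4, u 5) p = cf 0" unfolding Z_def by (rule sol_jmul[where w = "jt W (pt p)", OF W0[OF p(1)]])
  have "Mj 1 (v 0, v 3, v 4, v 5) p k = jmul (jt W (pt p)) (qjet (cf 1) (fst p) (snd p)) k" if "k < 6" for k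
  proof -
   have "Mj 1 (v 0, v 3, v 4, v 5) p k = v k - jt (G 1) (pt p) k" using less_6_cases[OF that] 3 unfolding Mj_def by auto
   then show ?thesis unfolding v_def uq .
  qed
  then have z1: "Z 1 (v 0, v 3, v 4, v 5) p = cf 1" unfolding Z_def by (rule sol_jmul[where w = "jt W (pt p)", OF W0[OF p(1)]])
  let ?e = "(p, (u 0, u 3, u 4, u 5), (v 0, v 3, v 4, v 5))"
  have "?e \<in> S2" using p by (simp add: S2_def)
  then have "(cf 0, cf 1) \<in> A3" unfolding A3_def by (intro image_eqI[of _ _ ?e]) (simp_all add: z0 z1 del: One_nat_def)
  then show False using c(3) by (simp add: cf_def)
 qed
qed

theorem theorem6p2:
  shows "(\<forall>l m :: nat. l \<ge> m \<and> m \<ge> 1 \<longrightarrow>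
            lorentz_representable (I22_lm l m) \<and>
            (\<exists>g d F. A_equivalent (I22_lm l m) g \<and> lorentz_harmonic_germ g \<and>
                      lorentz_versal_deformation g d F))
       \<and> (\<forall>l :: nat. l \<ge> 1 \<longrightarrow> \<not> lorentz_representable (I22_l l))
       \<and> (\<nexists>g. lorentz_harmonic_germ g \<and> same_jet 2 g (\<lambda>_. 0) \<and> finitely_A_determined g)"
proof -
  have "lorentz_representable (I22_lm l m) \<and>
      (\<exists>g d F. A_equivalent (I22_lm l m) g \<and> lorentz_harmonic_germ g \<and> lorentz_versal_deformation g d F)"
    if "l \<ge> m \<and> m \<ge> 1" for l m :: nat
  proof -
    have "1 \<le> l" "1 \<le> m" using that by auto
    from I22_lm_lorentz_versal[OF this] show ?thesis unfolding lorentz_representable_def by blast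
  qed
  then show ?thesis using I22_l_not_representable zero_jet_not_finitely_determined by blast
qed

end
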